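(* Assume that $(\mathcal X,\sim)$, $d$, $m$, $R$, $(R^k)_{k\ge1}$, $\mu_0$, $\mu_1$ satisfy all the standing assumptions listed in the context, and let $\widehat P\in\mathrm P(\Omega)$ be the displacement random walk between $\mu_0$ and $\mu_1$ defined there. Then: (1) $\widehat P$ is Markov. (2) The jump kernel of the Markov measure $\widehat P$ is given by $$\widehat J_{t,z}(\cdot)=\int_{\mathcal X}J^{G,y}_{t,z}(\cdot)\,\widehat P(X_1\in dy\mid X_t=z),$$ a mixture of the jump kernels $J^{G,y}$ of the bridges $G^{xy}$, where $J^{G,y}$ is given explicitly in the context.
   Context: **Notation.** $\mathrm P(Y)$, $\mathrm M_+(Y)$: probability measures and positive measures on $Y$. The relative entropy is $H(p|r)=\int\log(dp/dr)\,dp$ if $p\ll r$, and $+\infty$ otherwise; for an unbounded $\sigma$-finite $r$ it is defined, for $p$ such that $\int W\,dp<\infty$ for some measurable $W\ge0$ with $z_W:=\int e^{-W}dr<\infty$, by $H(p|r)=H(p|z_W^{-1}e^{-W}r)-\int W\,dp-\log z_W$. **Graph and paths.** $\mathcal X$ is a countable set (discrete topology) with an undirected graph structure $\sim$ which is irreducible (connected), has no loop and is locally finite. $\Omega$ is the set of all right-continuous, left-limited, piecewise constant paths $\omega:[0,1]\to\mathcal X$ with finitely many jumps, left-continuous at $t=1$, such that $\omega_{t^-}\ne\omega_t$ implies $\omega_{t^-}\sim\omega_t$. It carries the Skorokhod topology and the $\sigma$-field generated by the canonical process $X_t(\omega)=\omega_t$; $\mathrm P(\Omega)$ carries the narrow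 topology. For $Q\in\mathrm M_+(\Omega)$: $Q_t=(X_t)_\#Q$, $Q_{01}=(X_0,X_1)_\#Q$, $Q^{xy}=Q(\cdot\mid X_0=x,X_1=y)$. The jump kernel $j$ of a Markov measure is the kernel such that the generator is $L_tu(x)=\sum_y[u(y)-u(x)]j_{t,x}(y)$ for finitely supported $u$. **Standing assumptions.** - $d$ is a distance on $\mathcal X$ with $d(x,y)\ge1$ for $x\ne y$ and $d(x,y)=\inf\{\ell(\omega):\omega\in\Omega,\omega_0=x,\omega_1=y\}$, where $\ell(\omega)=\sum_{0<t<1}d(\omega_{t^-},\omega_t)$. - $R\in\mathrm M_+(\Omega)$ is Markov with forward jump kernel $J_{t,x}=\sum_{y\sim x}J_{t,x}(y)\delta_y$, where $J_{t,x}(y)>0$ for all $t\in[0,1]$ if and only if $x\sim y$ (and $J_{t,x}(y)=0$ for non-neighbours), and $\sup_{t,x}J_{t,x}(\mathcal X)<\infty$. - For $k\ge1$, $R^k\in\mathrm M_+(\Omega)$ is the Markov measure with forward jump kernel $J^k_{t,x}=\sum_{y\sim x}k^{-d(x,y)}J_{t,x}(y)\delta_y$ and initial measure $R^k_0=m\in\mathrm M_+(\mathcal X)$, $m_x>0$ for all $x$; $R=R^1$. - $\mu_0,\mu_1\in\mathrm P(\mathcal X)$ are such that there is $\pi^o\in\mathrm P(\mathcal X^2)$ with marginals $\mu_0,\mu_1$, $\int_{\mathcal X^2}E_{R^{xy}}(\ell)\,\pi^o(dxdy)<\infty$ and $H(\pi^o|R_{01})<\infty$. **Displacement random walk.** For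 $k\ge2$, $\widehat P^k$ is the unique minimizer of $H(P|R^k)$ over $P\in\mathrm P(\Omega)$ with $P_0=\mu_0,P_1=\mu_1$. $\widehat P$ is the narrow limit $\lim_{k\to\infty}\widehat P^k$ (it exists). Equivalently, with $\Gamma^{xy}=\{\omega\in\Omega:\omega_0=x,\omega_1=y,\ell(\omega)=d(x,y)\}$, $\Gamma=\bigcup_{x,y}\Gamma^{xy}$ and $G=\mathbf 1_\Gamma\exp(\int_0^1J_{t,X_t}(\mathcal X)dt)R$, $\widehat P$ is the unique minimizer of $H(P|G)$ over $P\in\mathrm P(\Omega)$ such that $P_{01}$ minimizes $\int d\,d\pi$ among all couplings $\pi$ of $\mu_0,\mu_1$. **The kernel $J^{G,y}$.** $\Gamma^{xy}([0,1])$ is the set of states visited by elements of $\Gamma^{xy}$; there, $z\to z'$ means $z\sim z'$ and $\gamma_t=z,\gamma_{t'}=z'$ for some $\gamma\in\Gamma^{xy}$, $0\le t<t'\le1$. Let $\{z\to\cdot\}^y=\{w\in\Gamma^{zy}([0,1]):z\to w\}$ (successors in $\Gamma^{zy}([0,1])$), $\Gamma(t,z;1,y)=\{\omega\in\Omega:\omega_{|[t,1]}=\gamma_{|[t,1]}\text{ for some }\gamma\in\Gamma,\omega_t=z,\omega_1=y\}$, and $g^y_t(z)=E_R[\exp(\int_t^1J_{s,X_s}(\mathcal X)ds)\mathbf 1_{\Gamma(t,z;1,y)}\mid X_t=z]$. Then $$J^{G,y}_{t,z}=\sum_{w\in\{z\to\cdot\}^y}\frac{g^y_t(w)}{g^y_t(z)}J_{t,z}(w)\,\delta_w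 ,\qquad 0\le t<1.$$ *)

theory Defs
  imports "HOL-Probability.Probability"
begin

section \<open>Paths on a graph\<close>

text \<open>
  The countable discrete state space is a type of class \<^class>\<open>countable\<close>; the graph is its edge
  relation \<open>E\<close>. Paths are indexed by \<open>{0..1}\<close>, hence extensional functions on that interval.
  One-sided limits in a discrete space are eventual equalities.
\<close>

definition left_lim :: "(real \<Rightarrow> 'a) \<Rightarrow> real \<Rightarrow> 'a" where
  "left_lim \<omega> t = (THE z. \<forall>\<^sub>F s in at_left t. \<omega> s = z)"

definition jump_times :: "(real \<Rightarrow> 'a) \<Rightarrow> real set" where
  "jump_times \<omega> = {t \<in> {0<..<1}. left_lim \<omega> t \<noteq> \<omega> t}"

definition paths :: "('a \<Rightarrow> 'a \<Rightarrow> bool) \<Rightarrow> (real \<Rightarrow> 'a) set" where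
  "paths E = {\<omega> \<in> extensional {0..1}.
     (\<forall>t\<in>{0..<1}. \<forall>\<^sub>F s in at_right t. \<omega> s = \<omega> t) \<and>
     (\<forall>t\<in>{0<..1}. \<exists>z. \<forall>\<^sub>F s in at_left t. \<omega> s = z) \<and>
     (\<forall>\<^sub>F s in at_left 1. \<omega> s = \<omega> 1) \<and>
     finite (jump_times \<omega>) \<and>
     (\<forall>t\<in>jump_times \<omega>. E (left_lim \<omega> t) (\<omega> t))}"

text \<open>\<open>path_events E I\<close> is the \<open>\<sigma>\<close>-field on paths generated by \<open>X\<^sub>t\<close>, \<open>t \<in> I\<close>.\<close>

definition path_events :: "('a \<Rightarrow> 'a \<Rightarrow> bool) \<Rightarrow> real set \<Rightarrow> (real \<Rightarrow> 'a) measure" where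
  "path_events E I = sigma (paths E) {{\<omega> \<in> paths E. \<omega> t \<in> B} | t B. t \<in> I}"

abbreviation path_space :: "('a \<Rightarrow> 'a \<Rightarrow> bool) \<Rightarrow> (real \<Rightarrow> 'a) measure" where
  "path_space E \<equiv> path_events E {0..1}"

definition path_length :: "('a \<Rightarrow> 'a \<Rightarrow> real) \<Rightarrow> (real \<Rightarrow> 'a) \<Rightarrow> real" where
  "path_length d \<omega> = (\<Sum>t\<in>jump_times \<omega>. d (left_lim \<omega> t) (\<omega> t))"

section \<open>Skorokhod topology and narrow convergence\<close>

definition time_changes :: "(real \<Rightarrow> real) set" where
  "time_changes = {l. l 0 = 0 \<and> l 1 = 1 \<and> strict_mono_on {0..1} l \<and> continuous_on {0..1} l}"

text \<open>The usual Skorokhod (J1) metric, with the discrete metric on the state space.\<close>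

definition skorokhod_dist :: "(real \<Rightarrow> 'a) \<Rightarrow> (real \<Rightarrow> 'a) \<Rightarrow> real" where
  "skorokhod_dist \<omega> \<eta> = (INF l\<in>time_changes.
     max (SUP t\<in>{0..1}. \<bar>l t - t\<bar>) (SUP t\<in>{0..1}. of_bool (\<omega> t \<noteq> \<eta> (l t))))"

definition time_change_cost :: "(real \<Rightarrow> real) \<Rightarrow> (real \<Rightarrow> 'a) \<Rightarrow> (real \<Rightarrow> 'a) \<Rightarrow> real" where
  "time_change_cost l \<omega> \<eta> = max (SUP t\<in>{0..1}. \<bar>l t - t\<bar>) (SUP t\<in>{0..1}. of_bool (\<omega> t \<noteq> \<eta> (l t)))"

lemma skorokhod_dist_eq_INF: "skorokhod_dist \<omega> \<eta> = (INF l\<in>time_changes. time_change_cost l \<omega> \<eta>)"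
  unfolding skorokhod_dist_def time_change_cost_def ..

lemma time_change_range: assumes "l \<in> time_changes" "t \<in> {0..1}" shows "l t \<in> {0..1}"
proof -
  have "mono_on {0..1} l" using assms unfolding time_changes_def by (auto intro: strict_mono_on_imp_mono_on)
  then show ?thesis using assms unfolding time_changes_def
    using \<open>mono_on {0..1} l\<close>[THEN mono_onD, of 0 t] \<open>mono_on {0..1} l\<close>[THEN mono_onD, of t 1] by auto
qed

lemma time_change_cost_le_iff:
  assumes l: "l \<in> time_changes"
  shows "time_change_cost l \<omega> \<eta> \<le> c \<longleftrightarrow> (\<forall>t\<in>{0..1}. \<bar>l t - t\<bar> \<le> c \<and> of_bool (\<omega> t \<noteq> \<eta> (l t)) \<le> c)"
proof -
  have 1: "bdd_above ((\<lambda>t. \<bar>l t - t\<bar>) ` {0..1})"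
    by (rule bdd_aboveI[of _ 1]) (use time_change_range[OF l] in fastforce)
  have 2: "bdd_above ((\<lambda>t. of_bool (\<omega> t \<noteq> \<eta> (l t)) :: real) ` {0..1})"
    by (rule bdd_aboveI[of _ 1]) auto
  show ?thesis unfolding time_change_cost_def max.bounded_iff
    by (subst cSUP_le_iff, simp, rule 1, subst cSUP_le_iff, simp, rule 2) auto
qed

lemma time_change_cost_ge: assumes l: "l \<in> time_changes" and t: "t \<in> {0..1}"
  shows "\<bar>l t - t\<bar> \<le> time_change_cost l \<omega> \<eta>" "of_bool (\<omega> t \<noteq> \<eta> (l t)) \<le> time_change_cost l \<omega> \<eta>"
  using time_change_cost_le_iff[OF l, THEN iffD1, OF order_refl, THEN bspec, OF t] by blast+

lemma time_change_cost_nonneg: "l \<in> time_changes \<Longrightarrow> 0 \<le> time_change_cost l \<omega> \<eta>"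
  using time_change_cost_ge(1)[of l 0 \<omega> \<eta>] by (simp add: time_changes_def)

lemma bdd_below_time_change_cost: "bdd_below ((\<lambda>l. time_change_cost l \<omega> \<eta>) ` time_changes)"
  by (rule bdd_belowI[of _ 0]) (auto simp: time_change_cost_nonneg)

lemma id_time_change: "(\<lambda>x. x) \<in> time_changes"
  by (auto simp: time_changes_def strict_mono_on_def)

lemma skorokhod_dist_le: "l \<in> time_changes \<Longrightarrow> skorokhod_dist \<omega> \<eta> \<le> time_change_cost l \<omega> \<eta>"
  unfolding skorokhod_dist_eq_INF by (rule cINF_lower[OF bdd_below_time_change_cost])

lemma skorokhod_dist_less: assumes "skorokhod_dist \<omega> \<eta> < c" obtains l where "l \<in> time_changes" "time_change_cost l \<omega> \<eta> < c"
  using assms unfolding skorokhod_dist_eq_INF by (subst (asm) cINF_less_iff) (use id_time_change bdd_below_time_change_cost in auto)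

lemma skorokhod_dist_nonneg: "0 \<le> skorokhod_dist \<omega> \<eta>"
  unfolding skorokhod_dist_eq_INF by (rule cINF_greatest) (use id_time_change time_change_cost_nonneg in auto)

lemma inverse_time_change: assumes l: "l \<in> time_changes"
  shows "\<exists>k\<in>time_changes. \<forall>t\<in>{0..1}. k t \<in> {0..1} \<and> l (k t) = t \<and> k (l t) = t"
proof -
  have sm: "strict_mono_on {0..1} l" and l01: "l 0 = 0" "l 1 = 1" and c: "continuous_on {0..1} l"
    using l by (auto simp: time_changes_def)
  have inj: "inj_on l {0..1}" using sm by (rule strict_mono_on_imp_inj_on)
  have im: "l ` {0..1} = {0..1}"
  proof
    show "l ` {0..1} \<subseteq> {0..1}" using time_change_range[OF l] by blast
    show "{0..1} \<subseteq> l ` {0..1}"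
    proof
      fix y :: real assume "y \<in> {0..1}"
      then have "\<exists>x\<ge>0. x \<le> 1 \<and> l x = y" by (intro IVT') (simp_all add: l01 c)
      then show "y \<in> l ` {0..1}" by auto
    qed
  qed
  define k where "k = inv_into {0..1} l"
  have k1: "l (k t) = t" "k t \<in> {0..1}" if "t \<in> {0..1}" for t
  proof -
    have "t \<in> l ` {0..1}" using that im by simp
    from f_inv_into_f[OF this] inv_into_into[OF this]
    show "l (k t) = t" "k t \<in> {0..1}" unfolding k_def by blast+
  qed
  have k2: "k (l t) = t" if "t \<in> {0..1}" for t using that inj by (simp add: k_def)
  have "k \<in> time_changes" unfolding time_changes_def
  proof (intro CollectI conjI)
    show "k 0 = 0" "k 1 = 1" using k2[of 0] k2[of 1] by (simp_all add: l01)
    show "strict_mono_on {0..1} k"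
    proof (rule strict_mono_onI)
      fix r s :: real assume a: "r \<in> {0..1}" "s \<in> {0..1}" "r < s"
      show "k r < k s"
      proof (rule ccontr)
        assume "\<not> k r < k s"
        then have "l (k s) \<le> l (k r)" using strict_mono_on_leD[OF sm k1(2)[OF a(2)] k1(2)[OF a(1)]] by simp
        then show False using a(3) k1(1)[OF a(1)] k1(1)[OF a(2)] by linarith
      qed
    qed
    have "continuous_on (l ` {0..1}) k"
      by (rule continuous_on_inv[OF c compact_Icc]) (simp add: k2)
    then show "continuous_on {0..1} k" by (simp only: im)
  qed
  then show ?thesis by (intro bexI[of _ k] ballI conjI k1 k2)
qed

lemma skorokhod_dist_sym_le: "skorokhod_dist \<eta> \<omega> \<le> skorokhod_dist \<omega> \<eta>"
proof (rule field_le_epsilon)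
  fix e :: real assume "0 < e"
  then obtain l where l: "l \<in> time_changes" "time_change_cost l \<omega> \<eta> < skorokhod_dist \<omega> \<eta> + e"
    using skorokhod_dist_less[of \<omega> \<eta> "skorokhod_dist \<omega> \<eta> + e"] by auto
  obtain k where k: "k \<in> time_changes" "\<forall>t\<in>{0..1}. k t \<in> {0..1} \<and> l (k t) = t \<and> k (l t) = t"
    using inverse_time_change[OF l(1)] by blast
  have "time_change_cost k \<eta> \<omega> \<le> time_change_cost l \<omega> \<eta>"
    unfolding time_change_cost_le_iff[OF k(1)]
  proof
    fix t :: real assume t: "t \<in> {0..1}"
    have kt: "k t \<in> {0..1}" "l (k t) = t" using k(2) t by blast+
    have "(\<omega> (k t) \<noteq> \<eta> t) = (\<eta> t \<noteq> \<omega> (k t))" by (simp only: eq_commute[of "\<eta> t"])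
    then show "\<bar>k t - t\<bar> \<le> time_change_cost l \<omega> \<eta> \<and> of_bool (\<eta> t \<noteq> \<omega> (k t)) \<le> time_change_cost l \<omega> \<eta>"
      using time_change_cost_ge[OF l(1) kt(1), of \<omega> \<eta>]
      by (simp only: kt(2) abs_minus_commute[of t] simp_thms)
  qed
  then show "skorokhod_dist \<eta> \<omega> \<le> skorokhod_dist \<omega> \<eta> + e" using skorokhod_dist_le[OF k(1), of \<eta> \<omega>] l(2) by linarith
qed

lemma skorokhod_dist_triangle: "skorokhod_dist \<omega> \<zeta> \<le> skorokhod_dist \<omega> \<eta> + skorokhod_dist \<eta> \<zeta>"
proof (rule field_le_epsilon)
  fix e :: real assume "0 < e"
  then have e: "skorokhod_dist \<omega> \<eta> < skorokhod_dist \<omega> \<eta> + e/2"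
    "skorokhod_dist \<eta> \<zeta> < skorokhod_dist \<eta> \<zeta> + e/2" by auto
  from e(1) obtain l where l: "l \<in> time_changes"
    "time_change_cost l \<omega> \<eta> < skorokhod_dist \<omega> \<eta> + e/2" by (rule skorokhod_dist_less)
  from e(2) obtain k where k: "k \<in> time_changes"
    "time_change_cost k \<eta> \<zeta> < skorokhod_dist \<eta> \<zeta> + e/2" by (rule skorokhod_dist_less)
  have kl: "(\<lambda>t. k (l t)) \<in> time_changes"
  proof -
    have ck: "continuous_on {0..1} k" and cl: "continuous_on {0..1} l"
      and mk: "strict_mono_on {0..1} k" and ml: "strict_mono_on {0..1} l"
      and ends: "l 0 = 0" "l 1 = 1" "k 0 = 0" "k 1 = 1"
      using l(1) k(1) by (simp_all add: time_changes_def)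
    have im: "l ` {0..1} \<subseteq> {0..1}" using time_change_range[OF l(1)] by blast
    have "continuous_on {0..1} (\<lambda>t. k (l t))" by (rule continuous_on_compose2[OF ck cl im])
    moreover have "strict_mono_on {0..1} (\<lambda>t. k (l t))"
    proof (rule strict_mono_onI)
      fix r s :: real assume rs: "r \<in> {0..1}" "s \<in> {0..1}" "r < s"
      show "k (l r) < k (l s)"
        by (rule strict_mono_onD[OF mk time_change_range[OF l(1) rs(1)] time_change_range[OF l(1) rs(2)]])
          (rule strict_mono_onD[OF ml rs])
    qed
    ultimately show ?thesis unfolding time_changes_def by (simp add: ends)
  qed
  have "time_change_cost (\<lambda>t. k (l t)) \<omega> \<zeta> \<le> time_change_cost l \<omega> \<eta> + time_change_cost k \<eta> \<zeta>"
    unfolding time_change_cost_le_iff[OF kl]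
  proof
    fix t :: real assume t: "t \<in> {0..1}"
    have "(of_bool (\<omega> t \<noteq> \<zeta> (k (l t)))::real) \<le> of_bool (\<omega> t \<noteq> \<eta> (l t)) + of_bool (\<eta> (l t) \<noteq> \<zeta> (k (l t)))"
      by auto
    then show "\<bar>k (l t) - t\<bar> \<le> time_change_cost l \<omega> \<eta> + time_change_cost k \<eta> \<zeta> \<and> of_bool (\<omega> t \<noteq> \<zeta> (k (l t))) \<le> time_change_cost l \<omega> \<eta> + time_change_cost k \<eta> \<zeta>"
      using time_change_cost_ge[OF l(1) t, of \<omega> \<eta>] time_change_cost_ge[OF k(1) time_change_range[OF l(1) t], of \<eta> \<zeta>] by linarith
  qed
  then show "skorokhod_dist \<omega> \<zeta> \<le> skorokhod_dist \<omega> \<eta> + skorokhod_dist \<eta> \<zeta> + e"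
    using skorokhod_dist_le[OF kl, of \<omega> \<zeta>] l k by linarith
qed

lemma skorokhod_dist_refl: "skorokhod_dist \<omega> \<omega> = 0"
proof -
  have "time_change_cost (\<lambda>x. x) \<omega> \<omega> \<le> 0" unfolding time_change_cost_le_iff[OF id_time_change] by auto
  then show ?thesis using skorokhod_dist_le[OF id_time_change, of \<omega> \<omega>] skorokhod_dist_nonneg[of \<omega> \<omega>] by linarith
qed

lemma skorokhod_dist_close: assumes "skorokhod_dist \<omega> \<eta> = 0" "0 < e" "t \<in> {0..1}"
  shows "\<exists>s\<in>{0..1}. \<bar>s - t\<bar> < e \<and> \<omega> t = \<eta> s"
proof -
  obtain l where l: "l \<in> time_changes" "time_change_cost l \<omega> \<eta> < min e 1"
    using skorokhod_dist_less[of \<omega> \<eta> "min e 1"] assms by auto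
  have "of_bool (\<omega> t \<noteq> \<eta> (l t)) < (1::real)" "\<bar>l t - t\<bar> < e"
    using time_change_cost_ge[OF l(1) assms(3), of \<omega> \<eta>] l(2) by linarith+
  then show ?thesis using time_change_range[OF l(1) assms(3)] by (intro bexI[of _ "l t"]) (auto split: if_splits)
qed

lemma skorokhod_dist_zero:
  assumes \<omega>: "\<omega> \<in> paths E" and \<eta>: "\<eta> \<in> paths E" and z: "skorokhod_dist \<omega> \<eta> = 0"
  shows "\<omega> = \<eta>"
proof -
  have cont: "\<omega> t = \<eta> t" if t: "t \<in> {0..1}" and l: "t > 0 \<Longrightarrow> \<forall>\<^sub>F s in at_left t. \<eta> s = \<eta> t" for t
  proof -
    have "\<exists>e>0. \<forall>s\<in>{0..1}. \<bar>s - t\<bar> < e \<longrightarrow> \<eta> s = \<eta> t"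
    proof -
      have r: "\<exists>e>0. \<forall>s\<in>{0..1}. t < s \<and> \<bar>s - t\<bar> < e \<longrightarrow> \<eta> s = \<eta> t"
      proof (cases "t < 1")
        case True
        then have "\<forall>\<^sub>F s in at_right t. \<eta> s = \<eta> t" using \<eta> t by (auto simp: paths_def)
        then obtain b where "b > t" "\<forall>y>t. y < b \<longrightarrow> \<eta> y = \<eta> t" unfolding eventually_at_right_field by auto
        then show ?thesis by (intro exI[of _ "b - t"]) auto
      next
        case False then show ?thesis using t by (intro exI[of _ 1]) auto
      qed
      have l: "\<exists>e>0. \<forall>s\<in>{0..1}. s < t \<and> \<bar>s - t\<bar> < e \<longrightarrow> \<eta> s = \<eta> t"
      proof (cases "t > 0")
        case True
        then obtain b where "b < t" "\<forall>y>b. y < t \<longrightarrow> \<eta> y = \<eta> t" using l unfolding eventually_at_left_field by auto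
        then show ?thesis by (intro exI[of _ "t - b"]) auto
      next
        case False then show ?thesis using t by (intro exI[of _ 1]) auto
      qed
      from r l obtain e e' where "e > 0" "e' > 0" "\<forall>s\<in>{0..1}. t < s \<and> \<bar>s - t\<bar> < e \<longrightarrow> \<eta> s = \<eta> t"
        "\<forall>s\<in>{0..1}. s < t \<and> \<bar>s - t\<bar> < e' \<longrightarrow> \<eta> s = \<eta> t" by blast
      then have "\<forall>s\<in>{0..1}. \<bar>s - t\<bar> < min e e' \<longrightarrow> \<eta> s = \<eta> t"
      proof (intro ballI impI)
        fix s :: real assume "s \<in> {0..1}" "\<bar>s - t\<bar> < min e e'"
        then show "\<eta> s = \<eta> t"
          using \<open>\<forall>s\<in>{0..1}. t < s \<and> \<bar>s - t\<bar> < e \<longrightarrow> \<eta> s = \<eta> t\<close>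
            \<open>\<forall>s\<in>{0..1}. s < t \<and> \<bar>s - t\<bar> < e' \<longrightarrow> \<eta> s = \<eta> t\<close>
          by (cases s t rule: linorder_cases) auto
      qed
      with \<open>e > 0\<close> \<open>e' > 0\<close> show ?thesis by (intro exI[of _ "min e e'"]) auto
    qed
    then obtain e where e: "e > 0" "\<forall>s\<in>{0..1}. \<bar>s - t\<bar> < e \<longrightarrow> \<eta> s = \<eta> t" by blast
    obtain s where "s \<in> {0..1}" "\<bar>s - t\<bar> < e" "\<omega> t = \<eta> s"
      using skorokhod_dist_close[OF z e(1) t] by blast
    then show ?thesis using e(2) by simp
  qed
  let ?D = "jump_times \<eta>"
  have fin: "finite ?D" using \<eta> by (simp add: paths_def)
  have off: "\<omega> t = \<eta> t" if t: "t \<in> {0..1}" "t \<notin> ?D" for t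
  proof (rule cont[OF t(1)])
    assume "t > 0"
    show "\<forall>\<^sub>F s in at_left t. \<eta> s = \<eta> t"
    proof (cases "t = 1")
      case True then show ?thesis using \<eta> by (simp add: paths_def)
    next
      case False
      have "t \<in> {0<..1}" using \<open>t > 0\<close> t by auto
      then obtain a where a: "\<forall>\<^sub>F s in at_left t. \<eta> s = a" using \<eta> unfolding paths_def by blast
      have "left_lim \<eta> t = a" unfolding left_lim_def
      proof (rule the_equality, rule a)
        fix b assume "\<forall>\<^sub>F s in at_left t. \<eta> s = b"
        with a have "\<forall>\<^sub>F s in at_left t. b = a" by eventually_elim simp
        then show "b = a" by simp
      qed
      moreover have "left_lim \<eta> t = \<eta> t" using t \<open>t > 0\<close> False by (auto simp: jump_times_def)
      ultimately show ?thesis using a by simp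
    qed
  qed
  have "\<omega> t = \<eta> t" if t: "t \<in> {0..1}" for t
  proof (cases "t = 1")
    case True then show ?thesis using off[of 1] by (auto simp: jump_times_def)
  next
    case False
    have "\<forall>\<^sub>F s in at_right t. \<omega> s = \<omega> t" "\<forall>\<^sub>F s in at_right t. \<eta> s = \<eta> t"
      using \<omega> \<eta> t False by (auto simp: paths_def)
    moreover have "\<forall>\<^sub>F s in at_right t. s \<notin> ?D"
      using islimpt_finite[OF fin, of t] by (simp add: islimpt_iff_eventually eventually_at_split)
    moreover have "\<forall>\<^sub>F s in at_right t. s \<in> {t<..<1}" using False t by (intro eventually_at_right_real) auto
    ultimately have "\<forall>\<^sub>F s in at_right t. \<omega> t = \<eta> t"
      by eventually_elim (use off t in force)
    then show ?thesis by simp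
  qed
  then show ?thesis using \<omega> \<eta> unfolding paths_def by (auto intro!: extensionalityI[of _ "{0..1}"])
qed

lemma Metric_space_skorokhod: "Metric_space (paths E) skorokhod_dist"
proof
  show "0 \<le> skorokhod_dist \<omega> \<eta>" for \<omega> \<eta> :: "real \<Rightarrow> 'a"
    by (rule skorokhod_dist_nonneg)
  show "skorokhod_dist \<omega> \<eta> = skorokhod_dist \<eta> \<omega>" for \<omega> \<eta> :: "real \<Rightarrow> 'a"
    by (intro antisym skorokhod_dist_sym_le)
  show "skorokhod_dist \<omega> \<eta> = 0 \<longleftrightarrow> \<omega> = \<eta>" if "\<omega> \<in> paths E" "\<eta> \<in> paths E" for \<omega> \<eta>
    using skorokhod_dist_zero[OF that] by (auto simp: skorokhod_dist_refl)
  show "skorokhod_dist \<omega> \<zeta> \<le> skorokhod_dist \<omega> \<eta> + skorokhod_dist \<eta> \<zeta>"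
    for \<omega> \<eta> \<zeta> :: "real \<Rightarrow> 'a"
    by (rule skorokhod_dist_triangle)
qed

definition skorokhod_topology :: "('a \<Rightarrow> 'a \<Rightarrow> bool) \<Rightarrow> (real \<Rightarrow> 'a) topology" where
  "skorokhod_topology E = Metric_space.mtopology (paths E) skorokhod_dist"

definition narrow_conv :: "'b topology \<Rightarrow> (nat \<Rightarrow> 'b measure) \<Rightarrow> 'b measure \<Rightarrow> bool" where
  "narrow_conv T Ps P \<longleftrightarrow>
     (\<forall>f. continuous_map T euclideanreal f \<and> bounded (f ` topspace T) \<longrightarrow>
        (\<lambda>n. \<integral>x. f x \<partial>Ps n) \<longlonglongrightarrow> (\<integral>x. f x \<partial>P))"

section \<open>Relative entropy\<close>

text \<open>
  \<^const>\<open>KL_divergence\<close> is real-valued and returns \<open>0\<close> for a divergent integral, so the entropy is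
  defined here with values in \<^typ>\<open>ereal\<close>. For a finite measure \<open>r\<close> the negative part of
  \<open>log (dp/dr)\<close> is always \<open>p\<close>-integrable.
\<close>

definition rel_entropy_finite :: "'b measure \<Rightarrow> 'b measure \<Rightarrow> ereal" where
  "rel_entropy_finite p r =
     (if absolutely_continuous r p then
        enn2ereal (\<integral>\<^sup>+x. ennreal (ln (enn2real (RN_deriv r p x))) \<partial>p)
        - enn2ereal (\<integral>\<^sup>+x. ennreal (- ln (enn2real (RN_deriv r p x))) \<partial>p)
      else \<infinity>)"

definition entropy_weights :: "'b measure \<Rightarrow> 'b measure \<Rightarrow> ('b \<Rightarrow> real) set" where
  "entropy_weights p r =
     {W \<in> borel_measurable r. (\<forall>x\<in>space r. 0 \<le> W x) \<and>
        integrable r (\<lambda>x. exp (- W x)) \<and> integrable p W}"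

text \<open>
  For unbounded \<open>r\<close> the value does not depend on the weight \<open>W\<close>; the infimum over all admissible
  weights is this common value, and it is \<open>\<infinity>\<close> when there is no admissible weight.
\<close>

definition rel_entropy :: "'b measure \<Rightarrow> 'b measure \<Rightarrow> ereal" where
  "rel_entropy p r =
     (if finite_measure r then rel_entropy_finite p r
      else (INF W\<in>entropy_weights p r.
        let z = (\<integral>x. exp (- W x) \<partial>r) in
        rel_entropy_finite p (density r (\<lambda>x. ennreal (exp (- W x) / z)))
          - ereal (\<integral>x. W x \<partial>p) - ereal (ln z)))"

section \<open>Markov measures and jump kernels\<close>

abbreviation at_time :: "('a \<Rightarrow> 'a \<Rightarrow> bool) \<Rightarrow> real \<Rightarrow> 'a \<Rightarrow> (real \<Rightarrow> 'a) set" where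
  "at_time E t z \<equiv> {\<omega> \<in> paths E. \<omega> t = z}"

abbreviation marginal :: "(real \<Rightarrow> 'a) measure \<Rightarrow> real \<Rightarrow> 'a measure" where
  "marginal Q t \<equiv> distr Q (count_space UNIV) (\<lambda>\<omega>. \<omega> t)"

abbreviation endpoint_marginal :: "(real \<Rightarrow> 'a) measure \<Rightarrow> ('a \<times> 'a) measure" where
  "endpoint_marginal Q \<equiv> distr Q (count_space UNIV) (\<lambda>\<omega>. (\<omega> 0, \<omega> 1))"

abbreviation bridge :: "('a \<Rightarrow> 'a \<Rightarrow> bool) \<Rightarrow> (real \<Rightarrow> 'a) measure \<Rightarrow> 'a \<Rightarrow> 'a \<Rightarrow> (real \<Rightarrow> 'a) measure"
  where "bridge E Q x y \<equiv> uniform_measure Q (at_time E 0 x \<inter> at_time E 1 y)"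

text \<open>
  A Markov path measure, possibly unbounded, is required to have \<open>\<sigma>\<close>-finite time marginals, so that
  conditioning on \<open>X\<^sub>t\<close> makes sense; past and future are independent conditionally on \<open>X\<^sub>t\<close>.
\<close>

definition markov_measure :: "('a \<Rightarrow> 'a \<Rightarrow> bool) \<Rightarrow> (real \<Rightarrow> 'a) measure \<Rightarrow> bool" where
  "markov_measure E Q \<longleftrightarrow>
     sets Q = sets (path_space E) \<and>
     (\<forall>t\<in>{0..1}. sigma_finite_measure (marginal Q t)) \<and>
     (\<forall>t\<in>{0..1}. \<forall>z. emeasure Q (at_time E t z) \<noteq> 0 \<longrightarrow>
        (\<forall>A\<in>sets (path_events E {0..t}). \<forall>B\<in>sets (path_events E {t..1}).
           measure (uniform_measure Q (at_time E t z)) (A \<inter> B) =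
           measure (uniform_measure Q (at_time E t z)) A *
           measure (uniform_measure Q (at_time E t z)) B))"

text \<open>A kernel \<open>j\<close> is given by its masses: \<open>j t x y\<close> is \<open>j\<^sub>t\<^sub>,\<^sub>x(y)\<close>.\<close>

definition kernel_gen :: "(real \<Rightarrow> 'a \<Rightarrow> 'a \<Rightarrow> real) \<Rightarrow> real \<Rightarrow> ('a \<Rightarrow> real) \<Rightarrow> 'a \<Rightarrow> real" where
  "kernel_gen j t u x = (\<Sum>\<^sub>\<infinity>y. (u y - u x) * j t x y)"

definition kernel_mass :: "(real \<Rightarrow> 'a \<Rightarrow> 'a \<Rightarrow> real) \<Rightarrow> real \<Rightarrow> 'a \<Rightarrow> real" where
  "kernel_mass j t x = (\<Sum>\<^sub>\<infinity>y. j t x y)"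

text \<open>
  The rates are only measurable in time, so the generator is the extended one: for each finitely
  supported \<open>u\<close>, the process \<open>u(X\<^sub>t) - \<integral>\<^sub>0\<^sup>t L\<^sub>r u(X\<^sub>r) dr\<close> is a \<open>Q\<close>-martingale. As \<open>Q\<close> may be unbounded,
  the martingale identity is tested on past events of finite measure.
\<close>

definition has_jump_kernel ::
  "('a \<Rightarrow> 'a \<Rightarrow> bool) \<Rightarrow> (real \<Rightarrow> 'a) measure \<Rightarrow> (real \<Rightarrow> 'a \<Rightarrow> 'a \<Rightarrow> real) \<Rightarrow> bool" where
  "has_jump_kernel E Q j \<longleftrightarrow>
     (\<forall>u. finite {x. u x \<noteq> 0} \<longrightarrow>
       (\<forall>s t. 0 \<le> s \<and> s \<le> t \<and> t \<le> 1 \<longrightarrow>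
         (\<forall>A\<in>sets (path_events E {0..s}). emeasure Q A < \<infinity> \<longrightarrow>
            set_integrable (Q \<Otimes>\<^sub>M lborel) (A \<times> {s..t}) (\<lambda>(\<omega>, r). kernel_gen j r u (\<omega> r)) \<and>
            (LINT \<omega>:A|Q. u (\<omega> t) - u (\<omega> s)) =
            (LINT \<omega>:A|Q. (LINT r:{s..t}|lborel. kernel_gen j r u (\<omega> r))))))"

section \<open>The Schroedinger problem\<close>

definition walks_between ::
  "('a \<Rightarrow> 'a \<Rightarrow> bool) \<Rightarrow> 'a pmf \<Rightarrow> 'a pmf \<Rightarrow> (real \<Rightarrow> 'a) measure set" where
  "walks_between E \<mu>0 \<mu>1 =
     {P. prob_space P \<and> sets P = sets (path_space E) \<and>
         marginal P 0 = measure_pmf \<mu>0 \<and> marginal P 1 = measure_pmf \<mu>1}"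

definition unique_arg_min :: "('b \<Rightarrow> 'c::order) \<Rightarrow> 'b set \<Rightarrow> 'b \<Rightarrow> bool" where
  "unique_arg_min f S x \<longleftrightarrow>
     is_arg_min f (\<lambda>y. y \<in> S) x \<and> (\<forall>y. is_arg_min f (\<lambda>y. y \<in> S) y \<longrightarrow> y = x)"

section \<open>Geodesic paths and the kernels of the geodesic bridges\<close>

definition geodesics_between ::
  "('a \<Rightarrow> 'a \<Rightarrow> bool) \<Rightarrow> ('a \<Rightarrow> 'a \<Rightarrow> real) \<Rightarrow> 'a \<Rightarrow> 'a \<Rightarrow> (real \<Rightarrow> 'a) set" where
  "geodesics_between E d x y = {\<omega> \<in> paths E. \<omega> 0 = x \<and> \<omega> 1 = y \<and> path_length d \<omega> = d x y}"

definition geodesics :: "('a \<Rightarrow> 'a \<Rightarrow> bool) \<Rightarrow> ('a \<Rightarrow> 'a \<Rightarrow> real) \<Rightarrow> (real \<Rightarrow> 'a) set" where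
  "geodesics E d = (\<Union>x y. geodesics_between E d x y)"

definition geodesic_measure ::
  "('a \<Rightarrow> 'a \<Rightarrow> bool) \<Rightarrow> ('a \<Rightarrow> 'a \<Rightarrow> real) \<Rightarrow> (real \<Rightarrow> 'a \<Rightarrow> 'a \<Rightarrow> real) \<Rightarrow>
     (real \<Rightarrow> 'a) measure \<Rightarrow> (real \<Rightarrow> 'a) measure" where
  "geodesic_measure E d J R =
     density R (\<lambda>\<omega>. ennreal (indicator (geodesics E d) \<omega> *
       exp (LINT t:{0..1}|lborel. kernel_mass J t (\<omega> t))))"

definition geodesic_states ::
  "('a \<Rightarrow> 'a \<Rightarrow> bool) \<Rightarrow> ('a \<Rightarrow> 'a \<Rightarrow> real) \<Rightarrow> 'a \<Rightarrow> 'a \<Rightarrow> 'a set" where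
  "geodesic_states E d x y = {\<gamma> t | \<gamma> t. \<gamma> \<in> geodesics_between E d x y \<and> t \<in> {0..1}}"

definition geodesic_step ::
  "('a \<Rightarrow> 'a \<Rightarrow> bool) \<Rightarrow> ('a \<Rightarrow> 'a \<Rightarrow> real) \<Rightarrow> 'a \<Rightarrow> 'a \<Rightarrow> 'a \<Rightarrow> 'a \<Rightarrow> bool" where
  "geodesic_step E d x y z z' \<longleftrightarrow> E z z' \<and>
     (\<exists>\<gamma>\<in>geodesics_between E d x y. \<exists>t t'. 0 \<le> t \<and> t < t' \<and> t' \<le> 1 \<and> \<gamma> t = z \<and> \<gamma> t' = z')"

definition geodesic_succs ::
  "('a \<Rightarrow> 'a \<Rightarrow> bool) \<Rightarrow> ('a \<Rightarrow> 'a \<Rightarrow> real) \<Rightarrow> 'a \<Rightarrow> 'a \<Rightarrow> 'a set" where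
  "geodesic_succs E d y z = {w \<in> geodesic_states E d z y. geodesic_step E d z y z w}"

definition geodesic_from ::
  "('a \<Rightarrow> 'a \<Rightarrow> bool) \<Rightarrow> ('a \<Rightarrow> 'a \<Rightarrow> real) \<Rightarrow> real \<Rightarrow> 'a \<Rightarrow> 'a \<Rightarrow> (real \<Rightarrow> 'a) set" where
  "geodesic_from E d t z y =
     {\<omega> \<in> paths E. (\<exists>\<gamma>\<in>geodesics E d. \<forall>s\<in>{t..1}. \<omega> s = \<gamma> s) \<and> \<omega> t = z \<and> \<omega> 1 = y}"

definition geodesic_weight ::
  "('a \<Rightarrow> 'a \<Rightarrow> bool) \<Rightarrow> ('a \<Rightarrow> 'a \<Rightarrow> real) \<Rightarrow> (real \<Rightarrow> 'a \<Rightarrow> 'a \<Rightarrow> real) \<Rightarrow>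
     (real \<Rightarrow> 'a) measure \<Rightarrow> 'a \<Rightarrow> real \<Rightarrow> 'a \<Rightarrow> real" where
  "geodesic_weight E d J R y t z =
     (\<integral>\<omega>. exp (LINT s:{t..1}|lborel. kernel_mass J s (\<omega> s)) * indicator (geodesic_from E d t z y) \<omega>
        \<partial>uniform_measure R (at_time E t z))"

definition geodesic_kernel ::
  "('a \<Rightarrow> 'a \<Rightarrow> bool) \<Rightarrow> ('a \<Rightarrow> 'a \<Rightarrow> real) \<Rightarrow> (real \<Rightarrow> 'a \<Rightarrow> 'a \<Rightarrow> real) \<Rightarrow>
     (real \<Rightarrow> 'a) measure \<Rightarrow> 'a \<Rightarrow> real \<Rightarrow> 'a \<Rightarrow> 'a \<Rightarrow> real" where
  "geodesic_kernel E d J R y t z w =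
     (if w \<in> geodesic_succs E d y z
      then geodesic_weight E d J R y t w / geodesic_weight E d J R y t z * J t z w else 0)"

end

theory Submission imports Defs
begin

text \<open>
  Changing the jump kernel of a walk by a factor depending on the edge only multiplies its law by
  an explicit functional: the product of the factors over the jumps times the exponential of the
  lost mass. Hence \<open>k\<^sup>d R\<^sup>k\<close>, restricted to the paths from \<open>x\<close> to \<open>y\<close>, converges boundedly to the
  geodesic measure \<open>G\<close>, so that \<open>G\<^sup>x\<^sup>y\<close> is a limit of Markov bridges; its kernel is the Doob transform
  of the rates by the backward solution \<open>g\<^sup>y\<close>. The Schroedinger minimizers factorize as
  \<open>f(X\<^sub>0) g(X\<^sub>1) R\<^sup>k\<close>, as local perturbations on rectangles of endpoints show, so they are Markov too, and
  their limit is the mixture of the \<open>G\<^sup>x\<^sup>y\<close>. Averaging Dynkin's formula for the bridges over the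
  endpoints and using the Markov property at the current time gives the mixed kernel.
\<close>

section \<open>Paths as step functions\<close>

text \<open>Three obstacles shape the argument. The rates are only measurable in time, so generators
  cannot be differentiated: the evolution identities come from errors that are additive or telescope
  over a grid and are of second order in the step \<open>h\<close>, where one jump has probability
  of order \<open>h\<close> and two jumps of order \<open>h\<^sup>2\<close>. Next, the kernel of a
  bridge to \<open>y\<close> divides by the weight \<open>g\<close>, which vanishes at time 1 away
  from \<open>y\<close>, so the kernel may be unbounded. The estimates are made for the flux, state
  mass times kernel, in which the division cancels; its time integral is at most the mass of the
  bridge, because a geodesic crosses an edge at most once. Finally, narrow convergence sees only
  continuous functionals, and evaluation at an interior time is in general not one. The minimizers
  share the bridges of \<open>R^k\<close>, which converge setwise; narrow convergence fixes the
  limit law of the endpoints, whose indicators are continuous, and identifies the limit through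
  averages over short time windows.\<close>

definition jumps :: "(real \<Rightarrow> 'a) \<Rightarrow> real \<Rightarrow> real \<Rightarrow> real set" where
  "jumps X s t = jump_times X \<inter> {s<..t}"

text \<open>Jumps are counted on half-open intervals \<open>(s, t]\<close>, so sums and products
  over them split exactly at any intermediate time.\<close>

definition jump_prod :: "('a \<Rightarrow> 'a \<Rightarrow> real) \<Rightarrow> real \<Rightarrow> real \<Rightarrow> (real \<Rightarrow> 'a) \<Rightarrow> real" where
  "jump_prod a s t X = (\<Prod>r\<in>jumps X s t. a (left_lim X r) (X r))"

definition grid :: "real \<Rightarrow> real \<Rightarrow> nat \<Rightarrow> nat \<Rightarrow> real" where
  "grid s t n i = s + (t - s) * real i / real n"

lemma left_lim_eqI: "\<forall>\<^sub>F s in at_left t. X s = z \<Longrightarrow> left_lim X t = z"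
  unfolding left_lim_def
proof (rule the_equality)
  fix b assume a: "\<forall>\<^sub>F s in at_left t. X s = z" and "\<forall>\<^sub>F s in at_left t. X s = b"
  then have "\<forall>\<^sub>F s in at_left t. b = z" by eventually_elim simp
  then show "b = z" by simp
qed

lemma jump_times_subset: "jump_times X \<subseteq> {0<..<1}"
  by (auto simp: jump_times_def)

lemma finite_jumps: "X \<in> paths E \<Longrightarrow> finite (jumps X s t)"
  by (auto simp: paths_def jumps_def)

lemma jumps_01: "jumps X 0 1 = jump_times X"
  using jump_times_subset[of X] by (auto simp: jumps_def)

lemma jumps_same [simp]: "jumps X s s = {}"
  by (auto simp: jumps_def)

lemma jumps_Un: "s \<le> t \<Longrightarrow> t \<le> u \<Longrightarrow> jumps X s u = jumps X s t \<union> jumps X t u"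
  by (auto simp: jumps_def)

lemma jumps_disjoint: "jumps X s t \<inter> jumps X t u = {}"
  by (auto simp: jumps_def)

lemma sum_jumps_split:
  "X \<in> paths E \<Longrightarrow> s \<le> t \<Longrightarrow> t \<le> u \<Longrightarrow>
    (\<Sum>r\<in>jumps X s u. f r) = (\<Sum>r\<in>jumps X s t. f r) + (\<Sum>r\<in>jumps X t u. f r)"
  using jumps_disjoint[of X s t u] by (simp add: jumps_Un[of s t u] sum.union_disjoint finite_jumps)

lemma jump_prod_split:
  "X \<in> paths E \<Longrightarrow> s \<le> t \<Longrightarrow> t \<le> u \<Longrightarrow> jump_prod a s u X = jump_prod a s t X * jump_prod a t u X"
  using jumps_disjoint[of X s t u]
  by (simp add: jump_prod_def jumps_Un[of s t u] prod.union_disjoint finite_jumps)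

lemma left_lim_eventually:
  assumes "X \<in> paths E" "0 < t" "t \<le> 1"
  shows "\<forall>\<^sub>F s in at_left t. X s = left_lim X t"
proof -
  have "\<exists>z. \<forall>\<^sub>F s in at_left t. X s = z" using assms by (auto simp: paths_def)
  then obtain z where z: "\<forall>\<^sub>F s in at_left t. X s = z" by blast
  with left_lim_eqI[OF z] show ?thesis by simp
qed

lemma right_eventually:
  "X \<in> paths E \<Longrightarrow> 0 \<le> t \<Longrightarrow> t < 1 \<Longrightarrow> \<forall>\<^sub>F s in at_right t. X s = X t"
  by (auto simp: paths_def)

lemma left_lim_no_jump:
  assumes "X \<in> paths E" "0 < t" "t \<le> 1" "t \<notin> jump_times X"
  shows "left_lim X t = X t"
proof (cases "t = 1")
  case True
  then show ?thesis using assms(1) by (intro left_lim_eqI) (simp add: paths_def)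
qed (use assms in \<open>auto simp: jump_times_def\<close>)

text \<open>Without jumps in \<open>(s, t]\<close> the path is locally constant on
  \<open>{s..t}\<close>: right-continuity settles the right side of a point and the absence of a
  jump the left side. Connectedness of the interval does the rest.\<close>

lemma path_const:
  assumes X: "X \<in> paths E" and st: "0 \<le> s" "s \<le> t" "t \<le> 1" and no: "jumps X s t = {}"
  shows "X s = X t"
proof (rule connected_local_const[of "{s..t}"])
  show "\<forall>u\<in>{s..t}. \<forall>\<^sub>F v in at u within {s..t}. X u = X v"
  proof
    fix u assume u: "u \<in> {s..t}"
    have "\<forall>\<^sub>F v in at_left u. v \<in> {s..t} \<longrightarrow> X u = X v"
    proof (cases "s < u")
      case True
      then have "u \<notin> jump_times X" using no u by (auto simp: jumps_def)
      then have "left_lim X u = X u" using left_lim_no_jump[OF X] True u st by auto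
      moreover have "\<forall>\<^sub>F v in at_left u. X v = left_lim X u"
        using left_lim_eventually[OF X, of u] True u st by auto
      ultimately show ?thesis by (auto elim: eventually_mono)
    next
      case False
      then show ?thesis using u by (auto simp: eventually_at_left_field intro!: exI[of _ "u - 1"])
    qed
    moreover have "\<forall>\<^sub>F v in at_right u. v \<in> {s..t} \<longrightarrow> X u = X v"
    proof (cases "u < t")
      case True
      then have "\<forall>\<^sub>F v in at_right u. X v = X u"
        using right_eventually[OF X, of u] u st by auto
      then show ?thesis by (auto elim: eventually_mono)
    next
      case False
      then show ?thesis using u by (auto simp: eventually_at_right_field intro!: exI[of _ "u + 1"])
    qed
    ultimately have "\<forall>\<^sub>F v in at u. v \<in> {s..t} \<longrightarrow> X u = X v" by (simp add: eventually_at_split)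
    then show "\<forall>\<^sub>F v in at u within {s..t}. X u = X v"
      unfolding eventually_at_filter by (rule eventually_mono) auto
  qed
qed (use st in auto)

lemma left_lim_eq_value:
  assumes X: "X \<in> paths E" and st: "0 \<le> s" "s < r" "r \<le> 1" and no: "jumps X s r \<subseteq> {r}"
  shows "left_lim X r = X s"
proof (rule left_lim_eqI)
  have "\<forall>\<^sub>F v in at_left r. v \<in> {s<..<r}" using st by (intro eventually_at_left_real) auto
  then show "\<forall>\<^sub>F v in at_left r. X v = X s"
  proof eventually_elim
    case (elim v)
    have "jumps X s v = {}" using no elim by (auto simp: jumps_def)
    then show ?case using path_const[OF X, of s v] elim st by auto
  qed
qed

lemma single_jump:
  assumes X: "X \<in> paths E" and st: "0 \<le> s" "s \<le> t" "t \<le> 1" and J: "jumps X s t = {r}"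
  shows "X s = left_lim X r" "X t = X r" "X s \<noteq> X t" "E (X s) (X t)"
proof -
  have "r \<in> jumps X s t" using J by simp
  then have r: "r \<in> jump_times X" "s < r" "r \<le> t" by (simp_all add: jumps_def)
  have "jumps X s r \<subseteq> jumps X s t" using r by (auto simp: jumps_def)
  then have "jumps X s r \<subseteq> {r}" unfolding J .
  then show 1: "X s = left_lim X r" using left_lim_eq_value[OF X, of s r] st r by auto
  have "jumps X r t = {}"
  proof -
    have "jumps X r t \<subseteq> jumps X s t - {r}" using r by (auto simp: jumps_def)
    then show ?thesis unfolding J by simp
  qed
  then show 2: "X t = X r" using path_const[OF X, of r t] st r by simp
  have "left_lim X r \<noteq> X r" using r(1) by (simp add: jump_times_def)
  then show "X s \<noteq> X t" by (simp only: 1 2 not_False_eq_True)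
  have "E (left_lim X r) (X r)" using r(1) X by (simp add: paths_def)
  then show "E (X s) (X t)" by (simp only: 1 2)
qed

text \<open>Strong induction on the number of jumps. The last jump \<open>r\<close> is isolated by
  cutting at \<open>q\<close>, the previous jump time or \<open>s\<close>. A property that survives
  concatenation thus has to be checked only on intervals with at most one jump.\<close>

lemma path_induct [consumes 4, case_names const jump trans]:
  assumes X: "X \<in> paths E" and st: "0 \<le> s" "s \<le> t" "t \<le> 1"
    and const: "\<And>u v. s \<le> u \<Longrightarrow> u \<le> v \<Longrightarrow> v \<le> t \<Longrightarrow> jumps X u v = {} \<Longrightarrow> X u = X v \<Longrightarrow> P u v"
    and jump: "\<And>u v r. s \<le> u \<Longrightarrow> u \<le> v \<Longrightarrow> v \<le> t \<Longrightarrow> jumps X u v = {r} \<Longrightarrow>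
      X u = left_lim X r \<Longrightarrow> X v = X r \<Longrightarrow> P u v"
    and trans: "\<And>u v w. s \<le> u \<Longrightarrow> u \<le> v \<Longrightarrow> v \<le> w \<Longrightarrow> w \<le> t \<Longrightarrow> P u v \<Longrightarrow> P v w \<Longrightarrow> P u w"
  shows "P s t"
proof -
  have "P s v" if "s \<le> v" "v \<le> t" for v
    using that
  proof (induction "card (jumps X s v)" arbitrary: v rule: less_induct)
    case less
    have fin: "finite (jumps X s v)" using finite_jumps[OF X] .
    show ?case
    proof (cases "jumps X s v = {}")
      case True
      then show ?thesis using const[of s v] path_const[OF X, of s v] less.prems st by auto
    next
      case False
      define r where "r = Max (jumps X s v)"
      have r: "r \<in> jumps X s v" using Max_in[OF fin False] by (simp add: r_def)
      have rmax: "q \<le> r" if "q \<in> jumps X s v" for q using Max_ge[OF fin that] by (simp add: r_def)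
      define q where "q = Max (insert s (jumps X s v - {r}))"
      have qin: "q \<in> insert s (jumps X s v - {r})" unfolding q_def using fin by (intro Max_in) auto
      have qmax: "p \<le> q" if "p \<in> jumps X s v" "p \<noteq> r" for p
        unfolding q_def using that fin by (intro Max_ge) auto
      have qb: "s \<le> q" "q < r" "r \<le> v"
        using qin r rmax[of q] by (auto simp: jumps_def)
      have "jumps X s q \<subseteq> jumps X s v - {r}" using qb by (auto simp: jumps_def)
      then have "card (jumps X s q) < card (jumps X s v)"
        using r fin by (intro psubset_card_mono) auto
      then have "P s q" using less.hyps[of q] qb less.prems by auto
      moreover have J: "jumps X q v = {r}"
      proof
        show "jumps X q v \<subseteq> {r}"
        proof
          fix p assume p: "p \<in> jumps X q v"
          then have "p \<in> jumps X s v" "q < p" using qb by (auto simp: jumps_def)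
          then show "p \<in> {r}" using qmax[of p] by auto
        qed
        show "{r} \<subseteq> jumps X q v" using r qb by (auto simp: jumps_def)
      qed
      have "P q v"
        using jump[of q v r] single_jump[OF X _ _ _ J] J qb less.prems st by auto
      ultimately show ?thesis using trans[of s q v] qb less.prems by auto
    qed
  qed
  then show ?thesis using st by auto
qed

text \<open>The typical \<open>\<psi>\<close> is the distance to a fixed state; the identity then
  compares the length of a path with the distance it has gained.\<close>

lemma sum_jumps_telescope:
  fixes \<psi> :: "'a \<Rightarrow> real"
  assumes X: "X \<in> paths E" and st: "0 \<le> s" "s \<le> t" "t \<le> 1"
  shows "(\<Sum>r\<in>jumps X s t. \<psi> (left_lim X r) - \<psi> (X r)) = \<psi> (X s) - \<psi> (X t)"
  using assms
proof (induction rule: path_induct)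
  case (trans u v w)
  then show ?case by (subst sum_jumps_split[OF X, of u v w]) auto
qed auto

lemma grid_diff: "grid s t n (Suc i) - grid s t n i = (t - s) / n"
proof -
  have "grid s t n (Suc i) - grid s t n i = ((t - s) * real (Suc i) - (t - s) * real i) / n"
    by (simp add: grid_def diff_divide_distrib)
  also have "(t - s) * real (Suc i) - (t - s) * real i = t - s" by (simp add: algebra_simps)
  finally show ?thesis .
qed

text \<open>As soon as the mesh is below the smallest gap between points of \<open>F\<close>, no
  cell holds two of them.\<close>

lemma separated_grid:
  assumes "finite F" and st: "s \<le> t"
  shows "\<forall>\<^sub>F n in sequentially. \<forall>i<n. \<forall>p\<in>F. \<forall>q\<in>F.
     p \<in> {grid s t n i<..grid s t n (Suc i)} \<longrightarrow> q \<in> {grid s t n i<..grid s t n (Suc i)} \<longrightarrow> p = q"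
proof -
  \<comment> \<open>The extra \<open>1\<close> keeps this set nonempty when \<open>F\<close> has at
    most one point.\<close>
  define D where "D = insert 1 {\<bar>p - q\<bar> | p q. p \<in> F \<and> q \<in> F \<and> p \<noteq> q}"
  have "D \<subseteq> insert 1 ((\<lambda>(p,q). \<bar>p - q\<bar>) ` (F \<times> F))" by (auto simp: D_def)
  then have D: "finite D" using assms by (meson finite.insertI finite_SigmaI finite_imageI finite_subset)
  define \<delta> where "\<delta> = Min D"
  have "\<delta> \<in> D" unfolding \<delta>_def using D by (intro Min_in) (auto simp: D_def)
  then have pos: "0 < \<delta>" by (auto simp: D_def)
  have far: "\<delta> \<le> \<bar>p - q\<bar>" if "p \<in> F" "q \<in> F" "p \<noteq> q" for p q
    unfolding \<delta>_def using D that by (intro Min_le) (auto simp: D_def)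
  have "\<forall>\<^sub>F n in sequentially. (t - s) / \<delta> < real n" 
    using filterlim_real_sequentially by (metis filterlim_at_top_dense)
  then show ?thesis
  proof eventually_elim
    case (elim n)
    have n: "n > 0"
    proof (rule ccontr)
      assume "\<not> n > 0" then show False using elim pos st by (simp add: divide_less_0_iff)
    qed
    have "(t - s) / n < \<delta>" using elim pos n by (simp add: field_simps)
    then have len: "grid s t n (Suc i) - grid s t n i < \<delta>" for i
      by (simp add: grid_diff)
    show ?case
    proof (intro allI impI ballI)
      fix i p q assume "p \<in> F" "q \<in> F" "p \<in> {grid s t n i<..grid s t n (Suc i)}" "q \<in> {grid s t n i<..grid s t n (Suc i)}"
      then have "\<bar>p - q\<bar> < \<delta>" "p \<in> F" "q \<in> F" using len[of i] by (auto simp: abs_less_iff)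
      then show "p = q" using far[of p q] by force
    qed
  qed
qed

lemma grid_0 [simp]: "grid s t n 0 = s" by (simp add: grid_def)

lemma grid_n [simp]: "n > 0 \<Longrightarrow> grid s t n n = t" by (simp add: grid_def)

lemma grid_mono: "s \<le> t \<Longrightarrow> i \<le> j \<Longrightarrow> grid s t n i \<le> grid s t n j"
  by (auto simp: grid_def intro!: divide_right_mono mult_left_mono)

lemma grid_in: assumes "s \<le> t" "i \<le> n" "n > 0" shows "s \<le> grid s t n i" "grid s t n i \<le> t"
  using grid_mono[OF assms(1), of 0 i n] grid_mono[OF assms(1,2), of n] assms(3) by auto

lemma grid_cell:
  assumes "s < r" "r \<le> t" "n > 0"
  obtains i where "i < n" "r \<in> {grid s t n i<..grid s t n (Suc i)}"
proof -
  have "\<exists>k<n. (\<forall>i\<le>k. \<not> r \<le> grid s t n i) \<and> r \<le> grid s t n (Suc k)"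
    by (rule ex_least_nat_less) (use assms in auto)
  then show ?thesis using that by auto
qed

lemma jumps_grid:
  assumes X: "X \<in> paths E" and st: "s \<le> t"
  shows "\<forall>\<^sub>F n in sequentially. n > 0 \<and> (\<forall>i<n. jumps X (grid s t n i) (grid s t n (Suc i)) = {} \<or>
     (\<exists>r. jumps X (grid s t n i) (grid s t n (Suc i)) = {r}))"
proof -
  have "finite (jump_times X)" using X by (simp add: paths_def)
  from separated_grid[OF this st] eventually_gt_at_top[of 0] show ?thesis
  proof eventually_elim
    case (elim n)
    show ?case
    proof (intro conjI allI impI)
      fix i assume "i < n"
      have "p = q" if "p \<in> jumps X (grid s t n i) (grid s t n (Suc i))" "q \<in> jumps X (grid s t n i) (grid s t n (Suc i))" for p q
        using elim(1)[rule_format, OF \<open>i < n\<close>, of p q] that by (auto simp: jumps_def)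
      then show "jumps X (grid s t n i) (grid s t n (Suc i)) = {} \<or>
         (\<exists>r. jumps X (grid s t n i) (grid s t n (Suc i)) = {r})"
        by blast
    qed (use elim in auto)
  qed
qed

text \<open>On a grid that separates the jumps, a cell contributes one factor if its two end values
  differ and 1 otherwise. The functional is thus eventually a function of finitely many coordinates,
  which is how its measurability is obtained.\<close>

lemma jump_prod_grid:
  assumes X: "X \<in> paths E" and st: "0 \<le> s" "s \<le> t" "t \<le> 1"
  shows "\<forall>\<^sub>F n in sequentially. (\<Prod>i<n. if X (grid s t n i) = X (grid s t n (Suc i)) then 1
     else a (X (grid s t n i)) (X (grid s t n (Suc i)))) = jump_prod a s t X"
  using jumps_grid[OF X st(2)]
proof eventually_elim
  case (elim n)
  define g where "g = grid s t n"
  have g: "0 \<le> g i" "g i \<le> g (Suc i)" "g i \<le> 1" if "i \<le> n" for i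
    using that grid_in[of s t i n] grid_mono[of s t i "Suc i" n] elim st unfolding g_def by auto
  have "(\<Prod>i<m. if X (g i) = X (g (Suc i)) then 1 else a (X (g i)) (X (g (Suc i)))) = jump_prod a (g 0) (g m) X"
    if "m \<le> n" for m
    using that
  proof (induction m)
    case 0 show ?case by (simp add: jump_prod_def)
  next
    case (Suc m)
    have "jump_prod a (g m) (g (Suc m)) X = (if X (g m) = X (g (Suc m)) then 1 else a (X (g m)) (X (g (Suc m))))"
    proof -
      consider "jumps X (g m) (g (Suc m)) = {}" | r where "jumps X (g m) (g (Suc m)) = {r}"
        using elim Suc.prems unfolding g_def by (meson Suc_le_lessD)
      then show ?thesis
      proof cases
        case 1
        then show ?thesis using path_const[OF X, of "g m" "g (Suc m)"] g[of m] g[of "Suc m"] Suc.prems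
          by (simp add: jump_prod_def)
      next
        case (2 r)
        then show ?thesis using single_jump[OF X, of "g m" "g (Suc m)" r] g[of m] g[of "Suc m"] Suc.prems
          by (simp add: jump_prod_def)
      qed
    qed
    then show ?case using Suc jump_prod_split[OF X, of "g 0" "g m" "g (Suc m)" a] g[of m]
        grid_mono[of s t 0 m n] st by (simp add: g_def)
  qed
  from this[of n] show ?case using elim unfolding g_def by simp
qed

lemma jump_in_cell:
  assumes X: "X \<in> paths E" and st: "0 \<le> s" "s \<le> t" "t \<le> 1" and n: "n > 0" "i < n"
    and r: "r \<in> jumps X (grid s t n i) (grid s t n (Suc i))"
    and one: "jumps X (grid s t n i) (grid s t n (Suc i)) = {} \<or>
      (\<exists>r. jumps X (grid s t n i) (grid s t n (Suc i)) = {r})"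
  shows "X (grid s t n i) \<noteq> X (grid s t n (Suc i))"
proof -
  have "jumps X (grid s t n i) (grid s t n (Suc i)) = {r}" using r one by auto
  from single_jump(3)[OF X _ _ _ this] show ?thesis
    using st n grid_in[of s t i n] grid_in[of s t "Suc i" n] grid_mono[of s t i "Suc i" n] by auto
qed

text \<open>Cells are judged by their end values, because these are what the martingale identity
  controls. Once the grid separates the jumps, no jump is masked by a return within its
  cell.\<close>

lemma jump_grid_detect:
  assumes X: "X \<in> paths E" and st: "0 \<le> s" "s \<le> t" "t \<le> 1" and ne: "jumps X s t \<noteq> {}"
  shows "\<forall>\<^sub>F n in sequentially. \<exists>i<n. X (grid s t n i) \<noteq> X (grid s t n (Suc i))"
  using jumps_grid[OF X st(2)]
proof eventually_elim
  case (elim n)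
  obtain r where r: "r \<in> jumps X s t" using ne by auto
  then obtain i where i: "i < n" "r \<in> {grid s t n i<..grid s t n (Suc i)}"
    using grid_cell[of s r t n] elim by (auto simp: jumps_def)
  then show ?case using jump_in_cell[OF X st _ i(1), of r] elim r by (auto simp: jumps_def)
qed

lemma two_jumps_grid_detect:
  assumes X: "X \<in> paths E" and st: "0 \<le> s" "s \<le> t" "t \<le> 1" and two: "2 \<le> card (jumps X s t)"
  shows "\<forall>\<^sub>F n in sequentially. \<exists>j<n. \<exists>i<j. X (grid s t n i) \<noteq> X (grid s t n (Suc i)) \<and>
    X (grid s t n j) \<noteq> X (grid s t n (Suc j))"
  using jumps_grid[OF X st(2)]
proof eventually_elim
  case (elim n)
  obtain p q where pq: "p \<in> jumps X s t" "q \<in> jumps X s t" "p < q"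
  proof -
    have "\<not> (\<forall>p\<in>jumps X s t. \<forall>q\<in>jumps X s t. p = q)"
      using two card_le_Suc0_iff_eq[OF finite_jumps[OF X, of s t]] by auto
    then obtain p q where "p \<in> jumps X s t" "q \<in> jumps X s t" "p \<noteq> q" by blast
    then show ?thesis using that[of p q] that[of q p] by (cases "p < q") auto
  qed
  obtain i where i: "i < n" "p \<in> {grid s t n i<..grid s t n (Suc i)}"
    using grid_cell[of s p t n] elim pq by (auto simp: jumps_def)
  obtain j where j: "j < n" "q \<in> {grid s t n j<..grid s t n (Suc j)}"
    using grid_cell[of s q t n] elim pq by (auto simp: jumps_def)
  have pi: "p \<in> jumps X (grid s t n i) (grid s t n (Suc i))" and qj: "q \<in> jumps X (grid s t n j) (grid s t n (Suc j))"
    using i j pq by (auto simp: jumps_def)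
  have "i \<noteq> j"
  proof
    assume "i = j"
    then have "p = q" using pi qj elim i by auto
    then show False using pq by simp
  qed
  moreover have "\<not> j < i"
  proof
    assume "j < i"
    then have "grid s t n (Suc j) \<le> grid s t n i" using grid_mono[OF st(2), of "Suc j" i n] by auto
    then show False using i j pq by auto
  qed
  ultimately have "i < j" by simp
  then show ?case using jump_in_cell[OF X st _ i(1) pi] jump_in_cell[OF X st _ j(1) qj] elim i j by auto
qed

lemma jumps_cases:
  assumes X: "X \<in> paths E"
  obtains "jumps X s t = {}" | r where "jumps X s t = {r}" | "2 \<le> card (jumps X s t)"
proof -
  have "card (jumps X s t) = 0 \<or> card (jumps X s t) = 1 \<or> 2 \<le> card (jumps X s t)" by linarith
  then show thesis using that finite_jumps[OF X, of s t] by (metis card_0_eq card_1_singletonE)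
qed

subsection \<open>Prefixing a path by a constant piece\<close>

text \<open>A surgery on paths: the part before \<open>r\<close> is replaced by the constant
  \<open>z\<close>, with at most one new jump, at \<open>r\<close>. It serves to prepend an edge to
  a path and to turn the part of a path after a given time into a geodesic of its own.\<close>

definition prefix_const :: "'a \<Rightarrow> real \<Rightarrow> (real \<Rightarrow> 'a) \<Rightarrow> real \<Rightarrow> 'a" where
  "prefix_const z r X = (\<lambda>t\<in>{0..1}. if t < r then z else X t)"

lemma const_path: "(\<lambda>t\<in>{0..1}. z) \<in> paths E" "jump_times (\<lambda>t\<in>{0..1}. z) = {}"
proof -
  have l: "\<forall>\<^sub>F s in at_left t. (\<lambda>t\<in>{0..1}. z) s = z" if "0 < t" "t \<le> 1" for t :: real
  proof -
    have "\<forall>\<^sub>F v in at_left t. v \<in> {0<..<t}" using that by (intro eventually_at_left_real) auto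
    then show ?thesis by eventually_elim (use that in auto)
  qed
  have r: "\<forall>\<^sub>F s in at_right t. (\<lambda>t\<in>{0..1}. z) s = z" if "0 \<le> t" "t < 1" for t :: real
  proof -
    have "\<forall>\<^sub>F v in at_right t. v \<in> {t<..<1}" using that by (intro eventually_at_right_real) auto
    then show ?thesis by eventually_elim (use that in auto)
  qed
  show J: "jump_times (\<lambda>t\<in>{0..1}. z) = {}"
    unfolding jump_times_def using left_lim_eqI[OF l] by fastforce
  show "(\<lambda>t\<in>{0..1}. z) \<in> paths E"
    unfolding paths_def J
  proof (intro CollectI conjI ballI)
    show "\<forall>\<^sub>F s in at_right t. (\<lambda>t\<in>{0..1}. z) s = (\<lambda>t\<in>{0..1}. z) t" if "t \<in> {0..<1}" for t :: real
      using r[of t] that by simp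
    show "\<exists>z'. \<forall>\<^sub>F s in at_left t. (\<lambda>t\<in>{0..1}. z) s = z'" if "t \<in> {0<..1}" for t :: real
      using l[of t] that by (intro exI[of _ z]) simp
    show "\<forall>\<^sub>F s in at_left (1::real). (\<lambda>t\<in>{0..1}. z) s = (\<lambda>t\<in>{0..1}. z) (1::real)"
    proof -
      have "(\<lambda>t\<in>{0..1}. z) (1::real) = z" by simp
      then show ?thesis using l[OF zero_less_one order_refl] by (simp only:)
    qed
  qed (use J in auto)
qed

lemma prefix_const:
  assumes X: "X \<in> paths E" and r: "0 \<le> r" "r \<le> 1" and z: "z = X r \<or> 0 < r \<and> r < 1 \<and> z \<noteq> X r \<and> E z (X r)"
  shows "prefix_const z r X \<in> paths E"
    and "jump_times (prefix_const z r X) = jumps X r 1 \<union> (if z = X r then {} else {r})"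
    and "\<And>t. t \<in> {r..1} \<Longrightarrow> prefix_const z r X t = X t"
    and "\<And>t. t \<in> {r<..1} \<Longrightarrow> left_lim (prefix_const z r X) t = left_lim X t"
    and "0 < r \<Longrightarrow> left_lim (prefix_const z r X) r = z"
    and "prefix_const z r X 0 = (if 0 < r then z else X 0)"
proof -
  let ?p = "prefix_const z r X"
  show val: "?p t = X t" if "t \<in> {r..1}" for t using that r by (auto simp: prefix_const_def)
  show "?p 0 = (if 0 < r then z else X 0)" using r by (auto simp: prefix_const_def)
  have l1: "\<forall>\<^sub>F s in at_left t. ?p s = z" if "0 < t" "t \<le> r" for t
  proof -
    have "\<forall>\<^sub>F v in at_left t. v \<in> {0<..<t}" using that by (intro eventually_at_left_real) auto
    then show ?thesis by eventually_elim (use that r in \<open>auto simp: prefix_const_def\<close>)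
  qed
  have l2: "\<forall>\<^sub>F s in at_left t. ?p s = left_lim X t" if "r < t" "t \<le> 1" for t
  proof -
    have "\<forall>\<^sub>F v in at_left t. v \<in> {r<..<t}" using that by (intro eventually_at_left_real) auto
    moreover have "\<forall>\<^sub>F v in at_left t. X v = left_lim X t" using left_lim_eventually[OF X, of t] that r by simp
    ultimately show ?thesis by eventually_elim (use that r in \<open>auto simp: prefix_const_def\<close>)
  qed
  show ll2: "left_lim ?p t = left_lim X t" if "t \<in> {r<..1}" for t using left_lim_eqI[OF l2] that by auto
  show ll1: "0 < r \<Longrightarrow> left_lim ?p r = z" using left_lim_eqI[OF l1[of r]] by auto
  have ll3: "left_lim ?p t = z" if "0 < t" "t \<le> r" for t using left_lim_eqI[OF l1] that by auto
  show J: "jump_times ?p = jumps X r 1 \<union> (if z = X r then {} else {r})"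
  proof (rule set_eqI)
    fix t
    consider "t \<le> 0 \<or> t \<ge> 1" | "0 < t" "t < r" | "0 < t" "t = r" "t < 1" | "r < t" "0 < t" "t < 1" using r by linarith
    then show "t \<in> jump_times ?p \<longleftrightarrow> t \<in> jumps X r 1 \<union> (if z = X r then {} else {r})"
    proof cases
      case 1 then show ?thesis using r z by (auto simp: jump_times_def jumps_def)
    next
      case 2
      then have "?p t = z" using r by (auto simp: prefix_const_def)
      then show ?thesis using 2 ll3[of t] r by (auto simp: jump_times_def jumps_def)
    next
      case 3
      then show ?thesis using ll3[of t] val[of t] by (auto simp: jump_times_def jumps_def)
    next
      case 4
      then show ?thesis using ll2[of t] val[of t] by (auto simp: jump_times_def jumps_def)
    qed
  qed
  show "?p \<in> paths E"
    unfolding paths_def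
  proof (intro CollectI conjI ballI)
    show "?p \<in> extensional {0..1}" by (simp add: prefix_const_def)
    show "finite (jump_times ?p)" unfolding J using finite_jumps[OF X] by auto
    show "\<forall>\<^sub>F s in at_right t. ?p s = ?p t" if t: "t \<in> {0..<1}" for t
    proof (cases "t < r")
      case True
      have "\<forall>\<^sub>F v in at_right t. v \<in> {t<..<r}" using True by (intro eventually_at_right_real) auto
      then show ?thesis by eventually_elim (use True r t in \<open>auto simp: prefix_const_def\<close>)
    next
      case False
      have "\<forall>\<^sub>F v in at_right t. v \<in> {t<..<1}" using t by (intro eventually_at_right_real) auto
      moreover have "\<forall>\<^sub>F v in at_right t. X v = X t" using right_eventually[OF X, of t] t by simp
      ultimately show ?thesis by eventually_elim (use val False t in auto)
    qed
    show "\<exists>z. \<forall>\<^sub>F s in at_left t. ?p s = z" if t: "t \<in> {0<..1}" for t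
      using l1[of t] l2[of t] t by (cases "t \<le> r") auto
    show "\<forall>\<^sub>F s in at_left 1. ?p s = ?p 1"
    proof (cases "r = 1")
      case True then show ?thesis using l1[of 1] val[of 1] z by auto
    next
      case False
      then have "left_lim X 1 = X 1" using left_lim_no_jump[OF X, of 1] by (auto simp: jump_times_def)
      then show ?thesis using l2[of 1] val[of 1] False r by auto
    qed
    show "E (left_lim ?p t) (?p t)" if t: "t \<in> jump_times ?p" for t
    proof (cases "t = r \<and> z \<noteq> X r")
      case True then show ?thesis using ll1 val[of r] z by auto
    next
      case False
      then have "t \<in> jumps X r 1" using t unfolding J by (auto split: if_splits)
      then show ?thesis using ll2[of t] val[of t] X by (auto simp: jumps_def paths_def)
    qed
  qed
qed

lemma path_exists:
  assumes "E\<^sup>*\<^sup>* x y" "irreflp E"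
  shows "\<exists>X\<in>paths E. X 0 = x \<and> X 1 = y"
  using assms(1)
proof (induction rule: converse_rtranclp_induct)
  case base
  show ?case using const_path(1)[of y E] by (intro bexI[of _ "\<lambda>t\<in>{0..1}. y"]) auto
next
  case (step x z)
  then obtain X where X: "X \<in> paths E" "X 0 = z" "X 1 = y" by auto
  obtain b where b: "b > 0" "\<forall>v>0. v < b \<longrightarrow> X v = z"
    using right_eventually[OF X(1), of 0] X(2) by (auto simp: eventually_at_right_field)
  \<comment> \<open>Early enough that \<open>X r\<close> is still the initial state
    \<open>z\<close>, to which the edge from \<open>x\<close> leads, and inside the open unit
    interval, where jumps are allowed.\<close>
  define r where "r = min (b/2) (1/2)"
  have r: "0 < r" "r < 1" "X r = z" using b by (auto simp: r_def min_def)
  have ne: "x \<noteq> X r" using step(1) assms(2) r by (auto simp: irreflp_def)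
  have z: "x = X r \<or> 0 < r \<and> r < 1 \<and> x \<noteq> X r \<and> E x (X r)" using step(1) ne r by auto
  have "0 \<le> r" "r \<le> 1" using r by auto
  note pc = prefix_const[OF X(1) this z]
  have "prefix_const x r X 0 = x" "prefix_const x r X 1 = y" using pc(3)[of 1] pc(6) r X by simp_all
  then show ?case using pc(1) by blast
qed

section \<open>Measurability on path space\<close>

lemma space_path_events [simp]: "space (path_events E I) = paths E"
  by (simp add: path_events_def space_measure_of_conv)

lemma path_events_gen: "{{X \<in> paths E. X t \<in> B} | t B. t \<in> I} \<subseteq> Pow (paths E)"
  by auto

lemma sets_path_events: "sets (path_events E I) = sigma_sets (paths E) {{X \<in> paths E. X t \<in> B} | t B. t \<in> I}"
  unfolding path_events_def by (rule sets_measure_of) (rule path_events_gen)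

lemma coord_sets: "t \<in> I \<Longrightarrow> {X \<in> paths E. X t \<in> B} \<in> sets (path_events E I)"
  unfolding sets_path_events by (rule sigma_sets.Basic) auto

lemma at_time_sets: "t \<in> I \<Longrightarrow> at_time E t z \<in> sets (path_events E I)"
  using coord_sets[of t I E "{z}"] by simp

lemma coord_measurable: "t \<in> I \<Longrightarrow> (\<lambda>X. X t) \<in> path_events E I \<rightarrow>\<^sub>M count_space UNIV"
  using coord_sets[of t I E] by (auto simp: measurable_def vimage_def Int_def conj_commute)

lemma path_events_mono: "I \<subseteq> I' \<Longrightarrow> sets (path_events E I) \<subseteq> sets (path_events E I')"
  unfolding sets_path_events by (rule sigma_sets_subseteq) auto

lemma measurable_path_events_mono:
  assumes "f \<in> path_events E I \<rightarrow>\<^sub>M N" "I \<subseteq> I'" shows "f \<in> path_events E I' \<rightarrow>\<^sub>M N"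
proof (rule measurableI)
  fix A assume "A \<in> sets N"
  with measurable_sets[OF assms(1)] show "f -` A \<inter> space (path_events E I') \<in> sets (path_events E I')"
    using path_events_mono[OF assms(2)] by auto
qed (use measurable_space[OF assms(1)] in auto)

lemma coord_compose_measurable:
  fixes f :: "'a::countable \<Rightarrow> 'b"
  shows "t \<in> I \<Longrightarrow> f \<in> UNIV \<rightarrow> space N \<Longrightarrow> (\<lambda>X. f (X t)) \<in> path_events E I \<rightarrow>\<^sub>M N"
  by (rule measurable_compose[OF coord_measurable]) auto

lemma coord2_compose_measurable:
  fixes f :: "'a::countable \<Rightarrow> 'a \<Rightarrow> real"
  assumes "s \<in> I" "t \<in> I"
  shows "(\<lambda>X. f (X s) (X t)) \<in> borel_measurable (path_events E I)"
  by (rule measurable_compose_countable[where f = "\<lambda>x X. f x (X t)", OF _ coord_measurable[OF assms(1)]])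
    (rule coord_compose_measurable[OF assms(2)], simp)

text \<open>The ceiling approximates \<open>u\<close> from the right, so right-continuity applies;
  clamping to \<open>{s..t}\<close> ensures that only coordinates of this interval are read.\<close>

lemma clamp_grid_converges:
  assumes X: "X \<in> paths E" and st: "0 \<le> s" "s \<le> t" "t \<le> 1" and u: "s \<le> u" "u \<le> t"
  shows "\<forall>\<^sub>F n in sequentially. X (max s (min t (real_of_int \<lceil>real (Suc n) * u\<rceil> / real (Suc n)))) = X u"
proof (cases "u < 1")
  case False
  then have "u = 1" "t = 1" using st u by auto
  then show ?thesis using st by (auto simp del: of_nat_Suc)
next
  case True
  then obtain b where b: "b > u" "\<forall>v>u. v < b \<longrightarrow> X v = X u"
    using right_eventually[OF X, of u] st u by (auto simp: eventually_at_right_field)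
  have "\<forall>\<^sub>F n in sequentially. inverse (real (Suc n)) < b - u"
    using b by (intro order_tendstoD(2)[OF LIMSEQ_inverse_real_of_nat]) auto
  then show ?thesis
  proof eventually_elim
    case (elim n)
    define v where "v = real_of_int \<lceil>real (Suc n) * u\<rceil> / real (Suc n)"
    have "real (Suc n) * u \<le> real_of_int \<lceil>real (Suc n) * u\<rceil>" by (rule le_of_int_ceiling)
    then have 1: "u \<le> v" unfolding v_def by (simp add: pos_le_divide_eq mult.commute del: of_nat_Suc)
    have "real_of_int \<lceil>real (Suc n) * u\<rceil> < real (Suc n) * u + 1" by linarith
    then have "v < u + inverse (real (Suc n))" unfolding v_def
      by (simp add: pos_divide_less_eq distrib_left distrib_right mult.commute[of u] del: of_nat_Suc)
    then have 2: "v < b" using elim by simp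
    have "u \<le> max s (min t v)" "max s (min t v) < b" using 1 2 u b by auto
    then show ?case using b(2) unfolding v_def[symmetric] by (cases "max s (min t v) = u") auto
  qed
qed

text \<open>The approximating times take countably many values, so the approximations are
  measurable. In a discrete space their convergence is eventual equality, which writes a level set
  of the limit as a countable union of countable intersections.\<close>

lemma clamp_coord_measurable:
  fixes E :: "'a::countable \<Rightarrow> 'a \<Rightarrow> bool"
  assumes st: "0 \<le> s" "s \<le> t" "t \<le> 1"
  shows "(\<lambda>(X, r). X (max s (min t r))) \<in> path_events E {s..t} \<Otimes>\<^sub>M borel \<rightarrow>\<^sub>M count_space UNIV"
proof -
  let ?M = "path_events E {s..t} \<Otimes>\<^sub>M (borel :: real measure)"
  define \<xi> where "\<xi> n = (\<lambda>(X::real \<Rightarrow> 'a, r). X (max s (min t (real_of_int \<lceil>real (Suc n) * max s (min t r)\<rceil> / real (Suc n)))))" for n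
  have \<xi>: "\<xi> n \<in> ?M \<rightarrow>\<^sub>M count_space UNIV" for n
  proof -
    have "(\<lambda>p. fst p (max s (min t (real_of_int k / real (Suc n))))) \<in> ?M \<rightarrow>\<^sub>M count_space UNIV" for k
      by (rule measurable_compose[OF measurable_fst coord_measurable]) (use st in auto)
    from measurable_compose_countable[OF this, where g = "\<lambda>p. \<lceil>real (Suc n) * max s (min t (snd p))\<rceil>"]
    have "(\<lambda>p. fst p (max s (min t (real_of_int \<lceil>real (Suc n) * max s (min t (snd p))\<rceil> / real (Suc n))))) \<in> ?M \<rightarrow>\<^sub>M count_space UNIV"
      by measurable
    then show ?thesis by (simp add: \<xi>_def case_prod_beta')
  qed
  have "(\<lambda>(X, r). X (max s (min t r))) -` {z} \<inter> space ?M \<in> sets ?M" for z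
  proof -
    have "(\<lambda>(X, r). X (max s (min t r))) -` {z} \<inter> space ?M = (\<Union>N. \<Inter>n\<in>{N..}. \<xi> n -` {z} \<inter> space ?M)"
    proof (rule set_eqI)
      fix p :: "(real \<Rightarrow> 'a) \<times> real"
      obtain X r where p: "p = (X, r)" by (cases p)
      show "p \<in> (\<lambda>(X, r). X (max s (min t r))) -` {z} \<inter> space ?M \<longleftrightarrow> p \<in> (\<Union>N. \<Inter>n\<in>{N..}. \<xi> n -` {z} \<inter> space ?M)"
      proof (cases "X \<in> paths E")
        case False then show ?thesis by (auto simp: p space_pair_measure)
      next
        case True
        have "\<forall>\<^sub>F n in sequentially. \<xi> n p = X (max s (min t r))"
          unfolding \<xi>_def p using clamp_grid_converges[OF True st, of "max s (min t r)"] st by simp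
        then obtain N where N: "\<And>n. n \<ge> N \<Longrightarrow> \<xi> n p = X (max s (min t r))" by (auto simp: eventually_sequentially)
        have sp: "p \<in> space ?M" using True by (simp add: p space_pair_measure)
        have "(\<exists>N. \<forall>n\<ge>N. \<xi> n p = z) \<longleftrightarrow> X (max s (min t r)) = z"
        proof
          assume "\<exists>N. \<forall>n\<ge>N. \<xi> n p = z"
          then obtain N' where "\<forall>n\<ge>N'. \<xi> n p = z" by blast
          then show "X (max s (min t r)) = z" using N[of "max N N'"] by auto
        qed (use N in blast)
        then show ?thesis using sp by (simp add: p) blast
      qed
    qed
    also have "\<dots> \<in> sets ?M"
    proof (intro sets.countable_UN'' ballI)
      show "(\<Inter>n\<in>{N..}. \<xi> n -` {z} \<inter> space ?M) \<in> sets ?M" for N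
        using measurable_sets[OF \<xi>] by (intro sets.countable_INT') auto
    qed auto
    finally show ?thesis .
  qed
  then show ?thesis by (subst measurable_count_space_eq_countable) auto
qed

text \<open>Along a path, a time-dependent function on the state space is integrated over closed
  subintervals; the clamped time makes the integrand measurable for the events of that
  subinterval.\<close>

lemma clamp_compose_measurable:
  fixes E :: "'a::countable \<Rightarrow> 'a \<Rightarrow> bool"
  assumes st: "0 \<le> s" "s \<le> t" "t \<le> 1" and c: "\<And>x. (\<lambda>r. c r x :: real) \<in> borel_measurable borel"
  shows "(\<lambda>(X, r). indicator {s..t} r * c r (X r)) \<in> borel_measurable (path_events E {s..t} \<Otimes>\<^sub>M borel)"
proof -
  have "(\<lambda>p. c (snd p) x) \<in> borel_measurable (path_events E {s..t} \<Otimes>\<^sub>M borel)" for x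
    using c measurable_compose[OF measurable_snd] by blast
  from measurable_compose_countable[OF this clamp_coord_measurable[OF st]]
  have "(\<lambda>p. indicator {s..t} (snd p) * c (snd p) (case p of (X, r) \<Rightarrow> X (max s (min t r)))) \<in>
     borel_measurable (path_events E {s..t} \<Otimes>\<^sub>M borel)"
    by measurable
  also have "(\<lambda>p. indicator {s..t} (snd p) * c (snd p) (case p of (X, r) \<Rightarrow> X (max s (min t r)))) =
     (\<lambda>(X, r). indicator {s..t} r * c r (X r))"
    by (auto simp: fun_eq_iff indicator_def max_def min_def)
  finally show ?thesis .
qed

lemma jump_prod_measurable:
  fixes E :: "'a::countable \<Rightarrow> 'a \<Rightarrow> bool"
  assumes st: "0 \<le> s" "s \<le> t" "t \<le> 1"
  shows "jump_prod a s t \<in> borel_measurable (path_events E {s..t})"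
proof (rule borel_measurable_LIMSEQ_real)
  fix X assume "X \<in> space (path_events E {s..t})"
  then have X: "X \<in> paths E" by simp
  have "\<forall>\<^sub>F n in sequentially. (\<Prod>i<Suc n. if X (grid s t (Suc n) i) = X (grid s t (Suc n) (Suc i)) then 1
     else a (X (grid s t (Suc n) i)) (X (grid s t (Suc n) (Suc i)))) = jump_prod a s t X"
    using jump_prod_grid[OF X st] by (subst eventually_sequentially_Suc)
  then show "(\<lambda>n. (\<Prod>i<Suc n. if X (grid s t (Suc n) i) = X (grid s t (Suc n) (Suc i)) then 1
     else a (X (grid s t (Suc n) i)) (X (grid s t (Suc n) (Suc i))))) \<longlonglongrightarrow> jump_prod a s t X"
    by (rule tendsto_eventually)
next
  fix n
  show "(\<lambda>X. \<Prod>i<Suc n. if X (grid s t (Suc n) i) = X (grid s t (Suc n) (Suc i)) then 1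
     else a (X (grid s t (Suc n) i)) (X (grid s t (Suc n) (Suc i)))) \<in> borel_measurable (path_events E {s..t})"
  proof (rule borel_measurable_prod)
    fix i assume "i \<in> {..<Suc n}"
    then have "grid s t (Suc n) i \<in> {s..t}" "grid s t (Suc n) (Suc i) \<in> {s..t}"
      using grid_in[OF st(2), of i "Suc n"] grid_in[OF st(2), of "Suc i" "Suc n"] by auto
    then show "(\<lambda>X. if X (grid s t (Suc n) i) = X (grid s t (Suc n) (Suc i)) then 1
       else a (X (grid s t (Suc n) i)) (X (grid s t (Suc n) (Suc i)))) \<in> borel_measurable (path_events E {s..t})"
      by (rule coord2_compose_measurable[where f = "\<lambda>x y. if x = y then 1 else a x y"])
  qed
qed

text \<open>With every factor equal to 2 the multiplicative functional is 2 to the number of jumps,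
  so the jump count inherits its measurability.\<close>

lemma two_jumps_sets:
  fixes E :: "'a::countable \<Rightarrow> 'a \<Rightarrow> bool"
  assumes st: "0 \<le> s" "s \<le> t" "t \<le> 1"
  shows "{X \<in> paths E. k \<le> card (jumps X s t)} \<in> sets (path_events E {s..t})"
proof -
  have eq: "jump_prod (\<lambda>_ _. 2) s t X = 2 ^ card (jumps X s t)" for X :: "real \<Rightarrow> 'a"
    by (simp add: jump_prod_def)
  have "{X \<in> space (path_events E {s..t}). 2 ^ k \<le> jump_prod (\<lambda>_ _. 2) s t X} \<in> sets (path_events E {s..t})"
    using jump_prod_measurable[OF st, of "\<lambda>_ _. 2" E] by measurable
  then show ?thesis unfolding eq by simp
qed

subsection \<open>Cylinders determine a path measure\<close>

definition cyl :: "('a \<Rightarrow> 'a \<Rightarrow> bool) \<Rightarrow> real set \<Rightarrow> (real \<Rightarrow> 'a) \<Rightarrow> (real \<Rightarrow> 'a) set" where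
  "cyl E F \<phi> = {X \<in> paths E. \<forall>t\<in>F. X t = \<phi> t}"

lemma cyl_sets:
  assumes "finite F" "F \<subseteq> I" shows "cyl E F \<phi> \<in> sets (path_events E I)"
proof -
  have "(\<Inter>t\<in>F. at_time E t (\<phi> t)) \<inter> paths E \<in> sets (path_events E I)"
  proof (cases "F = {}")
    case True then show ?thesis using sets.top[of "path_events E I"] by simp
  next
    case False
    have "paths E \<in> sets (path_events E I)" using sets.top[of "path_events E I"] by simp
    then show ?thesis using False assms at_time_sets[of _ I E]
      by (intro sets.Int sets.finite_INT) auto
  qed
  also have "(\<Inter>t\<in>F. at_time E t (\<phi> t)) \<inter> paths E = cyl E F \<phi>" by (auto simp: cyl_def)
  finally show ?thesis .
qed

text \<open>Cylinders that fix the state at time 0 form a generator closed under intersection, and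
  the cells of time 0 among them are a countable cover by sets of finite mass. Time 0 is part of
  every cylinder for this reason: the measures may be infinite.\<close>

lemma path_measure_eqI:
  fixes E :: "'a::countable \<Rightarrow> 'a \<Rightarrow> bool"
  assumes M: "sets M = sets (path_space E)" and N: "sets N = sets (path_space E)"
    and eq: "\<And>F \<phi>. finite F \<Longrightarrow> F \<subseteq> {0<..1} \<Longrightarrow> emeasure M (cyl E (insert 0 F) \<phi>) = emeasure N (cyl E (insert 0 F) \<phi>)"
    and fin: "\<And>x. emeasure M (at_time E 0 x) \<noteq> \<infinity>"
  shows "M = N"
proof -
  \<comment> \<open>The empty set is added because cylinders that disagree at a common time are
    disjoint.\<close>
  define G where "G = insert {} {cyl E (insert 0 F) \<phi> | F \<phi>. finite F \<and> F \<subseteq> {0<..1}}"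
  have G_sub: "G \<subseteq> sets (path_space E)"
    unfolding G_def by (auto intro!: cyl_sets)
  have gen: "sets (path_space E) = sigma_sets (paths E) G"
  proof
    show "sigma_sets (paths E) G \<subseteq> sets (path_space E)"
      using sets.sigma_sets_subset[OF G_sub] by simp
    show "sets (path_space E) \<subseteq> sigma_sets (paths E) G"
      unfolding sets_path_events
    proof (rule sigma_sets_mono, rule subsetI)
      fix A assume "A \<in> {{X \<in> paths E. X t \<in> B} | t B. t \<in> {0..1}}"
      then obtain t B where A: "A = {X \<in> paths E. X t \<in> B}" and t: "t \<in> {0..1}" by blast
      have "A = (\<Union>p\<in>UNIV \<times> B. cyl E (insert 0 ({t} - {0})) (\<lambda>s. if s = t then snd p else fst p))"
      proof (rule set_eqI)
        fix X
        show "X \<in> A \<longleftrightarrow> X \<in> (\<Union>p\<in>UNIV \<times> B. cyl E (insert 0 ({t} - {0})) (\<lambda>s. if s = t then snd p else fst p))"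
        proof
          assume "X \<in> A"
          then have "X \<in> cyl E (insert 0 ({t} - {0})) (\<lambda>s. if s = t then snd (X 0, X t) else fst (X 0, X t))"
            by (auto simp: A cyl_def)
          then show "X \<in> (\<Union>p\<in>UNIV \<times> B. cyl E (insert 0 ({t} - {0})) (\<lambda>s. if s = t then snd p else fst p))"
            using \<open>X \<in> A\<close> A by blast
        next
          assume "X \<in> (\<Union>p\<in>UNIV \<times> B. cyl E (insert 0 ({t} - {0})) (\<lambda>s. if s = t then snd p else fst p))"
          then show "X \<in> A" by (cases "t = 0") (auto simp: A cyl_def)
        qed
      qed
      also have "\<dots> \<in> sigma_sets (paths E) G"
      proof (rule sigma_sets_UNION)
        show "countable ((\<lambda>p. cyl E (insert 0 ({t} - {0})) (\<lambda>s. if s = t then snd p else fst p)) ` (UNIV \<times> B))"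
          by auto
        fix b assume "b \<in> (\<lambda>p. cyl E (insert 0 ({t} - {0})) (\<lambda>s. if s = t then snd p else fst p)) ` (UNIV \<times> B)"
        then have "b \<in> G" unfolding G_def using t by (auto intro!: exI[of _ "{t} - {0}"])
        then show "b \<in> sigma_sets (paths E) G" by (rule sigma_sets.Basic)
      qed
      finally show "A \<in> sigma_sets (paths E) G" .
    qed
  qed
  show ?thesis
  proof (rule measure_eqI_generator_eq_countable[where E = G and \<Omega> = "paths E" and A = "range (at_time E 0)"])
    show "Int_stable G"
    proof (rule Int_stableI)
      fix a b assume "a \<in> G" "b \<in> G"
      show "a \<inter> b \<in> G"
      proof (cases "a = {} \<or> b = {}")
        case True then show ?thesis by (auto simp: G_def)
      next
        case False
        then obtain F \<phi> F' \<psi> where ab: "a = cyl E (insert 0 F) \<phi>" "finite F" "F \<subseteq> {0<..1}"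
          "b = cyl E (insert 0 F') \<psi>" "finite F'" "F' \<subseteq> {0<..1}"
          using \<open>a \<in> G\<close> \<open>b \<in> G\<close> by (auto simp: G_def)
        show ?thesis
        proof (cases "\<forall>t\<in>insert 0 F \<inter> insert 0 F'. \<phi> t = \<psi> t")
          case True
          have "a \<inter> b = cyl E (insert 0 (F \<union> F')) (\<lambda>t. if t \<in> insert 0 F then \<phi> t else \<psi> t)"
            unfolding ab cyl_def using True by auto
          then show ?thesis unfolding G_def using ab by blast
        next
          case False
          then obtain t where t: "t \<in> insert 0 F" "t \<in> insert 0 F'" "\<phi> t \<noteq> \<psi> t" by auto
          have "a \<inter> b = {}"
          proof (rule equals0I)
            fix X assume "X \<in> a \<inter> b"
            then have "X t = \<phi> t" "X t = \<psi> t" using t(1,2) unfolding ab cyl_def by blast+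
            then show False using t(3) by simp
          qed
          then show ?thesis unfolding G_def by simp
        qed
      qed
    qed
    show "G \<subseteq> Pow (paths E)" by (auto simp: G_def cyl_def)
    show "emeasure M \<xi> = emeasure N \<xi>" if "\<xi> \<in> G" for \<xi>
      using that eq unfolding G_def by auto
    show "sets M = sigma_sets (paths E) G" "sets N = sigma_sets (paths E) G" using M N gen by auto
    show "range (at_time E 0) \<subseteq> G"
    proof
      fix A assume "A \<in> range (at_time E 0)"
      then obtain x where "A = at_time E 0 x" by auto
      then have "A = cyl E (insert 0 {}) (\<lambda>_. x)" by (auto simp: cyl_def)
      then show "A \<in> G" unfolding G_def by blast
    qed
    show "\<Union> (range (at_time E 0)) = paths E" by auto
  qed (use fin in auto)
qed

subsection \<open>Countable partitions and conditioning on an event\<close>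

lemma integral_eq_on_partition:
  fixes f g :: "'b \<Rightarrow> real" and \<xi> :: "'b \<Rightarrow> 'a::countable"
  assumes f: "integrable M f" and g: "integrable M g" and \<xi>: "\<xi> \<in> M \<rightarrow>\<^sub>M count_space UNIV"
    and eq: "\<And>z. (\<integral>x. indicator {x\<in>space M. \<xi> x = z} x * f x \<partial>M) = (\<integral>x. indicator {x\<in>space M. \<xi> x = z} x * g x \<partial>M)"
  shows "(\<integral>x. f x \<partial>M) = (\<integral>x. g x \<partial>M)"
proof -
  define A where "A i = {x \<in> space M. to_nat (\<xi> x) = i}" for i
  have A: "A i \<in> sets M" for i
  proof -
    have "(\<lambda>x. to_nat (\<xi> x)) \<in> M \<rightarrow>\<^sub>M count_space UNIV" using \<xi> by measurable
    then show ?thesis unfolding A_def by measurable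
  qed
  have disj: "A i \<inter> A j = {}" if "i \<noteq> j" for i j using that by (auto simp: A_def)
  have un: "(\<Union>i. A i) = space M" by (auto simp: A_def)
  have *: "(LINT x:A i|M. f x) = (LINT x:A i|M. g x)" for i
  proof (cases "i \<in> range (to_nat :: 'a \<Rightarrow> nat)")
    case True
    then obtain z :: 'a where "i = to_nat z" by auto
    then have "A i = {x \<in> space M. \<xi> x = z}" by (auto simp: A_def)
    then show ?thesis using eq[of z] by (simp add: set_lebesgue_integral_def)
  next
    case False
    then have "A i = {}" by (auto simp: A_def)
    then show ?thesis by (simp add: set_lebesgue_integral_def)
  qed
  have sf: "set_integrable M (space M) f" "set_integrable M (space M) g"
    unfolding set_integrable_def using f g by (auto intro!: integrable_mult_indicator simp del: real_scaleR_def)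
  have "(\<integral>x. f x \<partial>M) = (LINT x:(\<Union>i. A i)|M. f x)"
    unfolding un set_lebesgue_integral_def by (intro Bochner_Integration.integral_cong) auto
  also have "\<dots> = (\<Sum>i. LINT x:A i|M. f x)"
    by (rule lebesgue_integral_countable_add[OF A disj]) (use un sf in auto)
  also have "\<dots> = (LINT x:(\<Union>i. A i)|M. g x)" unfolding *
    by (rule lebesgue_integral_countable_add[symmetric, OF A disj]) (use un sf in auto)
  also have "\<dots> = (\<integral>x. g x \<partial>M)"
    unfolding un set_lebesgue_integral_def by (intro Bochner_Integration.integral_cong) auto
  finally show ?thesis .
qed

lemma integral_uniform_measure:
  fixes f :: "'b \<Rightarrow> real"
  assumes A: "A \<in> sets M" "emeasure M A \<noteq> 0" "emeasure M A \<noteq> \<infinity>" and f: "f \<in> borel_measurable M"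
  shows "(\<integral>x. f x \<partial>uniform_measure M A) = (LINT x:A|M. f x) / measure M A"
proof -
  have e: "emeasure M A = ennreal (measure M A)" using A by (simp add: emeasure_eq_ennreal_measure)
  have pos: "measure M A > 0" using A by (simp add: measure_def enn2real_positive_iff top.not_eq_extremum zero_less_iff_neq_zero)
  have "uniform_measure M A = density M (\<lambda>x. ennreal (indicator A x / measure M A))"
    unfolding uniform_measure_def e
  proof (rule arg_cong[where f = "density M"], rule ext)
    fix x show "indicator A x / ennreal (measure M A) = ennreal (indicator A x / measure M A)"
      using pos divide_ennreal[of 1 "measure M A"] by (auto simp: indicator_def)
  qed
  then have "(\<integral>x. f x \<partial>uniform_measure M A) = (\<integral>x. (indicator A x / measure M A) *\<^sub>R f x \<partial>M)"
    using A f by (simp add: integral_density)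
  also have "\<dots> = (LINT x:A|M. f x) / measure M A"
    by (simp add: set_lebesgue_integral_def)
  finally show ?thesis .
qed

section \<open>The Markov property for functions\<close>

text \<open>Conditional expectation given the state \<open>z\<close> at time \<open>t\<close>, as an
  elementary quotient. For a state without mass division by zero yields 0, a case that
  \<open>markov_mult\<close> covers.\<close>

definition cexp :: "('a \<Rightarrow> 'a \<Rightarrow> bool) \<Rightarrow> (real \<Rightarrow> 'a) measure \<Rightarrow> real \<Rightarrow> 'a \<Rightarrow> ((real \<Rightarrow> 'a) \<Rightarrow> real) \<Rightarrow> real" where
  "cexp E Q t z H = (LINT X:at_time E t z|Q. H X) / measure Q (at_time E t z)"

lemma abs_set_integral_le:
  fixes f :: "'b \<Rightarrow> real"
  assumes A: "A \<in> sets M" "emeasure M A < \<infinity>" and B: "0 \<le> B" "\<And>x. x \<in> A \<Longrightarrow> \<bar>f x\<bar> \<le> B"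
  shows "\<bar>LINT x:A|M. f x\<bar> \<le> B * measure M A"
proof (cases "set_integrable M A f")
  case True
  have i: "integrable M (\<lambda>x. indicator A x * B)"
    using A by (intro integrable_mult_left) simp_all
  have "\<bar>LINT x:A|M. f x\<bar> \<le> (\<integral>x. norm (indicator A x *\<^sub>R f x) \<partial>M)"
    unfolding set_lebesgue_integral_def real_norm_def[symmetric] by (rule integral_norm_bound)
  also have "\<dots> \<le> (\<integral>x. indicator A x * B \<partial>M)"
    using True i B unfolding set_integrable_def
    by (intro integral_mono) (auto simp: indicator_def)
  also have "\<dots> = B * measure M A" using A by simp
  finally show ?thesis .
next
  case False
  then show ?thesis using B by (simp add: set_lebesgue_integral_def set_integrable_def not_integrable_integral_eq)
qed

lemma set_integrable_bounded:
  fixes f :: "'b \<Rightarrow> real"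
  assumes "A \<in> sets M" "emeasure M A < \<infinity>" "f \<in> borel_measurable M" "\<And>x. x \<in> A \<Longrightarrow> \<bar>f x\<bar> \<le> B"
  shows "set_integrable M A f"
  unfolding set_integrable_def using assms
  by (intro integrableI_bounded_set[where A = A and B = B]) (auto simp: indicator_def)

locale markov_path =
  fixes E :: "'a::countable \<Rightarrow> 'a \<Rightarrow> bool" and Q :: "(real \<Rightarrow> 'a) measure"
  assumes markov: "markov_measure E Q"
begin

lemma sets_Q: "sets Q = sets (path_space E)"
  using markov by (simp add: markov_measure_def)

lemma space_Q [simp]: "space Q = paths E"
  using sets_eq_imp_space_eq[OF sets_Q] by simp

lemma sets_QI: "A \<in> sets (path_events E I) \<Longrightarrow> I \<subseteq> {0..1} \<Longrightarrow> A \<in> sets Q"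
  unfolding sets_Q using path_events_mono[of I "{0..1}"] by auto

lemma measurable_Q: "f \<in> path_events E I \<rightarrow>\<^sub>M N \<Longrightarrow> I \<subseteq> {0..1} \<Longrightarrow> f \<in> Q \<rightarrow>\<^sub>M N"
  using measurable_path_events_mono[of f E I N "{0..1}"] measurable_cong_sets[OF sets_Q refl] by blast

lemma at_time_Q: "t \<in> {0..1} \<Longrightarrow> at_time E t z \<in> sets Q"
  by (rule sets_QI[OF at_time_sets[of t "{t}"]]) auto

lemma coord_Q: "t \<in> {0..1} \<Longrightarrow> (\<lambda>X. X t) \<in> Q \<rightarrow>\<^sub>M count_space UNIV"
  by (rule measurable_Q[OF coord_measurable[of t "{t}"]]) auto

text \<open>The state \<open>z\<close> belongs to one of the sets of finite mass that exhaust the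
  space, so its own mass is finite.\<close>

lemma at_time_finite: 
  assumes "t \<in> {0..1}" shows "emeasure Q (at_time E t z) < \<infinity>"
proof -
  interpret D: sigma_finite_measure "marginal Q t" using markov assms by (auto simp: markov_measure_def)
  obtain A :: "nat \<Rightarrow> 'a set" where A: "range A \<subseteq> sets (marginal Q t)" "(\<Union>i. A i) = space (marginal Q t)" "\<And>i. emeasure (marginal Q t) (A i) \<noteq> \<infinity>"
    by (rule D.sigma_finite) blast
  have "z \<in> (\<Union>i. A i)" unfolding A(2) by simp
  then obtain i where "z \<in> A i" by blast
  have "emeasure Q (at_time E t z) = emeasure (marginal Q t) {z}"
    using coord_Q[OF assms] by (subst emeasure_distr) (auto intro!: arg_cong[where f = "emeasure Q"])
  also have "\<dots> \<le> emeasure (marginal Q t) (A i)" using \<open>z \<in> A i\<close> by (intro emeasure_mono) auto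
  also have "\<dots> < \<infinity>" using A(3)[of i] by (simp add: top.not_eq_extremum)
  finally show ?thesis .
qed

lemma indep_past_future:
  fixes F :: "(real \<Rightarrow> 'a) \<Rightarrow> 'b::topological_space" and H :: "(real \<Rightarrow> 'a) \<Rightarrow> 'b"
  assumes t: "t \<in> {0..1}" and z: "emeasure Q (at_time E t z) \<noteq> 0"
    and F: "F \<in> borel_measurable (path_events E {0..t})" and H: "H \<in> borel_measurable (path_events E {t..1})"
  shows "prob_space (uniform_measure Q (at_time E t z))"
    and "prob_space.indep_var (uniform_measure Q (at_time E t z)) borel F borel H"
proof -
  let ?\<nu> = "uniform_measure Q (at_time E t z)"
  show p: "prob_space ?\<nu>" using z at_time_finite[OF t, of z] by (intro prob_space_uniform_measure) auto
  interpret prob_space ?\<nu> by (rule p)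
  have FQ: "F \<in> borel_measurable Q" and HQ: "H \<in> borel_measurable Q"
    using measurable_Q[OF F] measurable_Q[OF H] t by auto
  have A: "sigma_sets (paths E) {F -` A \<inter> paths E | A. A \<in> sets borel} \<subseteq> sets (path_events E {0..t})"
    using measurable_sets[OF F] by (intro sets.sigma_sets_subset[of _ "path_events E {0..t}", simplified]) auto
  have B: "sigma_sets (paths E) {H -` A \<inter> paths E | A. A \<in> sets borel} \<subseteq> sets (path_events E {t..1})"
    using measurable_sets[OF H] by (intro sets.sigma_sets_subset[of _ "path_events E {t..1}", simplified]) auto
  show "indep_var borel F borel H"
    unfolding indep_var_eq
  proof (intro conjI indep_setI)
    show "random_variable borel F" "random_variable borel H" using FQ HQ by auto
    show "sigma_sets (space ?\<nu>) {F -` A \<inter> space ?\<nu> |A. A \<in> sets borel} \<subseteq> events"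
      using A path_events_mono[of "{0..t}" "{0..1}" E] t by (auto simp: sets_Q)
    show "sigma_sets (space ?\<nu>) {H -` A \<inter> space ?\<nu> |A. A \<in> sets borel} \<subseteq> events"
      using B path_events_mono[of "{t..1}" "{0..1}" E] t by (auto simp: sets_Q)
    show "prob (a \<inter> b) = prob a * prob b" if "a \<in> sigma_sets (space ?\<nu>) {F -` A \<inter> space ?\<nu> |A. A \<in> sets borel}"
      "b \<in> sigma_sets (space ?\<nu>) {H -` A \<inter> space ?\<nu> |A. A \<in> sets borel}" for a b
    proof -
      have "a \<in> sets (path_events E {0..t})" "b \<in> sets (path_events E {t..1})" using that A B by auto
      then show ?thesis using markov t z unfolding markov_measure_def by blast
    qed
  qed
qed

text \<open>Conditional independence with denominators cleared. The extended nonnegative values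
  matter: endpoint densities and the geodesic kernel near time 1 come without a bound.\<close>

lemma nn_markov:
  fixes F H :: "(real \<Rightarrow> 'a) \<Rightarrow> ennreal"
  assumes t: "t \<in> {0..1}"
    and F: "F \<in> borel_measurable (path_events E {0..t})" and H: "H \<in> borel_measurable (path_events E {t..1})"
  shows "(\<integral>\<^sup>+X. F X * H X * indicator (at_time E t z) X \<partial>Q) * emeasure Q (at_time E t z) =
    (\<integral>\<^sup>+X. F X * indicator (at_time E t z) X \<partial>Q) * (\<integral>\<^sup>+X. H X * indicator (at_time E t z) X \<partial>Q)"
proof (cases "emeasure Q (at_time E t z) = 0")
  case True
  then have "AE X in Q. X \<notin> at_time E t z" using at_time_Q[OF t] by (intro AE_not_in) auto
  then have "(\<integral>\<^sup>+X. F X * indicator (at_time E t z) X \<partial>Q) = (\<integral>\<^sup>+X. 0 \<partial>Q)"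
    by (intro nn_integral_cong_AE) auto
  then show ?thesis using True by simp
next
  case False
  let ?\<nu> = "uniform_measure Q (at_time E t z)" and ?q = "emeasure Q (at_time E t z)"
  note ip = indep_past_future[OF t False F H]
  interpret prob_space ?\<nu> by (rule ip(1))
  have q: "?q < \<infinity>" by (rule at_time_finite[OF t])
  have [measurable]: "F \<in> borel_measurable Q" "H \<in> borel_measurable Q" "at_time E t z \<in> sets Q"
    using measurable_Q[OF F] measurable_Q[OF H] t at_time_Q[OF t] by auto
  have iv: "indep_vars (\<lambda>_. borel) (case_bool F H) UNIV"
  proof -
    have "case_bool borel borel = (\<lambda>_. borel :: ennreal measure)" by (auto simp: fun_eq_iff split: bool.split)
    then show ?thesis using ip(2) unfolding indep_var_def by simp
  qed
  have "(\<integral>\<^sup>+X. (\<Prod>i\<in>UNIV. case_bool F H i X) \<partial>?\<nu>) = (\<Prod>i\<in>UNIV. \<integral>\<^sup>+X. case_bool F H i X \<partial>?\<nu>)"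
    by (rule indep_vars_nn_integral) (use iv in auto)
  then have *: "(\<integral>\<^sup>+X. F X * H X \<partial>?\<nu>) = (\<integral>\<^sup>+X. F X \<partial>?\<nu>) * (\<integral>\<^sup>+X. H X \<partial>?\<nu>)"
    by (simp add: UNIV_bool mult.commute)
  define a where "a = (\<integral>\<^sup>+X. F X * H X * indicator (at_time E t z) X \<partial>Q)"
  define b where "b = (\<integral>\<^sup>+X. F X * indicator (at_time E t z) X \<partial>Q)"
  define c where "c = (\<integral>\<^sup>+X. H X * indicator (at_time E t z) X \<partial>Q)"
  have "a / ?q = (b / ?q) * (c / ?q)"
    using * unfolding a_def b_def c_def by (simp add: nn_integral_uniform_measure)
  then have "(a / ?q) * ?q * ?q = ((b / ?q) * ?q) * ((c / ?q) * ?q)" by (simp add: ac_simps)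
  moreover have "(x / ?q) * ?q = x" for x
    using False q ennreal_divide_times[of x ?q ?q] ennreal_divide_self[of ?q] by simp
  ultimately show ?thesis unfolding a_def b_def c_def by (simp only:)
qed

lemma cexp_eq_uniform:
  assumes t: "t \<in> {0..1}" and z: "emeasure Q (at_time E t z) \<noteq> 0" and H: "H \<in> borel_measurable Q"
  shows "cexp E Q t z H = (\<integral>X. H X \<partial>uniform_measure Q (at_time E t z))"
  unfolding cexp_def by (subst integral_uniform_measure) (use at_time_Q[OF t] at_time_finite[OF t, of z] z H in auto)

lemma markov_mult:
  assumes t: "t \<in> {0..1}"
    and F: "F \<in> borel_measurable (path_events E {0..t})" "\<And>X. X \<in> paths E \<Longrightarrow> \<bar>F X\<bar> \<le> B"
    and H: "H \<in> borel_measurable (path_events E {t..1})" "\<And>X. X \<in> paths E \<Longrightarrow> \<bar>H X\<bar> \<le> B'"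
  shows "(LINT X:at_time E t z|Q. F X * H X) = (LINT X:at_time E t z|Q. F X) * cexp E Q t z H"
proof (cases "emeasure Q (at_time E t z) = 0")
  case True
  then have AE: "AE X in Q. X \<notin> at_time E t z" using at_time_Q[OF t] by (intro AE_not_in) auto
  have m: "F \<in> borel_measurable Q" "H \<in> borel_measurable Q" "at_time E t z \<in> sets Q"
    using measurable_Q[OF F(1)] measurable_Q[OF H(1)] t at_time_Q[OF t] by auto
  have "(LINT X:at_time E t z|Q. G X) = 0" if "G \<in> borel_measurable Q" for G :: "_ \<Rightarrow> real"
  proof -
    have "(\<lambda>X. indicator (at_time E t z) X *\<^sub>R G X) \<in> borel_measurable Q"
      using that m(3) by (intro borel_measurable_scaleR borel_measurable_indicator)
    moreover have "AE X in Q. indicator (at_time E t z) X *\<^sub>R G X = 0"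
      using AE by eventually_elim simp
    ultimately have "(\<integral>X. indicator (at_time E t z) X *\<^sub>R G X \<partial>Q) = (\<integral>X. 0 \<partial>Q)"
      by (intro integral_cong_AE) auto
    then show ?thesis by (simp add: set_lebesgue_integral_def)
  qed
  from this[of F] this[of "\<lambda>X. F X * H X"] show ?thesis using m by simp
next
  case False
  let ?\<nu> = "uniform_measure Q (at_time E t z)"
  note ip = indep_past_future[OF t False F(1) H(1)]
  interpret prob_space ?\<nu> by (rule ip(1))
  have m: "F \<in> borel_measurable Q" "H \<in> borel_measurable Q"
    using measurable_Q[OF F(1)] measurable_Q[OF H(1)] t by auto
  have "integrable ?\<nu> F"
    using F m by (auto intro!: integrable_const_bound[where B = B] AE_I2)
  moreover have "integrable ?\<nu> H"
    using H m by (auto intro!: integrable_const_bound[where B = B'] AE_I2)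
  ultimately have "(\<integral>X. F X * H X \<partial>?\<nu>) = (\<integral>X. F X \<partial>?\<nu>) * (\<integral>X. H X \<partial>?\<nu>)"
    by (rule indep_var_lebesgue_integral[OF ip(2)])

  then have "cexp E Q t z (\<lambda>X. F X * H X) = cexp E Q t z F * cexp E Q t z H"
    using m cexp_eq_uniform[OF t False] by simp
  moreover have "measure Q (at_time E t z) \<noteq> 0"
    using False at_time_finite[OF t, of z] by (simp add: measure_def enn2real_eq_0_iff)
  ultimately show ?thesis unfolding cexp_def by (simp add: field_simps)
qed

lemma cexp_bounded:
  assumes "t \<in> {0..1}" "0 \<le> B" "\<And>X. X \<in> at_time E t z \<Longrightarrow> \<bar>H X\<bar> \<le> B"
  shows "\<bar>cexp E Q t z H\<bar> \<le> B"
proof (cases "measure Q (at_time E t z) = 0")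
  case False
  then have "measure Q (at_time E t z) > 0" by (simp add: zero_less_measure_iff)
  then show ?thesis
    using abs_set_integral_le[OF at_time_Q[OF assms(1)] at_time_finite[OF assms(1)] assms(2,3)]
    unfolding cexp_def by (simp add: field_simps)
qed (use assms in \<open>simp add: cexp_def\<close>)

text \<open>The equality is checked on each cell \<open>X t = z\<close>, where the indicator of
  \<open>A\<close> joins the past factor \<open>F\<close> and conditional independence replaces
  \<open>H\<close> by its conditional mean. Finite mass of \<open>A\<close> makes both sides
  integrable, so the cells can be summed.\<close>

lemma tower:
  assumes t: "t \<in> {0..1}" and A: "A \<in> sets (path_events E {0..t})" "emeasure Q A < \<infinity>"
    and F: "F \<in> borel_measurable (path_events E {0..t})" "\<And>X. X \<in> paths E \<Longrightarrow> \<bar>F X\<bar> \<le> B"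
    and H: "H \<in> borel_measurable (path_events E {t..1})" "\<And>X. X \<in> paths E \<Longrightarrow> \<bar>H X\<bar> \<le> B'"
  shows "(LINT X:A|Q. F X * H X) = (LINT X:A|Q. F X * cexp E Q t (X t) H)"
proof -
  have m: "F \<in> borel_measurable Q" "H \<in> borel_measurable Q" "A \<in> sets Q"
    using measurable_Q[OF F(1)] measurable_Q[OF H(1)] t sets_QI[OF A(1)] by auto
  have cm: "(\<lambda>X. cexp E Q t (X t) H) \<in> borel_measurable Q"
    by (rule measurable_compose[OF coord_Q[OF t]]) simp
  have A_sub: "A \<subseteq> paths E" using sets.sets_into_space[OF m(3)] by simp
  define B1 where "B1 = max 0 B'"
  have B1: "0 \<le> B1" "\<bar>H X\<bar> \<le> B1" if "X \<in> paths E" for X using H(2)[OF that] by (auto simp: B1_def)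
  have B1': "0 \<le> B1" by (simp add: B1_def)
  have cb: "\<bar>cexp E Q t z H\<bar> \<le> B1" for z
    by (rule cexp_bounded[OF t B1']) (use B1 in auto)
  define B0 where "B0 = max 0 B"
  have B0: "0 \<le> B0" "\<And>X. X \<in> paths E \<Longrightarrow> \<bar>F X\<bar> \<le> B0" using F(2) by (auto simp: B0_def max.coboundedI2)
  show ?thesis unfolding set_lebesgue_integral_def
  proof (rule integral_eq_on_partition[OF _ _ coord_Q[OF t]])
    show "integrable Q (\<lambda>X. indicator A X *\<^sub>R (F X * H X))"
      unfolding set_integrable_def[symmetric]
      by (rule set_integrable_bounded[where B = "B0 * B1"])
        (use m A A_sub B0 B1 in \<open>auto simp: abs_mult intro!: mult_mono\<close>)
    show "integrable Q (\<lambda>X. indicator A X *\<^sub>R (F X * cexp E Q t (X t) H))"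
      unfolding set_integrable_def[symmetric]
      by (rule set_integrable_bounded[where B = "B0 * B1"])
        (use m cm A A_sub B0 cb in \<open>auto simp: abs_mult intro!: mult_mono\<close>)
    fix z
    let ?Z = "at_time E t z"
    have Fm: "(\<lambda>X. indicator A X * F X) \<in> borel_measurable (path_events E {0..t})" using F(1) A(1) by measurable
    have Fb: "\<bar>indicator A X * F X\<bar> \<le> B0" if "X \<in> paths E" for X using B0 that by (auto simp: indicator_def)
    have "(\<integral>X. indicator {X \<in> space Q. X t = z} X * (indicator A X *\<^sub>R (F X * H X)) \<partial>Q) =
      (LINT X:?Z|Q. (indicator A X * F X) * H X)"
      by (simp add: set_lebesgue_integral_def mult.assoc)
    also have "\<dots> = (LINT X:?Z|Q. indicator A X * F X) * cexp E Q t z H"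
      by (rule markov_mult[OF t Fm Fb H]) auto
    also have "\<dots> = (\<integral>X. indicator {X \<in> space Q. X t = z} X * (indicator A X *\<^sub>R (F X * cexp E Q t (X t) H)) \<partial>Q)"
      unfolding set_lebesgue_integral_def integral_mult_left_zero[symmetric]
      by (intro Bochner_Integration.integral_cong) (auto simp: indicator_def)
    finally show "(\<integral>X. indicator {X \<in> space Q. X t = z} X * (indicator A X *\<^sub>R (F X * H X)) \<partial>Q) =
      (\<integral>X. indicator {X \<in> space Q. X t = z} X * (indicator A X *\<^sub>R (F X * cexp E Q t (X t) H)) \<partial>Q)" .
  qed
qed

end

section \<open>Multiplicative functionals\<close>

definition expo :: "(real \<Rightarrow> 'a \<Rightarrow> real) \<Rightarrow> real \<Rightarrow> real \<Rightarrow> (real \<Rightarrow> 'a) \<Rightarrow> real" where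
  "expo c s t X = (LINT r:{s..t}|lborel. c r (X r))"

text \<open>A Feynman-Kac functional with a factor for each jump. Two instances matter: damping
  factors with the lost mass as potential give the density of the damped walk;
  \<open>towards y\<close> with the total jump rate gives the density of the geodesic measure on the
  paths ending at \<open>y\<close>.\<close>

definition mult :: "('a \<Rightarrow> 'a \<Rightarrow> real) \<Rightarrow> (real \<Rightarrow> 'a \<Rightarrow> real) \<Rightarrow> real \<Rightarrow> real \<Rightarrow> (real \<Rightarrow> 'a) \<Rightarrow> real" where
  "mult a c s t X = jump_prod a s t X * exp (expo c s t X)"

lemma expo_measurable:
  fixes E :: "'a::countable \<Rightarrow> 'a \<Rightarrow> bool"
  assumes "0 \<le> s" "s \<le> t" "t \<le> 1" and c_meas: "\<And>x. (\<lambda>r. c r x) \<in> borel_measurable borel"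
  shows "expo c s t \<in> borel_measurable (path_events E {s..t})"
proof -
  have "(\<lambda>(X, r). indicator {s..t} r * c r (X r)) \<in> borel_measurable (path_events E {s..t} \<Otimes>\<^sub>M lborel)"
    using clamp_compose_measurable[OF assms, where E = E] by (simp cong: measurable_cong_sets)
  from lborel.borel_measurable_lebesgue_integral[OF this]
  show ?thesis unfolding expo_def set_lebesgue_integral_def by (simp add: fun_eq_iff[symmetric])
qed

lemma path_compose_measurable:
  fixes E :: "'a::countable \<Rightarrow> 'a \<Rightarrow> bool"
  assumes "0 \<le> s" "s \<le> t" "t \<le> 1" "X \<in> paths E" and c_meas: "\<And>x. (\<lambda>r. c r x :: real) \<in> borel_measurable borel"
  shows "(\<lambda>r. indicator {s..t} r * c r (X r)) \<in> borel_measurable borel"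
  using measurable_Pair2[OF clamp_compose_measurable[OF assms(1-3) c_meas, where E = E], of X] assms(4) by simp

lemma path_compose_integrable:
  fixes E :: "'a::countable \<Rightarrow> 'a \<Rightarrow> bool"
  assumes "0 \<le> s" "s \<le> t" "t \<le> 1" "X \<in> paths E" and c_meas: "\<And>x. (\<lambda>r. c r x :: real) \<in> borel_measurable borel"
    and b: "\<And>r x. \<bar>c r x\<bar> \<le> B"
  shows "set_integrable lborel {s..t} (\<lambda>r. c r (X r))"
  unfolding set_integrable_def
  using path_compose_measurable[OF assms(1-5)] b
  by (intro integrableI_bounded_set[where A = "{s..t}" and B = B]) (auto simp: indicator_def assms(2))

locale potential =
  fixes E :: "'a::countable \<Rightarrow> 'a \<Rightarrow> bool" and c :: "real \<Rightarrow> 'a \<Rightarrow> real" and C :: real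
  assumes c_meas: "\<And>x. (\<lambda>r. c r x) \<in> borel_measurable borel"
    and c_bounds: "\<And>r x. 0 \<le> c r x" "\<And>r x. c r x \<le> C"
begin

lemma C_nonneg: "0 \<le> C" using c_bounds[of 0 undefined] by linarith

lemma c_path_integrable:
  assumes "0 \<le> s" "s \<le> t" "t \<le> 1" "X \<in> paths E"
  shows "set_integrable lborel {s..t} (\<lambda>r. c r (X r))"
  by (rule path_compose_integrable[OF assms c_meas, where B = C]) (use c_bounds in auto)

lemma expo_split:
  assumes "0 \<le> s" "s \<le> t" "t \<le> u" "u \<le> 1" "X \<in> paths E"
  shows "expo c s u X = expo c s t X + expo c t u X"
proof -
  have *: "{s..u} = {s..t} \<union> {t..u}" using assms by auto
  have "AE r in lborel. r \<noteq> t" by (rule AE_lborel_singleton)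
  then have "AE r in lborel. \<not> (r \<in> {s..t} \<and> r \<in> {t..u})" by eventually_elim auto
  then show ?thesis unfolding expo_def *
    by (rule set_integral_Un_AE) (use c_path_integrable[of s t X] c_path_integrable[of t u X] assms in auto)
qed

lemma expo_bounds:
  assumes "0 \<le> s" "s \<le> t" "t \<le> 1" "X \<in> paths E"
  shows "0 \<le> expo c s t X" "expo c s t X \<le> C * (t - s)"
proof -
  show "0 \<le> expo c s t X"
    unfolding expo_def set_lebesgue_integral_def using c_bounds by (intro integral_nonneg_AE) auto
  have "\<bar>expo c s t X\<bar> \<le> C * measure lborel {s..t}"
    unfolding expo_def using c_bounds assms C_nonneg by (intro abs_set_integral_le) auto
  then show "expo c s t X \<le> C * (t - s)" using assms by simp
qed

end

locale functional = potential E c C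
  for E :: "'a::countable \<Rightarrow> 'a \<Rightarrow> bool" and a :: "'a \<Rightarrow> 'a \<Rightarrow> real" and c :: "real \<Rightarrow> 'a \<Rightarrow> real" and C :: real +
  assumes a_bounds: "\<And>x y. 0 \<le> a x y" "\<And>x y. a x y \<le> 1"
begin

lemma mult_measurable:
  "0 \<le> s \<Longrightarrow> s \<le> t \<Longrightarrow> t \<le> 1 \<Longrightarrow> mult a c s t \<in> borel_measurable (path_events E {s..t})"
  unfolding mult_def using jump_prod_measurable[of s t a, where E = E] expo_measurable[of s t c, where E = E, OF _ _ _ c_meas] by measurable

lemma mult_split:
  "0 \<le> s \<Longrightarrow> s \<le> t \<Longrightarrow> t \<le> u \<Longrightarrow> u \<le> 1 \<Longrightarrow> X \<in> paths E \<Longrightarrow>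
    mult a c s u X = mult a c s t X * mult a c t u X"
  by (simp add: mult_def expo_split[of s t u] jump_prod_split[of X E s t u] exp_add)

lemma jump_prod_bounds: "0 \<le> jump_prod a s t X" "jump_prod a s t X \<le> 1"
  unfolding jump_prod_def using a_bounds by (auto intro!: prod_nonneg prod_le_1)

lemma mult_bounds:
  assumes "0 \<le> s" "s \<le> t" "t \<le> 1" "X \<in> paths E"
  shows "0 \<le> mult a c s t X" "mult a c s t X \<le> exp C"
proof -
  show "0 \<le> mult a c s t X" by (simp add: mult_def jump_prod_bounds)
  have "expo c s t X \<le> C" using expo_bounds[OF assms] mult_left_le[of "t - s" C] assms C_nonneg by linarith
  then show "mult a c s t X \<le> exp C" unfolding mult_def
    using jump_prod_bounds[of s t X] mult_mono[of "jump_prod a s t X" 1 "exp (expo c s t X)" "exp C"] by auto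
qed

lemma abs_mult_bound:
  "0 \<le> s \<Longrightarrow> s \<le> t \<Longrightarrow> t \<le> 1 \<Longrightarrow> X \<in> paths E \<Longrightarrow> \<bar>mult a c s t X\<bar> \<le> exp C"
  using mult_bounds[of s t X] by simp

lemma mult_same: "mult a c s s X = 1"
proof -
  have "expo c s s X = 0" unfolding expo_def set_lebesgue_integral_def
    by (intro integral_eq_zero_AE) (use AE_lborel_singleton[of s] in \<open>auto elim!: eventually_mono\<close>)
  then show ?thesis by (simp add: mult_def jump_prod_def)
qed

end

section \<open>Short-time expansion\<close>

lemma set_integral_constant:
  fixes k :: real
  assumes "A \<in> sets M" "emeasure M A < \<infinity>"
  shows "(LINT x:A|M. k) = k * measure M A"
proof -
  have "A \<inter> space M = A" using sets.sets_into_space[OF assms(1)] by blast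
  then show ?thesis using assms by (simp add: set_lebesgue_integral_def)
qed

text \<open>The set lies in the lower limit of the \<open>D n\<close>. The tail intersections
  \<open>G N\<close> increase to that limit, and each is contained in \<open>D N\<close>.\<close>

lemma emeasure_le_eventually:
  assumes B: "B \<in> sets M" and D: "\<And>n. D n \<in> sets M" "\<And>n::nat. emeasure M (D n) \<le> c"
    and ev: "\<And>x. x \<in> B \<Longrightarrow> \<forall>\<^sub>F n in sequentially. x \<in> D n"
  shows "emeasure M B \<le> c"
proof -
  define G where "G N = (\<Inter>n\<in>{N..}. D n)" for N
  have G: "G N \<in> sets M" for N unfolding G_def using D(1) by (intro sets.countable_INT') auto
  have "incseq G" unfolding G_def by (auto simp: incseq_def)
  have "B \<subseteq> (\<Union>N. G N)"
  proof
    fix x assume "x \<in> B"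
    then obtain N where "\<forall>n\<ge>N. x \<in> D n" using ev[of x] by (auto simp: eventually_sequentially)
    then have "x \<in> G N" by (auto simp: G_def)
    then show "x \<in> (\<Union>N. G N)" by blast
  qed
  then have "emeasure M B \<le> emeasure M (\<Union>N. G N)"
    using G by (intro emeasure_mono) auto
  also have "\<dots> = (SUP N. emeasure M (G N))"
    using G \<open>incseq G\<close> by (intro SUP_emeasure_incseq[symmetric]) auto
  also have "\<dots> \<le> c"
  proof (rule SUP_least)
    fix N
    have "emeasure M (G N) \<le> emeasure M (D N)" using D(1) by (intro emeasure_mono) (auto simp: G_def)
    then show "emeasure M (G N) \<le> c" using D(2)[of N] by (rule order_trans)
  qed
  finally show ?thesis .
qed

text \<open>Made for the trichotomy of no jump, some jump, several jumps on a short interval: the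
  three bounds will be of orders 2, 1, 0 in its length and the masses of orders 0, 1, 2, so that
  each product is of second order.\<close>

lemma abs_set_integral_le3:
  fixes f :: "'b \<Rightarrow> real"
  assumes Z: "Z \<in> sets M" "emeasure M Z < \<infinity>" and A: "A1 \<in> sets M" "A2 \<in> sets M"
    and B: "0 \<le> B0" "0 \<le> B1" "0 \<le> B2"
    and b: "\<And>x. x \<in> Z \<Longrightarrow> \<bar>f x\<bar> \<le> B0 + B1 * indicator A1 x + B2 * indicator A2 x"
  shows "\<bar>LINT x:Z|M. f x\<bar> \<le> B0 * measure M Z + B1 * measure M (Z \<inter> A1) + B2 * measure M (Z \<inter> A2)"
proof (cases "set_integrable M Z f")
  case True
  have fin: "emeasure M (Z \<inter> A1) < \<infinity>" "emeasure M (Z \<inter> A2) < \<infinity>"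
    using Z emeasure_mono[of "Z \<inter> A1" Z M] emeasure_mono[of "Z \<inter> A2" Z M] by (auto intro: le_less_trans)
  have i: "integrable M (\<lambda>x. B0 * indicator Z x + B1 * indicator (Z \<inter> A1) x + B2 * indicator (Z \<inter> A2) x)"
    using Z A fin by (intro Bochner_Integration.integrable_add integrable_mult_right integrable_real_indicator) auto
  have "\<bar>LINT x:Z|M. f x\<bar> \<le> (\<integral>x. norm (indicator Z x *\<^sub>R f x) \<partial>M)"
    unfolding set_lebesgue_integral_def real_norm_def[symmetric] by (rule integral_norm_bound)
  also have "\<dots> \<le> (\<integral>x. B0 * indicator Z x + B1 * indicator (Z \<inter> A1) x + B2 * indicator (Z \<inter> A2) x \<partial>M)"
  proof (rule integral_mono[OF integrable_norm i])
    fix x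
    show "norm (indicat_real Z x *\<^sub>R f x) \<le> B0 * indicator Z x + B1 * indicator (Z \<inter> A1) x + B2 * indicator (Z \<inter> A2) x"
      using b[of x] by (cases "x \<in> Z") (auto simp: indicator_inter_arith)
  qed (use True in \<open>simp add: set_integrable_def\<close>)
  also have "\<dots> = B0 * measure M Z + B1 * measure M (Z \<inter> A1) + B2 * measure M (Z \<inter> A2)"
    using Z A fin by (subst Bochner_Integration.integral_add Bochner_Integration.integral_add integrable_real_indicator, auto)+
  finally show ?thesis .
next
  case False
  then show ?thesis using B by (simp add: set_lebesgue_integral_def set_integrable_def not_integrable_integral_eq)
qed

section \<open>Bounded rates on a locally finite graph, and martingale bounds on the number of
  jumps\<close>

locale jump_rates =
  fixes E :: "'a::countable \<Rightarrow> 'a \<Rightarrow> bool" and j :: "real \<Rightarrow> 'a \<Rightarrow> 'a \<Rightarrow> real" and C :: real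
  assumes irrefl: "\<And>x. \<not> E x x" and finite_nbrs: "\<And>x. finite {y. E x y}"
    and j_meas: "\<And>x y. (\<lambda>t. j t x y) \<in> borel_measurable borel"
    and j_nonneg: "\<And>t x y. 0 \<le> j t x y"
    and j_supp: "\<And>t x y. \<not> E x y \<Longrightarrow> j t x y = 0"
    and j_mass: "\<And>t x. (\<Sum>y | E x y. j t x y) \<le> C"
begin

lemma C_nonneg: "0 \<le> C"
proof -
  have "0 \<le> (\<Sum>y | E undefined y. j 0 undefined y)" using j_nonneg by (rule sum_nonneg)
  then show ?thesis using j_mass[where t = 0 and x = undefined] by linarith
qed

lemma kernel_mass_eq: "kernel_mass j t x = (\<Sum>y | E x y. j t x y)"
proof -
  have "kernel_mass j t x = infsum (j t x) {y. E x y}"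
    unfolding kernel_mass_def by (rule infsum_cong_neutral) (auto simp: j_supp)
  then show ?thesis using finite_nbrs by simp
qed

lemma kernel_mass_bounds: "0 \<le> kernel_mass j t x" "kernel_mass j t x \<le> C"
  using j_mass[where x = x and t = t] j_nonneg by (auto simp: kernel_mass_eq intro!: sum_nonneg)

lemma kernel_mass_measurable: "(\<lambda>t. kernel_mass j t x) \<in> borel_measurable borel"
  unfolding kernel_mass_eq using j_meas by measurable

lemma kernel_gen_eq: "kernel_gen j t u x = (\<Sum>y | E x y. (u y - u x) * j t x y)"
proof -
  have "kernel_gen j t u x = infsum (\<lambda>y. (u y - u x) * j t x y) {y. E x y}"
    unfolding kernel_gen_def by (rule infsum_cong_neutral) (auto simp: j_supp)
  then show ?thesis using finite_nbrs by simp
qed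

lemma kernel_gen_measurable: "(\<lambda>t. kernel_gen j t u x) \<in> borel_measurable borel"
  unfolding kernel_gen_eq using j_meas by measurable

lemma weighted_rates_bound:
  assumes "\<And>y. E x y \<Longrightarrow> \<bar>w y\<bar> \<le> B" "0 \<le> B"
  shows "\<bar>\<Sum>y | E x y. w y * j t x y\<bar> \<le> B * C"
proof -
  have "\<bar>\<Sum>y | E x y. w y * j t x y\<bar> \<le> (\<Sum>y | E x y. \<bar>w y * j t x y\<bar>)" by (rule sum_abs)
  also have "\<dots> \<le> (\<Sum>y | E x y. B * j t x y)"
    using assms j_nonneg by (intro sum_mono) (auto simp: abs_mult intro!: mult_right_mono)
  also have "\<dots> \<le> B * C" using j_mass[where x = x and t = t] assms(2) by (simp add: sum_distrib_left[symmetric] mult_left_mono)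
  finally show ?thesis .
qed

lemma kernel_gen_bound:
  assumes "\<And>y. \<bar>u y\<bar> \<le> B" shows "\<bar>kernel_gen j t u x\<bar> \<le> 2 * B * C"
  unfolding kernel_gen_eq
proof (rule weighted_rates_bound)
  show "0 \<le> 2 * B" using assms[of undefined] by linarith
  show "\<bar>u y - u x\<bar> \<le> 2 * B" for y using assms[of x] assms[of y] by linarith
qed

end

locale walk = jump_rates E j C + markov_path E Q
  for E :: "'a::countable \<Rightarrow> 'a \<Rightarrow> bool" and j :: "real \<Rightarrow> 'a \<Rightarrow> 'a \<Rightarrow> real" and C :: real
    and Q :: "(real \<Rightarrow> 'a) measure" +
  assumes kernel: "has_jump_kernel E Q j"
begin

lemma finite_past:
  assumes "s \<in> {0..1}" "A \<in> sets Q"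
  shows "emeasure Q (A \<inter> at_time E s x) < \<infinity>"
proof -
  have "emeasure Q (A \<inter> at_time E s x) \<le> emeasure Q (at_time E s x)"
    by (rule emeasure_mono) (use at_time_Q[OF assms(1)] in auto)
  then show ?thesis using at_time_finite[OF assms(1), of x] by (rule le_less_trans)
qed

lemma emeasure_partition:
  assumes "s \<in> {0..1}" "A \<in> sets Q"
  shows "emeasure Q A = (\<integral>\<^sup>+x. emeasure Q (A \<inter> at_time E s x) \<partial>count_space UNIV)"
proof -
  have "A \<subseteq> paths E" using sets.sets_into_space[OF assms(2)] by simp
  then have "A = (\<Union>x. A \<inter> at_time E s x)" by auto
  then have "emeasure Q A = emeasure Q (\<Union>x. A \<inter> at_time E s x)" by simp
  also have "\<dots> = (\<integral>\<^sup>+x. emeasure Q (A \<inter> at_time E s x) \<partial>count_space UNIV)"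
    by (rule emeasure_UN_countable) (use assms at_time_Q[OF assms(1)] in \<open>auto simp: disjoint_family_on_def\<close>)
  finally show ?thesis .
qed

lemma moved_sets:
  assumes "s \<in> {0..1}" "t \<in> {0..1}"
  shows "{X \<in> paths E. X s \<noteq> X t} \<in> sets (path_events E {min s t..max s t})"
proof -
  have "(\<lambda>X. of_bool (X s \<noteq> X t) :: real) \<in> borel_measurable (path_events E {min s t..max s t})"
    by (rule coord2_compose_measurable[where f = "\<lambda>x y. of_bool (x \<noteq> y)"]) auto
  then have "{X \<in> space (path_events E {min s t..max s t}). (of_bool (X s \<noteq> X t) :: real) = 1} \<in> sets (path_events E {min s t..max s t})"
    by measurable
  moreover have "{X \<in> space (path_events E {min s t..max s t}). (of_bool (X s \<noteq> X t) :: real) = 1} = {X \<in> paths E. X s \<noteq> X t}"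
    by auto
  ultimately show ?thesis by simp
qed

text \<open>The martingale identity is tested with the indicator of the state \<open>x\<close>
  occupied at time \<open>s\<close>. Its generator is at least \<open>- C\<close>: at
  \<open>x\<close> it is minus the total rate, elsewhere it is nonnegative. Summing over
  \<open>x\<close> admits every past event, also one of infinite mass.\<close>

lemma moved_bound:
  assumes st: "0 \<le> s" "s \<le> t" "t \<le> 1" and A: "A \<in> sets (path_events E {0..s})"
  shows "emeasure Q (A \<inter> {X \<in> paths E. X s \<noteq> X t}) \<le> ennreal (C * (t - s)) * emeasure Q A"
proof -
  have AQ: "A \<in> sets Q" using sets_QI[OF A] st by auto
  have A_sub: "A \<subseteq> paths E" using sets.sets_into_space[OF AQ] by simp
  have s: "s \<in> {0..1}" using st by auto
  have D: "{X \<in> paths E. X s \<noteq> X t} \<in> sets Q" using sets_QI[OF moved_sets[of s t]] st by auto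
  have part: "emeasure Q ((A \<inter> {X \<in> paths E. X s \<noteq> X t}) \<inter> at_time E s x) \<le> ennreal (C * (t - s)) * emeasure Q (A \<inter> at_time E s x)" for x
  proof -
    define B where "B = A \<inter> at_time E s x"
    define u :: "'a \<Rightarrow> real" where "u = indicator {x}"
    have B: "B \<in> sets (path_events E {0..s})" unfolding B_def using A at_time_sets[of s "{0..s}" E x] st by auto
    have BQ: "B \<in> sets Q" using sets_QI[OF B] st by auto
    have Bfin: "emeasure Q B < \<infinity>" unfolding B_def by (rule finite_past[OF s AQ])
    have "finite {x. u x \<noteq> 0}" by (rule finite_subset[of _ "{x}"]) (auto simp: u_def indicator_def)
    then have eq: "(LINT X:B|Q. u (X t) - u (X s)) = (LINT X:B|Q. (LINT r:{s..t}|lborel. kernel_gen j r u (X r)))"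
      using kernel st B Bfin unfolding has_jump_kernel_def by blast
    have low: "- C \<le> kernel_gen j r u z" for r z
    proof (cases "z = x")
      case True
      have "kernel_gen j r u z = (\<Sum>y | E x y. - j r x y)" unfolding kernel_gen_eq True
        by (intro sum.cong) (use irrefl in \<open>auto simp: u_def indicator_def\<close>)
      then show ?thesis using j_mass[where t = r and x = x] by (simp add: sum_negf)
    next
      case False
      then have "0 \<le> kernel_gen j r u z" unfolding kernel_gen_eq
        using j_nonneg by (intro sum_nonneg) (auto simp: u_def indicator_def)
      then show ?thesis using C_nonneg by linarith
    qed
    have ub: "\<bar>kernel_gen j r u z\<bar> \<le> 2 * 1 * C" for r z
      by (rule kernel_gen_bound) (auto simp: u_def indicator_def)
    have inner: "- (C * (t - s)) \<le> (LINT r:{s..t}|lborel. kernel_gen j r u (X r))" if "X \<in> paths E" for X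
    proof -
      have si: "set_integrable lborel {s..t} (\<lambda>r. kernel_gen j r u (X r))"
        by (rule path_compose_integrable[OF st that kernel_gen_measurable ub])
      have "(LINT r:{s..t}|lborel. - C) \<le> (LINT r:{s..t}|lborel. kernel_gen j r u (X r))"
        by (rule set_integral_mono[OF _ si]) (use low st in \<open>auto simp: set_integrable_def\<close>)
      then show ?thesis using st by (simp add: set_lebesgue_integral_def mult.commute)
    qed
    define D where "D = {X \<in> paths E. X s \<noteq> X t}"
    have DQ: "D \<in> sets Q" using D by (simp add: D_def)
    have BDfin: "emeasure Q (B \<inter> D) < \<infinity>" using Bfin emeasure_mono[of "B \<inter> D" B Q] BQ by (auto intro: le_less_trans)
    have "(LINT X:B|Q. u (X t) - u (X s)) = (\<integral>X. - indicator (B \<inter> D) X \<partial>Q)"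
      unfolding set_lebesgue_integral_def
      by (rule Bochner_Integration.integral_cong) (auto simp: indicator_def B_def D_def u_def)
    also have "\<dots> = - measure Q (B \<inter> D)" using BQ DQ sets.sets_into_space[of "B \<inter> D" Q] by (simp add: Int_absorb2)
    finally have 1: "(LINT X:B|Q. u (X t) - u (X s)) = - measure Q (B \<inter> D)" .
    have "(LINT X:B|Q. (LINT r:{s..t}|lborel. kernel_gen j r u (X r))) \<ge> - (C * (t - s)) * measure Q B"
    proof -
      have m: "(\<lambda>X. LINT r:{s..t}|lborel. kernel_gen j r u (X r)) \<in> borel_measurable Q"
        using measurable_Q[OF expo_measurable[OF st, where E = E and c = "\<lambda>r. kernel_gen j r u", OF kernel_gen_measurable]] st unfolding expo_def by auto
      have "\<bar>LINT r:{s..t}|lborel. kernel_gen j r u (X r)\<bar> \<le> 2 * C * (t - s)" if "X \<in> paths E" for X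
        using abs_set_integral_le[of "{s..t}" lborel "2 * C" "\<lambda>r. kernel_gen j r u (X r)"] ub C_nonneg st by auto
      then have si: "set_integrable Q B (\<lambda>X. LINT r:{s..t}|lborel. kernel_gen j r u (X r))"
        using BQ Bfin m A_sub by (intro set_integrable_bounded[where B = "2 * C * (t - s)"]) (auto simp: B_def)
      have "(LINT X:B|Q. - (C * (t - s))) \<le> (LINT X:B|Q. (LINT r:{s..t}|lborel. kernel_gen j r u (X r)))"
        by (rule set_integral_mono[OF _ si])
          (use inner A_sub BQ Bfin in \<open>auto simp: B_def set_integrable_def intro!: integrable_mult_left\<close>)
      then show ?thesis using BQ Bfin by (simp only: set_integral_constant)
    qed
    then have "measure Q (B \<inter> D) \<le> C * (t - s) * measure Q B" using 1 eq by simp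
    then have "ennreal (measure Q (B \<inter> D)) \<le> ennreal (C * (t - s)) * ennreal (measure Q B)"
      using C_nonneg st by (simp add: ennreal_mult[symmetric] ennreal_leI)
    then have "emeasure Q (B \<inter> D) \<le> ennreal (C * (t - s)) * emeasure Q B"
      using Bfin BDfin by (simp add: emeasure_eq_ennreal_measure)
    then show ?thesis by (simp add: B_def D_def Int_ac)
  qed
  have "emeasure Q (A \<inter> {X \<in> paths E. X s \<noteq> X t}) =
    (\<integral>\<^sup>+x. emeasure Q ((A \<inter> {X \<in> paths E. X s \<noteq> X t}) \<inter> at_time E s x) \<partial>count_space UNIV)"
    by (rule emeasure_partition[OF s]) (use AQ D in auto)
  also have "\<dots> \<le> (\<integral>\<^sup>+x. ennreal (C * (t - s)) * emeasure Q (A \<inter> at_time E s x) \<partial>count_space UNIV)"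
    by (rule nn_integral_mono) (rule part)
  also have "\<dots> = ennreal (C * (t - s)) * emeasure Q A"
    by (subst nn_integral_cmult, simp, subst emeasure_partition[OF s AQ], rule refl)
  finally show ?thesis .
qed

abbreviation "jumped s t \<equiv> {X \<in> paths E. 1 \<le> card (jumps X s t)}"
abbreviation "jumped2 s t \<equiv> {X \<in> paths E. 2 \<le> card (jumps X s t)}"

text \<open>A union bound over the cells of a grid: each contributes
  \<open>C * ((t - s) / n)\<close>, so the sum does not depend on \<open>n\<close>, and for large
  \<open>n\<close> every jump shows up in some cell.\<close>

lemma jump_bound:
  assumes st: "0 \<le> s" "s \<le> t" "t \<le> 1" and A: "A \<in> sets (path_events E {0..s})"
  shows "emeasure Q (A \<inter> jumped s t) \<le> ennreal (C * (t - s)) * emeasure Q A"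
proof -
  define m where "m n i = {X \<in> paths E. X (grid s t n i) \<noteq> X (grid s t n (Suc i))}" for n i
  have AQ: "A \<in> sets Q" using sets_QI[OF A] st by auto
  have A_sub: "A \<subseteq> paths E" using sets.sets_into_space[OF AQ] by simp
  have g: "s \<le> grid s t n i" "grid s t n i \<le> grid s t n (Suc i)" "grid s t n (Suc i) \<le> t" if "i < n" for n i
    using that grid_in[of s t i n] grid_in[of s t "Suc i" n] grid_mono[of s t i "Suc i" n] st by auto
  have mQ: "m n i \<in> sets Q" if "i < n" for n i
    unfolding m_def using g[OF that] st by (intro sets_QI[OF moved_sets]) auto
  have bound: "emeasure Q (A \<inter> m n i) \<le> ennreal (C * ((t - s) / n)) * emeasure Q A" if "i < n" for n i
  proof -
    have "A \<in> sets (path_events E {0..grid s t n i})"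
      using A path_events_mono[of "{0..s}" "{0..grid s t n i}" E] g[OF that] by auto
    from moved_bound[OF _ _ _ this, of "grid s t n (Suc i)"] show ?thesis
      using g[OF that] st by (simp add: grid_diff m_def)
  qed
  show ?thesis
  proof (rule emeasure_le_eventually[where D = "\<lambda>n. \<Union>i<n. A \<inter> m n i"])
    show "A \<inter> jumped s t \<in> sets Q" using AQ sets_QI[OF two_jumps_sets[OF st, of E 1]] st by auto
    show "(\<Union>i<n. A \<inter> m n i) \<in> sets Q" for n using AQ mQ by auto
    show "emeasure Q (\<Union>i<n. A \<inter> m n i) \<le> ennreal (C * (t - s)) * emeasure Q A" for n
    proof -
      have "emeasure Q (\<Union>i<n. A \<inter> m n i) \<le> (\<Sum>i<n. emeasure Q (A \<inter> m n i))"
        using AQ mQ by (intro emeasure_subadditive_finite) auto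
      also have "\<dots> \<le> (\<Sum>i<n. ennreal (C * ((t - s) / n)) * emeasure Q A)"
        using bound by (intro sum_mono) auto
      also have "\<dots> = (of_nat n * ennreal (C * ((t - s) / n))) * emeasure Q A"
        by (simp add: mult.assoc)
      also have "of_nat n * ennreal (C * ((t - s) / n)) = (if n = 0 then 0 else ennreal (C * (t - s)))"
        using C_nonneg st by (simp add: ennreal_of_nat_eq_real_of_nat ennreal_mult[symmetric])
      also have "\<dots> * emeasure Q A \<le> ennreal (C * (t - s)) * emeasure Q A" by (auto intro: mult_right_mono)
      finally show ?thesis .
    qed
    fix X assume X: "X \<in> A \<inter> jumped s t"
    then have "X \<in> paths E" "jumps X s t \<noteq> {}" by auto
    from jump_grid_detect[OF this(1) st this(2)]
    show "\<forall>\<^sub>F n in sequentially. X \<in> (\<Union>i<n. A \<inter> m n i)"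
      by eventually_elim (use X in \<open>auto simp: m_def\<close>)
  qed
qed

text \<open>The bound for one cell is applied twice, the first displacement being a past event for
  the second. At most \<open>n * n\<close> pairs of cells contribute
  \<open>(C * ((t - s) / n))\<^sup>2\<close> each.\<close>

lemma jump2_bound:
  assumes st: "0 \<le> s" "s \<le> t" "t \<le> 1" and A: "A \<in> sets (path_events E {0..s})"
  shows "emeasure Q (A \<inter> jumped2 s t) \<le> ennreal ((C * (t - s))\<^sup>2) * emeasure Q A"
proof -
  define m where "m n i = {X \<in> paths E. X (grid s t n i) \<noteq> X (grid s t n (Suc i))}" for n i
  have AQ: "A \<in> sets Q" using sets_QI[OF A] st by auto
  have A_sub: "A \<subseteq> paths E" using sets.sets_into_space[OF AQ] by simp
  have g: "s \<le> grid s t n i" "grid s t n i \<le> grid s t n (Suc i)" "grid s t n (Suc i) \<le> t" if "i < n" for n i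
    using that grid_in[of s t i n] grid_in[of s t "Suc i" n] grid_mono[of s t i "Suc i" n] st by auto
  have me: "m n i \<in> sets (path_events E {0..grid s t n (Suc i)})" if "i < n" for n i
  proof -
    have "m n i \<in> sets (path_events E {grid s t n i..grid s t n (Suc i)})"
      unfolding m_def using g[OF that] st moved_sets[of "grid s t n i" "grid s t n (Suc i)"] by auto
    then show ?thesis
      using path_events_mono[of "{grid s t n i..grid s t n (Suc i)}" "{0..grid s t n (Suc i)}" E] g[OF that] st by auto
  qed
  have mQ: "m n i \<in> sets Q" if "i < n" for n i using sets_QI[OF me[OF that]] g[OF that] st by auto
  have step: "emeasure Q (B \<inter> m n i) \<le> ennreal (C * ((t - s) / n)) * emeasure Q B"
    if "i < n" "B \<in> sets (path_events E {0..grid s t n i})" for n i B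
    using moved_bound[OF _ _ _ that(2), of "grid s t n (Suc i)"] g[OF that(1)] st by (simp add: grid_diff m_def)
  have bound: "emeasure Q (A \<inter> m n i \<inter> m n k) \<le> ennreal ((C * ((t - s) / n))\<^sup>2) * emeasure Q A" if "i < k" "k < n" for n i k
  proof -
    have "A \<in> sets (path_events E {0..grid s t n i})"
      using A path_events_mono[of "{0..s}" "{0..grid s t n i}" E] g[of i n] that by auto
    from step[OF _ this] have 1: "emeasure Q (A \<inter> m n i) \<le> ennreal (C * ((t - s) / n)) * emeasure Q A" using that by auto
    have "grid s t n (Suc i) \<le> grid s t n k" using that st by (intro grid_mono) auto
    then have "m n i \<in> sets (path_events E {0..grid s t n k})" "A \<in> sets (path_events E {0..grid s t n k})"
      using me[of i n] that A path_events_mono[of "{0..s}" "{0..grid s t n k}" E] g[of k n]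
        path_events_mono[of "{0..grid s t n (Suc i)}" "{0..grid s t n k}" E] by auto
    then have "A \<inter> m n i \<in> sets (path_events E {0..grid s t n k})" by auto
    from step[OF that(2) this] have "emeasure Q (A \<inter> m n i \<inter> m n k) \<le> ennreal (C * ((t - s) / n)) * emeasure Q (A \<inter> m n i)" .
    also have "\<dots> \<le> ennreal (C * ((t - s) / n)) * (ennreal (C * ((t - s) / n)) * emeasure Q A)"
      by (rule mult_left_mono[OF 1]) simp
    also have "\<dots> = ennreal ((C * ((t - s) / n))\<^sup>2) * emeasure Q A"
    proof -
      have "0 \<le> C * ((t - s) / n)" using C_nonneg st by simp
      from ennreal_mult[OF this this] show ?thesis unfolding power2_eq_square by (metis mult.assoc)
    qed
    finally show ?thesis .
  qed
  show ?thesis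
  proof (rule emeasure_le_eventually[where D = "\<lambda>n. \<Union>k<n. \<Union>i<k. A \<inter> m n i \<inter> m n k"])
    show "A \<inter> jumped2 s t \<in> sets Q" using AQ sets_QI[OF two_jumps_sets[OF st, of E 2]] st by auto
    show "(\<Union>k<n. \<Union>i<k. A \<inter> m n i \<inter> m n k) \<in> sets Q" for n using AQ mQ by (auto intro!: sets.finite_UN)
    show "emeasure Q (\<Union>k<n. \<Union>i<k. A \<inter> m n i \<inter> m n k) \<le> ennreal ((C * (t - s))\<^sup>2) * emeasure Q A" for n
    proof -
      have "emeasure Q (\<Union>k<n. \<Union>i<k. A \<inter> m n i \<inter> m n k) \<le> (\<Sum>k<n. emeasure Q (\<Union>i<k. A \<inter> m n i \<inter> m n k))"
        using AQ mQ by (intro emeasure_subadditive_finite) (auto intro!: sets.finite_UN)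
      also have "\<dots> \<le> (\<Sum>k<n. \<Sum>i<k. emeasure Q (A \<inter> m n i \<inter> m n k))"
        using AQ mQ by (intro sum_mono emeasure_subadditive_finite) auto
      also have "\<dots> \<le> (\<Sum>k<n. \<Sum>i<k. ennreal ((C * ((t - s) / n))\<^sup>2) * emeasure Q A)"
        using bound by (intro sum_mono) auto
      also have "\<dots> \<le> (\<Sum>k<n. \<Sum>i<n. ennreal ((C * ((t - s) / n))\<^sup>2) * emeasure Q A)"
        by (intro sum_mono sum_mono2) auto
      also have "\<dots> = (of_nat n * (of_nat n * ennreal ((C * ((t - s) / n))\<^sup>2))) * emeasure Q A"
        by (simp add: mult.assoc)
      also have "of_nat n * (of_nat n * ennreal ((C * ((t - s) / n))\<^sup>2)) = (if n = 0 then 0 else ennreal ((C * (t - s))\<^sup>2))"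
      proof (cases "n = 0")
        case False
        have "real n * (real n * (C * ((t - s) / n))\<^sup>2) = (C * (t - s))\<^sup>2"
          using False by (simp add: power2_eq_square)
        then show ?thesis
          using False by (simp add: ennreal_of_nat_eq_real_of_nat ennreal_mult[symmetric])
      qed simp
      also have "\<dots> * emeasure Q A \<le> ennreal ((C * (t - s))\<^sup>2) * emeasure Q A" by (auto intro: mult_right_mono)
      finally show ?thesis .
    qed
    fix X assume X: "X \<in> A \<inter> jumped2 s t"
    then have "X \<in> paths E" "2 \<le> card (jumps X s t)" by auto
    from two_jumps_grid_detect[OF this(1) st this(2)]
    show "\<forall>\<^sub>F n in sequentially. X \<in> (\<Union>k<n. \<Union>i<k. A \<inter> m n i \<inter> m n k)"
      by eventually_elim (use X in \<open>auto simp: m_def\<close>)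
  qed
qed

lemma measure_jump_bounds:
  assumes st: "0 \<le> s" "s \<le> t" "t \<le> 1" and A: "A \<in> sets (path_events E {0..s})" "emeasure Q A < \<infinity>"
  shows "measure Q (A \<inter> jumped s t) \<le> C * (t - s) * measure Q A"
    and "measure Q (A \<inter> jumped2 s t) \<le> (C * (t - s))\<^sup>2 * measure Q A"
proof -
  have AQ: "A \<in> sets Q" using sets_QI[OF A(1)] st by auto
  have A2: "emeasure Q A = ennreal (measure Q A)" using A(2) by (simp add: emeasure_eq_ennreal_measure)
  have fin: "emeasure Q (A \<inter> D) = ennreal (measure Q (A \<inter> D))" for D
    using A(2) emeasure_mono[of "A \<inter> D" A Q] AQ by (intro emeasure_eq_ennreal_measure) (auto simp: top_unique)
  show "measure Q (A \<inter> jumped s t) \<le> C * (t - s) * measure Q A"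
    using jump_bound[OF st A(1)] C_nonneg st unfolding A2 fin by (simp add: ennreal_mult[symmetric])
  show "measure Q (A \<inter> jumped2 s t) \<le> (C * (t - s))\<^sup>2 * measure Q A"
    using jump2_bound[OF st A(1)] C_nonneg st unfolding A2 fin by (simp add: ennreal_mult[symmetric])
qed

end

lemma exp_minus_one_bounds:
  fixes x :: real
  assumes "0 \<le> x"
  shows "exp x - 1 \<le> x * exp x" "exp x - 1 - x \<le> x\<^sup>2 * exp x"
proof -
  have "1 - x \<le> exp (- x)" using exp_ge_add_one_self[of "- x"] by simp
  then have "(1 - x) * exp x \<le> exp (- x) * exp x" by (intro mult_right_mono) auto
  then show 1: "exp x - 1 \<le> x * exp x" by (simp add: exp_minus algebra_simps)
  have "exp x - 1 - x \<le> x * (exp x - 1)" using 1 by (simp add: algebra_simps)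
  also have "\<dots> \<le> x * (x * exp x)" using 1 assms by (intro mult_left_mono)
  finally show "exp x - 1 - x \<le> x\<^sup>2 * exp x" by (simp add: power2_eq_square)
qed

section \<open>Second-order expansion of the weighted conditional expectations\<close>

locale walk_functional = walk E j C Q + functional E a c C
  for E :: "'a::countable \<Rightarrow> 'a \<Rightarrow> bool" and j :: "real \<Rightarrow> 'a \<Rightarrow> 'a \<Rightarrow> real" and C :: real
    and Q :: "(real \<Rightarrow> 'a) measure" and a :: "'a \<Rightarrow> 'a \<Rightarrow> real" and c :: "real \<Rightarrow> 'a \<Rightarrow> real"
begin

abbreviation "M \<equiv> mult a c"

text \<open>Generator of the weighted evolution: the values after a jump damped by \<open>a\<close>,
  the full rate of leaving, and the potential \<open>c\<close>. If \<open>c\<close> is the total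
  rate, the diagonal term cancels; this is the geodesic case.\<close>

definition gen :: "real \<Rightarrow> ('a \<Rightarrow> real) \<Rightarrow> 'a \<Rightarrow> real" where
  "gen r f v = (\<Sum>w | E v w. a v w * f w * j r v w) + (c r v - kernel_mass j r v) * f v"

text \<open>The sum of four second-order coefficients, relative to
  \<open>B * (t - s)\<^sup>2\<close>: \<open>C\<^sup>2 * exp C\<close> without jump,
  \<open>C\<^sup>2 * (exp C + 1)\<close> from one jump, \<open>C\<^sup>2 * (exp C + 1 + C)\<close>
  from two or more, and \<open>4 * C\<^sup>2\<close> for freezing the generator at the initial
  state.\<close>

definition K :: real where "K = C\<^sup>2 * (3 * exp C + C + 6)"

lemma K_nonneg: "0 \<le> K" using C_nonneg by (simp add: K_def)

lemma M_measurable_Q: "0 \<le> s \<Longrightarrow> s \<le> t \<Longrightarrow> t \<le> 1 \<Longrightarrow> M s t \<in> borel_measurable Q"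
  by (rule measurable_Q[OF mult_measurable]) auto

lemma f_measurable_Q: "t \<in> {0..1} \<Longrightarrow> (\<lambda>X. (f (X t) :: real)) \<in> borel_measurable Q"
  by (rule measurable_compose[OF coord_Q]) auto

lemma gen_bound:
  assumes "\<And>x. \<bar>f x\<bar> \<le> B" shows "\<bar>gen r f v\<bar> \<le> 2 * B * C"
proof -
  have B: "0 \<le> B" using assms[of v] by linarith
  have "\<bar>\<Sum>w | E v w. (a v w * f w) * j r v w\<bar> \<le> B * C"
    using assms a_bounds B mult_mono[of "a v _" 1 "\<bar>f _\<bar>" B] by (intro weighted_rates_bound) (auto simp: abs_mult)
  moreover have "\<bar>(c r v - kernel_mass j r v) * f v\<bar> \<le> C * B"
    unfolding abs_mult using assms c_bounds[of r v] kernel_mass_bounds[of r v] by (intro mult_mono) auto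
  ultimately show ?thesis unfolding gen_def by (simp add: algebra_simps)
qed

lemma gen_measurable: "(\<lambda>r. gen r f v) \<in> borel_measurable borel"
  unfolding gen_def using j_meas c_meas kernel_mass_measurable by measurable

text \<open>The function \<open>u\<close> absorbs the factor of a single jump: after one jump
  \<open>M s t X * f (X t)\<close> and \<open>u (X t)\<close> differ only through the exponential,
  and without jump the difference is \<open>exp \<kappa> - 1\<close> times \<open>f v\<close>, whose
  linear part is subtracted. For two or more jumps a crude bound is enough.\<close>

lemma short_time_pathwise:
  assumes st: "0 \<le> s" "s \<le> t" "t \<le> 1" and X: "X \<in> at_time E s v" and f: "\<And>x. \<bar>f x\<bar> \<le> B"
  defines "u \<equiv> \<lambda>w. if w = v then f v else if E v w then a v w * f w else 0"
    and "\<kappa> \<equiv> LINT r:{s..t}|lborel. c r v"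
  shows "\<bar>M s t X * f (X t) - u (X t) - \<kappa> * f v\<bar> \<le> B * (C\<^sup>2 * (t - s)\<^sup>2 * exp C) +
    B * (C * (t - s) * (exp C + 1)) * indicator (jumped s t) X + B * (exp C + 1 + C) * indicator (jumped2 s t) X"
proof -
  have XE: "X \<in> paths E" and Xv: "X s = v" using X by auto
  have B: "0 \<le> B" using f[of v] by linarith
  have ub: "\<bar>u w\<bar> \<le> B" for w
    unfolding u_def using f a_bounds[of v w] B mult_mono[of "a v w" 1 "\<bar>f w\<bar>" B] by (auto simp: abs_mult)
  have h: "0 \<le> C * (t - s)" "C * (t - s) \<le> C"
    using C_nonneg st mult_left_le[of "t - s" C] by auto
  have \<kappa>: "0 \<le> \<kappa>" "\<kappa> \<le> C * (t - s)"
  proof -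
    show "0 \<le> \<kappa>" unfolding \<kappa>_def set_lebesgue_integral_def using c_bounds by (intro integral_nonneg_AE) auto
    have "\<bar>\<kappa>\<bar> \<le> C * measure lborel {s..t}"
      unfolding \<kappa>_def using c_bounds st C_nonneg by (intro abs_set_integral_le) auto
    then show "\<kappa> \<le> C * (t - s)" using st by simp
  qed
  have kf: "\<bar>\<kappa> * f v\<bar> \<le> C * (t - s) * B" unfolding abs_mult using f \<kappa> h by (intro mult_mono) auto
  define \<xi> where "\<xi> = expo c s t X"
  have \<xi>: "0 \<le> \<xi>" "\<xi> \<le> C * (t - s)" using expo_bounds[OF st XE] by (auto simp: \<xi>_def)
  have eX: "exp \<xi> - 1 \<le> C * (t - s) * exp C"
  proof -
    have "exp \<xi> - 1 \<le> \<xi> * exp \<xi>" by (rule exp_minus_one_bounds(1)[OF \<xi>(1)])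
    also have "\<dots> \<le> C * (t - s) * exp C" using \<xi> h by (intro mult_mono) auto
    finally show ?thesis .
  qed
  show ?thesis
  proof (rule jumps_cases[OF XE, of s t])
    assume J: "jumps X s t = {}"
    have const: "X r = v" if "r \<in> {s..t}" for r
    proof -
      have "jumps X s r \<subseteq> jumps X s t" using that by (auto simp: jumps_def)
      then show ?thesis using path_const[OF XE, of s r] J that st Xv by auto
    qed
    have XK: "\<xi> = \<kappa>" unfolding \<xi>_def expo_def \<kappa>_def by (intro set_lebesgue_integral_cong) (auto simp: const)
    have "M s t X * f (X t) - u (X t) - \<kappa> * f v = (exp \<kappa> - 1 - \<kappa>) * f v"
      using const[of t] st J by (simp add: mult_def jump_prod_def \<xi>_def[symmetric] XK u_def algebra_simps)
    moreover have "\<bar>(exp \<kappa> - 1 - \<kappa>) * f v\<bar> \<le> (C\<^sup>2 * (t - s)\<^sup>2 * exp C) * B"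
      unfolding abs_mult
    proof (intro mult_mono f)
      have "exp \<kappa> - 1 - \<kappa> \<le> \<kappa>\<^sup>2 * exp \<kappa>" by (rule exp_minus_one_bounds(2)[OF \<kappa>(1)])
      also have "\<dots> \<le> (C * (t - s))\<^sup>2 * exp C" using \<kappa> h by (intro mult_mono power_mono) auto
      finally show "\<bar>exp \<kappa> - 1 - \<kappa>\<bar> \<le> C\<^sup>2 * (t - s)\<^sup>2 * exp C"
        using exp_ge_add_one_self[of \<kappa>] unfolding power_mult_distrib by linarith
    qed (use C_nonneg in auto)
    ultimately show ?thesis using J by (simp add: mult.commute)
  next
    fix r assume J: "jumps X s t = {r}"
    note sj = single_jump[OF XE st J]
    have "M s t X = a v (X t) * exp \<xi>"
      using sj Xv J by (simp add: mult_def jump_prod_def \<xi>_def)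
    moreover have "u (X t) = a v (X t) * f (X t)" using sj Xv by (auto simp: u_def)
    ultimately have "M s t X * f (X t) - u (X t) - \<kappa> * f v = u (X t) * (exp \<xi> - 1) - \<kappa> * f v"
      by (simp add: algebra_simps)
    moreover have "\<bar>u (X t) * (exp \<xi> - 1)\<bar> \<le> B * (C * (t - s) * exp C)"
      unfolding abs_mult using ub eX \<xi> B by (intro mult_mono) auto
    ultimately have "\<bar>M s t X * f (X t) - u (X t) - \<kappa> * f v\<bar> \<le> B * (C * (t - s) * exp C) + C * (t - s) * B"
      using kf by linarith
    also have "\<dots> = B * (C * (t - s) * (exp C + 1))" by (simp add: algebra_simps)
    also have "\<dots> \<le> B * (C\<^sup>2 * (t - s)\<^sup>2 * exp C) + B * (C * (t - s) * (exp C + 1))" using B by simp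
    finally show ?thesis using J XE by simp
  next
    assume J: "2 \<le> card (jumps X s t)"
    have "\<bar>M s t X * f (X t)\<bar> \<le> exp C * B" unfolding abs_mult
      using abs_mult_bound[OF st XE] f by (intro mult_mono) auto
    moreover have "\<bar>\<kappa> * f v\<bar> \<le> C * B" using kf h B mult_right_mono[of "C * (t - s)" C B] by linarith
    ultimately have "\<bar>M s t X * f (X t) - u (X t) - \<kappa> * f v\<bar> \<le> exp C * B + B + C * B"
      using ub[of "X t"] by linarith
    also have "\<dots> = B * (exp C + 1 + C)" by (simp add: algebra_simps)
    also have "\<dots> \<le> B * (C\<^sup>2 * (t - s)\<^sup>2 * exp C) + B * (C * (t - s) * (exp C + 1)) + B * (exp C + 1 + C)"
      using B h by simp
    finally show ?thesis using J XE by simp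
  qed
qed

text \<open>The functional is traded for \<open>u (X t)\<close>, whose support is finite by local
  finiteness, so that the martingale identity applies; the generator that results is then frozen at
  \<open>v\<close>.\<close>

lemma short_time:
  assumes st: "0 \<le> s" "s \<le> t" "t \<le> 1" and f: "\<And>x. \<bar>f x\<bar> \<le> B"
  shows "\<bar>(LINT X:at_time E s v|Q. M s t X * f (X t)) -
      measure Q (at_time E s v) * (f v + (LINT r:{s..t}|lborel. gen r f v))\<bar> \<le>
    K * B * (t - s)\<^sup>2 * measure Q (at_time E s v)"
proof -
  define Z where "Z = at_time E s v"
  define q where "q = measure Q Z"
  define u where "u = (\<lambda>w. if w = v then f v else if E v w then a v w * f w else 0)"
  define \<kappa> where "\<kappa> = (LINT r:{s..t}|lborel. c r v)"
  have s01: "s \<in> {0..1}" and t01: "t \<in> {0..1}" using st by auto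
  have Z: "Z \<in> sets (path_events E {0..s})" "Z \<in> sets Q" "emeasure Q Z < \<infinity>"
    unfolding Z_def using at_time_sets[of s "{0..s}" E v] at_time_Q[OF s01] at_time_finite[OF s01] st by auto
  have B: "0 \<le> B" using f[of v] by linarith
  have ub: "\<bar>u w\<bar> \<le> B" for w
    unfolding u_def using f a_bounds[of v w] B mult_mono[of "a v w" 1 "\<bar>f w\<bar>" B] by (auto simp: abs_mult)
  have ufin: "finite {x. u x \<noteq> 0}"
    by (rule finite_subset[of _ "insert v {w. E v w}"]) (use finite_nbrs in \<open>auto simp: u_def split: if_splits\<close>)
  have kb: "\<bar>kernel_gen j r u x\<bar> \<le> 2 * B * C" for r x by (rule kernel_gen_bound[OF ub])
  have BC: "0 \<le> 2 * B * C" using B C_nonneg by simp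
  define I where "I X = (LINT r:{s..t}|lborel. kernel_gen j r u (X r))" for X :: "real \<Rightarrow> 'a"
  define Iv where "Iv = (LINT r:{s..t}|lborel. kernel_gen j r u v)"
  have eq: "(LINT X:Z|Q. u (X t) - u (X s)) = (LINT X:Z|Q. I X)"
    unfolding I_def using kernel st Z(1,3) ufin unfolding has_jump_kernel_def by blast
  have Im: "I \<in> borel_measurable Q"
    using measurable_Q[OF expo_measurable[OF st, where E = E and c = "\<lambda>r. kernel_gen j r u", OF kernel_gen_measurable]] st unfolding expo_def I_def by auto
  have Ib: "\<bar>I X\<bar> \<le> 2 * B * C * (t - s)" for X
    unfolding I_def using abs_set_integral_le[of "{s..t}" lborel "2 * B * C" "\<lambda>r. kernel_gen j r u (X r)"] kb BC st by auto
  have kv: "set_integrable lborel {s..t} (\<lambda>r. kernel_gen j r u v)"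
    using kernel_gen_measurable kb st by (intro set_integrable_bounded[where B = "2 * B * C"]) auto
  have cv: "set_integrable lborel {s..t} (\<lambda>r. c r v)"
    using c_meas c_bounds st by (intro set_integrable_bounded[where B = C]) auto
  have J: "jumped s t \<in> sets Q" "jumped2 s t \<in> sets Q"
    using sets_QI[OF two_jumps_sets[OF st, of E 1]] sets_QI[OF two_jumps_sets[OF st, of E 2]] st by auto
  have jb: "measure Q (Z \<inter> jumped s t) \<le> C * (t - s) * q" "measure Q (Z \<inter> jumped2 s t) \<le> (C * (t - s))\<^sup>2 * q"
    unfolding q_def by (rule measure_jump_bounds[OF st Z(1,3)])+
  have si: "set_integrable Q Z (\<lambda>X. M s t X * f (X t))" "set_integrable Q Z (\<lambda>X. u (X t))"
    "set_integrable Q Z I" "set_integrable Q Z (\<lambda>X. k :: real)" for k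
  proof -
    have "\<bar>M s t X * f (X t)\<bar> \<le> exp C * B" if "X \<in> Z" for X
      unfolding abs_mult using abs_mult_bound[OF st, of X] f that by (intro mult_mono) (auto simp: Z_def)
    then show "set_integrable Q Z (\<lambda>X. M s t X * f (X t))"
      using Z M_measurable_Q[OF st] f_measurable_Q[OF t01, of f] by (intro set_integrable_bounded[where B = "exp C * B"]) auto
    show "set_integrable Q Z (\<lambda>X. u (X t))"
      using Z f_measurable_Q[OF t01, of u] ub by (intro set_integrable_bounded[where B = B]) auto
    show "set_integrable Q Z I" using Z Im Ib by (intro set_integrable_bounded) auto
    show "set_integrable Q Z (\<lambda>X. k)" using Z by (intro set_integrable_bounded[where B = "\<bar>k\<bar>"]) auto
  qed
  have const: "(LINT X:Z|Q. k) = q * k" for k :: real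
    using Z by (simp add: set_integral_constant q_def)
  \<comment> \<open>\<open>X1\<close> is the error of trading the functional for \<open>u\<close>,
    \<open>X3\<close> that of freezing the generator. The integrand of \<open>X3\<close> vanishes on
    paths without jump.\<close>
  define X1 where "X1 = (LINT X:Z|Q. M s t X * f (X t) - u (X t) - \<kappa> * f v)"
  define X3 where "X3 = (LINT X:Z|Q. I X - Iv)"
  have X1: "\<bar>X1\<bar> \<le> B * (C\<^sup>2 * (t - s)\<^sup>2 * exp C) * q +
    B * (C * (t - s) * (exp C + 1)) * measure Q (Z \<inter> jumped s t) + B * (exp C + 1 + C) * measure Q (Z \<inter> jumped2 s t)"
    unfolding X1_def q_def
  proof (rule abs_set_integral_le3[OF Z(2,3) J])
    show "\<bar>M s t X * f (X t) - u (X t) - \<kappa> * f v\<bar> \<le> B * (C\<^sup>2 * (t - s)\<^sup>2 * exp C) +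
      B * (C * (t - s) * (exp C + 1)) * indicator (jumped s t) X + B * (exp C + 1 + C) * indicator (jumped2 s t) X"
      if "X \<in> Z" for X
      unfolding u_def \<kappa>_def by (rule short_time_pathwise[OF st _ f]) (use that in \<open>simp add: Z_def\<close>)
  qed (use B C_nonneg st in auto)
  have X3: "\<bar>X3\<bar> \<le> 0 * q + (4 * B * C * (t - s)) * measure Q (Z \<inter> jumped s t) + 0 * measure Q (Z \<inter> jumped2 s t)"
    unfolding X3_def q_def
  proof (rule abs_set_integral_le3[OF Z(2,3) J])
    fix X assume "X \<in> Z"
    then have X: "X \<in> paths E" "X s = v" by (auto simp: Z_def)
    show "\<bar>I X - Iv\<bar> \<le> 0 + 4 * B * C * (t - s) * indicator (jumped s t) X + 0 * indicator (jumped2 s t) X"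
    proof (cases "jumps X s t = {}")
      case True
      have "X r = v" if "r \<in> {s..t}" for r
      proof -
        have "jumps X s r \<subseteq> jumps X s t" using that by (auto simp: jumps_def)
        then show ?thesis using path_const[OF X(1), of s r] True that st X by auto
      qed
      then have "I X = Iv" unfolding I_def Iv_def by (intro set_lebesgue_integral_cong) auto
      then show ?thesis using B C_nonneg st by simp
    next
      case False
      then have "card (jumps X s t) \<noteq> 0" using finite_jumps[OF X(1)] by simp
      then have "X \<in> jumped s t" using X(1) by auto
      moreover have "\<bar>Iv\<bar> \<le> 2 * B * C * (t - s)"
        unfolding Iv_def using abs_set_integral_le[of "{s..t}" lborel "2 * B * C" "\<lambda>r. kernel_gen j r u v"] kb BC st by auto
      ultimately show ?thesis using Ib[of X] by simp
    qed
  qed (use B C_nonneg st in auto)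
  have e1: "X1 = (LINT X:Z|Q. M s t X * f (X t)) - (LINT X:Z|Q. u (X t)) - q * (\<kappa> * f v)"
    unfolding X1_def using si by (simp add: set_integral_diff const)
  have e2: "(LINT X:Z|Q. u (X t) - u (X s)) = (LINT X:Z|Q. u (X t)) - q * f v"
  proof -
    have "(LINT X:Z|Q. u (X t) - u (X s)) = (LINT X:Z|Q. u (X t) - f v)"
      by (rule set_lebesgue_integral_cong) (use Z in \<open>auto simp: Z_def u_def\<close>)
    then show ?thesis using si by (simp add: set_integral_diff const)
  qed
  have e3: "X3 = (LINT X:Z|Q. I X) - q * Iv"
    unfolding X3_def using si by (simp add: set_integral_diff const)
  \<comment> \<open>The values of \<open>u\<close> are \<open>f v\<close> at \<open>v\<close> and
    \<open>a v w * f w\<close> at its neighbours, so the generator of \<open>u\<close> at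
    \<open>v\<close> is \<open>gen\<close> without the potential.\<close>
  have e4: "(LINT r:{s..t}|lborel. gen r f v) = \<kappa> * f v + Iv"
  proof -
    have "gen r f v = kernel_gen j r u v + c r v * f v" for r
    proof -
      have "kernel_gen j r u v = (\<Sum>w | E v w. a v w * f w * j r v w - f v * j r v w)"
        unfolding kernel_gen_eq by (intro sum.cong) (use irrefl in \<open>auto simp: u_def algebra_simps\<close>)
      then show ?thesis by (simp add: gen_def kernel_mass_eq sum_subtractf sum_distrib_left[symmetric] algebra_simps)
    qed
    then show ?thesis using kv cv by (simp add: \<kappa>_def Iv_def set_integral_add)
  qed
  have "(LINT X:Z|Q. M s t X * f (X t)) - q * (f v + (LINT r:{s..t}|lborel. gen r f v)) = X1 + X3"
    using e1 e2 e3 e4 eq by (simp add: algebra_simps)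
  also have "\<bar>\<dots>\<bar> \<le> \<bar>X1\<bar> + \<bar>X3\<bar>" by (rule abs_triangle_ineq)
  also have "\<dots> \<le> (B * (C\<^sup>2 * (t - s)\<^sup>2 * exp C) * q +
    B * (C * (t - s) * (exp C + 1)) * (C * (t - s) * q) + B * (exp C + 1 + C) * ((C * (t - s))\<^sup>2 * q)) +
    (4 * B * C * (t - s)) * (C * (t - s) * q)"
  proof (rule add_mono)
    show "\<bar>X1\<bar> \<le> B * (C\<^sup>2 * (t - s)\<^sup>2 * exp C) * q +
      B * (C * (t - s) * (exp C + 1)) * (C * (t - s) * q) + B * (exp C + 1 + C) * ((C * (t - s))\<^sup>2 * q)"
      by (rule order_trans[OF X1]) (intro add_mono mult_left_mono jb order_refl; use B C_nonneg st in simp)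
    have "(4 * B * C * (t - s)) * measure Q (Z \<inter> jumped s t) \<le> (4 * B * C * (t - s)) * (C * (t - s) * q)"
      by (intro mult_left_mono jb) (use B C_nonneg st in simp)
    then show "\<bar>X3\<bar> \<le> (4 * B * C * (t - s)) * (C * (t - s) * q)" using X3 by linarith
  qed
  also have "\<dots> = K * B * (t - s)\<^sup>2 * q"
    unfolding K_def by (simp add: power2_eq_square algebra_simps)
  finally show ?thesis unfolding Z_def q_def .
qed

end

section \<open>The semigroup of a multiplicative functional\<close>

context walk
begin

lemma measure_pos_iff: "t \<in> {0..1} \<Longrightarrow> 0 < measure Q (at_time E t v) \<longleftrightarrow> emeasure Q (at_time E t v) \<noteq> 0"
  using at_time_finite[of t v] by (simp add: measure_def enn2real_positive_iff top.not_eq_extremum zero_less_iff_neq_zero)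

text \<open>In a time step \<open>h\<close> at most the fraction \<open>C * h\<close> of the mass at
  \<open>v\<close> leaves. For a mesh with \<open>C * h < 1\<close> some mass stays in every step,
  and finitely many steps reach \<open>t\<close>.\<close>

lemma at_time_pos:
  assumes init: "0 < measure Q (at_time E 0 v)" and t: "t \<in> {0..1}"
  shows "0 < measure Q (at_time E t v)"
proof -
  obtain n :: nat where n: "C * t < n" using reals_Archimedean2 by blast
  have n0: "n > 0" using n C_nonneg t by (cases n) (auto simp: mult_less_0_iff)
  have "0 < measure Q (at_time E (grid 0 t n i) v)" if "i \<le> n" for i
    using that
  proof (induction i)
    case 0 then show ?case using init by simp
  next
    case (Suc i)
    define s u where "s = grid 0 t n i" and "u = grid 0 t n (Suc i)"
    have su: "0 \<le> s" "s \<le> u" "u \<le> 1"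
      using grid_in[of 0 t i n] grid_in[of 0 t "Suc i" n] grid_mono[of 0 t i "Suc i" n] Suc.prems t unfolding s_def u_def by auto
    have s01: "s \<in> {0..1}" and u01: "u \<in> {0..1}" using su by auto
    have diff: "u - s = t / n" unfolding s_def u_def grid_diff by simp
    let ?Z = "at_time E s v" and ?D = "{X \<in> paths E. X s \<noteq> X u}"
    have pos: "0 < measure Q ?Z" using Suc unfolding s_def by simp
    have D: "?D \<in> sets Q" using sets_QI[OF moved_sets[OF s01 u01]] su by auto
    have Z: "?Z \<in> sets Q" "emeasure Q ?Z < \<infinity>" using at_time_Q[OF s01] at_time_finite[OF s01] by auto
    have le: "measure Q (?Z \<inter> ?D) \<le> C * (u - s) * measure Q ?Z"
    proof -
      have Z': "?Z \<in> sets (path_events E {0..s})" using at_time_sets[of s "{0..s}" E v] su by auto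
      have "emeasure Q (?Z \<inter> ?D) \<le> ennreal (C * (u - s)) * emeasure Q ?Z" by (rule moved_bound[OF su Z'])
      moreover have "emeasure Q (?Z \<inter> ?D) = ennreal (measure Q (?Z \<inter> ?D))"
        using Z emeasure_mono[of "?Z \<inter> ?D" ?Z Q] by (intro emeasure_eq_ennreal_measure) (auto simp: top_unique)
      ultimately show ?thesis using Z C_nonneg su by (simp add: emeasure_eq_ennreal_measure ennreal_mult[symmetric])
    qed
    have "C * (u - s) < 1" unfolding diff using n n0 by (simp add: field_simps)
    then have "measure Q (?Z \<inter> ?D) < measure Q ?Z"
      using le pos mult_strict_right_mono[of "C * (u - s)" 1 "measure Q ?Z"] by linarith
    moreover have "measure Q ?Z - measure Q (?Z \<inter> ?D) \<le> measure Q (at_time E u v)"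
    proof -
      have "measure Q ?Z - measure Q (?Z \<inter> ?D) = measure Q (?Z - ?Z \<inter> ?D)"
        using Z D by (intro measure_Diff[symmetric]) (auto simp: top.not_eq_extremum)
      also have "\<dots> \<le> measure Q (at_time E u v)"
        using at_time_Q[OF u01] at_time_finite[OF u01, of v] by (intro measure_mono_fmeasurable) (auto simp: fmeasurable_def intro!: sets.Diff sets.Int Z(1) D)
      finally show ?thesis .
    qed
    ultimately show ?case unfolding u_def by linarith
  qed
  from this[of n] show ?thesis using n0 by simp
qed

end

context walk_functional
begin

text \<open>The backward evolution of the functional: a two-parameter semigroup by
  \<open>U_split\<close>, with \<open>gen\<close> as its generator by
  \<open>U_short\<close>.\<close>

definition U :: "real \<Rightarrow> real \<Rightarrow> ('a \<Rightarrow> real) \<Rightarrow> 'a \<Rightarrow> real" where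
  "U s t f v = cexp E Q s v (\<lambda>X. M s t X * f (X t))"

lemma Mf_measurable:
  "0 \<le> s \<Longrightarrow> s \<le> t \<Longrightarrow> t \<le> 1 \<Longrightarrow> (\<lambda>X. M s t X * f (X t)) \<in> borel_measurable (path_events E {s..t})"
  by (intro borel_measurable_times mult_measurable coord_compose_measurable) auto

lemma Mf_bound:
  assumes "0 \<le> s" "s \<le> t" "t \<le> 1" "\<And>x. \<bar>f x\<bar> \<le> B" "X \<in> paths E"
  shows "\<bar>M s t X * f (X t)\<bar> \<le> exp C * B"
  unfolding abs_mult using abs_mult_bound[OF assms(1-3,5)] assms(4) by (intro mult_mono) auto

lemma U_bound:
  assumes st: "0 \<le> s" "s \<le> t" "t \<le> 1" and f: "\<And>x. \<bar>f x\<bar> \<le> B"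
  shows "\<bar>U s t f v\<bar> \<le> exp C * B"
  unfolding U_def using st f[of v] by (intro cexp_bounded Mf_bound f) auto

lemma tower_M:
  assumes u: "0 \<le> r" "r \<le> u" "u \<le> t" "t \<le> 1" and A: "A \<in> sets (path_events E {0..u})" "emeasure Q A < \<infinity>"
    and f: "\<And>x. \<bar>f x\<bar> \<le> B"
  shows "(LINT X:A|Q. M r t X * f (X t)) = (LINT X:A|Q. M r u X * U u t f (X u))"
proof -
  have A_sub: "A \<subseteq> paths E" using sets.sets_into_space[OF A(1)] by simp
  have "(LINT X:A|Q. M r t X * f (X t)) = (LINT X:A|Q. M r u X * (M u t X * f (X t)))"
    using A_sub u by (intro set_lebesgue_integral_cong sets_QI[OF A(1)]) (auto simp: mult_split[of r u t])
  also have "\<dots> = (LINT X:A|Q. M r u X * U u t f (X u))"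
    unfolding U_def
  proof (rule tower[OF _ A, where B = "exp C" and B' = "exp C * B"])
    show "M r u \<in> borel_measurable (path_events E {0..u})"
      by (rule measurable_path_events_mono[OF mult_measurable]) (use u in auto)
    show "(\<lambda>X. M u t X * f (X t)) \<in> borel_measurable (path_events E {u..1})"
      by (rule measurable_path_events_mono[OF Mf_measurable]) (use u in auto)
    show "\<bar>M r u X\<bar> \<le> exp C" if "X \<in> paths E" for X using abs_mult_bound[of r u X] u that by auto
    show "\<bar>M u t X * f (X t)\<bar> \<le> exp C * B" if "X \<in> paths E" for X
      using Mf_bound[where f = f, OF _ _ _ f that] u by auto
  qed (use u in auto)
  finally show ?thesis .
qed

lemma U_split:
  assumes "0 \<le> s" "s \<le> u" "u \<le> t" "t \<le> 1" and f: "\<And>x. \<bar>f x\<bar> \<le> B"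
  shows "U s t f v = U s u (U u t f) v"
proof -
  have "at_time E s v \<in> sets (path_events E {0..u})" using at_time_sets[of s "{0..u}" E v] assms by auto
  from tower_M[where f = f, OF assms(1-4) this _ f] show ?thesis
    unfolding U_def cexp_def using at_time_finite[of s v] assms by auto
qed

lemma Mf_integrable:
  assumes "0 \<le> s" "s \<le> t" "t \<le> 1" "\<And>x. \<bar>f x\<bar> \<le> B" and A: "A \<in> sets Q" "emeasure Q A < \<infinity>"
  shows "set_integrable Q A (\<lambda>X. M s t X * f (X t))"
proof (rule set_integrable_bounded[OF A])
  show "(\<lambda>X. M s t X * f (X t)) \<in> borel_measurable Q"
    by (rule measurable_Q[OF Mf_measurable]) (use assms in auto)
  show "\<bar>M s t X * f (X t)\<bar> \<le> exp C * B" if "X \<in> A" for X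
    using Mf_bound[where f = f and X = X, OF assms(1-4)] sets.sets_into_space[OF A(1)] that by auto
qed

lemma U_diff:
  assumes st: "0 \<le> s" "s \<le> t" "t \<le> 1" and f: "\<And>x. \<bar>f x\<bar> \<le> B" "\<And>x. \<bar>g x\<bar> \<le> B'"
  shows "U s t (\<lambda>x. f x - g x) v = U s t f v - U s t g v"
proof -
  have "at_time E s v \<in> sets Q" "emeasure Q (at_time E s v) < \<infinity>" using at_time_Q[of s] at_time_finite[of s] st by auto
  note i = Mf_integrable[where f = f, OF st f(1) this] Mf_integrable[where f = g, OF st f(2) this]
  show ?thesis unfolding U_def cexp_def
    using i by (simp add: right_diff_distrib set_integral_diff diff_divide_distrib)
qed

lemma U_same:
  assumes "s \<in> {0..1}" "0 < measure Q (at_time E s v)" shows "U s s f v = f v"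
proof -
  have Z: "at_time E s v \<in> sets Q" using at_time_Q assms by auto
  have "(LINT X:at_time E s v|Q. M s s X * f (X s)) = (LINT X:at_time E s v|Q. f v)"
    by (rule set_lebesgue_integral_cong) (use Z in \<open>auto simp: mult_same\<close>)
  also have "\<dots> = f v * measure Q (at_time E s v)"
    by (rule set_integral_constant[OF Z at_time_finite[OF assms(1)]])
  finally show ?thesis using assms by (simp add: U_def cexp_def)
qed

lemma U_short:
  assumes st: "0 \<le> s" "s \<le> t" "t \<le> 1" and f: "\<And>x. \<bar>f x\<bar> \<le> B" and pos: "0 < measure Q (at_time E s v)"
  shows "\<bar>U s t f v - f v - (LINT r:{s..t}|lborel. gen r f v)\<bar> \<le> K * B * (t - s)\<^sup>2"
proof -
  define q I L where "q = measure Q (at_time E s v)" and "I = (LINT X:at_time E s v|Q. M s t X * f (X t))"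
    and "L = (LINT r:{s..t}|lborel. gen r f v)"
  have q: "q > 0" using pos by (simp add: q_def)
  have "U s t f v - f v - L = (I - q * (f v + L)) / q"
    using q unfolding U_def cexp_def I_def[symmetric] q_def[symmetric] by (simp add: field_simps)
  also have "\<bar>\<dots>\<bar> \<le> K * B * (t - s)\<^sup>2 * q / q"
    unfolding abs_divide using short_time[where f = f and v = v, OF st f] q unfolding q_def[symmetric] I_def[symmetric] L_def[symmetric]
    by (simp add: pos_divide_le_eq)
  also have "\<dots> = K * B * (t - s)\<^sup>2" using q by simp
  finally show ?thesis unfolding L_def .
qed

lemma U_lipschitz:
  assumes st: "0 \<le> s" "s \<le> t" "t \<le> 1" and f: "\<And>x. \<bar>f x\<bar> \<le> B" and pos: "0 < measure Q (at_time E s v)"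
  shows "\<bar>U s t f v - f v\<bar> \<le> (2 * C + K) * B * (t - s)"
proof -
  have B: "0 \<le> B" using f[of v] by linarith
  have "\<bar>LINT r:{s..t}|lborel. gen r f v\<bar> \<le> 2 * B * C * (t - s)"
    using abs_set_integral_le[of "{s..t}" lborel "2 * B * C" "\<lambda>r. gen r f v"] gen_bound[where f = f, OF f] B C_nonneg st by auto
  moreover have "K * B * (t - s)\<^sup>2 \<le> K * B * (t - s)"
    using K_nonneg B st mult_left_le[of "t - s" "t - s"] by (intro mult_left_mono) (auto simp: power2_eq_square)
  ultimately have "\<bar>U s t f v - f v\<bar> \<le> 2 * B * C * (t - s) + K * B * (t - s)"
    using U_short[where f = f, OF st f pos] by linarith
  then show ?thesis by (simp add: algebra_simps)
qed

end

section \<open>Change of the jump kernel\<close>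

lemma mult_trivial: "mult (\<lambda>_ _. 1) (\<lambda>_ _. 0) s t X = 1"
  by (simp add: mult_def jump_prod_def expo_def set_lebesgue_integral_def)

text \<open>Positive initial masses propagate to all states and times by \<open>at_time_pos\<close>,
  so that the semigroups of both walks obey the short-time expansion at every state.\<close>

locale thinned_walk = W: walk E j C Q + W': walk E "\<lambda>t x y. a x y * j t x y" C Q'
  for E :: "'a::countable \<Rightarrow> 'a \<Rightarrow> bool" and j :: "real \<Rightarrow> 'a \<Rightarrow> 'a \<Rightarrow> real" and C :: real
    and Q Q' :: "(real \<Rightarrow> 'a) measure" and a :: "'a \<Rightarrow> 'a \<Rightarrow> real" +
  assumes a01: "\<And>x y. 0 \<le> a x y" "\<And>x y. a x y \<le> 1"
    and init: "\<And>x. emeasure Q' (at_time E 0 x) = emeasure Q (at_time E 0 x)"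
    and init_pos: "\<And>x. 0 < measure Q (at_time E 0 x)"
begin

definition c :: "real \<Rightarrow> 'a \<Rightarrow> real" where
  "c r x = kernel_mass j r x - kernel_mass (\<lambda>t x y. a x y * j t x y) r x"

lemma c_eq: "c r x = (\<Sum>y | E x y. (1 - a x y) * j r x y)"
  by (simp add: c_def W.kernel_mass_eq W'.kernel_mass_eq sum_subtractf[symmetric] algebra_simps)

sublocale F: walk_functional E j C Q a c
proof
  show "(\<lambda>r. c r x) \<in> borel_measurable borel" for x unfolding c_eq using W.j_meas by measurable
  show "0 \<le> c r x" for r x unfolding c_eq using a01 W.j_nonneg by (intro sum_nonneg mult_nonneg_nonneg) auto
  show "c r x \<le> C" for r x
    unfolding c_def using W.kernel_mass_bounds[of r x] W'.kernel_mass_bounds[of r x] by linarith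
qed (use a01 in auto)

sublocale F': walk_functional E "\<lambda>t x y. a x y * j t x y" C Q' "\<lambda>_ _. 1" "\<lambda>_ _. 0"
  using W.C_nonneg by unfold_locales auto

text \<open>The reason for the choice of \<open>c\<close>: the exponential restores exactly the rate
  lost by the damping, so the weighted walk and the damped walk have one generator.\<close>

lemma gen_same: "F'.gen r f v = F.gen r f v"
  by (simp add: F.gen_def F'.gen_def c_def mult_ac)

lemma pos: "s \<in> {0..1} \<Longrightarrow> 0 < measure Q (at_time E s v)"
  by (rule W.at_time_pos[OF init_pos])

lemma pos': "s \<in> {0..1} \<Longrightarrow> 0 < measure Q' (at_time E s v)"
proof (rule W'.at_time_pos)
  show "0 < measure Q' (at_time E 0 v)" using init_pos[of v] by (simp add: measure_def init)
qed

lemma U'_contraction: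
  assumes "0 \<le> s" "s \<le> t" "t \<le> 1" "\<And>x. \<bar>f x\<bar> \<le> B"
  shows "\<bar>F'.U s t f v\<bar> \<le> B"
proof -
  have "0 \<le> B" using assms(4)[of v] by linarith
  then show ?thesis unfolding F'.U_def mult_trivial using assms by (intro W'.cexp_bounded) auto
qed

text \<open>Both semigroups are unrolled over the same grid, backwards from \<open>t\<close>. A step
  costs twice the second-order error, as the generators agree, and earlier errors are not amplified,
  because the evolution of the damped walk contracts the supremum norm. The total is of order
  \<open>1 / n\<close>.\<close>

lemma U_eq:
  assumes st: "0 \<le> s" "s \<le> t" "t \<le> 1" and f: "\<And>x. \<bar>f x\<bar> \<le> B"
  shows "F.U s t f v = F'.U s t f v"
proof -
  \<comment> \<open>Twice the constant \<open>K\<close>, once for either semigroup;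
    \<open>exp C * B\<close> bounds the function \<open>g\<close> on which both are
    expanded.\<close>
  define D where "D = 2 * F.K * (exp C * B)"
  have B: "0 \<le> B" using f[of v] by linarith
  have D0: "0 \<le> D" using F.K_nonneg B by (simp add: D_def)
  have est: "\<bar>F.U s t f v - F'.U s t f v\<bar> \<le> D * (t - s)\<^sup>2 / n" if n: "n > 0" for n :: nat
  proof -
    define p where "p i = grid s t n (n - i)" for i
    have "\<bar>F.U (p i) t f x - F'.U (p i) t f x\<bar> \<le> real i * (D * ((t - s) / n)\<^sup>2)" if "i \<le> n" for i x
      using that
    proof (induction i arbitrary: x)
      case 0
      have "p 0 = t" using n by (simp add: p_def)
      then show ?case using F.U_same[OF _ pos, of t] F'.U_same[OF _ pos', of t] st by simp
    next
      case (Suc i)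
      define g g' where "g = F.U (p i) t f" and "g' = F'.U (p i) t f"
      have ni: "n - i = Suc (n - Suc i)" using Suc.prems by simp
      have pp: "0 \<le> p (Suc i)" "p (Suc i) \<le> p i" "p i \<le> t" "p i \<le> 1"
        using grid_in[of s t "n - i" n] grid_in[of s t "n - Suc i" n] grid_mono[of s t "n - Suc i" "n - i" n] st n
        unfolding p_def by auto
      have dp: "p i - p (Suc i) = (t - s) / n" unfolding p_def ni by (rule grid_diff)
      have gb: "\<bar>g y\<bar> \<le> exp C * B" for y unfolding g_def using F.U_bound[where f = f, OF _ _ _ f] pp st by auto
      have g'b: "\<bar>g' y\<bar> \<le> B" for y unfolding g'_def using U'_contraction[where f = f, OF _ _ _ f] pp st by auto
      have diff: "\<bar>g y - g' y\<bar> \<le> real i * (D * ((t - s) / n)\<^sup>2)" for y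
        using Suc.IH[of y] Suc.prems by (simp add: g_def g'_def)
      have "F.U (p (Suc i)) t f x = F.U (p (Suc i)) (p i) g x" unfolding g_def
        by (rule F.U_split[OF _ _ _ _ f]) (use pp st in auto)
      moreover have "F'.U (p (Suc i)) t f x = F'.U (p (Suc i)) (p i) g' x" unfolding g'_def
        by (rule F'.U_split[OF _ _ _ _ f]) (use pp st in auto)
      moreover have "\<bar>F.U (p (Suc i)) (p i) g x - F'.U (p (Suc i)) (p i) g x\<bar> \<le> D * ((t - s) / n)\<^sup>2"
        using F.U_short[of "p (Suc i)" "p i" g "exp C * B" x, OF _ _ _ gb pos]
          F'.U_short[of "p (Suc i)" "p i" g "exp C * B" x, OF _ _ _ gb pos'] pp
        unfolding gen_same dp D_def by auto
      moreover have "\<bar>F'.U (p (Suc i)) (p i) g x - F'.U (p (Suc i)) (p i) g' x\<bar> \<le> real i * (D * ((t - s) / n)\<^sup>2)"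
      proof -
        have "F'.U (p (Suc i)) (p i) (\<lambda>y. g y - g' y) x = F'.U (p (Suc i)) (p i) g x - F'.U (p (Suc i)) (p i) g' x"
          by (rule F'.U_diff[OF _ _ _ gb g'b]) (use pp in auto)
        moreover have "\<bar>F'.U (p (Suc i)) (p i) (\<lambda>y. g y - g' y) x\<bar> \<le> real i * (D * ((t - s) / n)\<^sup>2)"
          by (rule U'_contraction[OF _ _ _ diff]) (use pp in auto)
        ultimately show ?thesis by simp
      qed
      ultimately show ?case by (simp add: algebra_simps)
    qed
    from this[of n v] have "\<bar>F.U s t f v - F'.U s t f v\<bar> \<le> real n * (D * ((t - s) / n)\<^sup>2)" by (simp add: p_def)
    also have "\<dots> = D * (t - s)\<^sup>2 / n" using n by (simp add: power2_eq_square)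
    finally show ?thesis .
  qed
  have "(\<lambda>n. D * (t - s)\<^sup>2 / real n) \<longlonglongrightarrow> 0" by (rule lim_const_over_n)
  then have "\<bar>F.U s t f v - F'.U s t f v\<bar> \<le> 0"
  proof (rule tendsto_lowerbound)
    show "\<forall>\<^sub>F n in sequentially. \<bar>F.U s t f v - F'.U s t f v\<bar> \<le> D * (t - s)\<^sup>2 / real n"
      using eventually_gt_at_top[of 0] by eventually_elim (rule est)
  qed simp
  then show ?thesis by simp
qed

text \<open>Induction on the latest time of the cylinder. The new time contributes one semigroup
  step from the previous latest time \<open>t\<close>, where the cylinder fixes the state, and the
  two semigroups agree.\<close>

lemma measure_cyl:
  assumes "finite F" "F \<subseteq> {0<..1}"
  shows "measure Q' (cyl E (insert 0 F) \<phi>) = (LINT X:cyl E (insert 0 F) \<phi>|Q. F.M 0 (Max (insert 0 F)) X)"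
  using assms
proof (induction F rule: finite_linorder_max_induct)
  case empty
  have *: "cyl E {0} \<phi> = at_time E 0 (\<phi> 0)" by (auto simp: cyl_def)
  have "at_time E 0 (\<phi> 0) \<in> sets Q" "emeasure Q (at_time E 0 (\<phi> 0)) < \<infinity>"
    using W.at_time_Q[of 0] W.at_time_finite[of 0] by auto
  then show ?case unfolding * by (simp add: F.mult_same set_integral_constant measure_def init)
next
  case (insert b F)
  define t where "t = Max (insert 0 F)"
  define A where "A = cyl E (insert 0 F) \<phi>"
  have b: "0 < b" "b \<le> 1" using insert.prems by auto
  have tin: "t \<in> insert 0 F" unfolding t_def using insert.hyps by (intro Max_in) auto
  have tb: "0 \<le> t" "t < b" "t \<in> {0..1}" using tin insert.hyps b insert.prems by auto
  have tmax: "s \<le> t" if "s \<in> insert 0 F" for s unfolding t_def using insert.hyps that by (intro Max_ge) auto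
  have maxb: "Max (insert 0 (insert b F)) = b"
    using insert.hyps b by (intro Max_eqI) auto
  have cyl: "cyl E (insert 0 (insert b F)) \<phi> = A \<inter> at_time E b (\<phi> b)" by (auto simp: A_def cyl_def)
  have sub: "insert 0 F \<subseteq> {0..t}" using tmax insert.prems by auto
  have A: "A \<in> sets (path_events E {0..t})" unfolding A_def using insert.hyps sub by (intro cyl_sets) auto
  have AQ: "A \<in> sets Q" "A \<in> sets Q'" using W.sets_QI[OF A] W'.sets_QI[OF A] tb by auto
  have A_sub: "A \<subseteq> at_time E 0 (\<phi> 0)" by (auto simp: A_def cyl_def)
  have Afin: "emeasure Q A < \<infinity>" "emeasure Q' A < \<infinity>"
    using emeasure_mono[OF A_sub, of Q] emeasure_mono[OF A_sub, of Q'] W.at_time_finite[of 0 "\<phi> 0"]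
      W'.at_time_finite[of 0 "\<phi> 0"] W.at_time_Q[of 0] W'.at_time_Q[of 0] by (auto intro: le_less_trans)
  define f :: "'a \<Rightarrow> real" where "f = indicator {\<phi> b}"
  have f: "\<bar>f x\<bar> \<le> 1" for x by (simp add: f_def indicator_def)
  have A_t: "X t = \<phi> t" if "X \<in> A" for X using that tin unfolding A_def cyl_def by blast
  have "measure Q' (A \<inter> at_time E b (\<phi> b)) = (LINT X:A|Q'. F'.M t b X * f (X b))"
  proof -
    have "(LINT X:A|Q'. F'.M t b X * f (X b)) = (\<integral>X. indicator (A \<inter> at_time E b (\<phi> b)) X \<partial>Q')"
      unfolding set_lebesgue_integral_def mult_trivial
      by (intro Bochner_Integration.integral_cong) (auto simp: f_def indicator_def)
    then show ?thesis using AQ W'.at_time_Q[of b "\<phi> b"] b sets.sets_into_space[of "A \<inter> at_time E b (\<phi> b)" Q']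
      by (simp add: Int_absorb2)
  qed
  also have "\<dots> = (LINT X:A|Q'. F'.M t t X * F'.U t b f (X t))"
    by (rule F'.tower_M[OF _ _ _ _ A Afin(2) f]) (use tb b in auto)
  also have "\<dots> = (LINT X:A|Q'. F'.U t b f (\<phi> t))"
    by (rule set_lebesgue_integral_cong) (use AQ A_t in \<open>auto simp: mult_trivial\<close>)
  also have "\<dots> = F.U t b f (\<phi> t) * measure Q' A"
    using U_eq[where f = f and s = t and t = b, OF _ _ _ f] tb b by (simp add: set_integral_constant[OF AQ(2) Afin(2)])
  also have "measure Q' A = (LINT X:A|Q. F.M 0 t X)"
    using insert.IH insert.prems by (simp add: A_def t_def)
  also have "F.U t b f (\<phi> t) * \<dots> = (LINT X:A|Q. F.M 0 t X * F.U t b f (\<phi> t))"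
    by (simp add: mult.commute)
  also have "\<dots> = (LINT X:A|Q. F.M 0 t X * F.U t b f (X t))"
    by (rule set_lebesgue_integral_cong) (use AQ A_t in auto)
  also have "\<dots> = (LINT X:A|Q. F.M 0 b X * f (X b))"
    by (rule F.tower_M[OF _ _ _ _ A Afin(1) f, symmetric]) (use tb b in auto)
  also have "\<dots> = (LINT X:A \<inter> at_time E b (\<phi> b)|Q. F.M 0 b X)"
    unfolding set_lebesgue_integral_def using A_sub
    by (intro Bochner_Integration.integral_cong) (auto simp: f_def indicator_def)
  finally show ?case unfolding cyl maxb .
qed

theorem change_of_kernel: "Q' = density Q (\<lambda>X. ennreal (mult a c 0 1 X))"
proof (rule path_measure_eqI)
  have Mm: "F.M 0 1 \<in> borel_measurable Q" by (rule F.M_measurable_Q) auto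
  show "sets Q' = sets (path_space E)" by (rule W'.sets_Q)
  show "sets (density Q (\<lambda>X. ennreal (mult a c 0 1 X))) = sets (path_space E)" using W.sets_Q by simp
  show "emeasure Q' (at_time E 0 x) \<noteq> \<infinity>" for x using W'.at_time_finite[of 0 x] by auto
  fix F \<phi> assume F: "finite F" "F \<subseteq> {0<..1::real}"
  define A where "A = cyl E (insert 0 F) \<phi>"
  define t where "t = Max (insert 0 F)"
  have tin: "t \<in> insert 0 F" unfolding t_def using F by (intro Max_in) auto
  have tb: "0 \<le> t" "t \<le> 1" using tin F by auto
  have "insert 0 F \<subseteq> {0..t}" using F by (auto simp: t_def)
  then have A: "A \<in> sets (path_events E {0..t})" unfolding A_def using F by (intro cyl_sets) auto
  have AQ: "A \<in> sets Q" "A \<in> sets Q'" using W.sets_QI[OF A] W'.sets_QI[OF A] tb by auto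
  have A_sub: "A \<subseteq> at_time E 0 (\<phi> 0)" by (auto simp: A_def cyl_def)
  have Afin: "emeasure Q A < \<infinity>" "emeasure Q' A < \<infinity>"
    using emeasure_mono[OF A_sub, of Q] emeasure_mono[OF A_sub, of Q'] W.at_time_finite[of 0 "\<phi> 0"]
      W'.at_time_finite[of 0 "\<phi> 0"] W.at_time_Q[of 0] W'.at_time_Q[of 0] by (auto intro: le_less_trans)
  \<comment> \<open>The functional has conditional mean 1, since \<open>F'.U\<close> of the constant
    1 is 1. Hence the density up to time 1 and the density up to the last time of the cylinder give
    the cylinder the same mass.\<close>
  have one: "F.U t 1 (\<lambda>_. 1) x = 1" for x
  proof -
    have "F.U t 1 (\<lambda>_. 1) x = F'.U t 1 (\<lambda>_. 1) x" by (rule U_eq) (use tb in auto)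
    also have "\<dots> = 1" unfolding F'.U_def mult_trivial cexp_def
      using set_integral_constant[OF W'.at_time_Q W'.at_time_finite, of t x 1] pos'[of t x] tb by auto
    finally show ?thesis .
  qed
  have "emeasure (density Q (\<lambda>X. ennreal (F.M 0 1 X))) A = (\<integral>\<^sup>+X. ennreal (indicator A X * F.M 0 1 X) \<partial>Q)"
    using Mm AQ(1) by (subst emeasure_density) (auto intro!: nn_integral_cong simp: indicator_def)
  also have "\<dots> = ennreal (LINT X:A|Q. F.M 0 1 X)"
    unfolding set_lebesgue_integral_def real_scaleR_def
  proof (rule nn_integral_eq_integral)
    show "integrable Q (\<lambda>X. indicat_real A X * F.M 0 1 X)"
      using F.Mf_integrable[of 0 1 "\<lambda>_. 1" 1 A] AQ Afin by (simp add: set_integrable_def)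
    have "0 \<le> F.M 0 1 X" if "X \<in> A" for X using F.mult_bounds(1)[of 0 1 X] that A_sub by auto
    then show "AE X in Q. 0 \<le> indicat_real A X * F.M 0 1 X" by (auto simp: indicator_def)
  qed
  also have "(LINT X:A|Q. F.M 0 1 X) = (LINT X:A|Q. F.M 0 t X)"
    using F.tower_M[of 0 t 1 A "\<lambda>_. 1" 1, OF _ _ _ _ A Afin(1)] tb one by simp
  also have "\<dots> = measure Q' A" using measure_cyl[OF F, of \<phi>] by (simp add: A_def t_def)
  finally show "emeasure Q' (cyl E (insert 0 F) \<phi>) = emeasure (density Q (\<lambda>X. ennreal (F.M 0 1 X))) (cyl E (insert 0 F) \<phi>)"
    using Afin(2) by (simp add: A_def[symmetric] emeasure_eq_ennreal_measure)
qed

end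

section \<open>Geodesics\<close>

text \<open>Cut into \<open>n\<close> equal pieces, the value is at most \<open>n\<close> times
  \<open>k * ((t - s) / n)\<^sup>2\<close>. This takes the place of uniqueness for a differential
  equation whose coefficients are only measurable in time.\<close>

lemma additive_zero:
  fixes D :: "real \<Rightarrow> real \<Rightarrow> real"
  assumes st: "s \<le> t"
    and add: "\<And>r u w. s \<le> r \<Longrightarrow> r \<le> u \<Longrightarrow> u \<le> w \<Longrightarrow> w \<le> t \<Longrightarrow> D r w = D r u + D u w"
    and small: "\<And>r u. s \<le> r \<Longrightarrow> r \<le> u \<Longrightarrow> u \<le> t \<Longrightarrow> \<bar>D r u\<bar> \<le> k * (u - r)\<^sup>2"
  shows "D s t = 0"
proof -
  have est: "\<bar>D s t\<bar> \<le> k * (t - s)\<^sup>2 / n" if n: "n > 0" for n :: nat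
  proof -
    have "\<bar>D s (grid s t n i)\<bar> \<le> real i * (k * ((t - s) / n)\<^sup>2)" if "i \<le> n" for i
      using that
    proof (induction i)
      case 0 then show ?case using small[of s s] st by simp
    next
      case (Suc i)
      have g: "s \<le> grid s t n i" "grid s t n i \<le> grid s t n (Suc i)" "grid s t n (Suc i) \<le> t"
        using grid_in[of s t i n] grid_in[of s t "Suc i" n] grid_mono[of s t i "Suc i" n] st Suc.prems by auto
      have "\<bar>D (grid s t n i) (grid s t n (Suc i))\<bar> \<le> k * ((t - s) / n)\<^sup>2"
        using small[OF g] by (simp add: grid_diff)
      moreover have "D s (grid s t n (Suc i)) = D s (grid s t n i) + D (grid s t n i) (grid s t n (Suc i))"
        using g by (intro add) auto
      ultimately show ?case using Suc by (simp add: algebra_simps)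
    qed
    from this[of n] have "\<bar>D s t\<bar> \<le> real n * (k * ((t - s) / n)\<^sup>2)" using n by simp
    also have "\<dots> = k * (t - s)\<^sup>2 / n" using n by (simp add: power2_eq_square)
    finally show ?thesis .
  qed
  have "(\<lambda>n. k * (t - s)\<^sup>2 / real n) \<longlonglongrightarrow> 0" by (rule lim_const_over_n)
  then have "\<bar>D s t\<bar> \<le> 0"
  proof (rule tendsto_lowerbound)
    show "\<forall>\<^sub>F n in sequentially. \<bar>D s t\<bar> \<le> k * (t - s)\<^sup>2 / real n"
      using eventually_gt_at_top[of 0] by eventually_elim (rule est)
  qed simp
  then show ?thesis by simp
qed

lemma set_integral_Icc_split:
  fixes f :: "real \<Rightarrow> real"
  assumes "s \<le> t" "t \<le> u" "set_integrable lborel {s..u} f"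
  shows "(LINT r:{s..u}|lborel. f r) = (LINT r:{s..t}|lborel. f r) + (LINT r:{t..u}|lborel. f r)"
proof -
  have *: "{s..u} = {s..t} \<union> {t..u}" using assms by auto
  have "AE r in lborel. r \<noteq> t" by (rule AE_lborel_singleton)
  then have "AE r in lborel. \<not> (r \<in> {s..t} \<and> r \<in> {t..u})" by eventually_elim auto
  then show ?thesis unfolding *
  proof (rule set_integral_Un_AE)
    show "set_integrable lborel {s..t} f" "set_integrable lborel {t..u} f"
      by (rule set_integrable_subset[OF assms(3)]; use assms in auto)+
  qed auto
qed

lemma set_integral_pos:
  fixes f :: "real \<Rightarrow> real"
  assumes "s < t" and i: "set_integrable lborel {s..t} f" and pos: "\<And>r. s \<le> r \<Longrightarrow> r < t \<Longrightarrow> 0 < f r"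
    and nn: "0 \<le> f t"
  shows "0 < (LINT r:{s..t}|lborel. f r)"
proof (rule ccontr)
  let ?f = "\<lambda>r. indicator {s..t} r *\<^sub>R f r"
  assume n: "\<not> 0 < (LINT r:{s..t}|lborel. f r)"
  have nonneg: "0 \<le> ?f r" for r using pos[of r] nn by (cases "r = t") (auto simp: indicator_def)
  have i': "integrable lborel ?f" using i by (simp add: set_integrable_def)
  have "integral\<^sup>L lborel ?f = 0"
    using n Bochner_Integration.integral_nonneg[of lborel ?f] nonneg unfolding set_lebesgue_integral_def by fastforce
  then have "AE r in lborel. ?f r = 0" using Bochner_Integration.integral_nonneg_eq_0_iff_AE[OF i'] nonneg by auto
  then have "AE r in lborel. r \<notin> {s..<t}"
    by eventually_elim (use pos in \<open>force simp: indicator_def split: if_splits\<close>)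
  then have "emeasure lborel {s..<t} = 0" by (subst (asm) AE_iff_measurable[where N = "{s..<t}"]) auto
  then show False using assms(1) by simp
qed

section \<open>Steps towards a target state, and geodesics as products over jumps\<close>

locale geodesic_walk = walk E j C Q
  for E :: "'a::countable \<Rightarrow> 'a \<Rightarrow> bool" and j :: "real \<Rightarrow> 'a \<Rightarrow> 'a \<Rightarrow> real" and C :: real
    and Q :: "(real \<Rightarrow> 'a) measure" +
  fixes d :: "'a \<Rightarrow> 'a \<Rightarrow> real"
  assumes sym: "E x y \<Longrightarrow> E y x" and connected: "E\<^sup>*\<^sup>* x y"
    and metric: "Metric_space UNIV d" and d_ge_1: "x \<noteq> y \<Longrightarrow> 1 \<le> d x y"
    and d_Inf: "d x y = Inf {path_length d X | X. X \<in> paths E \<and> X 0 = x \<and> X 1 = y}"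
    and init_pos: "\<And>x. 0 < measure Q (at_time E 0 x)"
    and j_pos: "\<And>t x y. t \<in> {0..1} \<Longrightarrow> E x y \<Longrightarrow> 0 < j t x y"
begin

lemma d_facts: "0 \<le> d x y" "d x y = d y x" "d x y = 0 \<longleftrightarrow> x = y" "d x z \<le> d x y + d y z"
  using metric by (auto simp: Metric_space_def)

text \<open>Over the jumps of a path ending at \<open>y\<close>, the product of these factors is the
  indicator of being a geodesic. For each fixed target, geodesicity becomes a multiplicative
  functional.\<close>

definition towards :: "'a \<Rightarrow> 'a \<Rightarrow> 'a \<Rightarrow> real" where
  "towards y v w = of_bool (d v w + d w y = d v y)"

lemma jump_prod_towards:
  "X \<in> paths E \<Longrightarrow> jump_prod (towards y) s t X =
    of_bool (\<forall>r\<in>jumps X s t. d (left_lim X r) (X r) + d (X r) y = d (left_lim X r) y)"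
  using finite_jumps[of X E s t] by (auto simp: jump_prod_def towards_def intro!: prod.neutral)

lemma dist_le_length:
  assumes X: "X \<in> paths E" and st: "0 \<le> s" "s \<le> t" "t \<le> 1"
  shows "d (X s) (X t) \<le> (\<Sum>r\<in>jumps X s t. d (left_lim X r) (X r))"
proof -
  have "d (X s) (X t) = (\<Sum>r\<in>jumps X s t. d (left_lim X r) (X t) - d (X r) (X t))"
    using sum_jumps_telescope[OF X st, of "\<lambda>x. d x (X t)"] d_facts(3)[of "X t" "X t"] by simp
  also have "\<dots> \<le> (\<Sum>r\<in>jumps X s t. d (left_lim X r) (X r))"
  proof (rule sum_mono)
    show "d (left_lim X r) (X t) - d (X r) (X t) \<le> d (left_lim X r) (X r)" for r
      using d_facts(4)[of "left_lim X r" "X t" "X r"] by simp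
  qed
  finally show ?thesis .
qed

text \<open>The length of a jump is at least the decrease of the distance to \<open>y\<close>, by
  the triangle inequality, and the decreases telescope to \<open>d (X s) y\<close>. A sum of
  nonnegative defects vanishes only if each defect does.\<close>

lemma length_towards_iff:
  assumes X: "X \<in> paths E" and st: "0 \<le> s" "s \<le> t" "t \<le> 1" and y: "X t = y"
  shows "(\<Sum>r\<in>jumps X s t. d (left_lim X r) (X r)) = d (X s) y \<longleftrightarrow>
    (\<forall>r\<in>jumps X s t. d (left_lim X r) (X r) + d (X r) y = d (left_lim X r) y)"
proof -
  have tel: "(\<Sum>r\<in>jumps X s t. d (left_lim X r) y - d (X r) y) = d (X s) y"
    using sum_jumps_telescope[OF X st, of "\<lambda>x. d x y"] d_facts(3)[of y y] y by simp
  have "(\<Sum>r\<in>jumps X s t. d (left_lim X r) (X r)) = d (X s) y \<longleftrightarrow>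
    (\<Sum>r\<in>jumps X s t. d (left_lim X r) (X r) - (d (left_lim X r) y - d (X r) y)) = 0"
    unfolding sum_subtractf[of "\<lambda>r. d (left_lim X r) (X r)" "\<lambda>r. d (left_lim X r) y - d (X r) y"] tel by simp
  also have "\<dots> \<longleftrightarrow> (\<forall>r\<in>jumps X s t. d (left_lim X r) (X r) - (d (left_lim X r) y - d (X r) y) = 0)"
  proof (rule sum_nonneg_eq_0_iff[OF finite_jumps[OF X]])
    show "0 \<le> d (left_lim X r) (X r) - (d (left_lim X r) y - d (X r) y)" for r
      using d_facts(4)[of "left_lim X r" y "X r"] by simp
  qed
  finally show ?thesis by (auto simp: algebra_simps)
qed

lemma geodesic_iff:
  assumes X: "X \<in> paths E"
  shows "X \<in> geodesics E d \<longleftrightarrow> jump_prod (towards (X 1)) 0 1 X = 1"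
  using length_towards_iff[OF X, of 0 1 "X 1"] X
  by (auto simp: geodesics_def geodesics_between_def path_length_def jump_prod_towards jumps_01)

text \<open>The infimum of the lengths is not known to be attained, but the first jump of any path
  offers a neighbour \<open>w\<close> with \<open>d v w + d w y\<close> at most its length. Over the
  finitely many neighbours a minimum is attained.\<close>

lemma exists_towards:
  assumes "v \<noteq> y"
  shows "\<exists>w. E v w \<and> d v w + d w y = d v y"
proof -
  let ?S = "{path_length d X | X. X \<in> paths E \<and> X 0 = v \<and> X 1 = y}"
  have first: "\<exists>w. E v w \<and> d v w + d w y \<le> path_length d X" if X: "X \<in> paths E" "X 0 = v" "X 1 = y" for X
  proof -
    have fin: "finite (jump_times X)" using X by (simp add: paths_def)
    have ne: "jump_times X \<noteq> {}"
    proof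
      assume "jump_times X = {}"
      then have "jumps X 0 1 = {}" by (simp add: jumps_01)
      from path_const[OF X(1) _ _ _ this] show False using X assms by simp
    qed
    define T where "T = Min (jump_times X)"
    have T: "T \<in> jump_times X" unfolding T_def using fin ne by (rule Min_in)
    then have T01: "0 < T" "T < 1" using jump_times_subset[of X] by auto
    have J: "jumps X 0 T = {T}"
    proof -
      have "T \<le> r" if "r \<in> jump_times X" for r unfolding T_def using fin that by (rule Min_le)
      then show ?thesis using T T01 by (fastforce simp: jumps_def)
    qed
    have vT: "left_lim X T = v" using single_jump(1)[OF X(1) _ _ _ J] T01 X by simp
    have "path_length d X = (\<Sum>r\<in>jumps X 0 T. d (left_lim X r) (X r)) + (\<Sum>r\<in>jumps X T 1. d (left_lim X r) (X r))"
      unfolding path_length_def jumps_01[symmetric] using T01 by (intro sum_jumps_split[OF X(1)]) auto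
    then have "d v (X T) + d (X T) y \<le> path_length d X"
      unfolding J using vT dist_le_length[OF X(1), of T 1] T01 X by simp
    moreover have "E v (X T)" using single_jump(4)[OF X(1) _ _ _ J] T01 X by simp
    ultimately show ?thesis by blast
  qed
  have irr: "irreflp E" using irrefl by (simp add: irreflp_def)
  obtain X0 where X0: "X0 \<in> paths E" "X0 0 = v" "X0 1 = y" using path_exists[OF connected[of v y] irr] by blast
  then have ne: "?S \<noteq> {}" by blast
  define m where "m = Min ((\<lambda>w. d v w + d w y) ` {w. E v w})"
  have nb: "{w. E v w} \<noteq> {}" using first[OF X0] by blast
  have "m \<in> (\<lambda>w. d v w + d w y) ` {w. E v w}" unfolding m_def using finite_nbrs nb by (intro Min_in) auto
  then obtain w where w: "E v w" "m = d v w + d w y" by auto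
  have "m \<le> Inf ?S"
  proof (rule cInf_greatest[OF ne])
    fix l assume "l \<in> ?S"
    then obtain X where X: "l = path_length d X" "X \<in> paths E" "X 0 = v" "X 1 = y" by blast
    obtain w' where w': "E v w'" "d v w' + d w' y \<le> l" using first[OF X(2-4)] X(1) by blast
    have "m \<le> d v w' + d w' y" unfolding m_def using finite_nbrs w' by (intro Min_le) auto
    then show "m \<le> l" using w' by linarith
  qed
  then have "d v w + d w y \<le> d v y" using w d_Inf[of v y] by simp
  then show ?thesis using w d_facts(4)[of v y w] by (intro exI[of _ w]) auto
qed

text \<open>A state other than \<open>x\<close> has a neighbour on the way to \<open>x\<close> that
  is closer by at least 1, so, apart from \<open>x\<close>, a ball consists of neighbours of the
  ball whose radius is smaller by 1.\<close>

lemma finite_dist_ball: "finite {v. d v x \<le> real n}"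
proof (induction n)
  case 0
  have "{v. d v x \<le> real 0} \<subseteq> {x}"
  proof
    fix v assume "v \<in> {v. d v x \<le> real 0}"
    then have "d v x = 0" using d_facts(1)[of v x] by simp
    then show "v \<in> {x}" using d_facts(3)[of v x] by simp
  qed
  then show ?case by (rule finite_subset) simp
next
  case (Suc n)
  have "{v. d v x \<le> real (Suc n)} \<subseteq> insert x (\<Union>w\<in>{v. d v x \<le> real n}. {v. E w v})"
  proof
    fix v assume v: "v \<in> {v. d v x \<le> real (Suc n)}"
    show "v \<in> insert x (\<Union>w\<in>{v. d v x \<le> real n}. {v. E w v})"
    proof (cases "v = x")
      case False
      then obtain w where w: "E v w" "d v w + d w x = d v x" using exists_towards by blast
      have "v \<noteq> w" using w irrefl by auto
      then have "1 \<le> d v w" by (rule d_ge_1)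
      then have "d w x \<le> real n" using w v by simp
      then show ?thesis using sym[OF w(1)] by blast
    qed simp
  qed
  then show ?case by (rule finite_subset) (use Suc finite_nbrs in auto)
qed

lemma pos: "t \<in> {0..1} \<Longrightarrow> 0 < measure Q (at_time E t v)"
  by (rule at_time_pos[OF init_pos])

section \<open>Backward equation and positivity of the geodesic weights\<close>

sublocale G: walk_functional E j C Q "towards y" "kernel_mass j" for y
proof
  show "(\<lambda>r. kernel_mass j r x) \<in> borel_measurable borel" for x by (rule kernel_mass_measurable)
qed (use kernel_mass_bounds in \<open>auto simp: towards_def\<close>)

lemma gen_eq: "G.gen y r f v = (\<Sum>w | E v w. towards y v w * f w * j r v w)"
  by (simp add: G.gen_def)

text \<open>The weight \<open>g^y_t(z)\<close> in terms of the semigroup;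
  \<open>geodesic_weight_eq\<close> identifies it with the explicit formula.\<close>

definition g :: "'a \<Rightarrow> real \<Rightarrow> 'a \<Rightarrow> real" where
  "g y t z = G.U y t 1 (indicator {y}) z"

lemma ind_bound: "\<bar>indicator {y} x :: real\<bar> \<le> 1" by (simp add: indicator_def)

lemma g_bound: "t \<in> {0..1} \<Longrightarrow> \<bar>g y t z\<bar> \<le> exp C"
  unfolding g_def using G.U_bound[of t 1 "indicator {y}" 1 y z] ind_bound by auto

lemma g_1: "g y 1 z = indicator {y} z"
  unfolding g_def by (rule G.U_same) (use pos in auto)

lemma g_split: "0 \<le> s \<Longrightarrow> s \<le> t \<Longrightarrow> t \<le> 1 \<Longrightarrow> g y s z = G.U y s t (g y t) z"
  unfolding g_def[abs_def] by (rule G.U_split[where B = 1]) (auto simp: indicator_def)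

lemma g_nonneg: "t \<in> {0..1} \<Longrightarrow> 0 \<le> g y t z"
proof -
  assume t: "t \<in> {0..1}"
  have "0 \<le> (LINT X:at_time E t z|Q. G.M y t 1 X * indicator {y} (X 1))"
    unfolding set_lebesgue_integral_def
    by (intro integral_nonneg_AE AE_I2) (use t G.mult_bounds(1)[of t 1] in \<open>auto simp: indicator_def\<close>)
  then show ?thesis unfolding g_def G.U_def cexp_def by (intro divide_nonneg_nonneg) auto
qed

text \<open>Lipschitz constant of \<open>g\<close> in time: \<open>U_lipschitz\<close> with
  \<open>exp C\<close> as the bound of \<open>g\<close>.\<close>

definition L :: real where "L = (2 * C + walk_functional.K C) * exp C"

lemma Kc: "walk_functional.K C = C\<^sup>2 * (3 * exp C + C + 6)" "0 \<le> walk_functional.K C"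
  using G.K_def G.K_nonneg by auto

lemma L_nonneg: "0 \<le> L" using Kc C_nonneg by (simp add: L_def)

lemma g_lipschitz:
  assumes "s \<in> {0..1}" "t \<in> {0..1}" shows "\<bar>g y s v - g y t v\<bar> \<le> L * \<bar>s - t\<bar>"
proof -
  have *: "\<bar>g y s v - g y t v\<bar> \<le> L * (t - s)" if st: "0 \<le> s" "s \<le> t" "t \<le> 1" for s t
    using G.U_lipschitz[OF st, of "g y t" "exp C" v y] g_bound[of t y] pos[of s v] st
    by (simp add: g_split[OF st] L_def)
  show ?thesis using *[of s t] *[of t s] assms by (cases "s \<le> t") (auto simp: abs_minus_commute)
qed

lemma lipschitz_measurable:
  fixes h :: "real \<Rightarrow> real"
  assumes "\<And>r r'. r \<in> {s..t} \<Longrightarrow> r' \<in> {s..t} \<Longrightarrow> \<bar>h r - h r'\<bar> \<le> k * \<bar>r - r'\<bar>" "0 \<le> k"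
  shows "(\<lambda>r. indicator {s..t} r * h r) \<in> borel_measurable borel"
proof -
  have "k-lipschitz_on {s..t} h" using assms by (intro lipschitz_onI) (auto simp: dist_real_def)
  then have "continuous_on {s..t} h" by (rule lipschitz_on_continuous_on)
  then show ?thesis using borel_measurable_continuous_on_indicator[of "{s..t}" h] by simp
qed

lemma g_measurable: "(\<lambda>r. indicator {0..1} r * g y r v) \<in> borel_measurable borel"
  using g_lipschitz L_nonneg by (intro lipschitz_measurable) auto

lemma g_flux_integrable:
  assumes "0 \<le> s" "s \<le> t" "t \<le> 1"
  shows "set_integrable lborel {s..t} (\<lambda>r. G.gen y r (g y r) v)"
  unfolding set_integrable_def
proof (rule integrableI_bounded_set[where A = "{s..t}" and B = "2 * exp C * C"])
  have *: "(\<lambda>r. indicator {s..t} r *\<^sub>R G.gen y r (g y r) v) =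
    (\<lambda>r. indicator {s..t} r * (\<Sum>w | E v w. towards y v w * (indicator {0..1} r * g y r w) * j r v w))"
    using assms by (auto simp: fun_eq_iff gen_eq indicator_def)
  show "(\<lambda>r. indicator {s..t} r *\<^sub>R G.gen y r (g y r) v) \<in> borel_measurable lborel"
    unfolding * using g_measurable j_meas by measurable
  show "AE r in lborel. r \<in> {s..t} \<longrightarrow> norm (indicator {s..t} r *\<^sub>R G.gen y r (g y r) v) \<le> 2 * exp C * C"
    using G.gen_bound[of "g y _" "exp C"] g_bound[of _ y] assms by (intro AE_I2) (auto simp: indicator_def)
qed (use assms in auto)

text \<open>The Kolmogorov backward equation in integrated form. The defect \<open>D\<close> is
  additive; on a short interval it is of second order, by the short-time expansion with
  \<open>g\<close> frozen at the right end and by the Lipschitz bound that unfreezes it.\<close>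

lemma g_backward:
  assumes st: "0 \<le> s" "s \<le> t" "t \<le> 1"
  shows "g y s v = g y t v + (LINT r:{s..t}|lborel. G.gen y r (g y r) v)"
proof -
  define D where "D s t = g y s v - g y t v - (LINT r:{s..t}|lborel. G.gen y r (g y r) v)" for s t
  have "D s t = 0"
  proof (rule additive_zero[OF st(2)])
    show "D r w = D r u + D u w" if "s \<le> r" "r \<le> u" "u \<le> w" "w \<le> t" for r u w
      unfolding D_def using set_integral_Icc_split[OF that(2,3) g_flux_integrable[of r w y v]] that st by simp
    fix r u assume ru: "s \<le> r" "r \<le> u" "u \<le> t"
    have ru': "0 \<le> r" "r \<le> u" "u \<le> 1" using ru st by auto
    have gb: "\<bar>g y u x\<bar> \<le> exp C" for x using g_bound[of u] ru' by auto
    have 1: "\<bar>g y r v - g y u v - (LINT q:{r..u}|lborel. G.gen y q (g y u) v)\<bar> \<le> walk_functional.K C * exp C * (u - r)\<^sup>2"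
      using G.U_short[OF ru', of "g y u" "exp C" v y] gb pos[of r v] ru' by (simp add: g_split[OF ru'])
    have 2: "\<bar>(LINT q:{r..u}|lborel. G.gen y q (g y u) v) - (LINT q:{r..u}|lborel. G.gen y q (g y q) v)\<bar> \<le> L * C * (u - r)\<^sup>2"
    proof -
      have i: "set_integrable lborel {r..u} (\<lambda>q. G.gen y q (g y u) v)"
        using G.gen_measurable[of y "g y u" v] G.gen_bound[of "g y u" "exp C" y _ v] gb ru'
        by (intro set_integrable_bounded[where B = "2 * exp C * C"]) auto
      have "\<bar>LINT q:{r..u}|lborel. G.gen y q (g y u) v - G.gen y q (g y q) v\<bar> \<le> (L * (u - r) * C) * measure lborel {r..u}"
      proof (rule abs_set_integral_le)
        fix q assume q: "q \<in> {r..u}"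
        have "G.gen y q (g y u) v - G.gen y q (g y q) v = (\<Sum>w | E v w. (towards y v w * (g y u w - g y q w)) * j q v w)"
          by (simp add: gen_eq sum_subtractf[symmetric] algebra_simps)
        also have "\<bar>\<dots>\<bar> \<le> (L * (u - r)) * C"
        proof (rule weighted_rates_bound)
          fix w
          have "\<bar>g y u w - g y q w\<bar> \<le> L * \<bar>u - q\<bar>" using q ru' by (intro g_lipschitz) auto
          also have "\<dots> \<le> L * (u - r)" using q L_nonneg by (intro mult_left_mono) auto
          finally show "\<bar>towards y v w * (g y u w - g y q w)\<bar> \<le> L * (u - r)"
            using L_nonneg ru' by (auto simp: towards_def)
        qed (use L_nonneg ru' in auto)
        finally show "\<bar>G.gen y q (g y u) v - G.gen y q (g y q) v\<bar> \<le> L * (u - r) * C" .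
      qed (use L_nonneg C_nonneg ru' in auto)
      then show ?thesis using set_integral_diff(2)[OF i g_flux_integrable[OF ru']] ru' by (simp add: power2_eq_square mult_ac)
    qed
    show "\<bar>D r u\<bar> \<le> (walk_functional.K C * exp C + L * C) * (u - r)\<^sup>2"
      unfolding D_def using 1 2 by (simp add: algebra_simps)
  qed
  then show ?thesis by (simp add: D_def)
qed

lemma flux_nonneg: "r \<in> {0..1} \<Longrightarrow> 0 \<le> G.gen y r (g y r) v"
  unfolding gen_eq using g_nonneg j_nonneg by (intro sum_nonneg) (auto simp: towards_def)

text \<open>Induction on the integer part of \<open>d v y\<close>. A neighbour on the way to
  \<open>y\<close> is closer by at least 1, so its weight is positive before time 1 and contributes
  a positive term to the backward equation at \<open>v\<close>; at \<open>y\<close> itself the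
  terminal value is 1.\<close>

lemma g_pos:
  assumes t: "0 \<le> t" "t < 1" shows "0 < g y t v"
  using t
proof (induction "nat \<lfloor>d v y\<rfloor>" arbitrary: v t rule: less_induct)
  case less
  have flux: "0 \<le> (LINT r:{t..1}|lborel. G.gen y r (g y r) v)"
    unfolding set_lebesgue_integral_def using flux_nonneg less.prems by (intro integral_nonneg_AE AE_I2) (auto simp: indicator_def)
  have eq: "g y t v = indicator {y} v + (LINT r:{t..1}|lborel. G.gen y r (g y r) v)"
    using g_backward[of t 1 y v] less.prems by (simp add: g_1)
  show ?case
  proof (cases "v = y")
    case True then show ?thesis using eq flux by simp
  next
    case False
    then obtain w where w: "E v w" "d v w + d w y = d v y" using exists_towards by blast
    have "v \<noteq> w" using w irrefl by auto
    then have "1 \<le> d v w" by (rule d_ge_1)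
    then have "nat \<lfloor>d w y\<rfloor> < nat \<lfloor>d v y\<rfloor>" using w d_facts(1)[of w y] by linarith
    then have IH: "0 < g y r w" if "0 \<le> r" "r < 1" for r using less.hyps that by blast
    have "0 < (LINT r:{t..1}|lborel. G.gen y r (g y r) v)"
    proof (rule set_integral_pos[OF less.prems(2) g_flux_integrable])
      fix r assume r: "t \<le> r" "r < 1"
      have "0 < towards y v w * g y r w * j r v w"
        using IH[of r] j_pos[of r v w] w r less.prems by (simp add: towards_def)
      also have "\<dots> \<le> G.gen y r (g y r) v" unfolding gen_eq
        using g_nonneg j_nonneg r less.prems finite_nbrs w
        by (intro member_le_sum) (auto simp: towards_def)
      finally show "0 < G.gen y r (g y r) v" .
    qed (use less.prems flux_nonneg in auto)
    then show ?thesis using eq by (simp add: False)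
  qed
qed

end

context walk_functional
begin

lemma U_scale: "U s t (\<lambda>x. k * f x) v = k * U s t f v"
  unfolding U_def cexp_def set_lebesgue_integral_def
  by (simp add: mult.left_commute[of _ k])

end

context geodesic_walk
begin

lemma towards_01: "towards y v w = 0 \<or> towards y v w = 1" "0 \<le> towards y v w" "towards y v w \<le> 1"
  by (auto simp: towards_def)

subsection \<open>The weights and successors in the explicit kernel\<close>

text \<open>From left to right only the jumps after \<open>t\<close> are compared, and they are
  those of the geodesic. From right to left the path is made constant before \<open>t\<close>, which
  removes all other jumps.\<close>

lemma geodesic_from_iff:
  assumes X: "X \<in> paths E" and t: "t \<in> {0..1}"
  shows "X \<in> geodesic_from E d t z y \<longleftrightarrow> X t = z \<and> X 1 = y \<and> jump_prod (towards y) t 1 X = 1"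
proof
  assume "X \<in> geodesic_from E d t z y"
  then obtain \<gamma> where \<gamma>: "\<gamma> \<in> geodesics E d" "\<And>s. s \<in> {t..1} \<Longrightarrow> X s = \<gamma> s" and e: "X t = z" "X 1 = y"
    by (auto simp: geodesic_from_def)
  have \<gamma>E: "\<gamma> \<in> paths E" using \<gamma>(1) by (auto simp: geodesics_def geodesics_between_def)
  have ll: "left_lim X r = left_lim \<gamma> r" if "t < r" "r \<le> 1" for r
  proof (rule left_lim_eqI)
    have "\<forall>\<^sub>F s in at_left r. s \<in> {t<..<r}" using that by (intro eventually_at_left_real) auto
    moreover have "\<forall>\<^sub>F s in at_left r. \<gamma> s = left_lim \<gamma> r" using left_lim_eventually[OF \<gamma>E, of r] that t by auto
    ultimately show "\<forall>\<^sub>F s in at_left r. X s = left_lim \<gamma> r"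
      by eventually_elim (use \<gamma>(2) that in auto)
  qed
  have "jumps X t 1 = jumps \<gamma> t 1" using ll \<gamma>(2) t by (auto simp: jumps_def jump_times_def)
  then have "jump_prod (towards y) t 1 X = jump_prod (towards y) t 1 \<gamma>"
    unfolding jump_prod_def using ll \<gamma>(2) by (intro prod.cong) (auto simp: jumps_def)
  moreover have "jump_prod (towards y) 0 1 \<gamma> = 1"
    using geodesic_iff[OF \<gamma>E] \<gamma> e t by auto
  then have "jump_prod (towards y) t 1 \<gamma> = 1"
    using t by (auto simp: jump_prod_towards[OF \<gamma>E] jumps_def)
  ultimately show "X t = z \<and> X 1 = y \<and> jump_prod (towards y) t 1 X = 1" using e by simp
next
  assume a: "X t = z \<and> X 1 = y \<and> jump_prod (towards y) t 1 X = 1"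
  have t': "0 \<le> t" "t \<le> 1" using t by auto
  note pc = prefix_const[OF X t', of z]
  have z: "z = X t \<or> 0 < t \<and> t < 1 \<and> z \<noteq> X t \<and> E z (X t)" using a by simp
  let ?\<gamma> = "prefix_const z t X"
  have J: "jump_times ?\<gamma> = jumps X t 1" using pc(2)[OF z] a by simp
  have "jump_prod (towards (?\<gamma> 1)) 0 1 ?\<gamma> = jump_prod (towards y) t 1 X"
    unfolding jump_prod_def jumps_01 J
    using pc(3)[OF z] pc(4)[OF z] a t by (intro prod.cong) (auto simp: jumps_def)
  then have "?\<gamma> \<in> geodesics E d" using geodesic_iff[OF pc(1)[OF z]] a by simp
  then show "X \<in> geodesic_from E d t z y"
    unfolding geodesic_from_def using pc(3)[OF z] a X by (auto intro!: bexI[of _ ?\<gamma>])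
qed

lemma geodesic_weight_eq:
  assumes t: "t \<in> {0..1}"
  shows "geodesic_weight E d j Q y t z = g y t z"
proof -
  define H where "H = (\<lambda>X. G.M y t 1 X * indicator {y} (X 1))"
  have Hm: "H \<in> borel_measurable Q" unfolding H_def
    by (rule measurable_Q[OF G.Mf_measurable]) (use t in auto)
  have at: "at_time E t z \<in> sets Q" using at_time_Q t by auto
  have "geodesic_weight E d j Q y t z =
    (\<integral>X. indicator (at_time E t z) X * H X \<partial>uniform_measure Q (at_time E t z))"
    unfolding geodesic_weight_def
  proof (rule Bochner_Integration.integral_cong[OF refl])
    fix X assume "X \<in> space (uniform_measure Q (at_time E t z))"
    then have X: "X \<in> paths E" by simp
    have "jump_prod (towards y) t 1 X = 0 \<or> jump_prod (towards y) t 1 X = 1"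
      unfolding jump_prod_towards[OF X] of_bool_def by meson
    then show "exp (LINT s:{t..1}|lborel. kernel_mass j s (X s)) * indicator (geodesic_from E d t z y) X =
      indicator (at_time E t z) X * H X"
      using geodesic_from_iff[OF X t, of z y] X by (auto simp: H_def mult_def expo_def indicator_def)
  qed
  also have "\<dots> = cexp E Q t z (\<lambda>X. indicator (at_time E t z) X * H X)"
    by (rule cexp_eq_uniform[symmetric, OF t]) (use pos[OF t, of z] measure_pos_iff[OF t] Hm at in auto)
  also have "\<dots> = g y t z" unfolding g_def G.U_def cexp_def H_def
    by (intro arg_cong2[where f = "(/)"] set_lebesgue_integral_cong at) auto
  finally show ?thesis .
qed

text \<open>For the forward direction the length of a geodesic through \<open>z\<close> and then
  \<open>w\<close> is split at the two visits, and the triangle inequality leaves no room.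
  Conversely the edge is prepended at time 1/2 to a path from \<open>w\<close> that moves towards
  \<open>y\<close>.\<close>

lemma geodesic_succs_iff: "w \<in> geodesic_succs E d y z \<longleftrightarrow> E z w \<and> d z w + d w y = d z y"
proof
  assume "w \<in> geodesic_succs E d y z"
  then obtain \<gamma> t t' where E: "E z w" and \<gamma>: "\<gamma> \<in> geodesics_between E d z y" "0 \<le> t" "t < t'" "t' \<le> 1" "\<gamma> t = z" "\<gamma> t' = w"
    by (auto simp: geodesic_succs_def geodesic_step_def)
  have \<gamma>E: "\<gamma> \<in> paths E" and len: "path_length d \<gamma> = d z y" and \<gamma>1: "\<gamma> 1 = y" using \<gamma>(1) by (auto simp: geodesics_between_def)
  let ?S = "\<lambda>s t. \<Sum>r\<in>jumps \<gamma> s t. d (left_lim \<gamma> r) (\<gamma> r)"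
  have "?S 0 1 = ?S 0 t + ?S t 1" "?S t 1 = ?S t t' + ?S t' 1"
    by (rule sum_jumps_split[OF \<gamma>E]; use \<gamma> in simp)+
  then have "d z y = ?S 0 t + ?S t t' + ?S t' 1"
    using len by (simp add: path_length_def jumps_01)
  moreover have "0 \<le> ?S 0 t" using d_facts(1) by (rule sum_nonneg)
  moreover have "d z w \<le> ?S t t'" "d w y \<le> ?S t' 1"
    using dist_le_length[OF \<gamma>E, of t t'] dist_le_length[OF \<gamma>E, of t' 1] \<gamma> \<gamma>1 by auto
  ultimately show "E z w \<and> d z w + d w y = d z y" using E d_facts(4)[of z y w] by linarith
next
  assume a: "E z w \<and> d z w + d w y = d z y"
  \<comment> \<open>Such a path exists because \<open>g\<close> is positive at time 1/2, so that the
    integrand defining it is not identically 0.\<close>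
  have "\<exists>X\<in>at_time E (1/2) w. G.M y (1/2) 1 X * indicator {y} (X 1) \<noteq> 0"
  proof (rule ccontr)
    assume n: "\<not> ?thesis"
    have "(LINT X:at_time E (1/2) w|Q. G.M y (1/2) 1 X * indicator {y} (X 1)) = (LINT X:at_time E (1/2) w|Q. 0)"
      by (rule set_lebesgue_integral_cong) (use n at_time_Q[of "1/2"] in auto)
    then have "g y (1/2) w = 0" unfolding g_def G.U_def cexp_def by simp
    then show False using g_pos[of "1/2" y w] by simp
  qed
  then obtain X where X: "X \<in> paths E" "X (1/2) = w" "G.M y (1/2) 1 X \<noteq> 0" "X 1 = y" by (auto simp: indicator_def split: if_splits)
  have jp: "\<forall>r\<in>jumps X (1/2) 1. d (left_lim X r) (X r) + d (X r) y = d (left_lim X r) y"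
    using X(3) by (auto simp: mult_def jump_prod_towards[OF X(1)])
  have zw: "z \<noteq> w" using a irrefl by auto
  have z: "z = X (1/2) \<or> 0 < (1/2::real) \<and> (1/2::real) < 1 \<and> z \<noteq> X (1/2) \<and> E z (X (1/2))" using a X zw by simp
  have half: "0 \<le> (1/2::real)" "(1/2::real) \<le> 1" by auto
  note pc = prefix_const[OF X(1) half z]
  let ?\<gamma> = "prefix_const z (1/2) X"
  have v: "?\<gamma> 0 = z" "?\<gamma> 1 = y" "?\<gamma> (1/2) = w" using pc(6) pc(3)[of 1] pc(3)[of "1/2"] X by auto
  have J: "jumps ?\<gamma> 0 1 = insert (1/2) (jumps X (1/2) 1)" unfolding jumps_01 pc(2) using X zw by auto
  have "\<forall>r\<in>jumps ?\<gamma> 0 1. d (left_lim ?\<gamma> r) (?\<gamma> r) + d (?\<gamma> r) y = d (left_lim ?\<gamma> r) y"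
  proof
    fix r assume "r \<in> jumps ?\<gamma> 0 1"
    then consider "r = 1/2" | "r \<in> jumps X (1/2) 1" unfolding J by auto
    then show "d (left_lim ?\<gamma> r) (?\<gamma> r) + d (?\<gamma> r) y = d (left_lim ?\<gamma> r) y"
    proof cases
      case 1 show ?thesis unfolding 1 using pc(5) v a by simp
    next
      case 2
      then have "r \<in> {1/2<..1}" by (auto simp: jumps_def)
      then show ?thesis using pc(3)[of r] pc(4)[of r] jp 2 by auto
    qed
  qed
  then have "path_length d ?\<gamma> = d z y"
    using length_towards_iff[OF pc(1), of 0 1 y] v by (simp add: path_length_def jumps_01)
  then have geo: "?\<gamma> \<in> geodesics_between E d z y" using pc(1) v by (simp add: geodesics_between_def)
  have "w \<in> geodesic_states E d z y" unfolding geodesic_states_def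
    using geo v by (intro CollectI exI[of _ ?\<gamma>] exI[of _ "1/2"]) auto
  moreover have "geodesic_step E d z y z w" unfolding geodesic_step_def
    using geo v a by (intro conjI bexI[of _ ?\<gamma>] exI[of _ 0] exI[of _ "1/2"]) auto
  ultimately show "w \<in> geodesic_succs E d y z" by (simp add: geodesic_succs_def)
qed

lemma geodesic_kernel_eq:
  assumes "t \<in> {0..1}"
  shows "geodesic_kernel E d j Q y t z w = towards y z w * g y t w * j t z w / g y t z"
  using j_supp[of z w t]
  by (auto simp: geodesic_kernel_def geodesic_succs_iff geodesic_weight_eq[OF assms] towards_def)

subsection \<open>Dynkin's formula\<close>

text \<open>The forward factor in the laws of the bridges to \<open>y\<close>: a function of the
  state at time \<open>q\<close>, integrated over the event \<open>A\<close> under the functional up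
  to \<open>q\<close>.\<close>

definition V :: "'a \<Rightarrow> (real \<Rightarrow> 'a) set \<Rightarrow> real \<Rightarrow> ('a \<Rightarrow> real) \<Rightarrow> real" where
  "V y A q f = (LINT X:A|Q. G.M y 0 q X * f (X q))"

text \<open>Contains every state from which a step can change \<open>u\<close>. This set is finite
  for finitely supported \<open>u\<close>, which makes the sums over states finite.\<close>

definition flux_states :: "('a \<Rightarrow> real) \<Rightarrow> 'a set" where
  "flux_states u = {v. u v \<noteq> 0} \<union> (\<Union>w\<in>{w. u w \<noteq> 0}. {v. E w v})"

lemma finite_flux_states: "finite {x. u x \<noteq> 0} \<Longrightarrow> finite (flux_states u)"
  unfolding flux_states_def using finite_nbrs by auto

lemma no_flux: "v \<notin> flux_states u \<Longrightarrow> E v w \<Longrightarrow> u w - u v = 0"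
  unfolding flux_states_def using sym by auto

lemma V_lipschitz:
  assumes A: "A \<in> sets (path_events E {0..s})" "emeasure Q A < \<infinity>" and r: "r \<in> {s..1}" "r' \<in> {s..1}" "0 \<le> s"
    and f: "\<And>x. \<bar>f x\<bar> \<le> 1"
  shows "\<bar>V y A r f - V y A r' f\<bar> \<le> L * measure Q A * \<bar>r - r'\<bar>"
proof -
  have AQ: "A \<in> sets Q" using sets_QI[OF A(1)] r by auto
  have A_sub: "A \<subseteq> paths E" using sets.sets_into_space[OF AQ] by simp
  have *: "\<bar>V y A r' f - V y A r f\<bar> \<le> L * measure Q A * (r' - r)" if rr: "s \<le> r" "r \<le> r'" "r' \<le> 1" for r r'
  proof -
    have Ar: "A \<in> sets (path_events E {0..r})" using A(1) path_events_mono[of "{0..s}" "{0..r}" E] rr by auto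
    have "V y A r' f = V y A r (G.U y r r' f)" unfolding V_def
      by (rule G.tower_M[OF _ _ _ _ Ar A(2) f]) (use rr r in auto)
    moreover have "V y A r (G.U y r r' f) - V y A r f = (LINT X:A|Q. G.M y 0 r X * (G.U y r r' f (X r) - f (X r)))"
    proof -
      have "set_integrable Q A (\<lambda>X. G.M y 0 r X * G.U y r r' f (X r))"
        by (rule G.Mf_integrable[OF _ _ _ _ AQ A(2), where B = "exp C * 1"]) (use rr r G.U_bound[OF _ _ _ f, of r r'] in auto)
      moreover have "set_integrable Q A (\<lambda>X. G.M y 0 r X * f (X r))"
        by (rule G.Mf_integrable[OF _ _ _ f AQ A(2)]) (use rr r in auto)
      ultimately show ?thesis unfolding V_def by (simp add: right_diff_distrib set_integral_diff)
    qed
    moreover have "\<bar>LINT X:A|Q. G.M y 0 r X * (G.U y r r' f (X r) - f (X r))\<bar> \<le> (exp C * ((2 * C + walk_functional.K C) * 1 * (r' - r))) * measure Q A"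
    proof (rule abs_set_integral_le[OF AQ A(2)])
      fix X assume X: "X \<in> A"
      show "\<bar>G.M y 0 r X * (G.U y r r' f (X r) - f (X r))\<bar> \<le> exp C * ((2 * C + walk_functional.K C) * 1 * (r' - r))"
        unfolding abs_mult
      proof (rule mult_mono)
        show "\<bar>G.M y 0 r X\<bar> \<le> exp C" using G.abs_mult_bound[of 0 r X] X A_sub rr r by auto
        show "\<bar>G.U y r r' f (X r) - f (X r)\<bar> \<le> (2 * C + walk_functional.K C) * 1 * (r' - r)"
          by (rule G.U_lipschitz[OF _ _ _ f pos]) (use rr r in auto)
      qed auto
    qed (use Kc(2) C_nonneg rr in auto)
    ultimately show ?thesis by (simp add: L_def mult_ac)
  qed
  show ?thesis using *[of r r'] *[of r' r] r by (cases "r \<le> r'") (auto simp: abs_minus_commute)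
qed

lemma V_bound:
  assumes A: "A \<in> sets Q" "emeasure Q A < \<infinity>" and q: "q \<in> {0..1}" and f: "\<And>x. \<bar>f x\<bar> \<le> B"
  shows "\<bar>V y A q f\<bar> \<le> exp C * B * measure Q A"
  unfolding V_def
proof (rule abs_set_integral_le[OF A])
  have "0 \<le> B" using f[of undefined] by linarith
  then show "0 \<le> exp C * B" by simp
  show "\<bar>G.M y 0 q X * f (X q)\<bar> \<le> exp C * B" if "X \<in> A" for X
    using G.Mf_bound[where f = f and X = X, OF _ _ _ f] sets.sets_into_space[OF A(1)] that q by auto
qed

lemma V_nonneg:
  assumes A: "A \<in> sets Q" and q: "q \<in> {0..1}" and f: "\<And>x. 0 \<le> f x"
  shows "0 \<le> V y A q f"
  unfolding V_def set_lebesgue_integral_def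
  using f q G.mult_bounds(1)[of 0 q] sets.sets_into_space[OF A]
  by (intro integral_nonneg_AE AE_I2) (auto simp: indicator_def)

lemma V_finite_sum:
  assumes A: "A \<in> sets Q" "emeasure Q A < \<infinity>" and q: "q \<in> {0..1}" and S: "finite S" "\<And>x. x \<notin> S \<Longrightarrow> f x = 0"
  shows "V y A q f = (\<Sum>v\<in>S. V y A q (indicator {v}) * f v)"
proof -
  have f: "f x = (\<Sum>v\<in>S. f v * indicator {v} x)" for x
  proof -
    have "(\<Sum>v\<in>S. f v * indicator {v} x) = (\<Sum>v\<in>S. if x = v then f x else 0)"
      by (intro sum.cong) auto
    also have "\<dots> = f x" using S by simp
    finally show ?thesis ..
  qed
  have "G.M y 0 q X * f (X q) = (\<Sum>v\<in>S. (G.M y 0 q X * indicator {v} (X q)) * f v)" for X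
    unfolding f[of "X q"] sum_distrib_left by (intro sum.cong) auto
  then have "V y A q f = (LINT X:A|Q. \<Sum>v\<in>S. (G.M y 0 q X * indicator {v} (X q)) * f v)"
    unfolding V_def by simp
  also have "\<dots> = (\<Sum>v\<in>S. LINT X:A|Q. (G.M y 0 q X * indicator {v} (X q)) * f v)"
  proof -
    have "set_integrable Q A (\<lambda>X. (G.M y 0 q X * indicator {v} (X q)) * f v)" for v
      using G.Mf_integrable[of 0 q "indicator {v}" 1 A y] A q ind_bound by auto
    then show ?thesis unfolding set_integrable_def set_lebesgue_integral_def by (simp add: sum_distrib_left)
  qed
  also have "\<dots> = (\<Sum>v\<in>S. V y A q (indicator {v}) * f v)" unfolding V_def by simp
  finally show ?thesis .
qed

text \<open>This is \<open>g y q v\<close> times the generator of the Doob transform, applied to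
  \<open>u\<close>. Keeping the factor avoids the division by \<open>g\<close>, which degenerates at
  time 1.\<close>

definition gain :: "'a \<Rightarrow> ('a \<Rightarrow> real) \<Rightarrow> real \<Rightarrow> 'a \<Rightarrow> real" where
  "gain y u q v = G.gen y q (\<lambda>w. (u w - u v) * g y q w) v"

lemma gain_off: "v \<notin> flux_states u \<Longrightarrow> gain y u q v = 0"
  unfolding gain_def gen_eq by (intro sum.neutral) (auto simp: no_flux)

lemma gain_bound:
  assumes "\<And>x. \<bar>u x\<bar> \<le> B" "q \<in> {0..1}" shows "\<bar>gain y u q v\<bar> \<le> 2 * (2 * B * exp C) * C"
  unfolding gain_def
proof (rule G.gen_bound)
  show "\<bar>(u w - u v) * g y q w\<bar> \<le> 2 * B * exp C" for w
    unfolding abs_mult using assms(1)[of v] assms(1)[of w] g_bound[OF assms(2), of y w] by (intro mult_mono) auto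
qed

lemma gain_measurable: "(\<lambda>q. indicator {0..1} q * gain y u q v) \<in> borel_measurable borel"
proof -
  have *: "(\<lambda>q. indicator {0..1} q * gain y u q v) =
    (\<lambda>q. \<Sum>w | E v w. towards y v w * ((u w - u v) * (indicator {0..1} q * g y q w)) * j q v w)"
    by (auto simp: gain_def gen_eq fun_eq_iff sum_distrib_left indicator_def)
  show ?thesis unfolding * using g_measurable j_meas by measurable
qed

lemma gain_integrable:
  assumes u: "\<And>x. \<bar>u x\<bar> \<le> B" and "0 \<le> s" "s \<le> t" "t \<le> 1"
  shows "set_integrable lborel {s..t} (\<lambda>q. gain y u q v)"
  unfolding set_integrable_def
proof (rule integrableI_bounded_set[where A = "{s..t}" and B = "2 * (2 * B * exp C) * C"])
  have "(\<lambda>q. indicator {s..t} q *\<^sub>R gain y u q v) = (\<lambda>q. indicator {s..t} q * (indicator {0..1} q * gain y u q v))"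
    using assms by (auto simp: fun_eq_iff indicator_def)
  then show "(\<lambda>q. indicator {s..t} q *\<^sub>R gain y u q v) \<in> borel_measurable lborel"
    using gain_measurable[of y u v] by simp
  show "AE q in lborel. q \<in> {s..t} \<longrightarrow> norm (indicator {s..t} q *\<^sub>R gain y u q v) \<le> 2 * (2 * B * exp C) * C"
    using gain_bound[where u = u, OF u] assms by (intro AE_I2) (auto simp: indicator_def)
qed (use assms in auto)

lemma V_measurable:
  assumes A: "A \<in> sets (path_events E {0..s})" "emeasure Q A < \<infinity>" and s: "0 \<le> s"
  shows "(\<lambda>q. indicator {s..1} q * V y A q (indicator {v})) \<in> borel_measurable borel"
  by (rule lipschitz_measurable[OF V_lipschitz[OF A]]) (use s ind_bound L_nonneg in auto)

lemma V_gain_integrable: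
  assumes A: "A \<in> sets (path_events E {0..s})" "emeasure Q A < \<infinity>" and u: "\<And>x. \<bar>u x\<bar> \<le> B"
    and st: "0 \<le> s" "s \<le> r" "r \<le> t" "t \<le> 1"
  shows "set_integrable lborel {r..t} (\<lambda>q. V y A q (indicator {v}) * gain y u q v)"
  unfolding set_integrable_def
proof (rule integrableI_bounded_set[where A = "{r..t}" and B = "(exp C * 1 * measure Q A) * (2 * (2 * B * exp C) * C)"])
  have "(\<lambda>q. indicator {r..t} q *\<^sub>R (V y A q (indicator {v}) * gain y u q v)) =
    (\<lambda>q. indicator {r..t} q * ((indicator {s..1} q * V y A q (indicator {v})) * (indicator {0..1} q * gain y u q v)))"
    using st by (auto simp: fun_eq_iff indicator_def)
  then show "(\<lambda>q. indicator {r..t} q *\<^sub>R (V y A q (indicator {v}) * gain y u q v)) \<in> borel_measurable lborel"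
    using gain_measurable[of y u v] V_measurable[OF A st(1), of y v] by simp
  have AQ: "A \<in> sets Q" using sets_QI[OF A(1)] st by auto
  have "\<bar>V y A q (indicator {v}) * gain y u q v\<bar> \<le> (exp C * 1 * measure Q A) * (2 * (2 * B * exp C) * C)" if "q \<in> {r..t}" for q
    unfolding abs_mult using V_bound[OF AQ A(2), of q "indicator {v}" 1 y] gain_bound[where u = u and q = q and y = y and v = v, OF u] that st ind_bound
    by (intro mult_mono) auto
  then show "AE q in lborel. q \<in> {r..t} \<longrightarrow> norm (indicator {r..t} q *\<^sub>R (V y A q (indicator {v}) * gain y u q v)) \<le> (exp C * 1 * measure Q A) * (2 * (2 * B * exp C) * C)"
    by (intro AE_I2) auto
qed (use st in auto)

text \<open>Under the bridge to \<open>y\<close>, the expectation of \<open>u (X t)\<close> is that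
  of \<open>u * g y t\<close> under the functional, up to normalisation; so this is Dynkin's formula
  for the Doob transform. The defect is additive in time and is shown to be of second order.\<close>

lemma dynkin:
  assumes A: "A \<in> sets (path_events E {0..s})" "emeasure Q A < \<infinity>" and st: "0 \<le> s" "s \<le> t" "t \<le> 1"
    and fin: "finite {x. u x \<noteq> 0}"
  shows "V y A t (\<lambda>x. u x * g y t x) - V y A s (\<lambda>x. u x * g y s x) =
    (\<Sum>v\<in>flux_states u. LINT q:{s..t}|lborel. V y A q (indicator {v}) * gain y u q v)"
proof -
  define S where "S = flux_states u"
  have S: "finite S" unfolding S_def by (rule finite_flux_states[OF fin])
  define Bu where "Bu = Max (insert 0 ((\<lambda>x. \<bar>u x\<bar>) ` {x. u x \<noteq> 0}))"
  have u: "\<bar>u x\<bar> \<le> Bu" for x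
    unfolding Bu_def using fin by (cases "u x = 0") (auto intro: Max_ge)
  have Bu: "0 \<le> Bu" using u[of undefined] by linarith
  have AQ: "A \<in> sets Q" using sets_QI[OF A(1)] st by auto
  have A_sub: "A \<subseteq> paths E" using sets.sets_into_space[OF AQ] by simp
  let ?K = "walk_functional.K C"
  note Vi = V_gain_integrable[where u = u and A = A and s = s, OF A u st(1)]
  define \<Phi> where "\<Phi> r = V y A r (\<lambda>x. u x * g y r x)" for r
  define D where "D r r' = \<Phi> r' - \<Phi> r - (\<Sum>v\<in>S. LINT q:{r..r'}|lborel. V y A q (indicator {v}) * gain y u q v)" for r r'
  define k1 where "k1 = ?K * (2 * Bu * exp C) + 2 * Bu * L * C"
  define k2 where "k2 = L * measure Q A * (2 * (2 * Bu * exp C) * C)"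
  have "D s t = 0"
  proof (rule additive_zero[OF st(2)])
    fix r m w assume r: "s \<le> r" "r \<le> m" "m \<le> w" "w \<le> t"
    have "(LINT q:{r..w}|lborel. V y A q (indicator {v}) * gain y u q v) =
      (LINT q:{r..m}|lborel. V y A q (indicator {v}) * gain y u q v) + (LINT q:{m..w}|lborel. V y A q (indicator {v}) * gain y u q v)" for v
      by (rule set_integral_Icc_split[OF r(2,3) Vi]) (use r st in auto)
    then show "D r w = D r m + D m w" unfolding D_def by (simp add: sum.distrib)
  next
    fix r r' assume "s \<le> r" "r \<le> r'" "r' \<le> t"
    then have r: "s \<le> r" "0 \<le> r" "r \<le> r'" "r' \<le> 1" and r01: "r \<in> {0..1}" "r' \<in> {0..1}" using st by auto
    define h where "h = r' - r"
    have h: "0 \<le> h" using r by (simp add: h_def)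
    have Ar: "A \<in> sets (path_events E {0..r})" using A(1) path_events_mono[of "{0..s}" "{0..r}" E] r by auto
    define \<xi> where "\<xi> v = G.U y r r' (\<lambda>w. (u w - u v) * g y r' w) v" for v
    define \<Psi> where "\<Psi> v = (LINT q:{r..r'}|lborel. gain y u q v)" for v
    have ugb: "\<bar>u x * g y q x\<bar> \<le> Bu * exp C" if "q \<in> {0..1}" for x q
      unfolding abs_mult using u g_bound[OF that] Bu by (intro mult_mono) auto
    have dgb: "\<bar>(u w - u v) * g y r' w\<bar> \<le> 2 * Bu * exp C" for v w
      unfolding abs_mult using u[of v] u[of w] g_bound[OF r01(2), of y w] by (intro mult_mono) auto
    \<comment> \<open>The weight is propagated exactly from \<open>g y r'\<close> to
      \<open>g y r\<close>. Subtracting \<open>u v\<close> times it leaves the evolution of a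
      function that vanishes at \<open>v\<close>, so the expansion of \<open>\<xi>\<close> has no
      term of order zero.\<close>
    have Xeq: "\<xi> v = G.U y r r' (\<lambda>x. u x * g y r' x) v - u v * g y r v" for v
    proof -
      have "G.U y r r' (\<lambda>x. u x * g y r' x - u v * g y r' x) v = G.U y r r' (\<lambda>x. u x * g y r' x) v - G.U y r r' (\<lambda>x. u v * g y r' x) v"
      proof (rule G.U_diff[OF r(2-4) ugb[OF r01(2)]])
        show "\<bar>u v * g y r' x\<bar> \<le> Bu * exp C" for x
          unfolding abs_mult using u[of v] g_bound[OF r01(2)] Bu by (intro mult_mono) auto
      qed
      also have "G.U y r r' (\<lambda>x. u v * g y r' x) v = u v * g y r v"
        using G.U_scale[of y r r' "u v" "g y r'" v] g_split[OF r(2-4), of y v] by simp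
      finally show ?thesis by (simp add: \<xi>_def left_diff_distrib)
    qed
    have Xb: "\<bar>\<xi> v\<bar> \<le> exp C * (2 * Bu * exp C)" for v
      unfolding \<xi>_def by (rule G.U_bound[OF r(2-4) dgb])
    have \<xi>\<Psi>: "\<bar>\<xi> v - \<Psi> v\<bar> \<le> k1 * h\<^sup>2" for v
    proof -
      have 1: "\<bar>\<xi> v - (u v - u v) * g y r' v - (LINT q:{r..r'}|lborel. G.gen y q (\<lambda>w. (u w - u v) * g y r' w) v)\<bar> \<le> ?K * (2 * Bu * exp C) * h\<^sup>2"
        unfolding \<xi>_def h_def by (rule G.U_short[OF r(2-4) dgb pos[OF r01(1)]])
      have i: "set_integrable lborel {r..r'} (\<lambda>q. G.gen y q (\<lambda>w. (u w - u v) * g y r' w) v)"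
        using G.gen_measurable G.gen_bound[where f = "\<lambda>w. (u w - u v) * g y r' w", OF dgb] r
        by (intro set_integrable_bounded[where B = "2 * (2 * Bu * exp C) * C"]) auto
      have "\<bar>LINT q:{r..r'}|lborel. G.gen y q (\<lambda>w. (u w - u v) * g y r' w) v - gain y u q v\<bar> \<le> (2 * Bu * (L * h) * C) * measure lborel {r..r'}"
      proof (rule abs_set_integral_le)
        fix q assume q: "q \<in> {r..r'}"
        have "G.gen y q (\<lambda>w. (u w - u v) * g y r' w) v - gain y u q v =
          (\<Sum>w | E v w. (towards y v w * ((u w - u v) * (g y r' w - g y q w))) * j q v w)"
          by (simp add: gain_def gen_eq sum_subtractf[symmetric] algebra_simps)
        also have "\<bar>\<dots>\<bar> \<le> (2 * Bu * (L * h)) * C"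
        proof (rule weighted_rates_bound)
          fix w
          have "\<bar>g y r' w - g y q w\<bar> \<le> L * \<bar>r' - q\<bar>" using q r by (intro g_lipschitz) auto
          also have "\<dots> \<le> L * h" unfolding h_def using q L_nonneg by (intro mult_left_mono) auto
          finally have "\<bar>(u w - u v) * (g y r' w - g y q w)\<bar> \<le> 2 * Bu * (L * h)"
            unfolding abs_mult using u[of v] u[of w] Bu by (intro mult_mono) auto
          then have "\<bar>(u w - u v) * (g y r' w - g y q w)\<bar> \<le> 2 * Bu * (L * h)" .
          then show "\<bar>towards y v w * ((u w - u v) * (g y r' w - g y q w))\<bar> \<le> 2 * Bu * (L * h)"
          proof (cases "towards y v w = 0")
            case True
            have "0 \<le> 2 * Bu * (L * h)" using L_nonneg h Bu by simp
            then show ?thesis by (simp add: True)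
          next
            case False
            then have "towards y v w = 1" using towards_01(1)[of y v w] by simp
            then show ?thesis using \<open>\<bar>(u w - u v) * (g y r' w - g y q w)\<bar> \<le> 2 * Bu * (L * h)\<close> by simp
          qed
        qed (use L_nonneg h Bu in auto)
        finally show "\<bar>G.gen y q (\<lambda>w. (u w - u v) * g y r' w) v - gain y u q v\<bar> \<le> 2 * Bu * (L * h) * C" .
      qed (use L_nonneg C_nonneg h Bu r in auto)
      then have 2: "\<bar>(LINT q:{r..r'}|lborel. G.gen y q (\<lambda>w. (u w - u v) * g y r' w) v) - \<Psi> v\<bar> \<le> 2 * Bu * L * C * h\<^sup>2"
        unfolding \<Psi>_def using set_integral_diff(2)[OF i gain_integrable[where u = u, OF u r(2-4)]] r
        by (simp add: h_def power2_eq_square mult_ac)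
      show ?thesis using 1 2 by (simp add: k1_def algebra_simps)
    qed
    have \<Psi>b: "\<bar>\<Psi> v\<bar> \<le> 2 * (2 * Bu * exp C) * C * h" for v
      unfolding \<Psi>_def h_def using abs_set_integral_le[of "{r..r'}" lborel "2 * (2 * Bu * exp C) * C" "\<lambda>q. gain y u q v"]
        gain_bound[where u = u and y = y and v = v, OF u] r Bu C_nonneg by auto
    have int: "set_integrable Q A (\<lambda>X. G.M y 0 r X * f (X r))" if "\<And>x. \<bar>f x\<bar> \<le> b" for f b
      by (rule G.Mf_integrable[OF _ _ _ that AQ A(2)]) (use r in auto)
    have e1: "\<Phi> r' = V y A r (G.U y r r' (\<lambda>x. u x * g y r' x))"
      unfolding \<Phi>_def V_def by (rule G.tower_M[OF _ _ _ _ Ar A(2) ugb[OF r01(2)]]) (use r in auto)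
    have e2: "\<Phi> r' - \<Phi> r = V y A r \<xi>"
    proof -
      note i1 = int[where f = "G.U y r r' (\<lambda>x. u x * g y r' x)", OF G.U_bound[where f = "\<lambda>x. u x * g y r' x", OF r(2-4) ugb[OF r01(2)]]]
      note i2 = int[where f = "\<lambda>x. u x * g y r x", OF ugb[OF r01(1)]]
      have "\<Phi> r' - \<Phi> r = (LINT X:A|Q. G.M y 0 r X * G.U y r r' (\<lambda>x. u x * g y r' x) (X r) - G.M y 0 r X * (u (X r) * g y r (X r)))"
        unfolding e1 unfolding \<Phi>_def V_def by (rule set_integral_diff(2)[OF i1 i2, symmetric])
      also have "\<dots> = V y A r \<xi>" unfolding V_def by (simp only: Xeq right_diff_distrib)
      finally show ?thesis .
    qed
    have e3: "\<bar>V y A r \<xi> - V y A r \<Psi>\<bar> \<le> exp C * (k1 * h\<^sup>2) * measure Q A"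
    proof -
      have "V y A r \<xi> - V y A r \<Psi> = V y A r (\<lambda>x. \<xi> x - \<Psi> x)"
        unfolding V_def right_diff_distrib by (rule set_integral_diff(2)[OF int[where f = \<xi>, OF Xb] int[where f = \<Psi>, OF \<Psi>b], symmetric])
      then show ?thesis using V_bound[where f = "\<lambda>x. \<xi> x - \<Psi> x" and y = y, OF AQ A(2) r01(1) \<xi>\<Psi>] by simp
    qed
    have e4: "V y A r \<Psi> = (\<Sum>v\<in>S. LINT q:{r..r'}|lborel. V y A r (indicator {v}) * gain y u q v)"
    proof -
      have "V y A r \<Psi> = (\<Sum>v\<in>S. V y A r (indicator {v}) * \<Psi> v)"
        by (rule V_finite_sum[OF AQ A(2) r01(1) S]) (simp add: \<Psi>_def S_def gain_off set_lebesgue_integral_def)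
      then show ?thesis by (simp add: \<Psi>_def)
    qed
    \<comment> \<open>Here the time argument of \<open>V\<close> is released, at the price of its
      Lipschitz constant times the bound on \<open>gain\<close>.\<close>
    have e5: "\<bar>(LINT q:{r..r'}|lborel. V y A r (indicator {v}) * gain y u q v) - (LINT q:{r..r'}|lborel. V y A q (indicator {v}) * gain y u q v)\<bar> \<le> k2 * h\<^sup>2" for v
    proof -
      have i: "set_integrable lborel {r..r'} (\<lambda>q. V y A r (indicator {v}) * gain y u q v)"
        using gain_integrable[where u = u and y = y and v = v, OF u r(2-4)] by simp
      have "\<bar>LINT q:{r..r'}|lborel. V y A r (indicator {v}) * gain y u q v - V y A q (indicator {v}) * gain y u q v\<bar> \<le> (k2 * h) * measure lborel {r..r'}"
      proof (rule abs_set_integral_le)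
        fix q assume q: "q \<in> {r..r'}"
        have "\<bar>V y A r (indicator {v}) - V y A q (indicator {v})\<bar> \<le> L * measure Q A * \<bar>r - q\<bar>"
          by (rule V_lipschitz[OF A]) (use q r st ind_bound in auto)
        also have "\<dots> \<le> L * measure Q A * h" unfolding h_def using q L_nonneg by (intro mult_left_mono) auto
        finally have "\<bar>(V y A r (indicator {v}) - V y A q (indicator {v})) * gain y u q v\<bar> \<le> (L * measure Q A * h) * (2 * (2 * Bu * exp C) * C)"
          unfolding abs_mult using gain_bound[where u = u and y = y and v = v and q = q, OF u] q r L_nonneg h by (intro mult_mono) auto
        moreover have "(L * measure Q A * h) * (2 * (2 * Bu * exp C) * C) = k2 * h" by (simp add: k2_def)
        ultimately show "\<bar>V y A r (indicator {v}) * gain y u q v - V y A q (indicator {v}) * gain y u q v\<bar> \<le> k2 * h"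
          by (simp only: left_diff_distrib)
      qed (use L_nonneg C_nonneg h Bu r in \<open>auto simp: k2_def\<close>)
      then show ?thesis using set_integral_diff(2)[OF i Vi[of r r' y v]] r by (simp add: h_def power2_eq_square mult_ac)
    qed
    define Y where "Y v = (LINT q:{r..r'}|lborel. V y A r (indicator {v}) * gain y u q v) -
      (LINT q:{r..r'}|lborel. V y A q (indicator {v}) * gain y u q v)" for v
    have "D r r' = (V y A r \<xi> - V y A r \<Psi>) + (\<Sum>v\<in>S. Y v)"
      unfolding D_def e2 Y_def sum_subtractf e4 by simp
    moreover have "\<bar>\<Sum>v\<in>S. Y v\<bar> \<le> (\<Sum>v\<in>S. k2 * h\<^sup>2)"
      by (rule order_trans[OF sum_abs], rule sum_mono) (unfold Y_def, rule e5)
    ultimately have "\<bar>D r r'\<bar> \<le> exp C * (k1 * h\<^sup>2) * measure Q A + (\<Sum>v\<in>S. k2 * h\<^sup>2)"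
      using e3 by linarith
    moreover have "exp C * (k1 * h\<^sup>2) * measure Q A + (\<Sum>v\<in>S. k2 * h\<^sup>2) = (exp C * k1 * measure Q A + card S * k2) * h\<^sup>2"
      by (simp add: algebra_simps)
    ultimately show "\<bar>D r r'\<bar> \<le> (exp C * k1 * measure Q A + card S * k2) * (r' - r)\<^sup>2"
      unfolding h_def by simp
  qed
  then show ?thesis unfolding D_def \<Phi>_def S_def by (simp only: right_minus_eq)
qed

end

context geodesic_walk
begin

subsection \<open>A criterion for jump kernels carried by the edges\<close>

lemma kernel_gen_edges:
  assumes k: "\<And>r z w. \<not> E z w \<Longrightarrow> k r z w = 0" and fin: "finite {x. u x \<noteq> 0}"
  shows "kernel_gen k r u x = (\<Sum>z\<in>flux_states u. \<Sum>w | E z w. (u w - u z) * (indicator {z} x * k r z w))"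
proof -
  have "kernel_gen k r u x = infsum (\<lambda>y. (u y - u x) * k r x y) {y. E x y}"
    unfolding kernel_gen_def by (rule infsum_cong_neutral) (auto simp: k)
  then have 1: "kernel_gen k r u x = (\<Sum>w | E x w. (u w - u x) * k r x w)" using finite_nbrs by simp
  have 2: "(\<Sum>z\<in>flux_states u. \<Sum>w | E z w. (u w - u z) * (indicator {z} x * k r z w)) =
    (\<Sum>z\<in>flux_states u. if x = z then \<Sum>w | E x w. (u w - u x) * k r x w else 0)"
    by (intro sum.cong refl) auto
  show ?thesis
  proof (cases "x \<in> flux_states u")
    case True then show ?thesis unfolding 1 2 using finite_flux_states[OF fin] by simp
  next
    case False
    then have "kernel_gen k r u x = 0" unfolding 1 by (intro sum.neutral) (auto simp: no_flux)
    then show ?thesis unfolding 2 using False finite_flux_states[OF fin] by simp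
  qed
qed

text \<open>A bridge kernel can blow up at time 1, so integrability is required edge by edge,
  weighted by the mass of the state; for a jump kernel this integral is the expected number of
  crossings of the edge. It justifies Fubini on each edge, and finitely many edges carry the
  generator of \<open>u\<close>.\<close>

lemma has_jump_kernelI:
  assumes P: "prob_space P" "sets P = sets (path_space E)"
    and k_supp: "\<And>r z w. \<not> E z w \<Longrightarrow> k r z w = 0"
    and k_meas: "\<And>z w. (\<lambda>r. indicator {0..1} r * k r z w) \<in> borel_measurable borel"
    and k_fin: "\<And>z w. (\<integral>\<^sup>+r. ennreal (indicator {0..1} r * (measure P (at_time E r z) * \<bar>k r z w\<bar>)) \<partial>lborel) < \<infinity>"
    and eq: "\<And>u s t A. finite {x. u x \<noteq> 0} \<Longrightarrow> 0 \<le> s \<Longrightarrow> s \<le> t \<Longrightarrow> t \<le> 1 \<Longrightarrow> A \<in> sets (path_events E {0..s}) \<Longrightarrow>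
      (LINT X:A|P. u (X t) - u (X s)) =
      (\<Sum>z\<in>flux_states u. \<Sum>w | E z w. (u w - u z) * (LINT r:{s..t}|lborel. measure P (A \<inter> at_time E r z) * k r z w))"
  shows "has_jump_kernel E P k"
  unfolding has_jump_kernel_def
proof (intro allI impI ballI)
  fix u :: "'a \<Rightarrow> real" and s t A
  assume fin: "finite {x. u x \<noteq> 0}" and st: "0 \<le> s \<and> s \<le> t \<and> t \<le> 1" and A: "A \<in> sets (path_events E {0..s})"
    and "emeasure P A < \<infinity>"
  interpret P: prob_space P by (rule P(1))
  interpret PL: pair_sigma_finite P lborel ..
  have spP: "space P = paths E" using sets_eq_imp_space_eq[OF P(2)] by simp
  have AP: "A \<in> sets P" using path_events_mono[of "{0..s}" "{0..1}" E] A st P(2) by auto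
  have atP: "at_time E r z \<in> sets P" if "r \<in> {0..1}" for r z using at_time_sets[of r "{0..1}" E z] that P(2) by auto
  define e where "e z w = (\<lambda>(X::real \<Rightarrow> 'a, r). indicator A X * indicator {s..t} r * (indicator {z} (X r) * k r z w))" for z w
  have e_meas: "e z w \<in> borel_measurable (P \<Otimes>\<^sub>M lborel)" for z w
  proof -
    have cl: "(\<lambda>(X, r). indicator {0..1} r * indicator {z} (X r) :: real) \<in> borel_measurable (path_space E \<Otimes>\<^sub>M borel)"
      by (rule clamp_compose_measurable) auto
    have "sets (path_space E \<Otimes>\<^sub>M borel) = sets (P \<Otimes>\<^sub>M lborel)"
      by (intro sets_pair_measure_cong) (simp_all add: P(2))
    then have c: "(\<lambda>p. indicator {0..1} (snd p) * indicator {z} (fst p (snd p)) :: real) \<in> borel_measurable (P \<Otimes>\<^sub>M lborel)"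
      using cl measurable_cong_sets by (metis (no_types, lifting) case_prod_beta' measurable_cong)
    have m: "(\<lambda>p. indicator {0..1} (snd p) * k (snd p) z w) \<in> borel_measurable (P \<Otimes>\<^sub>M lborel)"
      using measurable_compose[OF measurable_snd, of "\<lambda>r. indicator {0..1} r * k r z w" lborel] k_meas by simp
    have "e z w = (\<lambda>p. indicator A (fst p) * indicator {s..t} (snd p) *
      ((indicator {0..1} (snd p) * indicator {z} (fst p (snd p))) * (indicator {0..1} (snd p) * k (snd p) z w)))"
      using st by (auto simp: e_def fun_eq_iff indicator_def)
    then show ?thesis using c m AP by simp
  qed
  have slice: "(\<integral>X. e z w (X, r) \<partial>P) = indicator {s..t} r * (measure P (A \<inter> at_time E r z) * k r z w)" for z w r
  proof (cases "r \<in> {s..t}")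
    case True
    then have m: "A \<inter> at_time E r z \<in> sets P" using AP atP[of r z] st by auto
    have "(\<integral>X. e z w (X, r) \<partial>P) = (\<integral>X. k r z w * indicator (A \<inter> at_time E r z) X \<partial>P)"
      using True spP by (intro Bochner_Integration.integral_cong) (auto simp: e_def indicator_def)
    then show ?thesis using m True sets.sets_into_space[OF m] by (simp add: Int_absorb2)
  qed (simp add: e_def)
  have e_int: "integrable (P \<Otimes>\<^sub>M lborel) (e z w)" for z w
  proof (rule integrableI_bounded[OF e_meas])
    have "(\<integral>\<^sup>+p. ennreal (norm (e z w p)) \<partial>(P \<Otimes>\<^sub>M lborel)) = (\<integral>\<^sup>+r. \<integral>\<^sup>+X. ennreal (norm (e z w (X, r))) \<partial>P \<partial>lborel)"
      by (rule PL.nn_integral_snd[symmetric]) (use e_meas in measurable)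
    also have "\<dots> \<le> (\<integral>\<^sup>+r. ennreal (indicator {0..1} r * (measure P (at_time E r z) * \<bar>k r z w\<bar>)) \<partial>lborel)"
    proof (rule nn_integral_mono)
      fix r
      show "(\<integral>\<^sup>+X. ennreal (norm (e z w (X, r))) \<partial>P) \<le> ennreal (indicator {0..1} r * (measure P (at_time E r z) * \<bar>k r z w\<bar>))"
      proof (cases "r \<in> {s..t}")
        case True
        then have r: "r \<in> {0..1}" using st by auto
        have "(\<integral>\<^sup>+X. ennreal (norm (e z w (X, r))) \<partial>P) \<le> (\<integral>\<^sup>+X. ennreal \<bar>k r z w\<bar> * indicator (at_time E r z) X \<partial>P)"
          using spP by (intro nn_integral_mono) (auto simp: e_def indicator_def)
        also have "\<dots> = ennreal \<bar>k r z w\<bar> * emeasure P (at_time E r z)" using atP[OF r] by (simp add: nn_integral_cmult)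
        also have "\<dots> = ennreal (measure P (at_time E r z) * \<bar>k r z w\<bar>)"
          by (simp add: P.emeasure_eq_measure ennreal_mult[symmetric] mult.commute)
        finally show ?thesis using r by simp
      qed (simp add: e_def)
    qed
    also have "\<dots> < \<infinity>" by (rule k_fin)
    finally show "(\<integral>\<^sup>+p. ennreal (norm (e z w p)) \<partial>(P \<Otimes>\<^sub>M lborel)) < \<infinity>" .
  qed
  define T where "T p = (\<Sum>z\<in>flux_states u. \<Sum>w | E z w. (u w - u z) * e z w p)" for p
  have T_int: "integrable (P \<Otimes>\<^sub>M lborel) T" unfolding T_def using e_int by simp
  have T_eq: "T (X, r) = indicator A X * (indicator {s..t} r * kernel_gen k r u (X r))" for X r
  proof -
    have "kernel_gen k r u (X r) = (\<Sum>z\<in>flux_states u. \<Sum>w | E z w. (u w - u z) * (indicator {z} (X r) * k r z w))"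
      by (rule kernel_gen_edges[OF k_supp fin])
    then show ?thesis unfolding T_def e_def by (simp add: sum_distrib_left mult_ac)
  qed
  show "set_integrable (P \<Otimes>\<^sub>M lborel) (A \<times> {s..t}) (\<lambda>(X, r). kernel_gen k r u (X r)) \<and>
    (LINT X:A|P. u (X t) - u (X s)) = (LINT X:A|P. LINT r:{s..t}|lborel. kernel_gen k r u (X r))"
  proof
    have "(\<lambda>p. indicator (A \<times> {s..t}) p *\<^sub>R (case p of (X, r) \<Rightarrow> kernel_gen k r u (X r))) = T"
      by (auto simp: fun_eq_iff T_eq indicator_def)
    then show "set_integrable (P \<Otimes>\<^sub>M lborel) (A \<times> {s..t}) (\<lambda>(X, r). kernel_gen k r u (X r))"
      unfolding set_integrable_def using T_int by simp
    have "(LINT X:A|P. LINT r:{s..t}|lborel. kernel_gen k r u (X r)) = (\<integral>X. \<integral>r. T (X, r) \<partial>lborel \<partial>P)"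
      by (simp add: set_lebesgue_integral_def T_eq)
    also have "\<dots> = integral\<^sup>L (P \<Otimes>\<^sub>M lborel) T" by (rule PL.integral_fst'[OF T_int])
    also have "\<dots> = (\<Sum>z\<in>flux_states u. \<Sum>w | E z w. (u w - u z) * integral\<^sup>L (P \<Otimes>\<^sub>M lborel) (e z w))"
      unfolding T_def using e_int by simp
    finally have sum: "(LINT X:A|P. LINT r:{s..t}|lborel. kernel_gen k r u (X r)) =
      (\<Sum>z\<in>flux_states u. \<Sum>w | E z w. (u w - u z) * integral\<^sup>L (P \<Otimes>\<^sub>M lborel) (e z w))" .
    have "integral\<^sup>L (P \<Otimes>\<^sub>M lborel) (e z w) = (LINT r:{s..t}|lborel. measure P (A \<inter> at_time E r z) * k r z w)" for z w
    proof -
      have "integrable (P \<Otimes>\<^sub>M lborel) (case_prod (\<lambda>X r. e z w (X, r)))" using e_int[of z w] by simp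
      from PL.integral_snd[OF this] have "(\<integral>r. \<integral>X. e z w (X, r) \<partial>P \<partial>lborel) = integral\<^sup>L (P \<Otimes>\<^sub>M lborel) (e z w)" by simp
      then show ?thesis unfolding slice by (simp add: set_lebesgue_integral_def)
    qed
    then show "(LINT X:A|P. u (X t) - u (X s)) = (LINT X:A|P. LINT r:{s..t}|lborel. kernel_gen k r u (X r))"
      unfolding sum using eq[OF fin _ _ _ A] st by simp
  qed
qed

lemma integral_finite_support:
  assumes P: "prob_space P" "sets P = sets (path_space E)" and A: "A \<in> sets P" and q: "q \<in> {0..1}"
    and fin: "finite {x. u x \<noteq> (0::real)}"
  shows "(LINT X:A|P. u (X q)) = (\<Sum>v | u v \<noteq> 0. u v * measure P (A \<inter> at_time E q v))"
    and "set_integrable P A (\<lambda>X. u (X q))"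
proof -
  interpret P: prob_space P by (rule P(1))
  have spP: "space P = paths E" using sets_eq_imp_space_eq[OF P(2)] by simp
  have atP: "A \<inter> at_time E q z \<in> sets P" for z using at_time_sets[of q "{0..1}" E z] q P(2) A by auto
  have eq: "indicator A X *\<^sub>R u (X q) = (\<Sum>v | u v \<noteq> 0. u v * indicator (A \<inter> at_time E q v) X)" if "X \<in> space P" for X
  proof -
    have "(\<Sum>v | u v \<noteq> 0. u v * indicator (A \<inter> at_time E q v) X) = (\<Sum>v | u v \<noteq> 0. if X q = v then indicator A X * u (X q) else 0)"
      using that spP by (intro sum.cong) (auto simp: indicator_def)
    also have "\<dots> = indicator A X * u (X q)" using fin by simp
    finally show ?thesis by simp
  qed
  have i: "integrable P (\<lambda>X. \<Sum>v | u v \<noteq> 0. u v * indicator (A \<inter> at_time E q v) X)"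
    using atP by (intro Bochner_Integration.integrable_sum integrable_mult_right integrable_real_indicator) (auto simp: P.emeasure_eq_measure)
  show "set_integrable P A (\<lambda>X. u (X q))"
    unfolding set_integrable_def using i eq by (subst Bochner_Integration.integrable_cong[OF refl eq]) auto
  have "(LINT X:A|P. u (X q)) = (\<integral>X. (\<Sum>v | u v \<noteq> 0. u v * indicator (A \<inter> at_time E q v) X) \<partial>P)"
    unfolding set_lebesgue_integral_def by (rule Bochner_Integration.integral_cong[OF refl eq])
  also have "\<dots> = (\<Sum>v | u v \<noteq> 0. \<integral>X. u v * indicator (A \<inter> at_time E q v) X \<partial>P)"
    using atP by (intro Bochner_Integration.integral_sum integrable_mult_right integrable_real_indicator) (auto simp: P.emeasure_eq_measure)
  also have "\<dots> = (\<Sum>v | u v \<noteq> 0. u v * measure P (A \<inter> at_time E q v))"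
    using atP sets.sets_into_space[OF atP] by (intro sum.cong refl) (simp add: Int_absorb2)
  finally show "(LINT X:A|P. u (X q)) = (\<Sum>v | u v \<noteq> 0. u v * measure P (A \<inter> at_time E q v))" .
qed

subsection \<open>The geodesic bridges\<close>

definition GM :: "(real \<Rightarrow> 'a) measure" where "GM = geodesic_measure E d j Q"

abbreviation ends :: "'a \<Rightarrow> 'a \<Rightarrow> (real \<Rightarrow> 'a) set" where
  "ends x y \<equiv> at_time E 0 x \<inter> at_time E 1 y"

definition br :: "'a \<Rightarrow> 'a \<Rightarrow> (real \<Rightarrow> 'a) measure" where "br x y = bridge E GM x y"

text \<open>The mass that the geodesic measure gives to the paths from \<open>x\<close> to
  \<open>y\<close>, by \<open>GM_ends\<close>. At time 0 the functional is trivial, which makes this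
  mass a product in \<open>\<beta>_eq\<close>.\<close>

definition \<beta> :: "'a \<Rightarrow> 'a \<Rightarrow> real" where "\<beta> x y = V y (at_time E 0 x) 0 (g y 0)"

lemma ends_Q: "ends x y \<in> sets Q" "emeasure Q (ends x y) < \<infinity>"
  using at_time_Q[of 0 x] at_time_Q[of 1 y] finite_past[of 0 "at_time E 1 y" x] by (auto simp: Int_commute)

text \<open>Being a geodesic refers to the terminal state, so the target of the functional is
  \<open>X 1\<close>; on paths ending at \<open>y\<close> it can be replaced by the fixed target
  \<open>y\<close>.\<close>

lemma geodesic_density:
  assumes X: "X \<in> paths E"
  shows "indicator (geodesics E d) X * exp (LINT t:{0..1}|lborel. kernel_mass j t (X t)) = G.M (X 1) 0 1 X"
proof -
  have "jump_prod (towards (X 1)) 0 1 X = 0 \<or> jump_prod (towards (X 1)) 0 1 X = 1"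
    unfolding jump_prod_towards[OF X] of_bool_def by meson
  then show ?thesis using geodesic_iff[OF X] by (auto simp: mult_def expo_def indicator_def)
qed

lemma geodesic_density_measurable: "(\<lambda>X. G.M (X 1) 0 1 X) \<in> borel_measurable Q"
  by (rule measurable_compose_countable[OF G.M_measurable_Q coord_Q]) auto

lemma GM_eq: "GM = density Q (\<lambda>X. ennreal (G.M (X 1) 0 1 X))"
  unfolding GM_def geodesic_measure_def
proof (rule density_cong)
  show "(\<lambda>X. ennreal (G.M (X 1) 0 1 X)) \<in> borel_measurable Q" using geodesic_density_measurable by simp
  have "(\<lambda>X. ennreal (indicator (geodesics E d) X * exp (LINT t:{0..1}|lborel. kernel_mass j t (X t)))) \<in> borel_measurable Q \<longleftrightarrow>
     (\<lambda>X. ennreal (G.M (X 1) 0 1 X)) \<in> borel_measurable Q"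
    by (rule measurable_cong) (simp add: geodesic_density)
  then show "(\<lambda>X. ennreal (indicator (geodesics E d) X * exp (LINT t:{0..1}|lborel. kernel_mass j t (X t)))) \<in> borel_measurable Q"
    using geodesic_density_measurable by simp
qed (auto simp: geodesic_density)

lemma sets_GM: "sets GM = sets Q" by (simp add: GM_eq)

lemma GM_measure:
  assumes B: "B \<in> sets Q" "B \<subseteq> ends x y"
  shows "emeasure GM B = ennreal (V y B 1 (\<lambda>_. 1))"
proof -
  have fin: "emeasure Q B < \<infinity>" using emeasure_mono[OF B(2) ends_Q(1)] ends_Q(2)[of x y] by (rule le_less_trans)
  have "emeasure GM B = (\<integral>\<^sup>+X. ennreal (G.M (X 1) 0 1 X) * indicator B X \<partial>Q)"
    unfolding GM_eq using geodesic_density_measurable B by (subst emeasure_density) auto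
  also have "\<dots> = (\<integral>\<^sup>+X. ennreal (indicator B X * (G.M y 0 1 X * 1)) \<partial>Q)"
    using B by (intro nn_integral_cong) (auto simp: indicator_def)
  also have "\<dots> = ennreal (V y B 1 (\<lambda>_. 1))"
    unfolding V_def set_lebesgue_integral_def real_scaleR_def
  proof (rule nn_integral_eq_integral)
    show "integrable Q (\<lambda>X. indicator B X * (G.M y 0 1 X * 1))"
      using G.Mf_integrable[of 0 1 "\<lambda>_. 1" 1 B y] B fin by (simp add: set_integrable_def)
    show "AE X in Q. 0 \<le> indicator B X * (G.M y 0 1 X * 1)"
      using B G.mult_bounds(1)[of 0 1] by (intro AE_I2) (auto simp: indicator_def)
  qed
  finally show ?thesis .
qed

text \<open>Conditioning on the past up to \<open>q\<close> turns the requirement to end at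
  \<open>y\<close> along geodesic steps into the weight \<open>g y q\<close>.\<close>

lemma V_end:
  assumes B: "B \<in> sets (path_events E {0..q})" "emeasure Q B < \<infinity>" and q: "q \<in> {0..1}"
  shows "V y (B \<inter> at_time E 1 y) 1 (\<lambda>_. 1) = V y B q (g y q)"
proof -
  have B_sub: "B \<subseteq> paths E" using sets.sets_into_space[OF B(1)] by simp
  have "V y (B \<inter> at_time E 1 y) 1 (\<lambda>_. 1) = (LINT X:B|Q. G.M y 0 1 X * indicator {y} (X 1))"
    unfolding V_def set_lebesgue_integral_def using B_sub
    by (intro Bochner_Integration.integral_cong) (auto simp: indicator_def)
  also have "\<dots> = V y B q (g y q)" unfolding V_def g_def[abs_def]
    by (rule G.tower_M[OF _ _ _ _ B ind_bound]) (use q in auto)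
  finally show ?thesis .
qed

lemma \<beta>_eq: "\<beta> x y = measure Q (at_time E 0 x) * g y 0 x"
proof -
  have "\<beta> x y = (LINT X:at_time E 0 x|Q. g y 0 x)"
    unfolding \<beta>_def V_def using at_time_Q[of 0 x] by (intro set_lebesgue_integral_cong) (auto simp: G.mult_same)
  then show ?thesis using set_integral_constant[OF at_time_Q at_time_finite, of 0 x "g y 0 x"] by simp
qed

lemma \<beta>_pos: "0 < \<beta> x y" unfolding \<beta>_eq using init_pos g_pos[of 0 y x] by simp

lemma \<beta>_ends: "V y (ends x y) 1 (\<lambda>_. 1) = \<beta> x y"
  unfolding \<beta>_def by (rule V_end) (use at_time_sets[of 0 "{0..0}" E x] at_time_finite[of 0 x] in auto)

lemma GM_ends: "emeasure GM (ends x y) = ennreal (\<beta> x y)"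
  using GM_measure[OF ends_Q(1), of x y x y] by (simp add: \<beta>_ends)

lemma prob_br: "prob_space (br x y)"
  unfolding br_def using GM_ends[of x y] \<beta>_pos[of x y] by (intro prob_space_uniform_measure) auto

lemma sets_br: "sets (br x y) = sets (path_space E)"
  by (simp add: br_def sets_GM sets_Q)

lemma measure_br:
  assumes B: "B \<in> sets Q" shows "measure (br x y) B = V y (B \<inter> ends x y) 1 (\<lambda>_. 1) / \<beta> x y"
proof -
  have m: "B \<inter> ends x y \<in> sets Q" using B ends_Q(1) by auto
  have "measure (br x y) B = measure GM (ends x y \<inter> B) / measure GM (ends x y)"
    unfolding br_def by (rule measure_uniform_measure) (use GM_ends[of x y] \<beta>_pos[of x y] B in \<open>auto simp: sets_GM\<close>)
  also have "measure GM (ends x y) = \<beta> x y" using GM_ends[of x y] \<beta>_pos[of x y] by (simp add: measure_def)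
  also have "measure GM (ends x y \<inter> B) = V y (B \<inter> ends x y) 1 (\<lambda>_. 1)"
    using GM_measure[OF m Int_lower2] V_nonneg[OF m, of 1 "\<lambda>_. 1" y]
    by (simp add: measure_def Int_commute[of "ends x y" B])
  finally show ?thesis .
qed

lemma measure_br_past:
  assumes B: "B \<in> sets (path_events E {0..q})" and q: "q \<in> {0..1}"
  shows "measure (br x y) B = V y (B \<inter> at_time E 0 x) q (g y q) / \<beta> x y"
proof -
  have B': "B \<inter> at_time E 0 x \<in> sets (path_events E {0..q})" using B at_time_sets[of 0 "{0..q}" E x] q by auto
  have fin: "emeasure Q (B \<inter> at_time E 0 x) < \<infinity>" using finite_past[of 0 B x] sets_QI[OF B] q by auto
  show ?thesis using measure_br[of B x y] sets_QI[OF B] V_end[OF B' fin q] q by (simp add: Int_assoc)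
qed

text \<open>The law of a bridge at one time is a forward factor times the backward weight
  \<open>g\<close>; the latter will cancel the denominator of the geodesic kernel.\<close>

lemma measure_br_state:
  assumes A: "A \<in> sets (path_events E {0..q})" and q: "q \<in> {0..1}"
  shows "measure (br x y) (A \<inter> at_time E q v) = V y (A \<inter> at_time E 0 x) q (indicator {v}) * g y q v / \<beta> x y"
proof -
  have B: "A \<inter> at_time E q v \<in> sets (path_events E {0..q})" using A at_time_sets[of q "{0..q}" E v] q by auto
  have A_sub: "A \<subseteq> paths E" using sets.sets_into_space[OF A] by simp
  have "V y (A \<inter> at_time E q v \<inter> at_time E 0 x) q (g y q) = V y (A \<inter> at_time E 0 x) q (indicator {v}) * g y q v"
    unfolding V_def set_lebesgue_integral_def integral_mult_left_zero[symmetric] using A_sub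
    by (intro Bochner_Integration.integral_cong) (auto simp: indicator_def)
  then show ?thesis using measure_br_past[OF B q, of x y] by simp
qed

text \<open>Rate at which the weighted paths in \<open>A\<close> cross the edge from
  \<open>z\<close> to \<open>w\<close>. Unlike the kernel it contains no division by
  \<open>g\<close> and stays bounded up to time 1.\<close>

definition flux :: "'a \<Rightarrow> (real \<Rightarrow> 'a) set \<Rightarrow> real \<Rightarrow> 'a \<Rightarrow> 'a \<Rightarrow> real" where
  "flux y A q z w = V y A q (indicator {z}) * (towards y z w * g y q w * j q z w)"

lemma j_le: "j q z w \<le> C"
proof (cases "E z w")
  case True
  then have "j q z w \<le> (\<Sum>w | E z w. j q z w)" using j_nonneg finite_nbrs by (intro member_le_sum) auto
  then show ?thesis using j_mass[where t = q and x = z] by simp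
qed (use C_nonneg j_supp in simp)

text \<open>For \<open>q < 1\<close> the weight \<open>g y q z\<close> is positive and cancels; at
  time 1 it vanishes away from \<open>y\<close>. The excluded time is a null set in the integrals
  that follow.\<close>

lemma br_flux:
  assumes A: "A \<in> sets (path_events E {0..q})" and q: "0 \<le> q" "q < 1"
  shows "measure (br x y) (A \<inter> at_time E q z) * geodesic_kernel E d j Q y q z w = flux y (A \<inter> at_time E 0 x) q z w / \<beta> x y"
  using measure_br_state[OF A, of x y z] q g_pos[OF q, of y z]
  by (simp add: geodesic_kernel_eq flux_def)

lemma flux_integrable:
  assumes A: "A \<in> sets (path_events E {0..s})" "emeasure Q A < \<infinity>" and st: "0 \<le> s" "s \<le> t" "t \<le> 1"
  shows "set_integrable lborel {s..t} (\<lambda>q. flux y A q z w)"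
  unfolding set_integrable_def
proof (rule integrableI_bounded_set[where A = "{s..t}" and B = "(exp C * 1 * measure Q A) * (exp C * C)"])
  have "(\<lambda>q. indicator {s..t} q *\<^sub>R flux y A q z w) =
    (\<lambda>q. indicator {s..t} q * ((indicator {s..1} q * V y A q (indicator {z})) * (towards y z w * (indicator {0..1} q * g y q w) * j q z w)))"
    using st by (auto simp: fun_eq_iff indicator_def flux_def)
  then show "(\<lambda>q. indicator {s..t} q *\<^sub>R flux y A q z w) \<in> borel_measurable lborel"
    using V_measurable[OF A st(1), of y z] g_measurable j_meas by simp
  have AQ: "A \<in> sets Q" using sets_QI[OF A(1)] st by auto
  have "\<bar>flux y A q z w\<bar> \<le> (exp C * 1 * measure Q A) * (exp C * C)" if "q \<in> {s..t}" for q
    unfolding flux_def abs_mult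
  proof (rule mult_mono)
    show "\<bar>V y A q (indicator {z})\<bar> \<le> exp C * 1 * measure Q A"
      using V_bound[OF AQ A(2), of q "indicator {z}" 1 y] that st ind_bound by auto
    have "\<bar>towards y z w\<bar> * \<bar>g y q w\<bar> \<le> 1 * exp C"
      using towards_01[of y z w] g_bound[of q y w] that st by (intro mult_mono) auto
    then show "\<bar>towards y z w\<bar> * \<bar>g y q w\<bar> * \<bar>j q z w\<bar> \<le> exp C * C"
      using j_le[of q z w] j_nonneg[of q z w] by (intro mult_mono) auto
  qed auto
  then show "AE q in lborel. q \<in> {s..t} \<longrightarrow> norm (indicator {s..t} q *\<^sub>R flux y A q z w) \<le> (exp C * 1 * measure Q A) * (exp C * C)"
    by (intro AE_I2) auto
qed (use st in auto)

lemma gain_flux: "V y A q (indicator {z}) * gain y u q z = (\<Sum>w | E z w. (u w - u z) * flux y A q z w)"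
  by (simp add: gain_def gen_eq flux_def sum_distrib_left mult_ac)

lemma br_dynkin:
  assumes A: "A \<in> sets (path_events E {0..s})" and st: "0 \<le> s" "s \<le> t" "t \<le> 1" and fin: "finite {x. u x \<noteq> 0}"
  shows "(LINT X:A|br x y. u (X t) - u (X s)) =
    (\<Sum>z\<in>flux_states u. \<Sum>w | E z w. (u w - u z) * (LINT q:{s..t}|lborel. flux y (A \<inter> at_time E 0 x) q z w / \<beta> x y))"
proof -
  define A' where "A' = A \<inter> at_time E 0 x"
  have A': "A' \<in> sets (path_events E {0..s})" unfolding A'_def using A at_time_sets[of 0 "{0..s}" E x] st by auto
  have fin': "emeasure Q A' < \<infinity>" unfolding A'_def using finite_past[of 0 A x] sets_QI[OF A] st by auto
  have AQ: "A \<in> sets (br x y)" "A' \<in> sets Q" using sets_QI[OF A] sets_QI[OF A'] st sets_br sets_Q by auto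
  have val: "(LINT X:A|br x y. u (X q)) = V y A' q (\<lambda>x. u x * g y q x) / \<beta> x y" if q: "s \<le> q" "q \<le> 1" for q
  proof -
    have q01: "q \<in> {0..1}" using q st by auto
    have Aq: "A \<in> sets (path_events E {0..q})" using A path_events_mono[of "{0..s}" "{0..q}" E] q by auto
    have "V y A' q (\<lambda>x. u x * g y q x) = (\<Sum>v | u v \<noteq> 0. V y A' q (indicator {v}) * (u v * g y q v))"
      by (rule V_finite_sum[OF AQ(2) fin' q01 fin]) auto
    then show ?thesis
      unfolding integral_finite_support(1)[OF prob_br sets_br AQ(1) q01 fin]
      by (simp add: measure_br_state[OF Aq q01] A'_def[symmetric] sum_divide_distrib mult_ac)
  qed
  have "(LINT X:A|br x y. u (X t) - u (X s)) = (LINT X:A|br x y. u (X t)) - (LINT X:A|br x y. u (X s))"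
    by (intro set_integral_diff integral_finite_support(2)[OF prob_br sets_br AQ(1) _ fin]) (use st in auto)
  also have "\<dots> = (V y A' t (\<lambda>x. u x * g y t x) - V y A' s (\<lambda>x. u x * g y s x)) / \<beta> x y"
    using val[of t] val[of s] st by (simp add: diff_divide_distrib)
  also have "\<dots> = (\<Sum>z\<in>flux_states u. LINT q:{s..t}|lborel. V y A' q (indicator {z}) * gain y u q z) / \<beta> x y"
    unfolding dynkin[OF A' fin' st fin] ..
  also have "\<dots> = (\<Sum>z\<in>flux_states u. \<Sum>w | E z w. (u w - u z) * (LINT q:{s..t}|lborel. flux y A' q z w / \<beta> x y))"
  proof -
    have "(LINT q:{s..t}|lborel. V y A' q (indicator {z}) * gain y u q z) = (\<Sum>w | E z w. (u w - u z) * (LINT q:{s..t}|lborel. flux y A' q z w))" for z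
    proof -
      have i: "integrable lborel (\<lambda>q. indicator {s..t} q * flux y A' q z w)" for w
        using flux_integrable[OF A' fin' st, of y z w] by (simp add: set_integrable_def)
      have "(LINT q:{s..t}|lborel. V y A' q (indicator {z}) * gain y u q z) =
        (\<integral>q. (\<Sum>w | E z w. (u w - u z) * (indicator {s..t} q * flux y A' q z w)) \<partial>lborel)"
        unfolding set_lebesgue_integral_def gain_flux by (simp add: sum_distrib_left mult_ac)
      also have "\<dots> = (\<Sum>w | E z w. (u w - u z) * (\<integral>q. indicator {s..t} q * flux y A' q z w \<partial>lborel))"
        using i by simp
      finally show ?thesis by (simp add: set_lebesgue_integral_def)
    qed
    then show ?thesis by (simp add: sum_divide_distrib set_lebesgue_integral_def)
  qed
  finally show ?thesis unfolding A'_def .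
qed

text \<open>Steps towards \<open>y\<close> reduce the distance to \<open>y\<close> by exactly their
  length. A contributing path therefore has length \<open>d x y - d v y\<close> when it is at
  \<open>v\<close>, and this is at least \<open>d x v\<close>, which puts \<open>v\<close> between
  \<open>x\<close> and \<open>y\<close>.\<close>

lemma V_off_geodesic:
  assumes q: "q \<in> {0..1}" and v: "d x v + d v y \<noteq> d x y"
  shows "V y (at_time E 0 x) q (indicator {v}) = 0"
proof -
  have "G.M y 0 q X * indicator {v} (X q) = 0" if "X \<in> at_time E 0 x" for X
  proof (rule ccontr)
    assume n: "\<not> ?thesis"
    have X: "X \<in> paths E" "X 0 = x" "X q = v" using n that by (auto simp: indicator_def split: if_splits)
    have jp: "\<forall>r\<in>jumps X 0 q. d (left_lim X r) (X r) + d (X r) y = d (left_lim X r) y"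
      using n by (auto simp: mult_def jump_prod_towards[OF X(1)])
    have "(\<Sum>r\<in>jumps X 0 q. d (left_lim X r) (X r)) = (\<Sum>r\<in>jumps X 0 q. d (left_lim X r) y - d (X r) y)"
      using jp by (intro sum.cong) (auto simp: algebra_simps)
    also have "\<dots> = d x y - d v y" using sum_jumps_telescope[OF X(1), of 0 q "\<lambda>x. d x y"] q X by simp
    finally have "d x v \<le> d x y - d v y" using dist_le_length[OF X(1), of 0 q] q X by simp
    then show False using v d_facts(4)[of x y v] by linarith
  qed
  then have "V y (at_time E 0 x) q (indicator {v}) = (LINT X:at_time E 0 x|Q. 0)"
    unfolding V_def using at_time_Q[of 0 x] by (intro set_lebesgue_integral_cong) auto
  then show ?thesis by simp
qed

text \<open>Along a geodesic to \<open>y\<close> the distance to \<open>y\<close> decreases strictly at each jump, so an edge is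
  crossed at most once. Testing Dynkin's formula with the indicator of a sublevel set of this
  distance turns that into the following bound.\<close>

lemma flux_total:
  assumes zw: "E z w"
  shows "(LINT q:{0..1}|lborel. flux y (at_time E 0 x) q z w) \<le> \<beta> x y"
proof -
  define A where "A = at_time E 0 x"
  have A: "A \<in> sets (path_events E {0..0})" unfolding A_def using at_time_sets[of 0 "{0..0}" E x] by auto
  have AQ: "A \<in> sets Q" "emeasure Q A < \<infinity>" unfolding A_def using at_time_Q[of 0] at_time_finite[of 0] by auto
  show ?thesis
  proof (cases "d x z + d z y = d x y \<and> d z w + d w y = d z y")
    case False
    have zero: "flux y A q z w = 0" if "q \<in> {0..1}" for q
      using False V_off_geodesic[OF that, of x z y] by (auto simp: flux_def A_def towards_def)
    have "(LINT q:{0..1}|lborel. flux y A q z w) = (LINT q:{0..1::real}|lborel. 0 :: real)"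
      by (intro set_lebesgue_integral_cong) (use zero in auto)
    then show ?thesis using \<beta>_pos[of x y] by (simp add: A_def)
  next
    case True
    \<comment> \<open>\<open>I\<close> is the metric interval between \<open>x\<close> and
      \<open>y\<close>, finite as part of a ball. Restricting the sublevel set to \<open>I\<close>
      gives \<open>u\<close> finite support; from a state of \<open>I\<close> a step towards
      \<open>y\<close> cannot lower \<open>u\<close>, and the edge considered raises it from 0 to
      1.\<close>
    define I where "I = {v. d x v + d v y = d x y}"
    define u :: "'a \<Rightarrow> real" where "u v = of_bool (v \<in> I \<and> d v y \<le> d w y)" for v
    have "I \<subseteq> {v. d v x \<le> real (nat \<lceil>d x y\<rceil>)}"
    proof
      fix v assume "v \<in> I"
      then have "d v x \<le> d x y" using d_facts(1)[of v y] d_facts(2)[of v x] by (simp add: I_def)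
      also have "\<dots> \<le> real (nat \<lceil>d x y\<rceil>)" by linarith
      finally show "v \<in> {v. d v x \<le> real (nat \<lceil>d x y\<rceil>)}" by simp
    qed
    then have "finite I" by (rule finite_subset) (rule finite_dist_ball)
    then have fin: "finite {v. u v \<noteq> 0}" by (rule rev_finite_subset) (auto simp: u_def)
    have mono: "0 \<le> towards y v w' * (u w' - u v)" if "v \<in> I" for v w'
    proof (cases "d v w' + d w' y = d v y")
      case tw: True
      have "w' \<in> I" using that tw d_facts(4)[of x w' v] d_facts(4)[of x y w'] by (simp add: I_def)
      moreover have "d w' y \<le> d v y" using tw d_facts(1)[of v w'] by linarith
      ultimately have "u v \<le> u w'" by (auto simp: u_def)
      then show ?thesis using towards_01 by simp
    qed (simp add: towards_def)
    have w_I: "w \<in> I" using True d_facts(4)[of x w z] d_facts(4)[of x y w] by (simp add: I_def)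
    have uw: "u w = 1" using w_I by (simp add: u_def)
    have "z \<noteq> w" using zw irrefl by auto
    then have "1 \<le> d z w" by (rule d_ge_1)
    then have uz: "u z = 0" using True by (simp add: u_def)
    have zS: "z \<in> flux_states u" unfolding flux_states_def using sym[OF zw] uw by (auto intro!: exI[of _ w])
    have nonneg: "0 \<le> (u w' - u v) * flux y A q v w'" if "q \<in> {0..1}" for v w' q
    proof (cases "v \<in> I")
      case vI: True
      have "0 \<le> V y A q (indicator {v}) * ((towards y v w' * (u w' - u v)) * (g y q w' * j q v w'))"
        by (rule mult_nonneg_nonneg[OF V_nonneg[OF AQ(1) that] mult_nonneg_nonneg[OF mono[OF vI]
          mult_nonneg_nonneg[OF g_nonneg[OF that] j_nonneg]]]) simp
      then show ?thesis by (simp add: flux_def mult_ac)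
    next
      case False
      then show ?thesis using V_off_geodesic[OF that, of x v y] by (simp add: flux_def A_def I_def)
    qed
    have i: "set_integrable lborel {0..1} (\<lambda>q. flux y A q v w')" for v w'
      by (rule flux_integrable[OF A AQ(2)]) auto
    have ub: "\<bar>u v\<bar> \<le> 1" for v by (simp add: u_def)
    have int_gain: "set_integrable lborel {0..1} (\<lambda>q. V y A q (indicator {v}) * gain y u q v)" for v
      by (rule V_gain_integrable[where u = u and s = 0, OF A AQ(2) ub]) auto
    have gain_nn: "0 \<le> V y A q (indicator {v}) * gain y u q v" if "q \<in> {0..1}" for q v
      unfolding gain_flux using nonneg[OF that] by (intro sum_nonneg) auto
    have "(LINT q:{0..1}|lborel. flux y A q z w) \<le> (LINT q:{0..1}|lborel. V y A q (indicator {z}) * gain y u q z)"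
    proof (rule set_integral_mono[OF i int_gain])
      fix q :: real assume q: "q \<in> {0..1}"
      have "(u w - u z) * flux y A q z w \<le> (\<Sum>w | E z w. (u w - u z) * flux y A q z w)"
        using nonneg[OF q] finite_nbrs zw by (intro member_le_sum) auto
      then show "flux y A q z w \<le> V y A q (indicator {z}) * gain y u q z" by (simp add: gain_flux uw uz)
    qed
    also have "\<dots> \<le> (\<Sum>v\<in>flux_states u. LINT q:{0..1}|lborel. V y A q (indicator {v}) * gain y u q v)"
    proof (rule member_le_sum[OF zS _ finite_flux_states[OF fin]])
      show "0 \<le> (LINT q:{0..1}|lborel. V y A q (indicator {v}) * gain y u q v)" for v
        unfolding set_lebesgue_integral_def using gain_nn by (intro integral_nonneg_AE AE_I2) (auto simp: indicator_def)
    qed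
    also have "\<dots> = V y A 1 (\<lambda>x. u x * g y 1 x) - V y A 0 (\<lambda>x. u x * g y 0 x)"
      by (rule dynkin[OF A AQ(2) _ _ _ fin, symmetric]) auto
    also have "\<dots> \<le> V y A 1 (\<lambda>x. u x * g y 1 x)"
      using V_nonneg[OF AQ(1), of 0 "\<lambda>x. u x * g y 0 x" y] g_nonneg[of 0 y] by (simp add: u_def)
    also have "\<dots> \<le> V y A 1 (g y 1)"
      unfolding V_def
    proof (rule set_integral_mono)
      show "set_integrable Q A (\<lambda>X. G.M y 0 1 X * (u (X 1) * g y 1 (X 1)))"
        by (rule G.Mf_integrable[OF _ _ _ _ AQ, where B = 1]) (auto simp: u_def g_1 indicator_def)
      show "set_integrable Q A (\<lambda>X. G.M y 0 1 X * g y 1 (X 1))"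
        by (rule G.Mf_integrable[OF _ _ _ _ AQ, where B = 1]) (auto simp: g_1 indicator_def)
      show "G.M y 0 1 X * (u (X 1) * g y 1 (X 1)) \<le> G.M y 0 1 X * g y 1 (X 1)" if "X \<in> A" for X
        using G.mult_bounds(1)[of 0 1 X y] that by (intro mult_left_mono) (auto simp: A_def u_def g_1 indicator_def)
    qed
    also have "\<dots> = \<beta> x y"
    proof -
      have A1: "A \<in> sets (path_events E {0..1})" using A path_events_mono[of "{0..0}" "{0..1::real}" E] by auto
      show ?thesis using V_end[OF A1 AQ(2), of y] \<beta>_ends[of y x] by (simp add: A_def)
    qed
    finally show ?thesis by (simp add: A_def)
  qed
qed

end

section \<open>Markov measures: densities and setwise limits\<close>

text \<open>With denominators cleared the Markov property is a polynomial identity between masses,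
  which is stable under setwise limits.\<close>

lemma markov_finiteI:
  fixes E :: "'a::countable \<Rightarrow> 'a \<Rightarrow> bool"
  assumes P: "finite_measure P" "sets P = sets (path_space E)"
    and eq: "\<And>t z A B. t \<in> {0..1} \<Longrightarrow> A \<in> sets (path_events E {0..t}) \<Longrightarrow> B \<in> sets (path_events E {t..1}) \<Longrightarrow>
      measure P (at_time E t z \<inter> (A \<inter> B)) * measure P (at_time E t z) = measure P (at_time E t z \<inter> A) * measure P (at_time E t z \<inter> B)"
  shows "markov_measure E P"
  unfolding markov_measure_def
proof (intro conjI ballI allI impI)
  interpret P: finite_measure P by (rule P(1))
  show "sets P = sets (path_space E)" by (rule P(2))
  fix t :: real assume t: "t \<in> {0..1}"
  have m: "(\<lambda>X. X t) \<in> P \<rightarrow>\<^sub>M count_space UNIV" using coord_measurable[OF t, of E] measurable_cong_sets[OF P(2) refl] by blast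
  show "sigma_finite_measure (marginal P t)"
    using P.finite_measure_distr[OF m] by (rule finite_measure.sigma_finite_measure)
  fix z A B assume z: "emeasure P (at_time E t z) \<noteq> 0" and A: "A \<in> sets (path_events E {0..t})" and B: "B \<in> sets (path_events E {t..1})"
  have AB: "A \<in> sets P" "B \<in> sets P"
    using A B path_events_mono[of "{0..t}" "{0..1}" E] path_events_mono[of "{t..1}" "{0..1}" E] t P(2) by auto
  have um: "measure (uniform_measure P (at_time E t z)) D = measure P (at_time E t z \<inter> D) / measure P (at_time E t z)" if "D \<in> sets P" for D
    by (rule measure_uniform_measure) (use z that P.emeasure_finite in auto)
  have "measure P (at_time E t z) \<noteq> 0" using z by (simp add: P.emeasure_eq_measure)
  then show "measure (uniform_measure P (at_time E t z)) (A \<inter> B) =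
    measure (uniform_measure P (at_time E t z)) A * measure (uniform_measure P (at_time E t z)) B"
    using eq[OF t A B, of z] AB by (simp add: um field_simps)
qed

lemma markov_finiteD:
  fixes E :: "'a::countable \<Rightarrow> 'a \<Rightarrow> bool"
  assumes P: "finite_measure P" "markov_measure E P" and t: "t \<in> {0..1}"
    and A: "A \<in> sets (path_events E {0..t})" and B: "B \<in> sets (path_events E {t..1})"
  shows "measure P (at_time E t z \<inter> (A \<inter> B)) * measure P (at_time E t z) = measure P (at_time E t z \<inter> A) * measure P (at_time E t z \<inter> B)"
proof -
  interpret P: finite_measure P by (rule P(1))
  interpret M: markov_path E P by unfold_locales (rule P(2))
  have AB: "A \<in> sets P" "B \<in> sets P" using M.sets_QI[OF A] M.sets_QI[OF B] t by auto
  show ?thesis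
  proof (cases "emeasure P (at_time E t z) = 0")
    case True
    have "measure P (at_time E t z \<inter> A) \<le> measure P (at_time E t z)"
      using M.at_time_Q[OF t] AB by (intro P.finite_measure_mono) auto
    moreover have "measure P (at_time E t z) = 0" using True by (simp add: measure_def)
    moreover have "0 \<le> measure P (at_time E t z \<inter> A)" by simp
    ultimately have "measure P (at_time E t z \<inter> A) = 0" by linarith
    then show ?thesis using \<open>measure P (at_time E t z) = 0\<close> by simp
  next
    case False
    have um: "measure (uniform_measure P (at_time E t z)) D = measure P (at_time E t z \<inter> D) / measure P (at_time E t z)" if "D \<in> sets P" for D
      by (rule measure_uniform_measure) (use False that P.emeasure_finite in auto)
    have "measure P (at_time E t z) \<noteq> 0" using False by (simp add: P.emeasure_eq_measure)
    moreover have "measure (uniform_measure P (at_time E t z)) (A \<inter> B) =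
      measure (uniform_measure P (at_time E t z)) A * measure (uniform_measure P (at_time E t z)) B"
      using P(2) t False A B unfolding markov_measure_def by blast
    ultimately show ?thesis using AB by (simp add: um field_simps)
  qed
qed

lemma markov_setwise_limit:
  fixes E :: "'a::countable \<Rightarrow> 'a \<Rightarrow> bool"
  assumes "\<And>n. finite_measure (Ps n)" "\<And>n. markov_measure E (Ps n)" "finite_measure P" "sets P = sets (path_space E)"
    and lim: "\<And>B. B \<in> sets (path_space E) \<Longrightarrow> (\<lambda>n. measure (Ps n) B) \<longlonglongrightarrow> measure P B"
  shows "markov_measure E P"
proof (rule markov_finiteI[OF assms(3,4)])
  fix t z A B assume t: "t \<in> {0..1}" and A: "A \<in> sets (path_events E {0..t})" and B: "B \<in> sets (path_events E {t..1})"
  let ?Z = "at_time E t z"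
  have AB: "A \<in> sets (path_space E)" "B \<in> sets (path_space E)" "?Z \<in> sets (path_space E)"
    using A B path_events_mono[of "{0..t}" "{0..1}" E] path_events_mono[of "{t..1}" "{0..1}" E] t at_time_sets[of t "{0..1}" E z] by auto
  have "(\<lambda>n. measure (Ps n) (?Z \<inter> (A \<inter> B)) * measure (Ps n) ?Z) \<longlonglongrightarrow> measure P (?Z \<inter> (A \<inter> B)) * measure P ?Z"
    by (intro tendsto_mult lim sets.Int AB)
  moreover have "(\<lambda>n. measure (Ps n) (?Z \<inter> A) * measure (Ps n) (?Z \<inter> B)) \<longlonglongrightarrow> measure P (?Z \<inter> A) * measure P (?Z \<inter> B)"
    by (intro tendsto_mult lim sets.Int AB)
  moreover have "measure (Ps n) (?Z \<inter> (A \<inter> B)) * measure (Ps n) ?Z = measure (Ps n) (?Z \<inter> A) * measure (Ps n) (?Z \<inter> B)" for n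
    by (rule markov_finiteD[OF assms(1,2) t A B])
  ultimately show "measure P (?Z \<inter> (A \<inter> B)) * measure P ?Z = measure P (?Z \<inter> A) * measure P (?Z \<inter> B)"
    by (auto intro: LIMSEQ_unique)
qed

text \<open>A function of \<open>X 0\<close> times a function of \<open>X 1\<close> splits at every
  time into a past and a future factor, so conditional independence survives. Up to the common
  factor \<open>q\<close>, each of the four masses in the claim is a product
  \<open>F A * H B\<close>.\<close>

lemma (in markov_path) markov_density:
  fixes f g :: "'a \<Rightarrow> ennreal"
  assumes P: "finite_measure P" and eq: "P = density Q (\<lambda>X. f (X 0) * g (X 1))"
  shows "markov_measure E P"
proof (rule markov_finiteI[OF P])
  interpret P: finite_measure P by (rule P)
  show "sets P = sets (path_space E)" by (simp add: eq sets_Q)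
  have f: "(\<lambda>X. f (X 0)) \<in> borel_measurable Q" and g: "(\<lambda>X. g (X 1)) \<in> borel_measurable Q"
    using measurable_compose[OF coord_Q[of 0], of f borel] measurable_compose[OF coord_Q[of 1], of g borel] by auto
  fix t z A B assume t: "t \<in> {0..1}" and A: "A \<in> sets (path_events E {0..t})" and B: "B \<in> sets (path_events E {t..1})"
  let ?Z = "at_time E t z"
  define q where "q = emeasure Q ?Z"
  define F where "F A = (\<integral>\<^sup>+X. (f (X 0) * indicator A X) * indicator ?Z X \<partial>Q)" for A
  define H where "H B = (\<integral>\<^sup>+X. (g (X 1) * indicator B X) * indicator ?Z X \<partial>Q)" for B
  have Z: "?Z \<in> sets Q" by (rule at_time_Q[OF t])
  have e: "emeasure P (?Z \<inter> (A \<inter> B)) * q = F A * H B"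
    if A: "A \<in> sets (path_events E {0..t})" and B: "B \<in> sets (path_events E {t..1})" for A B
  proof -
    have AB: "A \<in> sets Q" "B \<in> sets Q" using sets_QI[OF A] sets_QI[OF B] t by auto
    have "emeasure P (?Z \<inter> (A \<inter> B)) = (\<integral>\<^sup>+X. f (X 0) * g (X 1) * indicator (?Z \<inter> (A \<inter> B)) X \<partial>Q)"
      unfolding eq using f g AB Z by (subst emeasure_density) auto
    also have "\<dots> = (\<integral>\<^sup>+X. (f (X 0) * indicator A X) * (g (X 1) * indicator B X) * indicator ?Z X \<partial>Q)"
      by (intro nn_integral_cong) (auto simp: indicator_def)
    finally show ?thesis unfolding q_def F_def H_def
      using nn_markov[OF t, of "\<lambda>X. f (X 0) * indicator A X" "\<lambda>X. g (X 1) * indicator B X" z]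
        coord_compose_measurable[of 0 "{0..t}" f borel E] coord_compose_measurable[of 1 "{t..1}" g borel E] A B t
      by auto
  qed
  have sp: "paths E \<in> sets (path_events E I)" for I using sets.top[of "path_events E I"] by simp
  have AB: "A \<subseteq> paths E" "B \<subseteq> paths E" using sets.sets_into_space[OF A] sets.sets_into_space[OF B] by auto
  have Zs: "?Z \<inter> (A \<inter> paths E) = ?Z \<inter> A" "?Z \<inter> (paths E \<inter> B) = ?Z \<inter> B" "?Z \<inter> (paths E \<inter> paths E) = ?Z"
    using AB by auto
  show "measure P (?Z \<inter> (A \<inter> B)) * measure P ?Z = measure P (?Z \<inter> A) * measure P (?Z \<inter> B)"
  proof (cases "q = 0")
    case True
    then have "AE X in Q. X \<notin> ?Z" using Z unfolding q_def by (intro AE_not_in) auto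
    then have "(\<integral>\<^sup>+X. f (X 0) * g (X 1) * indicator ?Z X \<partial>Q) = (\<integral>\<^sup>+X. 0 \<partial>Q)"
      by (intro nn_integral_cong_AE) auto
    then have Z0: "emeasure P ?Z = 0" unfolding eq using f g Z by (subst emeasure_density) auto
    have "emeasure P (?Z \<inter> A) \<le> emeasure P ?Z" using Z by (intro emeasure_mono) (auto simp: eq)
    then have "measure P ?Z = 0" "measure P (?Z \<inter> A) = 0" using Z0 by (simp_all add: measure_def)
    then show ?thesis by simp
  next
    case False
    have qfin: "q < \<infinity>" unfolding q_def by (rule at_time_finite[OF t])
    have "(emeasure P (?Z \<inter> (A \<inter> B)) * q) * (emeasure P (?Z \<inter> (paths E \<inter> paths E)) * q) =
      (emeasure P (?Z \<inter> (A \<inter> paths E)) * q) * (emeasure P (?Z \<inter> (paths E \<inter> B)) * q)"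
      unfolding e[OF A B] e[OF sp sp] e[OF A sp] e[OF sp B] by (simp add: mult_ac)
    moreover obtain q' where q': "q = ennreal q'" "0 < q'"
      using False qfin by (cases q) auto
    ultimately have "ennreal (measure P (?Z \<inter> (A \<inter> B)) * q' * (measure P ?Z * q')) = ennreal (measure P (?Z \<inter> A) * q' * (measure P (?Z \<inter> B) * q'))"
      unfolding Zs P.emeasure_eq_measure by (simp add: ennreal_mult)
    then have "measure P (?Z \<inter> (A \<inter> B)) * q' * (measure P ?Z * q') = measure P (?Z \<inter> A) * q' * (measure P (?Z \<inter> B) * q')"
      using q' by (subst (asm) ennreal_inj) auto
    then show ?thesis using q' by simp
  qed
qed

text \<open>By Fatou's lemma over the cells, applied to \<open>f\<close> and to \<open>1 - f\<close>, convergence on each cell of a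
  countable partition suffices for probability measures.\<close>

lemma convergence_on_partition:
  fixes \<xi> :: "'b \<Rightarrow> 'a::countable" and f :: "'b \<Rightarrow> real"
  assumes Ps: "\<And>n. prob_space (Ps n)" "\<And>n. sets (Ps n) = sets N" and P: "prob_space P" "sets P = sets N"
    and \<xi>: "\<xi> \<in> N \<rightarrow>\<^sub>M count_space UNIV"
    and conv: "\<And>(f :: 'b \<Rightarrow> real) x. f \<in> borel_measurable N \<Longrightarrow> (\<And>X. X \<in> space N \<Longrightarrow> 0 \<le> f X \<and> f X \<le> 1) \<Longrightarrow>
      (\<lambda>n. \<integral>X. indicator {X\<in>space N. \<xi> X = x} X * f X \<partial>Ps n) \<longlonglongrightarrow> (\<integral>X. indicator {X\<in>space N. \<xi> X = x} X * f X \<partial>P)"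
    and f: "f \<in> borel_measurable N" "\<And>X. X \<in> space N \<Longrightarrow> 0 \<le> f X \<and> f X \<le> 1"
  shows "(\<lambda>n. \<integral>X. f X \<partial>Ps n) \<longlonglongrightarrow> (\<integral>X. f X \<partial>P)"
proof -
  have cell: "{X\<in>space N. \<xi> X = x} \<in> sets N" for x using \<xi> by measurable
  have int: "integrable R f" "integrable R (\<lambda>X. indicator {X\<in>space N. \<xi> X = x} X * f X)"
    if R: "prob_space R" "sets R = sets N" and f: "f \<in> borel_measurable N" "\<And>X. X \<in> space N \<Longrightarrow> 0 \<le> f X \<and> f X \<le> 1" for R and f :: "'b \<Rightarrow> real" and x
  proof -
    interpret R: prob_space R by (rule R(1))
    have sp: "space R = space N" by (rule sets_eq_imp_space_eq[OF R(2)])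
    have fm: "f \<in> borel_measurable R" using f(1) measurable_cong_sets[OF R(2) refl] by blast
    show "integrable R f" using fm f(2) sp by (intro R.integrable_const_bound[where B = 1]) auto
    show "integrable R (\<lambda>X. indicator {X\<in>space N. \<xi> X = x} X * f X)" using fm f(2) sp cell[of x] R(2)
      by (intro R.integrable_const_bound[where B = 1]) (auto simp: indicator_def)
  qed
  have split: "ennreal (\<integral>X. f X \<partial>R) = (\<integral>\<^sup>+x. ennreal (\<integral>X. indicator {X\<in>space N. \<xi> X = x} X * f X \<partial>R) \<partial>count_space UNIV)"
    if R: "prob_space R" "sets R = sets N" and f: "f \<in> borel_measurable N" "\<And>X. X \<in> space N \<Longrightarrow> 0 \<le> f X \<and> f X \<le> 1" for R and f :: "'b \<Rightarrow> real"
  proof -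
    have sp: "space R = space N" by (rule sets_eq_imp_space_eq[OF R(2)])
    have "ennreal (\<integral>X. f X \<partial>R) = (\<integral>\<^sup>+X. ennreal (f X) \<partial>R)"
      using int(1)[OF R f] f(2) sp by (intro nn_integral_eq_integral[symmetric]) auto
    also have "\<dots> = (\<integral>\<^sup>+X. \<integral>\<^sup>+x. ennreal (indicator {X\<in>space N. \<xi> X = x} X * f X) \<partial>count_space UNIV \<partial>R)"
    proof (rule nn_integral_cong)
      fix X assume "X \<in> space R"
      then have "(\<integral>\<^sup>+x. ennreal (indicator {X\<in>space N. \<xi> X = x} X * f X) \<partial>count_space UNIV) =
        (\<integral>\<^sup>+x. ennreal (f X) * indicator {\<xi> X} x \<partial>count_space UNIV)"
        using sp by (intro nn_integral_cong) (auto simp: indicator_def)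
      also have "\<dots> = ennreal (f X)" by (subst nn_integral_cmult) auto
      finally show "ennreal (f X) = (\<integral>\<^sup>+x. ennreal (indicator {X\<in>space N. \<xi> X = x} X * f X) \<partial>count_space UNIV)" ..
    qed
    also have "\<dots> = (\<integral>\<^sup>+x. \<integral>\<^sup>+X. ennreal (indicator {X\<in>space N. \<xi> X = x} X * f X) \<partial>R \<partial>count_space UNIV)"
      by (rule nn_integral_count_space_nn_integral) (use int(2)[OF R f] in auto)
    also have "\<dots> = (\<integral>\<^sup>+x. ennreal (\<integral>X. indicator {X\<in>space N. \<xi> X = x} X * f X \<partial>R) \<partial>count_space UNIV)"
      using f(2) by (intro nn_integral_cong nn_integral_eq_integral int(2)[OF R f] AE_I2) (auto simp: indicator_def)
    finally show ?thesis .
  qed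
  have low: "\<forall>\<^sub>F n in sequentially. c < (\<integral>X. f X \<partial>Ps n)" if c: "c < (\<integral>X. f X \<partial>P)"
    and f: "f \<in> borel_measurable N" "\<And>X. X \<in> space N \<Longrightarrow> 0 \<le> f X \<and> f X \<le> 1" for f :: "'b \<Rightarrow> real" and c
  proof -
    define F where "F n x = (\<integral>X. indicator {X\<in>space N. \<xi> X = x} X * f X \<partial>Ps n)" for n x
    have nn: "0 \<le> (\<integral>X. f X \<partial>Ps n)" for n
      using f(2) sets_eq_imp_space_eq[OF Ps(2)[of n]] by (intro integral_nonneg_AE AE_I2) auto
    have "ennreal (\<integral>X. f X \<partial>P) = (\<integral>\<^sup>+x. liminf (\<lambda>n. ennreal (F n x)) \<partial>count_space UNIV)"
    proof -
      have "liminf (\<lambda>n. ennreal (F n x)) = ennreal (\<integral>X. indicator {X\<in>space N. \<xi> X = x} X * f X \<partial>P)" for x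
        unfolding F_def by (rule lim_imp_Liminf[OF trivial_limit_sequentially tendsto_ennrealI[OF conv]]) (use f in auto)
      then show ?thesis using split[of P f, OF P f] by simp
    qed
    also have "\<dots> \<le> liminf (\<lambda>n. \<integral>\<^sup>+x. ennreal (F n x) \<partial>count_space UNIV)"
      by (rule nn_integral_liminf) simp
    also have "(\<lambda>n. \<integral>\<^sup>+x. ennreal (F n x) \<partial>count_space UNIV) = (\<lambda>n. ennreal (\<integral>X. f X \<partial>Ps n))"
      unfolding F_def using split[OF Ps f] by simp
    finally have le: "ennreal (\<integral>X. f X \<partial>P) \<le> liminf (\<lambda>n. ennreal (\<integral>X. f X \<partial>Ps n))" .
    show ?thesis
    proof (cases "c < 0")
      case True
      then show ?thesis using nn by (intro always_eventually allI) (meson less_le_trans)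
    next
      case False
      then have "ennreal c < ennreal (\<integral>X. f X \<partial>P)" using c by (intro ennreal_lessI) auto
      then have "ennreal c < liminf (\<lambda>n. ennreal (\<integral>X. f X \<partial>Ps n))" using le by (rule less_le_trans)
      from less_LiminfD[OF this] show ?thesis
        by eventually_elim (use False in \<open>simp add: ennreal_less_iff\<close>)
    qed
  qed
  show ?thesis
  proof (rule order_tendstoI)
    show "\<forall>\<^sub>F n in sequentially. c < (\<integral>X. f X \<partial>Ps n)" if "c < (\<integral>X. f X \<partial>P)" for c
      by (rule low[OF that f])
    fix c assume c: "(\<integral>X. f X \<partial>P) < c"
    have compl: "(\<integral>X. 1 - f X \<partial>R) = 1 - (\<integral>X. f X \<partial>R)" if R: "prob_space R" "sets R = sets N" for R
    proof -
      interpret R: prob_space R by (rule R(1))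
      show ?thesis using int(1)[OF R f] by (simp add: R.prob_space)
    qed
    have "\<forall>\<^sub>F n in sequentially. 1 - c < (\<integral>X. 1 - f X \<partial>Ps n)"
      by (rule low) (use c f compl[OF P] in auto)
    then show "\<forall>\<^sub>F n in sequentially. (\<integral>X. f X \<partial>Ps n) < c"
      by eventually_elim (use compl[OF Ps] in simp)
  qed
qed

section \<open>Continuous functionals for the Skorokhod topology\<close>

lemma continuous_map_skorokhodI:
  assumes "\<And>X e. X \<in> paths E \<Longrightarrow> 0 < e \<Longrightarrow>
    \<exists>\<delta>>0. \<forall>\<eta>\<in>paths E. skorokhod_dist X \<eta> < \<delta> \<longrightarrow> \<bar>f \<eta> - f X\<bar> < (e::real)"
  shows "continuous_map (skorokhod_topology E) euclideanreal f"
proof -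
  interpret S: Metric_space "paths E" skorokhod_dist by (rule Metric_space_skorokhod)
  show ?thesis unfolding skorokhod_topology_def continuous_map_def
  proof (intro conjI allI impI)
    fix U :: "real set" assume "openin euclideanreal U"
    then have U: "open U" by simp
    show "openin S.mtopology {X \<in> topspace S.mtopology. f X \<in> U}"
      unfolding S.openin_mtopology
    proof (intro conjI allI impI)
      fix X assume X: "X \<in> {X \<in> topspace S.mtopology. f X \<in> U}"
      then obtain e where e: "e > 0" "\<And>x. dist x (f X) < e \<Longrightarrow> x \<in> U" using U unfolding open_dist by auto
      obtain \<delta> where \<delta>: "\<delta> > 0" "\<And>\<eta>. \<eta> \<in> paths E \<Longrightarrow> skorokhod_dist X \<eta> < \<delta> \<Longrightarrow> \<bar>f \<eta> - f X\<bar> < e"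
        using assms[of X e] X e(1) by auto
      have "S.mball X \<delta> \<subseteq> {X \<in> topspace S.mtopology. f X \<in> U}"
        using \<delta>(2) e(2) by (auto simp: S.mball_def dist_real_def)
      then show "\<exists>r>0. S.mball X r \<subseteq> {X \<in> topspace S.mtopology. f X \<in> U}" using \<delta>(1) by blast
    qed auto
  qed auto
qed

text \<open>Time changes fix 0 and 1. At Skorokhod distance below 1 the mismatch term, which is 0 or
  1, is 0, so both endpoints agree.\<close>

lemma endpoints_continuous:
  "continuous_map (skorokhod_topology E) euclideanreal (indicator (at_time E 0 x \<inter> at_time E 1 y))"
proof (rule continuous_map_skorokhodI)
  fix X :: "real \<Rightarrow> 'a" and e :: real assume X: "X \<in> paths E" and e: "0 < e"
  have "indicator (at_time E 0 x \<inter> at_time E 1 y) \<eta> = (indicator (at_time E 0 x \<inter> at_time E 1 y) X :: real)"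
    if \<eta>: "\<eta> \<in> paths E" "skorokhod_dist X \<eta> < 1" for \<eta>
  proof -
    obtain l where l: "l \<in> time_changes" "time_change_cost l X \<eta> < 1" using skorokhod_dist_less[OF \<eta>(2)] by blast
    have "X t = \<eta> (l t)" if "t \<in> {0..1}" for t
    proof -
      have "of_bool (X t \<noteq> \<eta> (l t)) < (1 :: real)" using time_change_cost_ge(2)[OF l(1) that, of X \<eta>] l(2) by linarith
      then show ?thesis by (cases "X t = \<eta> (l t)") auto
    qed
    from this[of 0] this[of 1] show ?thesis using l(1) X \<eta>(1) by (simp add: time_changes_def indicator_def)
  qed
  then show "\<exists>\<delta>>0. \<forall>\<eta>\<in>paths E. skorokhod_dist X \<eta> < \<delta> \<longrightarrow>
    \<bar>indicator (at_time E 0 x \<inter> at_time E 1 y) \<eta> - indicator (at_time E 0 x \<inter> at_time E 1 y) X\<bar> < e"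
    using e by (intro exI[of _ 1]) auto
qed

text \<open>Evaluation at an interior time is in general not Skorokhod continuous, but its integral
  over a time window is; suitably scaled it serves as a smoothed indicator of a state.\<close>

definition occupation :: "real \<Rightarrow> real \<Rightarrow> 'a \<Rightarrow> (real \<Rightarrow> 'a) \<Rightarrow> real" where
  "occupation a b z X = (LINT s:{a..b}|lborel. indicator {z} (X s))"

text \<open>Off the \<open>\<delta>\<close>-neighbourhood of the jump times of \<open>X\<close>, a
  nearby path has the same values as \<open>X\<close>; that neighbourhood has length at most
  \<open>2 * \<delta> * N\<close>.\<close>

lemma occupation_continuous:
  fixes E :: "'a::countable \<Rightarrow> 'a \<Rightarrow> bool"
  assumes ab: "0 \<le> a" "a \<le> b" "b \<le> 1"
  shows "continuous_map (skorokhod_topology E) euclideanreal (occupation a b z)"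
proof (rule continuous_map_skorokhodI)
  fix X :: "real \<Rightarrow> 'a" and e :: real assume X: "X \<in> paths E" and e: "0 < e"
  define N where "N = real (card (jump_times X))"
  have fin: "finite (jump_times X)" using X by (simp add: paths_def)
  \<comment> \<open>At most 1, so that the mismatch indicator vanishes; the \<open>+ 1\<close>
    covers a path without jumps and makes \<open>2 * \<delta> * N < e\<close> strict.\<close>
  define \<delta> where "\<delta> = min 1 (e / (2 * N + 1))"
  have N: "0 \<le> N" by (simp add: N_def)
  have \<delta>: "0 < \<delta>" "2 * \<delta> * N < e"
  proof -
    show "0 < \<delta>" using e N by (simp add: \<delta>_def)
    have "\<delta> \<le> e / (2 * N + 1)" by (simp add: \<delta>_def)
    then have "\<delta> * (2 * N + 1) \<le> e" using N by (simp add: pos_le_divide_eq)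
    then show "2 * \<delta> * N < e" using \<open>0 < \<delta>\<close> by (simp add: algebra_simps)
  qed
  have si: "set_integrable lborel {a..b} (\<lambda>s. indicator {z} (\<zeta> s) :: real)" if "\<zeta> \<in> paths E" for \<zeta>
    by (rule path_compose_integrable[OF ab that, where B = 1]) (auto simp: indicator_def)
  have "\<bar>occupation a b z \<eta> - occupation a b z X\<bar> < e" if \<eta>: "\<eta> \<in> paths E" "skorokhod_dist X \<eta> < \<delta>" for \<eta>
  proof -
    have "skorokhod_dist \<eta> X < \<delta>" using skorokhod_dist_sym_le[of \<eta> X] \<eta> by simp
    then obtain l where l: "l \<in> time_changes" "time_change_cost l \<eta> X < \<delta>" by (rule skorokhod_dist_less)
    define W where "W = (\<Union>r\<in>jump_times X. {r - \<delta>..r + \<delta>})"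
    have W: "W \<in> sets lborel" unfolding W_def using fin by auto
    have same: "\<eta> s = X s" if s: "s \<in> {0..1}" "s \<notin> W" for s
    proof -
      have 1: "\<bar>l s - s\<bar> < \<delta>" "\<eta> s = X (l s)"
      proof -
        show "\<bar>l s - s\<bar> < \<delta>" using time_change_cost_ge(1)[OF l(1) s(1), of \<eta> X] l(2) by linarith
        have "of_bool (\<eta> s \<noteq> X (l s)) < (1 :: real)"
          using time_change_cost_ge(2)[OF l(1) s(1), of \<eta> X] l(2) \<delta>_def by linarith
        then show "\<eta> s = X (l s)" by (cases "\<eta> s = X (l s)") auto
      qed
      have ls: "l s \<in> {0..1}" by (rule time_change_range[OF l(1) s(1)])
      have no: "jumps X p q = {}" if "p \<in> {s - \<delta>..s + \<delta>}" "q \<in> {s - \<delta>..s + \<delta>}" for p q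
        using s(2) that by (fastforce simp: jumps_def W_def)
      have "X (l s) = X s"
      proof (cases "l s \<le> s")
        case True
        have "jumps X (l s) s = {}" using 1 \<delta> by (intro no) auto
        from path_const[OF X _ True _ this] show ?thesis using ls s by auto
      next
        case False
        have "jumps X s (l s) = {}" using 1 \<delta> by (intro no) auto
        from path_const[OF X _ _ _ this] show ?thesis using False ls s by auto
      qed
      then show ?thesis using 1 by simp
    qed
    have "occupation a b z \<eta> - occupation a b z X = (LINT s:{a..b}|lborel. indicator {z} (\<eta> s) - indicator {z} (X s))"
      unfolding occupation_def using si[OF \<eta>(1)] si[OF X] by (simp add: set_integral_diff)
    also have "\<dots> = (LINT s:{a..b} \<inter> W|lborel. indicator {z} (\<eta> s) - indicator {z} (X s))"
      unfolding set_lebesgue_integral_def using same ab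
      by (intro Bochner_Integration.integral_cong) (auto simp: indicator_def)
    finally have eq: "occupation a b z \<eta> - occupation a b z X = (LINT s:{a..b} \<inter> W|lborel. indicator {z} (\<eta> s) - indicator {z} (X s))" .
    have Wfin: "emeasure lborel W \<le> ennreal (2 * \<delta> * N)"
    proof -
      have "emeasure lborel W \<le> (\<Sum>r\<in>jump_times X. emeasure lborel {r - \<delta>..r + \<delta>})"
        unfolding W_def using fin by (intro emeasure_subadditive_finite) auto
      also have "\<dots> = ennreal (2 * \<delta> * N)" using \<delta> by (simp add: N_def ennreal_of_nat_eq_real_of_nat ennreal_mult[symmetric] mult_ac)
      finally show ?thesis .
    qed
    have le: "emeasure lborel ({a..b} \<inter> W) \<le> ennreal (2 * \<delta> * N)"
      using emeasure_mono[of "{a..b} \<inter> W" W lborel] W Wfin by (auto intro: order_trans)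
    have "\<bar>LINT s:{a..b} \<inter> W|lborel. indicator {z} (\<eta> s) - indicator {z} (X s)\<bar> \<le> 1 * measure lborel ({a..b} \<inter> W)"
      using W le by (intro abs_set_integral_le) (auto simp: indicator_def intro: le_less_trans)
    also have "\<dots> \<le> 2 * \<delta> * N" using le \<delta> N by (simp add: measure_def enn2real_leI)
    finally show ?thesis using eq \<delta> by simp
  qed
  then show "\<exists>\<delta>>0. \<forall>\<eta>\<in>paths E. skorokhod_dist X \<eta> < \<delta> \<longrightarrow> \<bar>occupation a b z \<eta> - occupation a b z X\<bar> < e"
    using \<delta>(1) by blast
qed

text \<open>Start of a window of length \<open>1 / Suc n\<close> inside the unit interval, equal to
  \<open>t < 1\<close> once \<open>n\<close> is large. For \<open>t = 1\<close> the window ends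
  there, and left-continuity at 1 makes the averages converge in that case too.\<close>

definition window :: "nat \<Rightarrow> real \<Rightarrow> real" where
  "window n t = (if t < 1 then min t (1 - 1 / Suc n) else 1 - 1 / Suc n)"

lemma window_bounds: "t \<in> {0..1} \<Longrightarrow> 0 \<le> window n t \<and> window n t + 1 / Suc n \<le> 1"
proof -
  assume t: "t \<in> {0..1}"
  have "1 / real (Suc n) \<le> 1" by simp
  then show ?thesis using t unfolding window_def by (auto simp: min_def simp del: of_nat_Suc)
qed

lemma occupation_bounds:
  assumes "t \<in> {0..1}"
  shows "0 \<le> real (Suc n) * occupation (window n t) (window n t + 1 / Suc n) z X"
    and "real (Suc n) * occupation (window n t) (window n t + 1 / Suc n) z X \<le> 1"
proof -
  let ?a = "window n t" and ?b = "window n t + 1 / Suc n"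
  have 0: "0 \<le> occupation ?a ?b z X"
    unfolding occupation_def set_lebesgue_integral_def by (intro integral_nonneg_AE AE_I2) auto
  then show "0 \<le> real (Suc n) * occupation ?a ?b z X" by (intro mult_nonneg_nonneg) auto
  have "\<bar>occupation ?a ?b z X\<bar> \<le> 1 * measure lborel {?a..?b}"
    unfolding occupation_def by (intro abs_set_integral_le) (auto simp: indicator_def)
  then have "occupation ?a ?b z X \<le> 1 / real (Suc n)" by simp
  then have "real (Suc n) * occupation ?a ?b z X \<le> real (Suc n) * (1 / real (Suc n))" by (intro mult_left_mono) auto
  then show "real (Suc n) * occupation ?a ?b z X \<le> 1" by simp
qed

lemma occupation_converges:
  fixes E :: "'a::countable \<Rightarrow> 'a \<Rightarrow> bool"
  assumes X: "X \<in> paths E" and t: "t \<in> {0..1}"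
  shows "(\<lambda>n. real (Suc n) * occupation (window n t) (window n t + 1 / Suc n) z X) \<longlonglongrightarrow> indicator {z} (X t)"
proof -
  have "\<forall>\<^sub>F n in sequentially. \<forall>s\<in>{window n t..window n t + 1 / Suc n} - {t}. X s = X t"
  proof (cases "t < 1")
    case True
    then obtain b where b: "b > t" "\<And>v. t < v \<Longrightarrow> v < b \<Longrightarrow> X v = X t"
      using right_eventually[OF X, of t] t by (auto simp: eventually_at_right_field)
    have "\<forall>\<^sub>F n in sequentially. inverse (real (Suc n)) < min (b - t) (1 - t)"
      using b True by (intro order_tendstoD(2)[OF LIMSEQ_inverse_real_of_nat]) auto
    then show ?thesis
    proof eventually_elim
      case (elim n)
      then have n: "1 / real (Suc n) < b - t" "1 / real (Suc n) < 1 - t" by (simp_all add: inverse_eq_divide)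
      have "window n t = t" using n True by (simp add: window_def min_def)
      then show ?case using n b(2) by auto
    qed
  next
    case False
    then have t1: "t = 1" using t by auto
    have "\<forall>\<^sub>F s in at_left 1. X s = X 1" using X by (simp add: paths_def)
    then obtain b where b: "b < 1" "\<And>v. b < v \<Longrightarrow> v < 1 \<Longrightarrow> X v = X 1" by (auto simp: eventually_at_left_field)
    have "\<forall>\<^sub>F n in sequentially. inverse (real (Suc n)) < 1 - b"
      using b by (intro order_tendstoD(2)[OF LIMSEQ_inverse_real_of_nat]) auto
    then show ?thesis
    proof eventually_elim
      case (elim n)
      then have n: "1 / real (Suc n) < 1 - b" by (simp add: inverse_eq_divide)
      then show ?case using b(2) by (auto simp: window_def t1)
    qed
  qed
  then have "\<forall>\<^sub>F n in sequentially. real (Suc n) * occupation (window n t) (window n t + 1 / Suc n) z X = indicator {z} (X t)"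
  proof eventually_elim
    case (elim n)
    let ?a = "window n t" and ?b = "window n t + 1 / Suc n"
    have "occupation ?a ?b z X = (LINT s:{?a..?b}|lborel. indicator {z} (X t))"
      unfolding occupation_def set_lebesgue_integral_def
    proof (rule integral_cong_AE)
      have wb: "0 \<le> ?a" "?a \<le> ?b" "?b \<le> 1" using window_bounds[OF t, of n] by auto
      show "(\<lambda>s. indicator {?a..?b} s *\<^sub>R (indicator {z} (X s) :: real)) \<in> borel_measurable lborel"
        using path_compose_measurable[OF wb X, where c = "\<lambda>_. indicator {z}"] by simp
      show "AE s in lborel. indicator {?a..?b} s *\<^sub>R indicator {z} (X s) = indicator {?a..?b} s *\<^sub>R (indicator {z} (X t) :: real)"
        using AE_lborel_singleton[of t] by eventually_elim (use elim in \<open>auto simp: indicator_def\<close>)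
    qed simp
    also have "\<dots> = indicator {z} (X t) * (1 / Suc n)" by (subst set_integral_constant) auto
    finally show ?case by simp
  qed
  then show ?thesis by (rule tendsto_eventually)
qed

text \<open>Products of window averages are continuous and bounded, and they converge to cylinder
  indicators. Both limits of \<open>Ps\<close> agree on these products; dominated convergence
  carries the agreement to cylinders, which determine the measure.\<close>

lemma narrow_limit_unique:
  fixes E :: "'a::countable \<Rightarrow> 'a \<Rightarrow> bool"
  assumes P: "prob_space P" "sets P = sets (path_space E)" and P': "prob_space P'" "sets P' = sets (path_space E)"
    and nar: "narrow_conv (skorokhod_topology E) Ps P"
    and conv: "\<And>f :: (real \<Rightarrow> 'a) \<Rightarrow> real. f \<in> borel_measurable (path_space E) \<Longrightarrow> (\<And>X. X \<in> paths E \<Longrightarrow> 0 \<le> f X \<and> f X \<le> 1) \<Longrightarrow>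
      (\<lambda>n. \<integral>X. f X \<partial>Ps n) \<longlonglongrightarrow> (\<integral>X. f X \<partial>P')"
  shows "P = P'"
proof (rule path_measure_eqI[OF P(2) P'(2)])
  interpret P: prob_space P by (rule P(1))
  interpret P': prob_space P' by (rule P'(1))
  show "emeasure P (at_time E 0 x) \<noteq> \<infinity>" for x by simp
  fix F and \<phi> :: "real \<Rightarrow> 'a" assume F: "finite F" "F \<subseteq> {0<..1::real}"
  define G where "G = insert 0 F"
  have G: "finite G" "G \<subseteq> {0..1}" using F by (auto simp: G_def)
  define f where "f n X = (\<Prod>t\<in>G. real (Suc n) * occupation (window n t) (window n t + 1 / Suc n) (\<phi> t) X)" for n X
  have sp: "space P = paths E" "space P' = paths E"
    using sets_eq_imp_space_eq[OF P(2)] sets_eq_imp_space_eq[OF P'(2)] by auto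
  have f01: "0 \<le> f n X \<and> f n X \<le> 1" for n X
  proof -
    have "0 \<le> real (Suc n) * occupation (window n t) (window n t + 1 / Suc n) (\<phi> t) X \<and>
      real (Suc n) * occupation (window n t) (window n t + 1 / Suc n) (\<phi> t) X \<le> 1" if "t \<in> G" for t
      using occupation_bounds[of t n "\<phi> t" X] that G(2) by blast
    then show ?thesis unfolding f_def by (intro conjI prod_nonneg prod_le_1) blast+
  qed
  have fm: "f n \<in> borel_measurable (path_space E)" for n
  proof -
    have "occupation (window n t) (window n t + 1 / Suc n) (\<phi> t) \<in> borel_measurable (path_space E)" if "t \<in> G" for t
    proof -
      have t: "t \<in> {0..1}" using that G by auto
      have wb: "0 \<le> window n t" "window n t \<le> window n t + 1 / Suc n" "window n t + 1 / Suc n \<le> 1"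
        using window_bounds[OF t, of n] by auto
      have "occupation (window n t) (window n t + 1 / Suc n) (\<phi> t) = expo (\<lambda>_. indicator {\<phi> t}) (window n t) (window n t + 1 / Suc n)"
        by (simp add: fun_eq_iff occupation_def expo_def)
      then show ?thesis using measurable_path_events_mono[OF expo_measurable[OF wb, where c = "\<lambda>_. indicator {\<phi> t}" and E = E], of "{0..1}"] wb by auto
    qed
    then show ?thesis unfolding f_def by measurable
  qed
  have fc: "continuous_map (skorokhod_topology E) euclideanreal (f n)" for n
    unfolding f_def
  proof (intro continuous_map_prod G(1) continuous_map_real_mult)
    fix t assume "t \<in> G"
    then have t: "t \<in> {0..1}" using G by auto
    show "continuous_map (skorokhod_topology E) euclideanreal (occupation (window n t) (window n t + 1 / Suc n) (\<phi> t))"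
      by (rule occupation_continuous) (use window_bounds[OF t, of n] in auto)
  qed auto
  have same: "(\<integral>X. f n X \<partial>P) = (\<integral>X. f n X \<partial>P')" for n
  proof (rule LIMSEQ_unique)
    have "bounded (f n ` topspace (skorokhod_topology E))"
      by (rule boundedI[where B = 1]) (use f01 in auto)
    then show "(\<lambda>k. \<integral>X. f n X \<partial>Ps k) \<longlonglongrightarrow> (\<integral>X. f n X \<partial>P)"
      using nar fc unfolding narrow_conv_def by blast
    show "(\<lambda>k. \<integral>X. f n X \<partial>Ps k) \<longlonglongrightarrow> (\<integral>X. f n X \<partial>P')"
      by (rule conv) (use fm f01 in auto)
  qed
  have lim: "(\<lambda>n. f n X) \<longlonglongrightarrow> indicator (cyl E G \<phi>) X" if X: "X \<in> paths E" for X
  proof -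
    have "(\<lambda>n. f n X) \<longlonglongrightarrow> (\<Prod>t\<in>G. indicator {\<phi> t} (X t))"
      unfolding f_def using G by (intro tendsto_prod occupation_converges[OF X]) auto
    also have "(\<Prod>t\<in>G. indicator {\<phi> t} (X t)) = (indicator (cyl E G \<phi>) X :: real)"
    proof (cases "\<forall>t\<in>G. X t = \<phi> t")
      case True then show ?thesis using X by (simp add: cyl_def)
    next
      case False
      then obtain t where "t \<in> G" "X t \<noteq> \<phi> t" by blast
      then have "\<exists>t\<in>G. indicator {\<phi> t} (X t) = (0::real)" by (intro bexI[of _ t]) auto
      then show ?thesis using False G(1) by (simp add: cyl_def prod_zero)
    qed
    finally show ?thesis .
  qed
  have cs: "cyl E G \<phi> \<in> sets (path_space E)" using G by (intro cyl_sets)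
  have conv_R: "(\<lambda>n. \<integral>X. f n X \<partial>R) \<longlonglongrightarrow> measure R (cyl E G \<phi>)" if R: "prob_space R" "sets R = sets (path_space E)" for R
  proof -
    interpret R: prob_space R by (rule R(1))
    have spR: "space R = paths E" using sets_eq_imp_space_eq[OF R(2)] by simp
    have "(\<lambda>n. \<integral>X. f n X \<partial>R) \<longlonglongrightarrow> (\<integral>X. indicator (cyl E G \<phi>) X \<partial>R)"
    proof (rule integral_dominated_convergence[where w = "\<lambda>_. 1"])
      show "f n \<in> borel_measurable R" for n using fm[of n] measurable_cong_sets[OF R(2) refl] by blast
      show "AE X in R. norm (f n X) \<le> 1" for n using f01 by simp
    qed (use lim spR cs R(2) in auto)
    then show ?thesis using cs R(2) sets.sets_into_space[of "cyl E G \<phi>" R] by (simp add: Int_absorb2)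
  qed
  have "measure P (cyl E G \<phi>) = measure P' (cyl E G \<phi>)"
    using conv_R[OF P] conv_R[OF P'] unfolding same by (rule LIMSEQ_unique)
  then show "emeasure P (cyl E (insert 0 F) \<phi>) = emeasure P' (cyl E (insert 0 F) \<phi>)"
    by (simp add: G_def P.emeasure_eq_measure P'.emeasure_eq_measure)
qed

section \<open>Relative entropy of densities\<close>

text \<open>The tangent of the convex function \<open>x * ln x\<close> at \<open>b\<close> lies
  below it. The comparisons of entropies below rest on this.\<close>

lemma ln_tangent:
  fixes a b :: real
  assumes "0 \<le> a" "0 < b"
  shows "b * ln b + (1 + ln b) * (a - b) \<le> a * ln a"
proof (cases "a = 0")
  case False
  then have a: "a > 0" using assms by simp
  have "ln (b / a) \<le> b / a - 1" using a assms by (intro ln_le_minus_one) auto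
  then have "a * (ln b - ln a) \<le> a * (b / a - 1)" using a assms by (intro mult_left_mono) (auto simp: ln_div)
  then show ?thesis using a by (simp add: algebra_simps)
qed (use assms in \<open>simp add: algebra_simps\<close>)

lemma integrable_density_ln:
  fixes q :: "'b \<Rightarrow> real"
  assumes q: "q \<in> borel_measurable r" "\<And>x. 0 \<le> q x"
  shows "integrable (density r (\<lambda>x. ennreal (q x))) (\<lambda>x. ln (q x)) \<longleftrightarrow> integrable r (\<lambda>x. q x * ln (q x))"
    and "(\<integral>x. ln (q x) \<partial>density r (\<lambda>x. ennreal (q x))) = (\<integral>x. q x * ln (q x) \<partial>r)"
  using q integrable_density[of "\<lambda>x. ln (q x)" r q] integral_density[of "\<lambda>x. ln (q x)" r q] by auto

text \<open>For a finite reference measure the negative part is integrable, since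
  \<open>- (f x * ln (f x)) \<le> 1\<close>; the difference of the two extended integrals is thus
  never infinity minus infinity.\<close>

lemma rel_entropy_finite_density:
  fixes f :: "'b \<Rightarrow> real"
  assumes r: "finite_measure r" and f: "f \<in> borel_measurable r" "\<And>x. 0 \<le> f x"
    and p: "p = density r (\<lambda>x. ennreal (f x))" "prob_space p"
  shows "rel_entropy_finite p r = (if integrable p (\<lambda>x. ln (f x)) then ereal (\<integral>x. ln (f x) \<partial>p) else \<infinity>)"
proof -
  interpret r: finite_measure r by (rule r)
  interpret p: prob_space p by (rule p(2))
  have ac: "absolutely_continuous r p" unfolding p(1) using f by (intro absolutely_continuousI_density) auto
  have fp: "(\<lambda>x. ln (f x)) \<in> borel_measurable p" using f p(1) by simp
  have "AE x in r. ennreal (f x) = RN_deriv r p x" using f p(1) by (intro r.RN_deriv_unique) auto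
  then have "AE x in p. ennreal (f x) = RN_deriv r p x"     using absolutely_continuous_AE[of p r "\<lambda>x. ennreal (f x) = RN_deriv r p x"] ac p(1) by simp
  then have AE: "AE x in p. ln (enn2real (RN_deriv r p x)) = ln (f x)"
    by eventually_elim (metis enn2real_ennreal f(2))
  define I J where "I = (\<integral>\<^sup>+x. ennreal (ln (f x)) \<partial>p)" and "J = (\<integral>\<^sup>+x. ennreal (- ln (f x)) \<partial>p)"
  have IJ: "rel_entropy_finite p r = enn2ereal I - enn2ereal J"
  proof -
    have "(\<integral>\<^sup>+x. ennreal (ln (enn2real (RN_deriv r p x))) \<partial>p) = I" unfolding I_def
      by (intro nn_integral_cong_AE) (use AE in \<open>auto elim: eventually_mono\<close>)
    moreover have "(\<integral>\<^sup>+x. ennreal (- ln (enn2real (RN_deriv r p x))) \<partial>p) = J" unfolding J_def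
      by (intro nn_integral_cong_AE) (use AE in \<open>auto elim: eventually_mono\<close>)
    ultimately show ?thesis using ac by (simp add: rel_entropy_finite_def)
  qed
  have "J = (\<integral>\<^sup>+x. ennreal (f x) * ennreal (- ln (f x)) \<partial>r)"
    unfolding J_def p(1) using f by (intro nn_integral_density) auto
  also have "\<dots> \<le> (\<integral>\<^sup>+x. 1 \<partial>r)"
  proof (rule nn_integral_mono)
    fix x
    have "f x * (- ln (f x)) \<le> 1" using ln_tangent[of "f x" 1] f(2)[of x] by simp
    then have "ennreal (f x * (- ln (f x))) \<le> ennreal 1" by (rule ennreal_leI)
    then show "ennreal (f x) * ennreal (- ln (f x)) \<le> 1" using f(2)[of x] by (simp add: ennreal_mult'[symmetric])
  qed
  also have "\<dots> < \<infinity>" by (simp add: r.emeasure_eq_measure)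
  finally have J: "J < \<infinity>" .
  show ?thesis
  proof (cases "integrable p (\<lambda>x. ln (f x))")
    case True
    then have I: "I \<noteq> \<infinity>" unfolding real_integrable_def I_def by simp
    have "(\<integral>x. ln (f x) \<partial>p) = enn2real I - enn2real J" unfolding I_def J_def by (rule real_lebesgue_integral_def[OF True])
    moreover obtain i where "I = ennreal i" "0 \<le> i" using I by (cases I) auto
    moreover obtain k where "J = ennreal k" "0 \<le> k" using J by (cases J) auto
    ultimately show ?thesis using True IJ by (simp add: enn2ereal_ennreal)
  next
    case False
    then have "I = \<infinity>" unfolding real_integrable_def using fp J by (auto simp: I_def J_def)
    moreover obtain b where "enn2ereal J = ereal b" using J by (cases J) auto
    ultimately show ?thesis using False IJ by simp
  qed
qed

text \<open>Relative to the normalised weighted measure the density is \<open>q * z * exp W\<close>,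
  with logarithm \<open>ln q + W + ln z\<close>; the two subtractions restore the integral of
  \<open>ln q\<close> for every admissible \<open>W\<close>.\<close>

lemma weighted_entropy:
  fixes q :: "'b \<Rightarrow> real"
  assumes r: "\<not> finite_measure r" and q: "q \<in> borel_measurable r" "\<And>x. 0 \<le> q x"
    and p: "p = density r (\<lambda>x. ennreal (q x))" "prob_space p" and W: "W \<in> entropy_weights p r"
  shows "(let z = (\<integral>x. exp (- W x) \<partial>r) in
        rel_entropy_finite p (density r (\<lambda>x. ennreal (exp (- W x) / z))) - ereal (\<integral>x. W x \<partial>p) - ereal (ln z)) =
      (if integrable p (\<lambda>x. ln (q x)) then ereal (\<integral>x. ln (q x) \<partial>p) else \<infinity>)"
proof -
  interpret p: prob_space p by (rule p(2))
  have Wm: "W \<in> borel_measurable r" and Wi: "integrable r (\<lambda>x. exp (- W x))" and Wp: "integrable p W"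
    using W by (auto simp: entropy_weights_def)
  define z where "z = (\<integral>x. exp (- W x) \<partial>r)"
  define rW where "rW = density r (\<lambda>x. ennreal (exp (- W x) / z))"
  \<comment> \<open>An infinite measure is not zero, so the integral of the positive function
    \<open>exp (- W)\<close> is positive.\<close>
  have z: "z > 0"
  proof (rule ccontr)
    assume "\<not> z > 0"
    moreover have "z \<ge> 0" unfolding z_def by simp
    ultimately have "z = 0" by simp
    then have "AE x in r. exp (- W x) = 0" unfolding z_def
      using Bochner_Integration.integral_nonneg_eq_0_iff_AE[OF Wi] by simp
    then have "AE x in r. False" by eventually_elim simp
    then have "emeasure r (space r) = 0" by (subst (asm) AE_iff_measurable[where N = "space r"]) auto
    then show False using r by (auto intro: finite_measureI)
  qed
  have fin: "finite_measure rW"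
  proof (rule finite_measureI)
    have "emeasure rW (space rW) = (\<integral>\<^sup>+x. ennreal (exp (- W x) / z) \<partial>r)"
      unfolding rW_def using Wm by (subst emeasure_density) (auto intro!: nn_integral_cong)
    also have "\<dots> < \<infinity>" using integrableD(2)[of r "\<lambda>x. exp (- W x) / z"] Wi z by (simp add: top.not_eq_extremum)
    finally show "emeasure rW (space rW) \<noteq> \<infinity>" by simp
  qed
  define f where "f x = q x * (z * exp (W x))" for x
  have pf: "p = density rW (\<lambda>x. ennreal (f x))"
  proof -
    have "density rW (\<lambda>x. ennreal (f x)) = density r (\<lambda>x. ennreal (exp (- W x) / z) * ennreal (f x))"
      unfolding rW_def using Wm q by (intro density_density_eq) (auto simp: f_def)
    also have "(\<lambda>x. ennreal (exp (- W x) / z) * ennreal (f x)) = (\<lambda>x. ennreal (q x))"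
      using z q(2) by (auto simp: f_def fun_eq_iff ennreal_mult[symmetric] exp_minus field_simps)
    finally show ?thesis using p(1) by simp
  qed
  have e: "rel_entropy_finite p rW = (if integrable p (\<lambda>x. ln (f x)) then ereal (\<integral>x. ln (f x) \<partial>p) else \<infinity>)"
    by (rule rel_entropy_finite_density[OF fin _ _ pf p(2)]) (use Wm q z in \<open>auto simp: f_def rW_def\<close>)
  have mp: "W \<in> borel_measurable p" "q \<in> borel_measurable p" using Wm q p(1) by auto
  have "AE x in p. 0 < q x" unfolding p(1) using q by (subst AE_density) (auto simp: less_le)
  then have AE: "AE x in p. ln (f x) = ln (q x) + (W x + ln z)"
    by eventually_elim (use z in \<open>simp add: f_def ln_mult\<close>)
  have iW: "integrable p (\<lambda>x. W x + ln z)" using Wp by simp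
  have cong: "integrable p (\<lambda>x. ln (f x)) \<longleftrightarrow> integrable p (\<lambda>x. ln (q x) + (W x + ln z))"
    by (rule integrable_cong_AE) (use mp AE in \<open>auto simp: f_def\<close>)
  have iff: "integrable p (\<lambda>x. ln (f x)) \<longleftrightarrow> integrable p (\<lambda>x. ln (q x))"
  proof
    assume "integrable p (\<lambda>x. ln (f x))"
    then have "integrable p (\<lambda>x. (ln (q x) + (W x + ln z)) - (W x + ln z))"
      unfolding cong using iW by (rule Bochner_Integration.integrable_diff)
    then show "integrable p (\<lambda>x. ln (q x))" by simp
  next
    assume "integrable p (\<lambda>x. ln (q x))"
    then show "integrable p (\<lambda>x. ln (f x))" unfolding cong using iW by (rule Bochner_Integration.integrable_add)
  qed
  have int: "(\<integral>x. ln (f x) \<partial>p) = (\<integral>x. ln (q x) \<partial>p) + (\<integral>x. W x \<partial>p) + ln z" if "integrable p (\<lambda>x. ln (q x))"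
  proof -
    have "(\<integral>x. ln (f x) \<partial>p) = (\<integral>x. ln (q x) + (W x + ln z) \<partial>p)"
      by (rule integral_cong_AE) (use mp AE in \<open>auto simp: f_def\<close>)
    then show ?thesis using that Wp by (simp add: p.prob_space)
  qed
  show ?thesis unfolding Let_def z_def[symmetric] rW_def[symmetric] e iff using int by auto
qed

text \<open>All admissible weights give the same value, so the infimum is that value, or
  \<open>\<infinity>\<close> over the empty set of weights.\<close>

lemma rel_entropy_density:
  fixes q :: "'b \<Rightarrow> real"
  assumes q: "q \<in> borel_measurable r" "\<And>x. 0 \<le> q x"
    and p: "p = density r (\<lambda>x. ennreal (q x))" "prob_space p"
  shows "rel_entropy p r < \<infinity> \<longleftrightarrow> integrable p (\<lambda>x. ln (q x)) \<and> (finite_measure r \<or> entropy_weights p r \<noteq> {})"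
    and "rel_entropy p r < \<infinity> \<Longrightarrow> rel_entropy p r = ereal (\<integral>x. ln (q x) \<partial>p)"
proof -
  have fin: "rel_entropy p r = (if integrable p (\<lambda>x. ln (q x)) then ereal (\<integral>x. ln (q x) \<partial>p) else \<infinity>)" if "finite_measure r"
    using rel_entropy_finite_density[OF that q p] that by (simp add: rel_entropy_def)
  have inf: "rel_entropy p r = (INF W\<in>entropy_weights p r. if integrable p (\<lambda>x. ln (q x)) then ereal (\<integral>x. ln (q x) \<partial>p) else \<infinity>)"
    if "\<not> finite_measure r"
    unfolding rel_entropy_def using that weighted_entropy[OF that q p] by (simp cong: INF_cong)
  have inf': "rel_entropy p r = (if integrable p (\<lambda>x. ln (q x)) \<and> entropy_weights p r \<noteq> {} then ereal (\<integral>x. ln (q x) \<partial>p) else \<infinity>)"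
    if "\<not> finite_measure r"
    unfolding inf[OF that] by (cases "entropy_weights p r = {}") (auto simp: top_ereal_def)
  show "rel_entropy p r < \<infinity> \<longleftrightarrow> integrable p (\<lambda>x. ln (q x)) \<and> (finite_measure r \<or> entropy_weights p r \<noteq> {})"
    using fin inf' by (cases "finite_measure r") auto
  show "rel_entropy p r < \<infinity> \<Longrightarrow> rel_entropy p r = ereal (\<integral>x. ln (q x) \<partial>p)"
    using fin inf' by (cases "finite_measure r") (auto split: if_splits)
qed

lemma rel_entropy_absolutely_continuous:
  assumes "rel_entropy p r < \<infinity>" shows "absolutely_continuous r p"
proof (cases "finite_measure r")
  case True
  then show ?thesis using assms by (auto simp: rel_entropy_def rel_entropy_finite_def split: if_splits)
next
  case False
  then obtain W where W: "W \<in> entropy_weights p r"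
    "(let z = (\<integral>x. exp (- W x) \<partial>r) in rel_entropy_finite p (density r (\<lambda>x. ennreal (exp (- W x) / z))) - ereal (\<integral>x. W x \<partial>p) - ereal (ln z)) < \<infinity>"
    using assms unfolding rel_entropy_def if_not_P[OF False] INF_less_iff by blast
  define rW where "rW = density r (\<lambda>x. ennreal (exp (- W x) / (\<integral>x. exp (- W x) \<partial>r)))"
  have Wm: "W \<in> borel_measurable r" using W(1) by (simp add: entropy_weights_def)
  have "rel_entropy_finite p rW \<noteq> \<infinity>" using W(2) by (auto simp: Let_def rW_def)
  then have "absolutely_continuous rW p" by (auto simp: rel_entropy_finite_def split: if_splits)
  moreover have "absolutely_continuous r rW" unfolding rW_def using Wm by (intro absolutely_continuousI_density) auto
  ultimately show ?thesis by (auto simp: absolutely_continuous_def)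
qed

text \<open>The weight \<open>W\<close> is replaced by zero on the set where the density is modified, which has finite
  reference measure, so that it stays admissible.\<close>

lemma rel_entropy_local_change:
  fixes q q' :: "'b \<Rightarrow> real"
  assumes q: "q \<in> borel_measurable r" "\<And>x. 0 \<le> q x" and q': "q' \<in> borel_measurable r" "\<And>x. 0 \<le> q' x"
    and p: "p = density r (\<lambda>x. ennreal (q x))" "prob_space p"
    and p': "p' = density r (\<lambda>x. ennreal (q' x))" "prob_space p'"
    and A: "A \<in> sets r" "emeasure r A < \<infinity>" and off: "\<And>x. x \<in> space r \<Longrightarrow> x \<notin> A \<Longrightarrow> q' x = q x"
    and B: "\<And>x. x \<in> A \<Longrightarrow> q' x \<le> B"
    and le: "set_integrable r A (\<lambda>x. q x * ln (q x)) \<Longrightarrow> (LINT x:A|r. q' x * ln (q' x)) \<le> (LINT x:A|r. q x * ln (q x))"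
  shows "rel_entropy p' r \<le> rel_entropy p r"
proof (cases "rel_entropy p r < \<infinity>")
  case True
  note rp = rel_entropy_density[OF q p]
  have i: "integrable r (\<lambda>x. q x * ln (q x))" using True rp(1) integrable_density_ln(1)[OF q] p(1) by simp
  have sA: "set_integrable r A (\<lambda>x. q x * ln (q x))" and sC: "set_integrable r (space r - A) (\<lambda>x. q x * ln (q x))"
    unfolding set_integrable_def using i A by (auto intro!: integrable_mult_indicator simp del: real_scaleR_def)
  define B1 where "B1 = max 1 B"
  have b: "\<bar>q' x * ln (q' x)\<bar> \<le> 1 + B1 * B1" if "x \<in> A" for x
  proof (cases "q' x \<le> 1")
    case True
    have "- 1 \<le> q' x * ln (q' x)" using ln_tangent[of "q' x" 1] q'(2)[of x] by simp
    moreover have "q' x * ln (q' x) \<le> 0"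
    proof (cases "q' x = 0")
      case False
      then have "0 < q' x" using q'(2)[of x] by simp
      then show ?thesis using True by (intro mult_nonneg_nonpos) auto
    qed simp
    moreover have "0 \<le> B1 * B1" by simp
    ultimately show ?thesis by linarith
  next
    case False
    then have "ln (q' x) \<le> q' x - 1" by (intro ln_le_minus_one) auto
    then have "0 \<le> ln (q' x)" "ln (q' x) \<le> B1" "q' x \<le> B1" using False B[OF that] by (auto simp: B1_def)
    then have "\<bar>q' x * ln (q' x)\<bar> \<le> B1 * B1" unfolding abs_mult using q'(2)[of x] by (intro mult_mono) auto
    then show ?thesis by linarith
  qed
  have sA': "set_integrable r A (\<lambda>x. q' x * ln (q' x))"
    using A q' b by (intro set_integrable_bounded[where B = "1 + B1 * B1"]) auto
  have sC': "set_integrable r (space r - A) (\<lambda>x. q' x * ln (q' x))"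
    using sC off by (subst set_integrable_cong[OF refl refl, where f' = "\<lambda>x. q x * ln (q x)"]) auto
  have split: "integrable r h \<and> (\<integral>x. h x \<partial>r) = (LINT x:A|r. h x) + (LINT x:space r - A|r. h x)"
    if "set_integrable r A h" "set_integrable r (space r - A) h" for h :: "'b \<Rightarrow> real"
  proof -
    have "indicator A x *\<^sub>R h x + indicator (space r - A) x *\<^sub>R h x = h x" if "x \<in> space r" for x using that by (auto simp: indicator_def)
    then have eq: "integrable r (\<lambda>x. indicator A x *\<^sub>R h x + indicator (space r - A) x *\<^sub>R h x) \<longleftrightarrow> integrable r h"
      "(\<integral>x. indicator A x *\<^sub>R h x + indicator (space r - A) x *\<^sub>R h x \<partial>r) = (\<integral>x. h x \<partial>r)"
      by (auto intro!: Bochner_Integration.integrable_cong Bochner_Integration.integral_cong)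
    then show ?thesis using that unfolding set_integrable_def set_lebesgue_integral_def
      by (metis Bochner_Integration.integrable_add Bochner_Integration.integral_add)
  qed
  have i': "integrable r (\<lambda>x. q' x * ln (q' x))" using split[OF sA' sC'] by simp
  have "(LINT x:space r - A|r. q' x * ln (q' x)) = (LINT x:space r - A|r. q x * ln (q x))"
    using off A by (intro set_lebesgue_integral_cong) auto
  then have int_le: "(\<integral>x. q' x * ln (q' x) \<partial>r) \<le> (\<integral>x. q x * ln (q x) \<partial>r)"
    using split[OF sA' sC'] split[OF sA sC] le[OF sA] by simp
  have W: "finite_measure r \<or> entropy_weights p' r \<noteq> {}"
  proof (cases "finite_measure r")
    case False
    then obtain W where "W \<in> entropy_weights p r" using True rp(1) by auto
    then have W: "W \<in> borel_measurable r" "\<And>x. x \<in> space r \<Longrightarrow> 0 \<le> W x" "integrable r (\<lambda>x. exp (- W x))" "integrable p W"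
      by (auto simp: entropy_weights_def)
    define W' where "W' x = indicator (space r - A) x * W x" for x
    have W'm: "W' \<in> borel_measurable r" unfolding W'_def using W(1) A by simp
    have "set_integrable r A (\<lambda>x. exp (- W' x))"
    proof (rule set_integrable_bounded[OF A, where B = 1])
      show "(\<lambda>x. exp (- W' x)) \<in> borel_measurable r" using W'm by simp
    qed (auto simp: W'_def)
    moreover have "set_integrable r (space r - A) (\<lambda>x. exp (- W' x))"
    proof -
      have "set_integrable r (space r - A) (\<lambda>x. exp (- W x))"
        unfolding set_integrable_def using W(3) A by (auto intro!: integrable_mult_indicator simp del: real_scaleR_def)
      then show ?thesis by (subst set_integrable_cong[OF refl refl, where f' = "\<lambda>x. exp (- W x)"]) (auto simp: W'_def)
    qed
    ultimately have e: "integrable r (\<lambda>x. exp (- W' x))" using split by blast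
    have "integrable r (\<lambda>x. q x * W x)" using W(1,4) q p(1) integrable_density[of W r q] by auto
    then have "integrable r (\<lambda>x. indicator (space r - A) x *\<^sub>R (q x * W x))"
      using A by (intro integrable_mult_indicator) auto
    then have "integrable r (\<lambda>x. q' x * W' x)"
      by (rule Bochner_Integration.integrable_cong[THEN iffD1, OF refl, rotated]) (use off in \<open>auto simp: W'_def indicator_def\<close>)
    then have "integrable p' W'" unfolding p'(1) using W'm q' integrable_density[of W' r q'] by auto
    then have "W' \<in> entropy_weights p' r" using e W'm W(2) by (auto simp: entropy_weights_def W'_def)
    then show ?thesis by blast
  qed simp
  note rp' = rel_entropy_density[OF q' p']
  have "rel_entropy p' r < \<infinity>" using rp'(1) W i' integrable_density_ln(1)[OF q'] p'(1) by simp
  then have "rel_entropy p' r = ereal (\<integral>x. q' x * ln (q' x) \<partial>r)"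
    using rp'(2) integrable_density_ln(2)[OF q'] p'(1) by simp
  moreover have "rel_entropy p r = ereal (\<integral>x. q x * ln (q x) \<partial>r)"
    using rp(2)[OF True] integrable_density_ln(2)[OF q] p(1) by simp
  ultimately show ?thesis using int_le by simp
qed auto

section \<open>Factorization of the Schroedinger minimizer\<close>

context markov_path
begin

abbreviation cell :: "'a \<Rightarrow> 'a \<Rightarrow> (real \<Rightarrow> 'a) set" where
  "cell x y \<equiv> at_time E 0 x \<inter> at_time E 1 y"

lemma cell_sets: "sets P = sets (path_space E) \<Longrightarrow> cell x y \<in> sets P"
  using at_time_sets[of 0 "{0..1}" E x] at_time_sets[of 1 "{0..1}" E y] by auto

lemma cell_finite: "emeasure Q (cell x y) < \<infinity>"
proof -
  have "emeasure Q (cell x y) \<le> emeasure Q (at_time E 0 x)" using at_time_Q[of 0 x] by (intro emeasure_mono) auto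
  then show ?thesis using at_time_finite[of 0 x] by (auto intro: le_less_trans)
qed

lemma emeasure_cells:
  assumes P: "sets P = sets (path_space E)" and B: "B \<in> sets P"
  shows "emeasure P B = (\<integral>\<^sup>+p. emeasure P (B \<inter> cell (fst p) (snd p)) \<partial>count_space UNIV)"
proof -
  have "space P = paths E" using sets_eq_imp_space_eq[OF P] by simp
  then have "B \<subseteq> paths E" using sets.sets_into_space[OF B] by simp
  then have "B = (\<Union>p. B \<inter> cell (fst p) (snd p))" by auto
  then have "emeasure P B = emeasure P (\<Union>p. B \<inter> cell (fst p) (snd p))" by simp
  also have "\<dots> = (\<integral>\<^sup>+p. emeasure P (B \<inter> cell (fst p) (snd p)) \<partial>count_space UNIV)"
  proof (rule emeasure_UN_countable)
    show "B \<inter> cell (fst p) (snd p) \<in> sets P" for p using B cell_sets[OF P] by blast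
    show "disjoint_family_on (\<lambda>p. B \<inter> cell (fst p) (snd p)) UNIV" by (auto simp: disjoint_family_on_def prod_eq_iff)
  qed auto
  finally show ?thesis .
qed

lemma measure_eq_on_cells:
  assumes P: "sets P = sets (path_space E)" and P': "sets P' = sets (path_space E)"
    and eq: "\<And>B x y. B \<in> sets (path_space E) \<Longrightarrow> emeasure P (B \<inter> cell x y) = emeasure P' (B \<inter> cell x y)"
  shows "P = P'"
proof (rule measure_eqI)
  show "sets P = sets P'" using P P' by simp
  show "emeasure P B = emeasure P' B" if "B \<in> sets P" for B
  proof -
    have B: "B \<in> sets (path_space E)" "B \<in> sets P'" using that P P' by auto
    show ?thesis unfolding emeasure_cells[OF P that] emeasure_cells[OF P' B(2)] eq[OF B(1)] ..
  qed
qed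

lemma marginal_eqI:
  assumes P: "sets P = sets (path_space E)" and P': "sets P' = sets (path_space E)" and t: "t \<in> {0..1}"
    and eq: "\<And>x. emeasure P' (at_time E t x) = emeasure P (at_time E t x)"
  shows "marginal P' t = marginal P t"
proof (rule measure_eqI_countable[where A = UNIV])
  have m: "(\<lambda>X. X t) \<in> P \<rightarrow>\<^sub>M count_space UNIV" "(\<lambda>X. X t) \<in> P' \<rightarrow>\<^sub>M count_space UNIV"
    using coord_measurable[OF t, of E] measurable_cong_sets[OF P refl] measurable_cong_sets[OF P' refl] by blast+
  have sp: "space P = paths E" "space P' = paths E" using sets_eq_imp_space_eq[OF P] sets_eq_imp_space_eq[OF P'] by auto
  show "emeasure (marginal P' t) {x} = emeasure (marginal P t) {x}" for x
    using eq[of x] m sp by (simp add: emeasure_distr vimage_def Int_def conj_commute)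
qed auto

text \<open>Outside \<open>A\<close> nothing moves, and inside \<open>A\<close> the masses of the
  initial and of the terminal states are kept. Total mass 1 then follows from the initial
  marginal.\<close>

lemma walks_between_local_change:
  assumes P: "P \<in> walks_between E \<mu>0 \<mu>1" and P': "sets P' = sets (path_space E)" and A: "A \<in> sets (path_space E)"
    and off: "\<And>B. B \<in> sets (path_space E) \<Longrightarrow> B \<inter> A = {} \<Longrightarrow> emeasure P' B = emeasure P B"
    and mass: "\<And>x. emeasure P' (A \<inter> at_time E 0 x) = emeasure P (A \<inter> at_time E 0 x)"
      "\<And>y. emeasure P' (A \<inter> at_time E 1 y) = emeasure P (A \<inter> at_time E 1 y)"
  shows "P' \<in> walks_between E \<mu>0 \<mu>1"
proof -
  have sP: "sets P = sets (path_space E)" and pP: "prob_space P" using P by (auto simp: walks_between_def)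
  have eq: "emeasure P' (at_time E t x) = emeasure P (at_time E t x)" if "t = 0 \<or> t = 1" for t x
  proof -
    have T: "at_time E t x \<in> sets (path_space E)" using at_time_sets[of t "{0..1}" E x] that by auto
    have "emeasure R (at_time E t x) = emeasure R (A \<inter> at_time E t x) + emeasure R (at_time E t x - A)"
      if sR: "sets R = sets (path_space E)" for R
    proof -
      have "(A \<inter> at_time E t x) \<union> (at_time E t x - A) = at_time E t x" by blast
      moreover have "(A \<inter> at_time E t x) \<inter> (at_time E t x - A) = {}" by blast
      moreover have "A \<inter> at_time E t x \<in> sets R" "at_time E t x - A \<in> sets R" using T A unfolding sR by auto
      ultimately show ?thesis using plus_emeasure[of "A \<inter> at_time E t x" R "at_time E t x - A"] by simp
    qed
    moreover have "at_time E t x - A \<in> sets (path_space E)" using T A by auto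
    moreover have "emeasure P' (at_time E t x - A) = emeasure P (at_time E t x - A)" by (rule off[OF calculation(2)]) blast
    moreover have "emeasure P' (A \<inter> at_time E t x) = emeasure P (A \<inter> at_time E t x)" using mass that by blast
    ultimately show ?thesis using P' sP by simp
  qed
  have "marginal P' 0 = marginal P 0" "marginal P' 1 = marginal P 1"
    using marginal_eqI[OF sP P'] eq by auto
  moreover have "prob_space P'"
  proof -
    have "prob_space (marginal P' 0)" using \<open>marginal P' 0 = marginal P 0\<close> P by (simp add: walks_between_def measure_pmf.prob_space_axioms)
    then show ?thesis
    proof (rule prob_space_distrD[rotated])
      show "(\<lambda>X. X 0) \<in> P' \<rightarrow>\<^sub>M count_space UNIV"
        using coord_measurable[of 0 "{0..1}" E] measurable_cong_sets[OF P' refl] by auto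
    qed
  qed
  ultimately show ?thesis using P P' by (simp add: walks_between_def)
qed

definition end_density :: "('a \<Rightarrow> 'a \<Rightarrow> real) \<Rightarrow> (real \<Rightarrow> 'a) measure" where
  "end_density h = density Q (\<lambda>X. ennreal (h (X 0) (X 1)))"

lemma ends_measurable: "(\<lambda>X. (h (X 0) (X 1) :: real)) \<in> borel_measurable Q"
  by (rule measurable_Q[OF coord2_compose_measurable[of 0 "{0..1}" 1]]) auto

lemma sets_end_density: "sets (end_density h) = sets (path_space E)"
  by (simp add: end_density_def sets_Q)

lemma end_density_cell:
  assumes B: "B \<in> sets (path_space E)"
  shows "emeasure (end_density h) (B \<inter> cell x y) = ennreal (h x y) * emeasure Q (B \<inter> cell x y)"
proof -
  have BC: "B \<inter> cell x y \<in> sets Q" using B cell_sets[OF sets_Q] sets_Q by blast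
  have "emeasure (end_density h) (B \<inter> cell x y) = (\<integral>\<^sup>+X. ennreal (h (X 0) (X 1)) * indicator (B \<inter> cell x y) X \<partial>Q)"
    unfolding end_density_def using BC ends_measurable[of h] by (subst emeasure_density) auto
  also have "\<dots> = (\<integral>\<^sup>+X. ennreal (h x y) * indicator (B \<inter> cell x y) X \<partial>Q)"
    by (intro nn_integral_cong) (auto simp: indicator_def)
  also have "\<dots> = ennreal (h x y) * emeasure Q (B \<inter> cell x y)" using BC by (simp add: nn_integral_cmult)
  finally show ?thesis .
qed

end

section \<open>The Schroedinger minimizer as a reweighting of the endpoints\<close>

locale schroedinger = markov_path E Q
  for E :: "'a::countable \<Rightarrow> 'a \<Rightarrow> bool" and Q :: "(real \<Rightarrow> 'a) measure" +
  fixes \<mu>0 \<mu>1 :: "'a pmf" and P :: "(real \<Rightarrow> 'a) measure"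
  assumes cell_pos: "\<And>x y. 0 < measure Q (cell x y)"
    and minimal: "unique_arg_min (\<lambda>R. rel_entropy R Q) (walks_between E \<mu>0 \<mu>1) P"
begin

lemma P_walk: "P \<in> walks_between E \<mu>0 \<mu>1"
  using minimal by (simp add: unique_arg_min_def is_arg_min_def)

lemma sets_P: "sets P = sets (path_space E)" and prob_P: "prob_space P"
  using P_walk by (auto simp: walks_between_def)

lemma P_unique:
  assumes R: "R \<in> walks_between E \<mu>0 \<mu>1" and le: "rel_entropy R Q \<le> rel_entropy P Q" shows "R = P"
proof -
  have "\<not> rel_entropy S Q < rel_entropy R Q" if "S \<in> walks_between E \<mu>0 \<mu>1" for S
    using minimal that le unfolding unique_arg_min_def is_arg_min_def by (meson less_le_trans)
  then show ?thesis using minimal R unfolding unique_arg_min_def is_arg_min_def by blast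
qed

abbreviation r :: "'a \<Rightarrow> 'a \<Rightarrow> real" where "r x y \<equiv> measure Q (cell x y)"
abbreviation \<pi> :: "'a \<Rightarrow> 'a \<Rightarrow> real" where "\<pi> x y \<equiv> measure P (cell x y)"

lemma emeasure_r: "emeasure Q (cell x y) = ennreal (r x y)"
  by (intro emeasure_eq_ennreal_measure) (use cell_finite[of x y] in auto)

lemma sigma_finite_Q: "sigma_finite_measure Q"
proof
  have "emeasure Q (at_time E 0 x) \<noteq> \<infinity>" for x using at_time_finite[of 0 x] by auto
  then show "\<exists>A. countable A \<and> A \<subseteq> sets Q \<and> \<Union> A = space Q \<and> (\<forall>a\<in>A. emeasure Q a \<noteq> \<infinity>)"
    using at_time_Q[of 0] space_Q by (intro exI[of _ "range (at_time E 0)"]) auto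
qed

text \<open>Averaging the density over a cell of fixed endpoints keeps both marginals and, by
  Jensen's inequality, does not raise the entropy. Uniqueness of the minimizer then says that the
  density was already constant on the cell.\<close>

lemma P_end_density: "P = end_density (\<lambda>x y. \<pi> x y / r x y)"
proof -
  interpret P: prob_space P by (rule prob_P)
  have main: "emeasure P (B \<inter> cell x y) = ennreal (\<pi> x y / r x y) * emeasure Q (B \<inter> cell x y)"
    if B: "B \<in> sets (path_space E)" for B x y
  proof (cases "rel_entropy P Q < \<infinity>")
    case True
    interpret Q: sigma_finite_measure Q by (rule sigma_finite_Q)
    have sPQ: "sets P = sets Q" by (simp add: sets_P sets_Q)
    have ac: "absolutely_continuous Q P" by (rule rel_entropy_absolutely_continuous[OF True])
    define q where "q x = enn2real (RN_deriv Q P x)" for x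
    have q1: "q \<in> borel_measurable Q" unfolding q_def[abs_def] by measurable
    have q0: "\<And>x. 0 \<le> q x" by (simp add: q_def)
    note qm = q1 q0
    have Pq: "P = density Q (\<lambda>x. ennreal (q x))"
    proof -
      have "AE x in Q. RN_deriv Q P x \<noteq> \<infinity>"
        using ac sPQ P.sigma_finite_measure_axioms by (intro Q.RN_deriv_finite) auto
      then have "density Q (\<lambda>x. ennreal (q x)) = density Q (RN_deriv Q P)"
        by (intro density_cong) (auto simp: q_def ennreal_enn2real_if elim: eventually_mono)
      then show ?thesis using Q.density_RN_deriv[OF ac sPQ] by simp
    qed
    define A where "A = cell x y"
    have A: "A \<in> sets Q" "A \<in> sets P" "emeasure Q A < \<infinity>" unfolding A_def using cell_sets[OF sets_Q] cell_sets[OF sets_P] cell_finite by auto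
    define b where "b = \<pi> x y / r x y"
    have b: "0 \<le> b" unfolding b_def by (intro divide_nonneg_nonneg) auto
    define q' where "q' X = (if X \<in> A then b else q X)" for X
    have q'1: "q' \<in> borel_measurable Q" unfolding q'_def[abs_def] by (rule measurable_If_set) (use q1 A(1) sets.Int_space_eq2[OF A(1)] in auto)
    have q'0: "\<And>x. 0 \<le> q' x" using q0 b by (simp add: q'_def)
    note q'm = q'1 q'0
    define P' where "P' = density Q (\<lambda>x. ennreal (q' x))"
    have inA: "emeasure P' (D \<inter> A) = ennreal b * emeasure Q (D \<inter> A)" if "D \<in> sets Q" for D
    proof -
      have "emeasure P' (D \<inter> A) = (\<integral>\<^sup>+X. ennreal b * indicator (D \<inter> A) X \<partial>Q)"
      proof -
        have "(\<lambda>X. ennreal (q' X)) \<in> borel_measurable Q" "D \<inter> A \<in> sets Q" using q'1 that A(1) by auto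
        then have "emeasure P' (D \<inter> A) = (\<integral>\<^sup>+X. ennreal (q' X) * indicator (D \<inter> A) X \<partial>Q)"
          unfolding P'_def by (rule emeasure_density)
        also have "\<dots> = (\<integral>\<^sup>+X. ennreal b * indicator (D \<inter> A) X \<partial>Q)"
          by (intro nn_integral_cong) (auto simp: q'_def indicator_def)
        finally show ?thesis .
      qed
      then show ?thesis using that A by (simp add: nn_integral_cmult)
    qed
    have b_r: "ennreal b * emeasure Q A = emeasure P A"
      unfolding A_def emeasure_r P.emeasure_eq_measure b_def using cell_pos[of x y] by (simp add: ennreal_mult[symmetric])
    have walk: "P' \<in> walks_between E \<mu>0 \<mu>1"
    proof (rule walks_between_local_change[OF P_walk])
      show "sets P' = sets (path_space E)" by (simp add: P'_def sets_Q)
      show "A \<in> sets (path_space E)" using A(1) sets_Q by simp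
      show "emeasure P' D = emeasure P D" if "D \<in> sets (path_space E)" "D \<inter> A = {}" for D
      proof -
        have D: "D \<in> sets Q" using that sets_Q by simp
        have "ennreal (q' X) * indicator D X = ennreal (q X) * indicator D X" for X
          using that(2) by (auto simp: q'_def indicator_def)
        moreover have "(\<lambda>X. ennreal (q' X)) \<in> borel_measurable Q" "(\<lambda>X. ennreal (q X)) \<in> borel_measurable Q"
          using q1 q'm(1) by auto
        ultimately show ?thesis unfolding P'_def Pq by (simp add: emeasure_density[OF _ D])
      qed
      have "A \<inter> at_time E 0 x' = (if x' = x then A else {})" "A \<inter> at_time E 1 x' = (if x' = y then A else {})" for x'
        by (auto simp: A_def)
      then show "emeasure P' (A \<inter> at_time E 0 x') = emeasure P (A \<inter> at_time E 0 x')"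
        "emeasure P' (A \<inter> at_time E 1 x') = emeasure P (A \<inter> at_time E 1 x')" for x'
        using inA[OF A(1)] b_r by auto
    qed
    have pP': "prob_space P'" using walk by (simp add: walks_between_def)
    have "rel_entropy P' Q \<le> rel_entropy P Q"
    proof (rule rel_entropy_local_change[OF qm q'm Pq prob_P P'_def pP' A(1,3)])
      show "q' X = q X" if "X \<notin> A" for X using that by (simp add: q'_def)
      show "q' X \<le> b" if "X \<in> A" for X using that by (simp add: q'_def)
      assume i: "set_integrable Q A (\<lambda>x. q x * ln (q x))"
      have "(LINT X:A|Q. q' X * ln (q' X)) = (LINT X:A|Q. b * ln b)"
        using A by (intro set_lebesgue_integral_cong) (auto simp: q'_def)
      moreover have "(LINT X:A|Q. b * ln b) \<le> (LINT X:A|Q. q X * ln (q X))"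
      proof (cases "b = 0")
        \<comment> \<open>Here \<open>P\<close> does not charge the cell, so \<open>q\<close>
          vanishes almost everywhere on it and both integrals are 0.\<close>
        case True
        have "emeasure P A = 0" using b_r True by simp
        then have "AE X in P. X \<notin> A" using A by (intro AE_not_in) auto
        then have "AE X in Q. 0 < q X \<longrightarrow> X \<notin> A" unfolding Pq using qm by (subst (asm) AE_density) auto
        then have "AE X in Q. indicator A X *\<^sub>R (q X * ln (q X)) = 0"
          by eventually_elim (use qm(2) in \<open>auto simp: indicator_def less_le\<close>)
        then have "(LINT X:A|Q. q X * ln (q X)) = 0"
          unfolding set_lebesgue_integral_def by (rule integral_eq_zero_AE)
        then show ?thesis using True by simp
      next
        case False
        then have bp: "0 < b" using b by simp
        have qi: "integrable Q (\<lambda>X. q X)"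
        proof -
          have "integrable (density Q (\<lambda>x. ennreal (q x))) (\<lambda>_. 1 :: real)"
            unfolding Pq[symmetric] by (rule P.integrable_const)
          then show ?thesis using integrable_density[of "\<lambda>_. 1 :: real" Q q] q1 q0 by simp
        qed
        then have sq: "set_integrable Q A q" unfolding set_integrable_def using A(1) by (auto intro!: integrable_mult_indicator simp del: real_scaleR_def)
        have qA: "(LINT X:A|Q. q X) = b * measure Q A"
        proof -
          have "(LINT X:A|Q. q X) = (\<integral>X. q X *\<^sub>R indicator A X \<partial>Q)" by (simp add: set_lebesgue_integral_def mult.commute)
          also have "\<dots> = (\<integral>X. indicator A X \<partial>P)" unfolding Pq using qm A(1) by (intro integral_density[symmetric]) auto
          also have "\<dots> = measure P A" using A(2) sets.sets_into_space[OF A(2)] by (simp add: Int_absorb2)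
          also have "\<dots> = b * measure Q A" unfolding A_def b_def using cell_pos[of x y] by simp
          finally show ?thesis .
        qed
        have sc: "set_integrable Q A (\<lambda>X. k)" for k :: real using A by (intro set_integrable_bounded[where B = "\<bar>k\<bar>"]) auto
        \<comment> \<open>Jensen's inequality by the tangent at the mean: as \<open>q\<close>
          averages to \<open>b\<close> on the cell, the linear term integrates to 0.\<close>
        have st: "set_integrable Q A (\<lambda>X. b * ln b + (1 + ln b) * (q X - b))"
          using sc sq by (intro set_integral_add(1) set_integrable_mult_right set_integral_diff(1))
        have "(LINT X:A|Q. b * ln b) = (LINT X:A|Q. b * ln b + (1 + ln b) * (q X - b))"
          using sc sq qA A by (simp add: set_integral_add set_integral_diff set_integral_constant)
        moreover have "(LINT X:A|Q. b * ln b + (1 + ln b) * (q X - b)) \<le> (LINT X:A|Q. q X * ln (q X))"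
          by (rule set_integral_mono[OF st i]) (rule ln_tangent[OF q0 bp])
        ultimately show ?thesis by linarith
      qed
      ultimately show "(LINT X:A|Q. q' X * ln (q' X)) \<le> (LINT X:A|Q. q X * ln (q X))" by linarith
    qed
    then have "P' = P" by (rule P_unique[OF walk])
    then show ?thesis using inA[of B] B sets_Q by (simp add: A_def b_def)
  next
    \<comment> \<open>If the minimal value is infinite, every walk between the marginals is a
      minimizer. The product coupling filled with the bridges of \<open>Q\<close> is such a walk, so
      by uniqueness it is \<open>P\<close>, and its density depends on the endpoints by
      construction.\<close>
    case False
    define R where "R = end_density (\<lambda>x y. pmf \<mu>0 x * pmf \<mu>1 y / r x y)"
    have R_cell: "emeasure R (D \<inter> cell x y) = ennreal (pmf \<mu>0 x * pmf \<mu>1 y / r x y) * emeasure Q (D \<inter> cell x y)"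
      if "D \<in> sets (path_space E)" for D x y unfolding R_def by (rule end_density_cell[OF that])
    have sR: "sets R = sets (path_space E)" by (simp add: R_def sets_end_density)
    have spR: "space R = paths E" using sets_eq_imp_space_eq[OF sR] by simp
    have R_cell1: "emeasure R (cell x y) = ennreal (pmf \<mu>0 x) * ennreal (pmf \<mu>1 y)" for x y
    proof -
      have "cell x y \<in> sets (path_space E)" by (rule cell_sets) simp
      from R_cell[OF this, of x y] have "emeasure R (cell x y) = ennreal (pmf \<mu>0 x * pmf \<mu>1 y / r x y) * ennreal (r x y)"
        unfolding emeasure_r Int_absorb .
      also have "\<dots> = ennreal (pmf \<mu>0 x * pmf \<mu>1 y / r x y * r x y)" by (rule ennreal_mult''[symmetric]) simp
      also have "pmf \<mu>0 x * pmf \<mu>1 y / r x y * r x y = pmf \<mu>0 x * pmf \<mu>1 y" using cell_pos[of x y] by simp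
      finally show ?thesis by (simp add: ennreal_mult'')
    qed
    have pmf1: "(\<integral>\<^sup>+y. ennreal (pmf \<mu> y) \<partial>count_space UNIV) = 1" for \<mu> :: "'a pmf"
      using nn_integral_pmf[of UNIV \<mu>] measure_pmf.emeasure_space_1[of \<mu>] by simp
    have R0: "emeasure R (at_time E 0 x) = ennreal (pmf \<mu>0 x)" for x
    proof -
      have T: "at_time E 0 x \<in> sets R" using at_time_sets[of 0 "{0..1}" E x] sR by auto
      have "at_time E 0 x = (\<Union>y. cell x y)" by auto
      then have "emeasure R (at_time E 0 x) = emeasure R (\<Union>y. cell x y)" by simp
      also have "\<dots> = (\<integral>\<^sup>+y. emeasure R (cell x y) \<partial>count_space UNIV)"
        by (rule emeasure_UN_countable) (use cell_sets[OF sR] in \<open>auto simp: disjoint_family_on_def\<close>)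
      also have "\<dots> = ennreal (pmf \<mu>0 x)" unfolding R_cell1 by (subst nn_integral_cmult) (simp_all add: pmf1)
      finally show ?thesis .
    qed
    have R1: "emeasure R (at_time E 1 y) = ennreal (pmf \<mu>1 y)" for y
    proof -
      have "at_time E 1 y = (\<Union>x. cell x y)" by auto
      then have "emeasure R (at_time E 1 y) = emeasure R (\<Union>x. cell x y)" by simp
      also have "\<dots> = (\<integral>\<^sup>+x. emeasure R (cell x y) \<partial>count_space UNIV)"
        by (rule emeasure_UN_countable) (use cell_sets[OF sR] in \<open>auto simp: disjoint_family_on_def\<close>)
      also have "\<dots> = ennreal (pmf \<mu>1 y)" unfolding R_cell1 by (subst nn_integral_multc) (simp_all add: pmf1)
      finally show ?thesis .
    qed
    have marg: "marginal R t = measure_pmf \<mu>" if "t \<in> {0..1}" "\<And>x. emeasure R (at_time E t x) = ennreal (pmf \<mu> x)" for t \<mu>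
    proof (rule measure_eqI_countable[where A = UNIV])
      have m: "(\<lambda>X. X t) \<in> R \<rightarrow>\<^sub>M count_space UNIV" using coord_measurable[OF that(1), of E] measurable_cong_sets[OF sR refl] by blast
      show "emeasure (marginal R t) {x} = emeasure (measure_pmf \<mu>) {x}" for x
        using m that(2)[of x] spR by (simp add: emeasure_distr emeasure_pmf_single vimage_def Int_def conj_commute)
    qed auto
    have "marginal R 0 = measure_pmf \<mu>0" "marginal R 1 = measure_pmf \<mu>1" using marg R0 R1 by auto
    moreover have "prob_space R"
    proof (rule prob_space_distrD)
      show "(\<lambda>X. X 0) \<in> R \<rightarrow>\<^sub>M count_space UNIV" using coord_measurable[of 0 "{0..1}" E] measurable_cong_sets[OF sR refl] by auto
      show "prob_space (marginal R 0)" using calculation by (simp add: measure_pmf.prob_space_axioms)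
    qed
    ultimately have "R \<in> walks_between E \<mu>0 \<mu>1" using sR by (simp add: walks_between_def)
    then have RP: "R = P" using False by (intro P_unique) auto
    have "\<pi> x y = pmf \<mu>0 x * pmf \<mu>1 y" using R_cell1[of x y] unfolding RP measure_def[of P] by (simp only: enn2real_mult enn2real_ennreal pmf_nonneg)
    then show ?thesis using R_cell[OF B, of x y] RP by simp
  qed
  show ?thesis
    by (rule measure_eq_on_cells[OF sets_P sets_end_density]) (simp add: main end_density_cell)
qed

text \<open>Moving a small mass around the rectangle \<open>(x, y)\<close>, \<open>(x', y')\<close>, \<open>(x, y')\<close>, \<open>(x', y)\<close> keeps the
  marginals; by convexity it would not increase the entropy if the inequality failed.\<close>

lemma cross_ratio_le:
  "\<pi> x y' * \<pi> x' y * (r x y * r x' y') \<le> \<pi> x y * \<pi> x' y' * (r x y' * r x' y)"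
proof (rule ccontr)
  assume n: "\<not> ?thesis"
  interpret P: prob_space P by (rule prob_P)
  have xx: "x \<noteq> x'" and yy: "y \<noteq> y'" using n by (auto simp: mult_ac)
  \<comment> \<open>The comparison of the cross products after a mass \<open>e\<close> has been
    moved. It is negative at 0 by assumption, hence for small positive \<open>e\<close> by
    continuity.\<close>
  define \<phi> where "\<phi> e = (\<pi> x y + e) * (\<pi> x' y' + e) * (r x y' * r x' y) - (\<pi> x y' - e) * (\<pi> x' y - e) * (r x y * r x' y')" for e
  have prod_pos: "0 < \<pi> x y' * \<pi> x' y"
  proof (rule ccontr)
    assume "\<not> 0 < \<pi> x y' * \<pi> x' y"
    moreover have "0 \<le> \<pi> x y' * \<pi> x' y" by (intro mult_nonneg_nonneg measure_nonneg)
    ultimately have "\<pi> x y' * \<pi> x' y = 0" by linarith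
    moreover have "0 \<le> \<pi> x y * \<pi> x' y' * (r x y' * r x' y)" by (intro mult_nonneg_nonneg measure_nonneg)
    ultimately show False using n by (simp only: mult_zero_left not_True_eq_False)
  qed
  then have ne: "\<pi> x y' \<noteq> 0" "\<pi> x' y \<noteq> 0" by fastforce+
  have pos: "0 < \<pi> x y'" "0 < \<pi> x' y"
    using ne measure_nonneg[of P "cell x y'"] measure_nonneg[of P "cell x' y"] by linarith+
  have "(\<phi> \<longlongrightarrow> \<phi> 0) (at_right 0)" unfolding \<phi>_def by (intro tendsto_intros)
  moreover have "\<phi> 0 < 0" using n by (simp only: \<phi>_def add_0_right diff_zero diff_less_0_iff_less not_le)
  ultimately have "\<forall>\<^sub>F e in at_right 0. \<phi> e < 0" by (rule order_tendstoD(2))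
  moreover have "\<forall>\<^sub>F e in at_right 0. e \<in> {0<..<min (\<pi> x y') (\<pi> x' y)}"
    by (rule eventually_at_right_real) (use pos in auto)
  ultimately have "\<forall>\<^sub>F e in at_right (0::real). \<phi> e < 0 \<and> e \<in> {0<..<min (\<pi> x y') (\<pi> x' y)}" by eventually_elim auto
  then obtain e where e: "\<phi> e < 0" "0 < e" "e < \<pi> x y'" "e < \<pi> x' y"
    using eventually_happens'[OF trivial_limit_at_right_real] by (metis (no_types, lifting) greaterThanLessThan_iff min_less_iff_conj)
  define S where "S = {(x, y), (x', y'), (x, y'), (x', y)}"
  have S: "finite S" by (simp add: S_def)
  define \<delta> where "\<delta> u v = (if (u, v) = (x, y) \<or> (u, v) = (x', y') then e else if (u, v) = (x, y') \<or> (u, v) = (x', y) then - e else 0)" for u v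
  have \<delta>: "\<delta> x y = e" "\<delta> x' y' = e" "\<delta> x y' = - e" "\<delta> x' y = - e" using xx yy by (auto simp: \<delta>_def)
  define h h' where "h u v = \<pi> u v / r u v" and "h' u v = (\<pi> u v + \<delta> u v) / r u v" for u v
  have sumS: "(\<Sum>p\<in>S. f p) = f (x, y) + f (x', y') + f (x, y') + f (x', y)" for f :: "'a \<times> 'a \<Rightarrow> real"
    using xx yy by (simp add: S_def)
  have nn: "0 \<le> \<pi> u v + \<delta> u v" for u v using e by (auto simp: \<delta>_def)
  have h: "0 \<le> h u v" "0 \<le> h' u v" for u v unfolding h_def h'_def using nn by (auto intro!: divide_nonneg_nonneg)
  define A where "A = (\<Union>p\<in>S. cell (fst p) (snd p))"
  have A: "A \<in> sets Q" unfolding A_def using S cell_sets[OF sets_Q] by (intro sets.finite_UN) auto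
  have Afin: "emeasure Q A < \<infinity>"
  proof -
    have "emeasure Q A \<le> (\<Sum>p\<in>S. emeasure Q (cell (fst p) (snd p)))"
      unfolding A_def using S cell_sets[OF sets_Q] by (intro emeasure_subadditive_finite) auto
    also have "\<dots> < \<infinity>" using S cell_finite by (simp add: less_top[symmetric])
    finally show ?thesis .
  qed
  have A_iff: "X \<in> A \<longleftrightarrow> X \<in> paths E \<and> (X 0, X 1) \<in> S" for X unfolding A_def by force
  have off: "h' (X 0) (X 1) = h (X 0) (X 1)" if "X \<in> paths E" "X \<notin> A" for X
    using that unfolding A_iff S_def by (auto simp: h_def h'_def \<delta>_def)
  define P' where "P' = end_density h'"
  have Pd: "P = end_density h" by (rule P_end_density[folded h_def])
  have cell_val: "emeasure (end_density k) (cell u v) = ennreal (k u v * r u v)" if "0 \<le> k u v" for k u v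
  proof -
    have "cell u v \<in> sets (path_space E)" by (rule cell_sets) simp
    from end_density_cell[OF this, of k u v] show ?thesis using that by (simp add: emeasure_r ennreal_mult)
  qed
  have P'_cell: "emeasure P' (cell u v) = ennreal (\<pi> u v + \<delta> u v)" for u v
    unfolding P'_def using cell_val[of h' u v] h cell_pos[of u v] by (simp add: h'_def)
  have A_parts: "emeasure R (A \<inter> T) = emeasure R (cell u v) + emeasure R (cell u' v')"
    if "sets R = sets (path_space E)" "A \<inter> T = cell u v \<union> cell u' v'" "(u, v) \<noteq> (u', v')" for R T u v u' v'
    unfolding that(2) by (rule plus_emeasure[symmetric]) (use cell_sets[OF that(1)] that(3) in auto)
  have sP': "sets P' = sets (path_space E)" by (simp add: P'_def sets_end_density)
  have walk: "P' \<in> walks_between E \<mu>0 \<mu>1"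
  proof (rule walks_between_local_change[OF P_walk sP'])
    show "A \<in> sets (path_space E)" using A sets_Q by simp
    show "emeasure P' D = emeasure P D" if "D \<in> sets (path_space E)" "D \<inter> A = {}" for D
    proof -
      have D: "D \<in> sets Q" using that sets_Q by simp
      have "D \<subseteq> paths E" using sets.sets_into_space[OF D] by simp
      then have "ennreal (h' (X 0) (X 1)) * indicator D X = ennreal (h (X 0) (X 1)) * indicator D X" for X
      proof (cases "X \<in> D")
        case True
        then have "X \<in> paths E" "X \<notin> A" using \<open>D \<subseteq> paths E\<close> that(2) by blast+
        from off[OF this] show ?thesis by (simp only:)
      qed simp
      then show ?thesis unfolding P'_def Pd end_density_def using D ends_measurable[of h] ends_measurable[of h']
        by (simp add: emeasure_density)
    qed
    have two: "emeasure P' (A \<inter> T) = emeasure P (A \<inter> T)"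
      if T: "A \<inter> T = cell u v \<union> cell u' v'" "(u, v) \<noteq> (u', v')" and s: "\<delta> u v + \<delta> u' v' = 0" for T u v u' v'
    proof -
      have "emeasure P' (A \<inter> T) = ennreal ((\<pi> u v + \<delta> u v) + (\<pi> u' v' + \<delta> u' v'))"
        unfolding A_parts[OF sP' T] P'_cell using nn by (simp add: ennreal_plus)
      also have "\<dots> = ennreal (\<pi> u v + \<pi> u' v')" by (rule arg_cong[where f = ennreal]) (use s in linarith)
      also have "\<dots> = emeasure P (A \<inter> T)" unfolding A_parts[OF sets_P T] unfolding P.emeasure_eq_measure by (simp add: ennreal_plus)
      finally show ?thesis .
    qed
    have parts: "A \<inter> at_time E 0 x = cell x y \<union> cell x y'" "A \<inter> at_time E 0 x' = cell x' y' \<union> cell x' y"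
      "A \<inter> at_time E 1 y = cell x y \<union> cell x' y" "A \<inter> at_time E 1 y' = cell x' y' \<union> cell x y'"
      using xx yy by (auto simp: A_def S_def)
    have b: "emeasure P' (A \<inter> at_time E 0 x) = emeasure P (A \<inter> at_time E 0 x)" "emeasure P' (A \<inter> at_time E 0 x') = emeasure P (A \<inter> at_time E 0 x')"
      "emeasure P' (A \<inter> at_time E 1 y) = emeasure P (A \<inter> at_time E 1 y)" "emeasure P' (A \<inter> at_time E 1 y') = emeasure P (A \<inter> at_time E 1 y')"
      using xx yy \<delta> by (intro two[OF parts(1)] two[OF parts(2)] two[OF parts(3)] two[OF parts(4)]; simp)+
    have "A \<inter> at_time E 0 u = {}" if "u \<noteq> x" "u \<noteq> x'" for u using that by (auto simp: A_def S_def)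
    then show "emeasure P' (A \<inter> at_time E 0 u) = emeasure P (A \<inter> at_time E 0 u)" for u using b by (cases "u = x \<or> u = x'") auto
    have "A \<inter> at_time E 1 u = {}" if "u \<noteq> y" "u \<noteq> y'" for u using that by (auto simp: A_def S_def)
    then show "emeasure P' (A \<inter> at_time E 1 u) = emeasure P (A \<inter> at_time E 1 u)" for u using b by (cases "u = y \<or> u = y'") auto
  qed
  have pP': "prob_space P'" using walk by (simp add: walks_between_def)
  have intA: "(LINT X:A|Q. k (X 0) (X 1)) = (\<Sum>p\<in>S. k (fst p) (snd p) * r (fst p) (snd p))" for k :: "'a \<Rightarrow> 'a \<Rightarrow> real"
  proof -
    have "(LINT X:A|Q. k (X 0) (X 1)) = (\<integral>X. (\<Sum>p\<in>S. k (fst p) (snd p) * indicator (cell (fst p) (snd p)) X) \<partial>Q)"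
      unfolding set_lebesgue_integral_def
    proof (rule Bochner_Integration.integral_cong[OF refl])
      fix X assume "X \<in> space Q"
      then have "(\<Sum>p\<in>S. k (fst p) (snd p) * indicator (cell (fst p) (snd p)) X) = (\<Sum>p\<in>S. if p = (X 0, X 1) then k (X 0) (X 1) else 0)"
        by (intro sum.cong) (auto simp: indicator_def)
      also have "\<dots> = indicator A X *\<^sub>R k (X 0) (X 1)" using \<open>X \<in> space Q\<close> S by (simp add: A_iff indicator_def)
      finally show "indicator A X *\<^sub>R k (X 0) (X 1) = (\<Sum>p\<in>S. k (fst p) (snd p) * indicator (cell (fst p) (snd p)) X)" ..
    qed
    also have "\<dots> = (\<Sum>p\<in>S. \<integral>X. k (fst p) (snd p) * indicator (cell (fst p) (snd p)) X \<partial>Q)"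
      using cell_sets[OF sets_Q] cell_finite by (intro Bochner_Integration.integral_sum integrable_mult_right integrable_real_indicator) auto
    also have "\<dots> = (\<Sum>p\<in>S. k (fst p) (snd p) * r (fst p) (snd p))"
      using sets.sets_into_space[OF cell_sets[OF sets_Q]] by (intro sum.cong refl) (simp add: Int_absorb2)
    finally show ?thesis .
  qed
  have "rel_entropy P' Q \<le> rel_entropy P Q"
  proof (rule rel_entropy_local_change[where A = A and B = "\<Sum>p\<in>S. h' (fst p) (snd p)",
      OF ends_measurable[of h] _ ends_measurable[of h'] _ Pd[unfolded end_density_def] prob_P P'_def[unfolded end_density_def] pP' A Afin])
    show "h' (X 0) (X 1) \<le> (\<Sum>p\<in>S. h' (fst p) (snd p))" if "X \<in> A" for X
      using member_le_sum[of "(X 0, X 1)" S "\<lambda>p. h' (fst p) (snd p)"] that S h by (auto simp: A_iff)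
    \<comment> \<open>The tangent is taken at the new value \<open>h' u v\<close>. Summed over the
      four cells the constants cancel, and what remains is \<open>e\<close> times the logarithm of
      the new cross ratio, at most 0 by the choice of \<open>e\<close>.\<close>
    have conv: "h' u v * ln (h' u v) * r u v \<le> h u v * ln (h u v) * r u v + \<delta> u v * (1 + ln (h' u v))" if "0 < \<pi> u v + \<delta> u v" for u v
    proof -
      have hp: "0 < h' u v" unfolding h'_def using that cell_pos by simp
      have "h' u v * ln (h' u v) + (1 + ln (h' u v)) * (h u v - h' u v) \<le> h u v * ln (h u v)" by (rule ln_tangent[OF h(1) hp])
      then have "(h' u v * ln (h' u v) + (1 + ln (h' u v)) * (h u v - h' u v)) * r u v \<le> h u v * ln (h u v) * r u v"
        using cell_pos[of u v] by (intro mult_right_mono) auto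
      moreover have "(h u v - h' u v) * r u v = - \<delta> u v" unfolding h_def h'_def using cell_pos[of u v] by (simp add: field_simps)
      then have "(h' u v * ln (h' u v) + (1 + ln (h' u v)) * (h u v - h' u v)) * r u v = h' u v * ln (h' u v) * r u v - \<delta> u v * (1 + ln (h' u v))"
        by (simp add: distrib_right mult.assoc) (simp add: algebra_simps)
      ultimately show ?thesis by linarith
    qed
    have p4: "0 < \<pi> x y + \<delta> x y" "0 < \<pi> x' y' + \<delta> x' y'" "0 < \<pi> x y' + \<delta> x y'" "0 < \<pi> x' y + \<delta> x' y"
      using e \<delta> measure_nonneg[of P] by (auto intro: add_nonneg_pos)
    have h4: "0 < h' x y" "0 < h' x' y'" "0 < h' x y'" "0 < h' x' y" unfolding h'_def using p4 cell_pos by (auto intro!: divide_pos_pos)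
    have "ln (h' x y) + ln (h' x' y') \<le> ln (h' x y') + ln (h' x' y)"
    proof -
      have "h' x y * h' x' y' \<le> h' x y' * h' x' y"
      proof -
        have frac: "a / b \<le> c / k" if "0 < b" "0 < k" "a * k \<le> c * b" for a b c k :: real
          using that by (simp add: pos_divide_le_eq pos_le_divide_eq)
        have "0 < r x y * r x' y'" "0 < r x y' * r x' y" by (intro mult_pos_pos cell_pos)+
        moreover have "(\<pi> x y + e) * (\<pi> x' y' + e) * (r x y' * r x' y) \<le> (\<pi> x y' - e) * (\<pi> x' y - e) * (r x y * r x' y')"
          using e(1) by (simp only: \<phi>_def diff_less_0_iff_less less_imp_le)
        ultimately have "(\<pi> x y + e) * (\<pi> x' y' + e) / (r x y * r x' y') \<le> (\<pi> x y' - e) * (\<pi> x' y - e) / (r x y' * r x' y)"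
          by (intro frac)
        then show ?thesis by (simp only: h'_def \<delta> times_divide_times_eq uminus_add_conv_diff add_uminus_conv_diff)
      qed
      then have "ln (h' x y * h' x' y') \<le> ln (h' x y' * h' x' y)" using h4 by (subst ln_le_cancel_iff) auto
      then show ?thesis using h4 by (simp add: ln_mult)
    qed
    then have "e * (ln (h' x y) + ln (h' x' y')) \<le> e * (ln (h' x y') + ln (h' x' y))" using e by (intro mult_left_mono) auto
    then show "(LINT X:A|Q. h' (X 0) (X 1) * ln (h' (X 0) (X 1))) \<le> (LINT X:A|Q. h (X 0) (X 1) * ln (h (X 0) (X 1)))"
      unfolding intA[of "\<lambda>u v. h' u v * ln (h' u v)"] intA[of "\<lambda>u v. h u v * ln (h u v)"] sumS
      using conv[OF p4(1)] conv[OF p4(2)] conv[OF p4(3)] conv[OF p4(4)] unfolding \<delta> by (simp add: algebra_simps)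
  qed (use h off in auto)
  then have "P' = P" by (rule P_unique[OF walk])
  then have "ennreal (\<pi> x y + e) = ennreal (\<pi> x y)" using P'_cell[of x y] \<delta> by (simp add: P.emeasure_eq_measure)
  then show False using e by (simp add: ennreal_inj)
qed

text \<open>Equality of all cross ratios says that the matrix \<open>h\<close> has rank one: it is
  the product of one of its columns and one of its rows, normalised at their common entry if that is
  not 0. Such an entry exists because \<open>P\<close> has mass 1.\<close>

theorem factorization: "\<exists>f g. P = density Q (\<lambda>X. f (X 0) * g (X 1))"
proof -
  interpret P: prob_space P by (rule prob_P)
  define h where "h x y = \<pi> x y / r x y" for x y
  have h0: "0 \<le> h x y" for x y unfolding h_def by (intro divide_nonneg_nonneg) auto
  have cross: "h x y * h x' y' = h x y' * h x' y" for x y x' y'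
  proof -
    have "\<pi> x y * \<pi> x' y' * (r x y' * r x' y) = \<pi> x y' * \<pi> x' y * (r x y * r x' y')"
      by (intro antisym cross_ratio_le)
    moreover have "r x y * r x' y' \<noteq> 0" "r x y' * r x' y \<noteq> 0" using cell_pos by (auto simp: less_imp_neq[symmetric])
    ultimately have "\<pi> x y * \<pi> x' y' / (r x y * r x' y') = \<pi> x y' * \<pi> x' y / (r x y' * r x' y)"
      by (simp only: frac_eq_eq not_False_eq_True)
    then show ?thesis by (simp only: h_def times_divide_times_eq)
  qed
  have "\<exists>x y. h x y \<noteq> 0"
  proof (rule ccontr)
    assume "\<not> ?thesis"
    then have "(\<lambda>x y. \<pi> x y / r x y) = (\<lambda>_ _. 0)" by (auto simp: h_def fun_eq_iff)
    then have "P = end_density (\<lambda>_ _. 0)" by (rule subst[of _ _ "\<lambda>h. P = end_density h"]) (rule P_end_density)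
    then have "P = density Q (\<lambda>_. 0)" unfolding end_density_def ennreal_0 .
    moreover have "space P \<in> sets Q" using sets_P sets_Q sets.top by metis
    ultimately have "emeasure P (space P) = (\<integral>\<^sup>+X. 0 * indicator (space P) X \<partial>Q)"
      using emeasure_density[of "\<lambda>_. 0" Q "space P"] by (metis borel_measurable_const)
    then have "emeasure P (space P) = 0" by simp
    then show False using P.emeasure_space_1 by simp
  qed
  then obtain x0 y0 where xy: "h x0 y0 \<noteq> 0" by blast
  have eq: "h x y = h x y0 / h x0 y0 * h x0 y" for x y using cross[of x y x0 y0] xy by (metis nonzero_eq_divide_eq times_divide_eq_left)
  have "P = density Q (\<lambda>X. ennreal (h (X 0) y0 / h x0 y0) * ennreal (h x0 (X 1)))"
  proof -
    have "ennreal (h (X 0) (X 1)) = ennreal (h (X 0) y0 / h x0 y0) * ennreal (h x0 (X 1))" for X :: "real \<Rightarrow> 'a"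
      using eq[of "X 0" "X 1"] h0 by (simp only: ennreal_mult''[symmetric])
    then have "end_density h = density Q (\<lambda>X. ennreal (h (X 0) y0 / h x0 y0) * ennreal (h x0 (X 1)))"
      by (simp only: end_density_def)
    moreover have "P = end_density h" by (rule P_end_density[folded h_def])
    ultimately show ?thesis by (rule trans[rotated])
  qed
  then show ?thesis
    by (intro exI[of _ "\<lambda>x. ennreal (h x y0 / h x0 y0)"] exI[of _ "\<lambda>y. ennreal (h x0 y)"])
qed

end

section \<open>Slowed-down walks and the geodesic bridges\<close>

lemma set_integral_discrete_cong:
  fixes f g :: "real \<Rightarrow> real"
  assumes "\<And>r. s \<le> r \<Longrightarrow> r \<le> t \<Longrightarrow> r \<noteq> a \<Longrightarrow> f r = g r"
  shows "(LINT r:{s..t}|lborel. f r) = (LINT r:{s..t}|lborel. g r)"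
  unfolding set_lebesgue_integral_def
  by (rule integral_discrete_difference[where X = "{a}"]) (use assms in \<open>auto simp: indicator_def\<close>)

locale slowed_walks = geodesic_walk E j C Q d
  for E :: "'a::countable \<Rightarrow> 'a \<Rightarrow> bool" and j :: "real \<Rightarrow> 'a \<Rightarrow> 'a \<Rightarrow> real" and C :: real
    and Q :: "(real \<Rightarrow> 'a) measure" and d :: "'a \<Rightarrow> 'a \<Rightarrow> real" +
  fixes Rk :: "nat \<Rightarrow> (real \<Rightarrow> 'a) measure"
  assumes slow_walk: "1 \<le> k \<Longrightarrow> walk E (\<lambda>t x y. real k powr (- d x y) * j t x y) C (Rk k)"
    and slow_init: "1 \<le> k \<Longrightarrow> emeasure (Rk k) (at_time E 0 x) = emeasure Q (at_time E 0 x)"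
begin

definition slow :: "nat \<Rightarrow> 'a \<Rightarrow> 'a \<Rightarrow> real" where "slow k x y = real k powr (- d x y)"

definition slow_mass :: "nat \<Rightarrow> real \<Rightarrow> 'a \<Rightarrow> real" where
  "slow_mass k = kernel_mass (\<lambda>t x y. slow k x y * j t x y)"

text \<open>By \<open>Rk_density\<close> this is the density of \<open>Rk k\<close> with respect to
  \<open>Q\<close>.\<close>

definition weight :: "nat \<Rightarrow> (real \<Rightarrow> 'a) \<Rightarrow> real" where
  "weight k = mult (slow k) (\<lambda>r x. kernel_mass j r x - slow_mass k r x) 0 1"

lemma slow_01: assumes "1 \<le> k" shows "0 \<le> slow k x y" "slow k x y \<le> 1"
proof -
  show "0 \<le> slow k x y" by (simp add: slow_def)
  have "real k powr (- d x y) \<le> real k powr 0" by (rule powr_mono) (use assms d_facts(1)[of x y] in simp_all)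
  then show "slow k x y \<le> 1" using assms by (simp add: slow_def)
qed

lemma thinned: "1 \<le> k \<Longrightarrow> thinned_walk E j C Q (Rk k) (slow k)"
  unfolding thinned_walk_def thinned_walk_axioms_def
  using walk_axioms slow_walk[of k] slow_01[of k] slow_init[of k] init_pos by (auto simp: slow_def)

lemma markov_Rk: "1 \<le> k \<Longrightarrow> markov_path E (Rk k)"
  using slow_walk[of k] unfolding walk_def by blast

lemma sets_Rk: "1 \<le> k \<Longrightarrow> sets (Rk k) = sets Q"
  using markov_path.sets_Q[OF markov_Rk] sets_Q by simp

lemma Rk_density:
  assumes "1 \<le> k"
  shows "Rk k = density Q (\<lambda>X. ennreal (weight k X))" and "weight k \<in> borel_measurable Q"
    and "potential (\<lambda>r x. kernel_mass j r x - slow_mass k r x) C"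
proof -
  interpret T: thinned_walk E j C Q "Rk k" "slow k" by (rule thinned[OF assms])
  have c: "T.c = (\<lambda>r x. kernel_mass j r x - slow_mass k r x)"
    by (auto simp: fun_eq_iff T.c_def slow_mass_def)
  show "Rk k = density Q (\<lambda>X. ennreal (weight k X))"
    using T.change_of_kernel unfolding weight_def c .
  show "weight k \<in> borel_measurable Q" using T.F.mult_measurable[of 0 1] measurable_Q unfolding weight_def c by auto
  show "potential (\<lambda>r x. kernel_mass j r x - slow_mass k r x) C" using T.F.potential_axioms unfolding c .
qed

text \<open>Every edge has length at least 1, so its factor is at most
  \<open>1 / real k\<close>.\<close>

lemma slow_mass_bounds:
  assumes k: "1 \<le> k"
  shows "0 \<le> slow_mass k r x" "slow_mass k r x \<le> C / real k"
proof -
  have e: "slow_mass k r x = (\<Sum>y | E x y. slow k x y * j r x y)"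
  proof -
    interpret T: thinned_walk E j C Q "Rk k" "slow k" by (rule thinned[OF k])
    show ?thesis unfolding slow_mass_def by (rule T.W'.kernel_mass_eq)
  qed
  show "0 \<le> slow_mass k r x" unfolding e using slow_01[OF k] j_nonneg by (intro sum_nonneg mult_nonneg_nonneg) auto
  have "slow k x y \<le> 1 / real k" if "E x y" for y
  proof -
    have "x \<noteq> y" using that irrefl by auto
    then have "real k powr (- d x y) \<le> real k powr (- 1)" using k d_ge_1[of x y] by (intro powr_mono) auto
    then show ?thesis using k by (simp add: slow_def powr_minus_divide)
  qed
  then have "slow_mass k r x \<le> (\<Sum>y | E x y. 1 / real k * j r x y)"
    unfolding e using j_nonneg by (intro sum_mono mult_right_mono) auto
  also have "\<dots> = 1 / real k * (\<Sum>y | E x y. j r x y)" by (rule sum_distrib_left[symmetric])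
  also have "\<dots> \<le> 1 / real k * C" using j_mass by (intro mult_left_mono) auto
  finally show "slow_mass k r x \<le> C / real k" by simp
qed

lemma slow_mass_potential:
  assumes k: "1 \<le> k" shows "potential (slow_mass k) (C / real k)"
proof
  show "(\<lambda>r. slow_mass k r x) \<in> borel_measurable borel" for x
  proof -
    interpret T: thinned_walk E j C Q "Rk k" "slow k" by (rule thinned[OF k])
    show ?thesis unfolding slow_mass_def by (rule T.W'.kernel_mass_measurable)
  qed
qed (rule slow_mass_bounds[OF k])+

text \<open>The jump factors multiply to \<open>k\<close> to the power minus the length. A path from
  \<open>x\<close> to \<open>y\<close> has length at least \<open>d x y\<close>, so
  \<open>k powr d x y\<close> is the scaling under which exactly the geodesics survive.\<close>

lemma weight_eq:
  assumes k: "1 \<le> k" and X: "X \<in> paths E"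
  shows "weight k X = real k powr (- path_length d X) * exp (expo (kernel_mass j) 0 1 X - expo (slow_mass k) 0 1 X)"
proof -
  have fin: "finite (jump_times X)" using X by (simp add: paths_def)
  have "jump_prod (slow k) 0 1 X = (\<Prod>r\<in>jump_times X. real k powr (- d (left_lim X r) (X r)))"
    unfolding jump_prod_def jumps_01 slow_def ..
  also have "\<dots> = real k powr (\<Sum>r\<in>jump_times X. - d (left_lim X r) (X r))"
    using k fin by (intro powr_sum[symmetric]) auto
  also have "\<dots> = real k powr (- path_length d X)" by (simp add: path_length_def sum_negf)
  finally have p: "jump_prod (slow k) 0 1 X = real k powr (- path_length d X)" .
  interpret S: potential E "slow_mass k" "C / real k" by (rule slow_mass_potential[OF k])
  have "set_integrable lborel {0..1} (\<lambda>r. kernel_mass j r (X r))" "set_integrable lborel {0..1} (\<lambda>r. slow_mass k r (X r))"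
    using G.c_path_integrable[of 0 1 X] S.c_path_integrable[of 0 1 X] X by auto
  then have "expo (\<lambda>r x. kernel_mass j r x - slow_mass k r x) 0 1 X = expo (kernel_mass j) 0 1 X - expo (slow_mass k) 0 1 X"
    unfolding expo_def by (rule set_integral_diff(2))
  then show ?thesis by (simp add: weight_def mult_def p)
qed

lemma expo_slow:
  assumes k: "1 \<le> k" and X: "X \<in> paths E"
  shows "0 \<le> expo (slow_mass k) 0 1 X" "expo (slow_mass k) 0 1 X \<le> C / real k"
proof -
  interpret S: potential E "slow_mass k" "C / real k" by (rule slow_mass_potential[OF k])
  show "0 \<le> expo (slow_mass k) 0 1 X" "expo (slow_mass k) 0 1 X \<le> C / real k"
    using S.expo_bounds[of 0 1 X] X by auto
qed

lemma weight_pos: "1 \<le> k \<Longrightarrow> X \<in> paths E \<Longrightarrow> 0 < weight k X"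
  by (simp add: weight_eq)

lemma length_ge: assumes "X \<in> ends x y" shows "d x y \<le> path_length d X"
  using dist_le_length[of X 0 1] assms by (auto simp: path_length_def jumps_01)

lemma geodesic_ends_iff: assumes "X \<in> ends x y" shows "jump_prod (towards y) 0 1 X = of_bool (path_length d X = d x y)"
proof -
  have X: "X \<in> paths E" "X 0 = x" "X 1 = y" using assms by auto
  have "path_length d X = d x y \<longleftrightarrow> (\<forall>r\<in>jumps X 0 1. d (left_lim X r) (X r) + d (X r) y = d (left_lim X r) y)"
    using length_towards_iff[OF X(1), of 0 1 y] X by (simp add: path_length_def jumps_01)
  then show ?thesis by (simp add: jump_prod_towards[OF X(1)])
qed

lemma weight_bound:
  assumes k: "1 \<le> k" and X: "X \<in> ends x y"
  shows "0 \<le> real k powr d x y * weight k X" "real k powr d x y * weight k X \<le> exp C"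
proof -
  have p: "X \<in> paths E" using X by auto
  show "0 \<le> real k powr d x y * weight k X" using weight_pos[OF k p] by simp
  have "real k powr d x y * real k powr (- path_length d X) = real k powr (d x y - path_length d X)"
    by (simp add: powr_add[symmetric])
  moreover have "real k powr (d x y - path_length d X) \<le> real k powr 0"
    using k length_ge[OF X] by (intro powr_mono) auto
  moreover have "exp (expo (kernel_mass j) 0 1 X - expo (slow_mass k) 0 1 X) \<le> exp C"
    using expo_slow(1)[OF k p] G.expo_bounds(2)[of 0 1 X] p by simp
  ultimately have "(real k powr d x y * real k powr (- path_length d X)) * exp (expo (kernel_mass j) 0 1 X - expo (slow_mass k) 0 1 X) \<le> 1 * exp C"
    using k by (intro mult_mono) auto
  then show "real k powr d x y * weight k X \<le> exp C" by (simp add: weight_eq[OF k p] mult.assoc)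
qed

text \<open>A positive excess of the length over \<open>d x y\<close> sends the power to 0, and the
  remaining rates, of order \<open>1 / k\<close>, disappear from the exponent. The index is shifted
  by 2 because the minimizers start at \<open>k = 2\<close>.\<close>

lemma weight_tendsto:
  assumes X: "X \<in> ends x y"
  shows "(\<lambda>n. real (n + 2) powr d x y * weight (n + 2) X) \<longlonglongrightarrow> G.M y 0 1 X"
proof -
  have p: "X \<in> paths E" using X by auto
  have "(\<lambda>n. C / real (n + 2)) \<longlonglongrightarrow> 0" by real_asymp
  then have "(\<lambda>n. expo (slow_mass (n + 2)) 0 1 X) \<longlonglongrightarrow> 0"
  proof (rule tendsto_sandwich[OF _ _ tendsto_const, rotated 2])
    have b: "0 \<le> expo (slow_mass (n + 2)) 0 1 X" "expo (slow_mass (n + 2)) 0 1 X \<le> C / real (n + 2)" for n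
      using expo_slow[of "n + 2", OF _ p] by simp_all
    show "\<forall>\<^sub>F n in sequentially. 0 \<le> expo (slow_mass (n + 2)) 0 1 X" using b(1) by (intro always_eventually allI)
    show "\<forall>\<^sub>F n in sequentially. expo (slow_mass (n + 2)) 0 1 X \<le> C / real (n + 2)" using b(2) by (intro always_eventually allI)
  qed
  then have e: "(\<lambda>n. exp (expo (kernel_mass j) 0 1 X - expo (slow_mass (n + 2)) 0 1 X)) \<longlonglongrightarrow> exp (expo (kernel_mass j) 0 1 X - 0)"
    by (intro tendsto_intros)
  have w: "real (n + 2) powr d x y * weight (n + 2) X = real (n + 2) powr (d x y - path_length d X) *
      exp (expo (kernel_mass j) 0 1 X - expo (slow_mass (n + 2)) 0 1 X)" for n
    by (simp add: weight_eq[OF _ p] powr_diff powr_minus_divide)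
  have "(\<lambda>n. real (n + 2) powr (d x y - path_length d X)) \<longlonglongrightarrow> of_bool (path_length d X = d x y)"
  proof (cases "path_length d X = d x y")
    case False
    define b where "b = path_length d X - d x y"
    have "0 < b" using False length_ge[OF X] by (simp add: b_def)
    then have "(\<lambda>n. real (n + 2) powr (- b)) \<longlonglongrightarrow> 0" by real_asymp
    then show ?thesis using False by (simp add: b_def)
  qed simp
  from tendsto_mult[OF this e] show ?thesis
    unfolding w mult_def geodesic_ends_iff[OF X] by simp
qed

section \<open>Convergence of the slowed bridges to the geodesic bridges\<close>

lemma integral_Rk:
  fixes f :: "(real \<Rightarrow> 'a) \<Rightarrow> real"
  assumes k: "1 \<le> k" and f: "f \<in> borel_measurable Q"
  shows "(\<integral>X. f X \<partial>Rk k) = (\<integral>X. weight k X * f X \<partial>Q)"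
proof -
  have "(\<integral>X. f X \<partial>Rk k) = (\<integral>X. f X \<partial>density Q (\<lambda>X. ennreal (weight k X)))" using Rk_density(1)[OF k] by simp
  also have "\<dots> = (\<integral>X. weight k X *\<^sub>R f X \<partial>Q)"
  proof (rule integral_density[OF f Rk_density(2)[OF k]])
    show "AE X in Q. 0 \<le> weight k X" by (rule AE_I2) (use weight_pos[OF k] in \<open>auto intro: less_imp_le\<close>)
  qed
  finally show ?thesis by simp
qed

abbreviation ind_ends :: "'a \<Rightarrow> 'a \<Rightarrow> (real \<Rightarrow> 'a) \<Rightarrow> real" where "ind_ends x y \<equiv> indicator (ends x y)"

lemma slow_limit:
  assumes f: "f \<in> borel_measurable Q" "\<And>X. X \<in> paths E \<Longrightarrow> 0 \<le> f X \<and> f X \<le> (1::real)"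
  shows "(\<lambda>n. real (n + 2) powr d x y * (\<integral>X. ind_ends x y X * f X \<partial>Rk (n + 2))) \<longlonglongrightarrow>
    (\<integral>X. ind_ends x y X * (G.M y 0 1 X * f X) \<partial>Q)"
proof -
  have m: "(\<lambda>X. ind_ends x y X * f X) \<in> borel_measurable Q" using f(1) ends_Q(1) by auto
  have e: "real (n + 2) powr d x y * (\<integral>X. ind_ends x y X * f X \<partial>Rk (n + 2)) =
      (\<integral>X. ind_ends x y X * (real (n + 2) powr d x y * weight (n + 2) X * f X) \<partial>Q)" for n
    using integral_Rk[OF _ m, of "n + 2"] by (simp add: mult_ac flip: integral_mult_right_zero)
  show ?thesis unfolding e
  proof (rule integral_dominated_convergence[where w = "\<lambda>X. exp C * ind_ends x y X"])
    show "integrable Q (\<lambda>X. exp C * ind_ends x y X)"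
      using ends_Q[of x y] by (intro integrable_mult_right integrable_real_indicator) auto
    show "(\<lambda>X. ind_ends x y X * (real (n + 2) powr d x y * weight (n + 2) X * f X)) \<in> borel_measurable Q" for n
      using f(1) ends_Q(1) Rk_density(2)[of "n + 2"] by auto
    show "(\<lambda>X. ind_ends x y X * (G.M y 0 1 X * f X)) \<in> borel_measurable Q"
      using f(1) ends_Q(1) G.M_measurable_Q[of 0 1] by auto
    show "AE X in Q. (\<lambda>n. ind_ends x y X * (real (n + 2) powr d x y * weight (n + 2) X * f X)) \<longlonglongrightarrow> ind_ends x y X * (G.M y 0 1 X * f X)"
    proof (rule AE_I2)
      fix X
      show "(\<lambda>n. ind_ends x y X * (real (n + 2) powr d x y * weight (n + 2) X * f X)) \<longlonglongrightarrow> ind_ends x y X * (G.M y 0 1 X * f X)"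
      proof (cases "X \<in> ends x y")
        case True
        from tendsto_mult[OF weight_tendsto[OF True] tendsto_const[of "f X"]] show ?thesis
          by (simp only: indicator_simps(1)[OF True] mult_1_left)
      qed simp
    qed
    show "AE X in Q. norm (ind_ends x y X * (real (n + 2) powr d x y * weight (n + 2) X * f X)) \<le> exp C * ind_ends x y X" for n
    proof (rule AE_I2)
      fix X
      show "norm (ind_ends x y X * (real (n + 2) powr d x y * weight (n + 2) X * f X)) \<le> exp C * ind_ends x y X"
      proof (cases "X \<in> ends x y")
        case True
        then have "0 \<le> f X \<and> f X \<le> 1" using f(2) by auto
        then have "\<bar>(real (n + 2) powr d x y * weight (n + 2) X) * f X\<bar> \<le> exp C * 1"
          unfolding abs_mult using weight_bound[OF _ True, of "n + 2"] by (intro mult_mono) auto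
        then show ?thesis using True by simp
      qed simp
    qed
  qed
qed

text \<open>\<open>Rk k\<close> has a positive density with respect to \<open>Q\<close>, so a cell
  that is null for it is null for \<open>Q\<close> and then for \<open>GM\<close>; but
  \<open>GM\<close> gives the cell the positive mass \<open>\<beta> x y\<close>.\<close>

lemma Rk_ends_pos:
  assumes k: "1 \<le> k" shows "0 < measure (Rk k) (ends x y)" "emeasure (Rk k) (ends x y) < \<infinity>"
proof -
  interpret R: markov_path E "Rk k" by (rule markov_Rk[OF k])
  show fin: "emeasure (Rk k) (ends x y) < \<infinity>" by (rule R.cell_finite)
  have "emeasure (Rk k) (ends x y) \<noteq> 0"
  proof
    assume "emeasure (Rk k) (ends x y) = 0"
    then have "AE X in Rk k. X \<notin> ends x y" using ends_Q(1) sets_Rk[OF k] by (intro AE_not_in) auto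
    then have "AE X in density Q (\<lambda>X. ennreal (weight k X)). X \<notin> ends x y" by (subst Rk_density(1)[OF k, symmetric])
    then have "AE X in Q. 0 < ennreal (weight k X) \<longrightarrow> X \<notin> ends x y"
      using Rk_density(2)[OF k] by (subst (asm) AE_density) auto
    then have "AE X in Q. X \<notin> ends x y" by eventually_elim (use weight_pos[OF k] in auto)
    then have "ends x y \<in> null_sets Q" using ends_Q(1) by (subst (asm) AE_iff_null_sets[symmetric]) auto
    then have "ends x y \<in> null_sets GM"
      using absolutely_continuousI_density[of "\<lambda>X. ennreal (G.M (X 1) 0 1 X)" Q] geodesic_density_measurable
      unfolding GM_eq[symmetric] absolutely_continuous_def by auto
    then show False using GM_ends[of x y] \<beta>_pos[of x y] by auto
  qed
  then show "0 < measure (Rk k) (ends x y)" using fin by (simp add: measure_def enn2real_positive_iff zero_less_iff_neq_zero)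
qed

lemma integral_br:
  fixes f :: "(real \<Rightarrow> 'a) \<Rightarrow> real"
  assumes f: "f \<in> borel_measurable Q"
  shows "(\<integral>X. f X \<partial>br x y) = (\<integral>X. ind_ends x y X * f X \<partial>GM) / \<beta> x y"
    and "(\<integral>X. ind_ends x y X * f X \<partial>GM) = (\<integral>X. ind_ends x y X * (G.M y 0 1 X * f X) \<partial>Q)"
proof -
  have "(\<integral>X. f X \<partial>br x y) = (LINT X:ends x y|GM. f X) / measure GM (ends x y)"
    unfolding br_def using GM_ends[of x y] \<beta>_pos[of x y] f ends_Q(1)[of x y] measurable_cong_sets[OF sets_GM refl]
    by (intro integral_uniform_measure) (auto simp: sets_GM)
  moreover have "measure GM (ends x y) = \<beta> x y" using GM_ends[of x y] \<beta>_pos[of x y] by (simp add: measure_def)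
  ultimately show "(\<integral>X. f X \<partial>br x y) = (\<integral>X. ind_ends x y X * f X \<partial>GM) / \<beta> x y"
    by (simp add: set_lebesgue_integral_def)
  have "(\<integral>X. ind_ends x y X * f X \<partial>GM) = (\<integral>X. G.M (X 1) 0 1 X *\<^sub>R (ind_ends x y X * f X) \<partial>Q)"
    unfolding GM_eq
  proof (rule integral_density)
    show "(\<lambda>X. ind_ends x y X * f X) \<in> borel_measurable Q" using f ends_Q(1) by auto
    show "AE X in Q. 0 \<le> G.M (X 1) 0 1 X" using G.mult_bounds(1)[of 0 1] by (intro AE_I2) auto
  qed (rule geodesic_density_measurable)
  also have "\<dots> = (\<integral>X. ind_ends x y X * (G.M y 0 1 X * f X) \<partial>Q)"
    by (intro Bochner_Integration.integral_cong refl) (auto simp: indicator_def)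
  finally show "(\<integral>X. ind_ends x y X * f X \<partial>GM) = (\<integral>X. ind_ends x y X * (G.M y 0 1 X * f X) \<partial>Q)" .
qed

text \<open>Numerator and denominator both carry the factor \<open>k powr d x y\<close>, which
  cancels in the conditional law.\<close>

lemma slow_bridge_limit:
  assumes f: "f \<in> borel_measurable Q" "\<And>X. X \<in> paths E \<Longrightarrow> 0 \<le> f X \<and> f X \<le> (1::real)"
  shows "(\<lambda>n. (\<integral>X. ind_ends x y X * f X \<partial>Rk (n + 2)) / measure (Rk (n + 2)) (ends x y)) \<longlonglongrightarrow> (\<integral>X. f X \<partial>br x y)"
proof -
  have one: "(\<integral>X. ind_ends x y X * 1 \<partial>Rk k) = measure (Rk k) (ends x y)" if "1 \<le> k" for k
    using sets_eq_imp_space_eq[OF sets_Rk[OF that]] by (simp add: Int_absorb2 subset_eq)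
  have "(\<integral>X. ind_ends x y X * 1 \<partial>GM) = \<beta> x y"
    using GM_ends[of x y] \<beta>_pos[of x y] sets_eq_imp_space_eq[OF sets_GM] by (simp add: Int_absorb2 subset_eq measure_def)
  then have \<beta>: "(\<integral>X. ind_ends x y X * (G.M y 0 1 X * 1) \<partial>Q) = \<beta> x y" using integral_br(2)[of "\<lambda>_. 1" x y] by simp
  have "(\<lambda>n. (real (n + 2) powr d x y * (\<integral>X. ind_ends x y X * f X \<partial>Rk (n + 2))) /
      (real (n + 2) powr d x y * (\<integral>X. ind_ends x y X * 1 \<partial>Rk (n + 2)))) \<longlonglongrightarrow>
      (\<integral>X. ind_ends x y X * (G.M y 0 1 X * f X) \<partial>Q) / \<beta> x y"
    using slow_limit[OF f] slow_limit[of "\<lambda>_. 1" x y] \<beta>_pos[of x y] unfolding \<beta> by (intro tendsto_divide) auto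
  moreover have "(real (n + 2) powr d x y * (\<integral>X. ind_ends x y X * f X \<partial>Rk (n + 2))) /
      (real (n + 2) powr d x y * (\<integral>X. ind_ends x y X * 1 \<partial>Rk (n + 2))) =
      (\<integral>X. ind_ends x y X * f X \<partial>Rk (n + 2)) / measure (Rk (n + 2)) (ends x y)" for n
    by (subst one) (simp_all only: mult_divide_mult_cancel_left powr_gt_zero le_add2 of_nat_add, simp_all)
  ultimately show ?thesis unfolding integral_br[OF f(1)] by (simp only:)
qed

text \<open>The event of fixed endpoints is a product of an indicator at time 0 and one at time 1,
  so \<open>markov_density\<close> makes the bridges of the slowed walks Markov; setwise convergence
  passes the property on.\<close>

theorem markov_br: "markov_measure E (br x y)"
proof (rule markov_setwise_limit)
  let ?B = "\<lambda>n. bridge E (Rk (n + 2)) x y"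
  have em: "emeasure (Rk (n + 2)) (ends x y) \<noteq> 0" "emeasure (Rk (n + 2)) (ends x y) \<noteq> \<infinity>" "ends x y \<in> sets (Rk (n + 2))" for n
    using Rk_ends_pos[of "n + 2" x y] ends_Q(1) sets_Rk[of "n + 2"] by (auto simp: measure_def)
  show fin: "finite_measure (?B n)" for n
    using em by (intro prob_space.finite_measure prob_space_uniform_measure) auto
  show "markov_measure E (?B n)" for n
  proof -
    interpret R: markov_path E "Rk (n + 2)" by (rule markov_Rk) simp
    have "?B n = density (Rk (n + 2)) (\<lambda>X. (indicator {x} (X 0) / emeasure (Rk (n + 2)) (ends x y)) * indicator {y} (X 1))"
      unfolding uniform_measure_def
    proof (rule density_cong)
      show "(\<lambda>X. indicator (ends x y) X / emeasure (Rk (n + 2)) (ends x y)) \<in> borel_measurable (Rk (n + 2))"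
        using em by (intro borel_measurable_divide_ennreal borel_measurable_indicator) auto
      have "(\<lambda>X. indicator {v} (X t) :: ennreal) \<in> borel_measurable (Rk (n + 2))" if "t \<in> {0..1}" for t v
        by (rule R.measurable_Q[OF coord_compose_measurable[of t "{0..1}"]]) (use that in auto)
      then show "(\<lambda>X. indicator {x} (X 0) / emeasure (Rk (n + 2)) (ends x y) * indicator {y} (X 1)) \<in> borel_measurable (Rk (n + 2))"
        by (intro borel_measurable_times_ennreal borel_measurable_divide_ennreal) auto
      show "AE X in Rk (n + 2). indicator (ends x y) X / emeasure (Rk (n + 2)) (ends x y) =
          indicator {x} (X 0) / emeasure (Rk (n + 2)) (ends x y) * (indicator {y} (X 1) :: ennreal)"
      proof (rule AE_I2)
        fix X assume "X \<in> space (Rk (n + 2))"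
        then have "X \<in> paths E" by (simp only: R.space_Q)
        then show "indicator (ends x y) X / emeasure (Rk (n + 2)) (ends x y) =
          indicator {x} (X 0) / emeasure (Rk (n + 2)) (ends x y) * (indicator {y} (X 1) :: ennreal)"
          by (auto simp: indicator_def)
      qed
    qed
    from R.markov_density[OF fin this] show ?thesis .
  qed
  show "finite_measure (br x y)" using prob_br by (rule prob_space.finite_measure)
  show "(\<lambda>n. measure (?B n) B) \<longlonglongrightarrow> measure (br x y) B" if "B \<in> sets (path_space E)" for B
  proof -
    have B: "B \<in> sets Q" using that sets_Q by simp
    have f: "indicat_real B \<in> borel_measurable Q" using B by simp
    have "measure (?B n) B = (\<integral>X. ind_ends x y X * indicat_real B X \<partial>Rk (n + 2)) / measure (Rk (n + 2)) (ends x y)" for n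
    proof -
      have "measure (?B n) B = measure (Rk (n + 2)) (ends x y \<inter> B) / measure (Rk (n + 2)) (ends x y)"
        using em B sets_Rk[of "n + 2"] by (intro measure_uniform_measure) auto
      moreover have "(\<integral>X. ind_ends x y X * indicat_real B X \<partial>Rk (n + 2)) = measure (Rk (n + 2)) (ends x y \<inter> B)"
        unfolding indicator_inter_arith[symmetric]
        using sets_eq_imp_space_eq[OF sets_Rk[of "n + 2"]] by (simp add: Int_absorb2 subset_eq)
      ultimately show ?thesis by simp
    qed
    moreover have "(\<integral>X. indicat_real B X \<partial>br x y) = measure (br x y) B"
      using sets.sets_into_space[OF B] sets_eq_imp_space_eq[OF sets_br[of x y]] by (simp add: Int_absorb2)
    ultimately show ?thesis using slow_bridge_limit[OF f, of x y] by (simp add: indicator_le_1)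
  qed
qed (rule sets_br)

section \<open>The jump kernel of a geodesic bridge\<close>

lemma kernel_nonneg:
  assumes "t \<in> {0..1}" shows "0 \<le> geodesic_kernel E d j Q y t z w"
  unfolding geodesic_kernel_eq[OF assms]
  using towards_01(2)[of y z w] g_nonneg[OF assms, of y w] g_nonneg[OF assms, of y z] j_nonneg[of t z w]
  by (intro divide_nonneg_nonneg mult_nonneg_nonneg) auto

lemma kernel_support: "\<not> E z w \<Longrightarrow> geodesic_kernel E d j Q y t z w = 0"
  by (simp add: geodesic_kernel_def geodesic_succs_iff)

lemma kernel_time_measurable: "(\<lambda>r. indicator {0..1} r * geodesic_kernel E d j Q y r z w) \<in> borel_measurable borel"
proof -
  have "(\<lambda>r. indicator {0..1} r * geodesic_kernel E d j Q y r z w) =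
    (\<lambda>r. towards y z w * (indicator {0..1} r * g y r w) * j r z w / (indicator {0..1} r * g y r z))"
    by (auto simp: fun_eq_iff geodesic_kernel_eq indicator_def)
  then show ?thesis
    by (simp only:) (intro borel_measurable_divide borel_measurable_times borel_measurable_const g_measurable j_meas)
qed

lemma start_past: "at_time E 0 x \<in> sets (path_events E {0..s})" if "0 \<le> s"
  by (rule at_time_sets) (use that in auto)

lemma flux_nonneg': assumes q: "q \<in> {0..1}" and A: "A \<in> sets Q" shows "0 \<le> flux y A q z w"
  unfolding flux_def using V_nonneg[OF A q, of "indicator {z}" y] towards_01(2)[of y z w] g_nonneg[OF q, of y w] j_nonneg[of q z w] by simp

text \<open>\<open>flux_total\<close>, normalised by \<open>\<beta>\<close>: the expected number of
  crossings of an edge under a bridge. Time 1, where the cancellation of \<open>g\<close> may fail,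
  is discarded as a null set.\<close>

lemma br_flux_total:
  assumes zw: "E z w"
  shows "(\<integral>\<^sup>+r. ennreal (indicator {0..1} r * (measure (br x y) (at_time E r z) * geodesic_kernel E d j Q y r z w)) \<partial>lborel) \<le> 1"
proof -
  have A0: "at_time E 0 x \<in> sets Q" "emeasure Q (at_time E 0 x) < \<infinity>" using at_time_finite[of 0 x] at_time_Q[of 0 x] by simp_all
  have i: "set_integrable lborel {0..1} (\<lambda>r. flux y (at_time E 0 x) r z w / \<beta> x y)"
    using flux_integrable[OF start_past[OF order_refl] A0(2), of 1 y z w] by (intro set_integrable_divide) auto
  have nn: "0 \<le> flux y (at_time E 0 x) r z w / \<beta> x y" if "r \<in> {0..1}" for r
    using flux_nonneg'[OF that A0(1)] \<beta>_pos[of x y] by simp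
  have "(\<integral>\<^sup>+r. ennreal (indicator {0..1} r * (measure (br x y) (at_time E r z) * geodesic_kernel E d j Q y r z w)) \<partial>lborel) =
      (\<integral>\<^sup>+r. ennreal (indicator {0..1} r *\<^sub>R (flux y (at_time E 0 x) r z w / \<beta> x y)) \<partial>lborel)"
  proof (rule nn_integral_cong_AE)
    have "AE r in lborel. r \<noteq> (1::real)" by (rule AE_lborel_singleton)
    then show "AE r in lborel. ennreal (indicator {0..1} r * (measure (br x y) (at_time E r z) * geodesic_kernel E d j Q y r z w)) =
      ennreal (indicator {0..1} r *\<^sub>R (flux y (at_time E 0 x) r z w / \<beta> x y))"
    proof eventually_elim
      case (elim r)
      show ?case
      proof (cases "r \<in> {0..1}")
        case True
        have "paths E \<in> sets (path_events E {0..r})" using sets.top[of "path_events E {0..r}"] by simp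
        from br_flux[OF this, of x y z w] have "measure (br x y) (at_time E r z) * geodesic_kernel E d j Q y r z w = flux y (at_time E 0 x) r z w / \<beta> x y"
          using True elim by (simp add: Int_absorb1 Int_absorb2 subset_eq)
        then show ?thesis by simp
      qed simp
    qed
  qed
  also have "\<dots> = ennreal (LINT r:{0..1}|lborel. flux y (at_time E 0 x) r z w / \<beta> x y)"
    unfolding set_lebesgue_integral_def
    by (rule nn_integral_eq_integral[OF i[unfolded set_integrable_def]]) (auto simp: indicator_def nn)
  also have "\<dots> \<le> ennreal 1"
  proof (rule ennreal_leI)
    have "(LINT r:{0..1}|lborel. flux y (at_time E 0 x) r z w / \<beta> x y) = (LINT r:{0..1}|lborel. flux y (at_time E 0 x) r z w) / \<beta> x y"
      by (rule set_integral_divide_zero)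
    then show "(LINT r:{0..1}|lborel. flux y (at_time E 0 x) r z w / \<beta> x y) \<le> 1"
      using flux_total[OF zw, of y x] \<beta>_pos[of x y] by simp
  qed
  finally show ?thesis by simp
qed

lemma br_dynkin_kernel:
  assumes A: "A \<in> sets (path_events E {0..s})" and st: "0 \<le> s" "s \<le> t" "t \<le> 1" and u: "finite {x. u x \<noteq> 0}"
  shows "(LINT X:A|br x y. u (X t) - u (X s)) =
    (\<Sum>z\<in>flux_states u. \<Sum>w | E z w. (u w - u z) * (LINT r:{s..t}|lborel. measure (br x y) (A \<inter> at_time E r z) * geodesic_kernel E d j Q y r z w))"
proof -
  have "(LINT r:{s..t}|lborel. flux y (A \<inter> at_time E 0 x) r z w / \<beta> x y) =
      (LINT r:{s..t}|lborel. measure (br x y) (A \<inter> at_time E r z) * geodesic_kernel E d j Q y r z w)" for z w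
  proof (rule set_integral_discrete_cong[where a = 1])
    fix r assume r: "s \<le> r" "r \<le> t" "r \<noteq> 1"
    have "A \<in> sets (path_events E {0..r})" using A path_events_mono[of "{0..s}" "{0..r}" E] r by auto
    from br_flux[OF this, of x y z w] show "flux y (A \<inter> at_time E 0 x) r z w / \<beta> x y = measure (br x y) (A \<inter> at_time E r z) * geodesic_kernel E d j Q y r z w"
      using r st by simp
  qed
  then show ?thesis using br_dynkin[OF A st u, of x y] by simp
qed

theorem br_kernel: "has_jump_kernel E (br x y) (geodesic_kernel E d j Q y)"
proof (rule has_jump_kernelI[OF prob_br sets_br kernel_support kernel_time_measurable])
  fix z w
  have "(\<integral>\<^sup>+r. ennreal (indicator {0..1} r * (measure (br x y) (at_time E r z) * \<bar>geodesic_kernel E d j Q y r z w\<bar>)) \<partial>lborel) =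
      (\<integral>\<^sup>+r. ennreal (indicator {0..1} r * (measure (br x y) (at_time E r z) * geodesic_kernel E d j Q y r z w)) \<partial>lborel)"
    by (intro nn_integral_cong) (auto simp: indicator_def kernel_nonneg)
  also have "\<dots> < \<infinity>"
  proof (cases "E z w")
    case True
    show ?thesis by (rule le_less_trans[OF br_flux_total[OF True]]) simp
  qed (simp add: kernel_support)
  finally show "(\<integral>\<^sup>+r. ennreal (indicator {0..1} r * (measure (br x y) (at_time E r z) * \<bar>geodesic_kernel E d j Q y r z w\<bar>)) \<partial>lborel) < \<infinity>" .
qed (assumption, rule br_dynkin_kernel, assumption+)

end

section \<open>The displacement random walk\<close>

lemma nn_integral_countable_space:
  fixes f :: "'b::countable \<Rightarrow> ennreal"
  assumes M: "sets M = UNIV"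
  shows "(\<integral>\<^sup>+x. f x \<partial>M) = (\<integral>\<^sup>+x. emeasure M {x} * f x \<partial>count_space UNIV)"
proof -
  have "M = density (count_space UNIV) (\<lambda>x. emeasure M {x})"
  proof (rule measure_eqI_countable[where A = UNIV])
    show "emeasure M {a} = emeasure (density (count_space UNIV) (\<lambda>x. emeasure M {x})) {a}" for a
      by (simp add: emeasure_density nn_integral_indicator_singleton)
  qed (auto simp: M)
  then have "(\<integral>\<^sup>+x. f x \<partial>M) = (\<integral>\<^sup>+x. f x \<partial>density (count_space UNIV) (\<lambda>x. emeasure M {x}))" by (rule arg_cong)
  also have "\<dots> = (\<integral>\<^sup>+x. emeasure M {x} * f x \<partial>count_space UNIV)" by (rule nn_integral_density) auto
  finally show ?thesis .
qed

lemma state_measure_measurable: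
  fixes E :: "'a::countable \<Rightarrow> 'a \<Rightarrow> bool"
  assumes P: "finite_measure P" "sets P = sets (path_space E)" and A: "A \<in> sets P"
  shows "(\<lambda>q. indicator {0..1::real} q * measure P (A \<inter> at_time E q z)) \<in> borel_measurable borel"
proof -
  interpret finite_measure P by (rule P)
  have sp: "space P = paths E" using sets_eq_imp_space_eq[OF P(2)] by simp
  have "(\<lambda>(X, r). indicator {0..1} r * indicat_real {z} (X r)) \<in> borel_measurable (P \<Otimes>\<^sub>M borel)"
    using clamp_compose_measurable[of 0 1 "\<lambda>_ x. indicat_real {z} x" E] measurable_cong_sets[OF sets_pair_measure_cong[OF P(2) refl] refl]
    by auto
  from measurable_compose[OF measurable_pair_swap' this]
  have m: "(\<lambda>p. indicator {0..1} (fst p) * indicat_real {z} (snd p (fst p))) \<in> borel_measurable (borel \<Otimes>\<^sub>M P)"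
    by (simp add: case_prod_beta)
  have "(\<lambda>p. indicat_real A (snd p) * (indicator {0..1} (fst p) * indicat_real {z} (snd p (fst p)))) \<in> borel_measurable (borel \<Otimes>\<^sub>M P)"
    by (rule borel_measurable_times[OF measurable_compose[OF measurable_snd borel_measurable_indicator[OF A]] m])
  then have "(\<lambda>q. \<integral>X. indicat_real A X * (indicator {0..1} q * indicat_real {z} (X q)) \<partial>P) \<in> borel_measurable borel"
    by (intro borel_measurable_lebesgue_integral) (simp add: case_prod_beta)
  moreover have "(\<integral>X. indicat_real A X * (indicator {0..1} q * indicat_real {z} (X q)) \<partial>P) = indicator {0..1} q * measure P (A \<inter> at_time E q z)" for q
  proof -
    have "(\<integral>X. indicat_real A X * (indicator {0..1} q * indicat_real {z} (X q)) \<partial>P) = (\<integral>X. indicator {0..1} q * indicat_real (A \<inter> at_time E q z) X \<partial>P)"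
      by (intro Bochner_Integration.integral_cong refl) (auto simp: indicator_def sp)
    also have "\<dots> = indicator {0..1} q * measure P (A \<inter> at_time E q z)"
      using sp by (simp add: Int_absorb2 subset_eq)
    finally show ?thesis .
  qed
  ultimately show ?thesis by simp
qed

locale displacement = slowed_walks E j C Q d Rk
  for E :: "'a::countable \<Rightarrow> 'a \<Rightarrow> bool" and j :: "real \<Rightarrow> 'a \<Rightarrow> 'a \<Rightarrow> real" and C :: real
    and Q :: "(real \<Rightarrow> 'a) measure" and d :: "'a \<Rightarrow> 'a \<Rightarrow> real" and Rk :: "nat \<Rightarrow> (real \<Rightarrow> 'a) measure" +
  fixes \<mu>0 \<mu>1 :: "'a pmf" and Pk :: "nat \<Rightarrow> (real \<Rightarrow> 'a) measure" and P :: "(real \<Rightarrow> 'a) measure"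
  assumes minimal: "2 \<le> k \<Longrightarrow> unique_arg_min (\<lambda>R. rel_entropy R (Rk k)) (walks_between E \<mu>0 \<mu>1) (Pk k)"
    and prob_P: "prob_space P" and sets_P: "sets P = sets (path_space E)"
    and narrow: "narrow_conv (skorokhod_topology E) Pk P"
begin

lemma schroedinger_Pk: assumes "2 \<le> k" shows "schroedinger E (Rk k) \<mu>0 \<mu>1 (Pk k)"
  unfolding schroedinger_def schroedinger_axioms_def
  using markov_Rk[of k] Rk_ends_pos(1)[of k] minimal[of k] assms by auto

lemma Pk_facts:
  assumes k: "2 \<le> k"
  shows "prob_space (Pk k)" "sets (Pk k) = sets (path_space E)" "markov_measure E (Pk k)"
proof -
  interpret S: schroedinger E "Rk k" \<mu>0 \<mu>1 "Pk k" by (rule schroedinger_Pk[OF k])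
  show p: "prob_space (Pk k)" and "sets (Pk k) = sets (path_space E)" by (rule S.prob_P, rule S.sets_P)
  from S.factorization obtain f g where "Pk k = density (Rk k) (\<lambda>X. f (X 0) * g (X 1))" by blast
  from S.markov_density[OF prob_space.finite_measure[OF p] this] show "markov_measure E (Pk k)" .
qed

text \<open>The density of \<open>Pk k\<close> depends on the endpoints only, so on a cell the
  minimizer and the slowed walk have the same conditional law.\<close>

lemma Pk_integral:
  fixes f :: "(real \<Rightarrow> 'a) \<Rightarrow> real"
  assumes k: "2 \<le> k" and f: "f \<in> borel_measurable Q"
  shows "(\<integral>X. ind_ends x y X * f X \<partial>Pk k) =
    measure (Pk k) (ends x y) * ((\<integral>X. ind_ends x y X * f X \<partial>Rk k) / measure (Rk k) (ends x y))"
proof -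
  interpret S: schroedinger E "Rk k" \<mu>0 \<mu>1 "Pk k" by (rule schroedinger_Pk[OF k])
  define h where "h x y = measure (Pk k) (ends x y) / measure (Rk k) (ends x y)" for x y
  have sR: "sets (Rk k) = sets Q" using sets_Rk[of k] k by simp
  have m: "(\<lambda>X. ind_ends x y X * f X) \<in> borel_measurable (Rk k)"
    using f ends_Q(1) by (subst measurable_cong_sets[OF sR refl]) auto
  have "(\<integral>X. ind_ends x y X * f X \<partial>Pk k) = (\<integral>X. ind_ends x y X * f X \<partial>S.end_density h)"
    using S.P_end_density[folded h_def] by (rule arg_cong)
  also have "\<dots> = (\<integral>X. h (X 0) (X 1) *\<^sub>R (ind_ends x y X * f X) \<partial>Rk k)"
    unfolding S.end_density_def
  proof (rule integral_density[OF m S.ends_measurable])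
    show "AE X in Rk k. 0 \<le> h (X 0) (X 1)" by (rule AE_I2) (simp add: h_def)
  qed
  also have "\<dots> = (\<integral>X. h x y * (ind_ends x y X * f X) \<partial>Rk k)"
    by (intro Bochner_Integration.integral_cong refl) (auto simp: indicator_def)
  also have "\<dots> = h x y * (\<integral>X. ind_ends x y X * f X \<partial>Rk k)" by (rule integral_mult_right_zero)
  finally show ?thesis by (simp add: h_def)
qed

section \<open>Identification of the narrow limit as a mixture of geodesic bridges\<close>

definition cpl :: "'a \<Rightarrow> 'a \<Rightarrow> real" where "cpl x y = measure P (ends x y)"

lemma ends_P: "ends x y \<in> sets P" using ends_Q(1) sets_Q sets_P by simp

lemma Pk_cpl: "(\<lambda>n. measure (Pk (n + 2)) (ends x y)) \<longlonglongrightarrow> cpl x y"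
proof -
  have "(\<lambda>n. \<integral>X. ind_ends x y X \<partial>Pk n) \<longlonglongrightarrow> (\<integral>X. ind_ends x y X \<partial>P)"
  proof -
    have "bounded (ind_ends x y ` topspace (skorokhod_topology E))"
      by (auto simp: bounded_iff indicator_def intro!: exI[of _ 1])
    then show ?thesis using narrow endpoints_continuous[of E x y] unfolding narrow_conv_def by blast
  qed
  from LIMSEQ_ignore_initial_segment[OF this, of 2]
  have "(\<lambda>n. \<integral>X. ind_ends x y X \<partial>Pk (n + 2)) \<longlonglongrightarrow> (\<integral>X. ind_ends x y X \<partial>P)" .
  moreover have I: "(\<integral>X. ind_ends x y X \<partial>R) = measure R (ends x y)" if "sets R = sets (path_space E)" for R
    using sets_eq_imp_space_eq[OF that] by (simp add: Int_absorb2 subset_eq)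
  ultimately show ?thesis unfolding cpl_def I[OF Pk_facts(2)[OF le_add2]] I[OF sets_P] by simp
qed

text \<open>The mixture of the bridges under the endpoint law of \<open>P\<close>. A bridge is
  \<open>GM\<close> restricted to a cell and divided by \<open>\<beta>\<close>, so the mixture is a
  density with respect to \<open>GM\<close>.\<close>

definition mix :: "(real \<Rightarrow> 'a) measure" where
  "mix = density GM (\<lambda>X. ennreal (cpl (X 0) (X 1) / \<beta> (X 0) (X 1)))"

lemma sets_mix: "sets mix = sets (path_space E)" by (simp add: mix_def sets_GM sets_Q)

lemma mix_weight_measurable: "(\<lambda>X. cpl (X 0) (X 1) / \<beta> (X 0) (X 1)) \<in> borel_measurable GM"
  unfolding measurable_cong_sets[OF sets_GM refl] by (rule ends_measurable)

lemma mix_weight_nonneg: "0 \<le> cpl x y / \<beta> x y"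
  using \<beta>_pos[of x y] by (simp add: cpl_def)

lemma emeasure_mix:
  assumes B: "B \<in> sets Q" shows "emeasure mix (B \<inter> ends x y) = ennreal (cpl x y * measure (br x y) B)"
proof -
  have m: "B \<inter> ends x y \<in> sets GM" using B ends_Q(1) by (auto simp: sets_GM)
  have "emeasure mix (B \<inter> ends x y) = (\<integral>\<^sup>+X. ennreal (cpl (X 0) (X 1) / \<beta> (X 0) (X 1)) * indicator (B \<inter> ends x y) X \<partial>GM)"
    unfolding mix_def using mix_weight_measurable m by (intro emeasure_density) auto
  also have "\<dots> = (\<integral>\<^sup>+X. ennreal (cpl x y / \<beta> x y) * indicator (B \<inter> ends x y) X \<partial>GM)"
    by (intro nn_integral_cong) (auto simp: indicator_def)
  also have "\<dots> = ennreal (cpl x y / \<beta> x y) * ennreal (V y (B \<inter> ends x y) 1 (\<lambda>_. 1))"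
    unfolding nn_integral_cmult_indicator[OF m] GM_measure[OF m[unfolded sets_GM] Int_lower2] ..
  also have "\<dots> = ennreal (cpl x y / \<beta> x y * V y (B \<inter> ends x y) 1 (\<lambda>_. 1))"
    by (rule ennreal_mult'[symmetric]) (rule mix_weight_nonneg)
  finally show ?thesis by (simp add: measure_br[OF B])
qed

lemma prob_mix: "prob_space mix"
proof
  interpret P: prob_space P by (rule prob_P)
  have s: "paths E \<in> sets Q" using sets.top[of Q] by simp
  have b: "measure (br x y) (paths E) = 1" for x y
    using prob_space.prob_space[OF prob_br[of x y]] sets_eq_imp_space_eq[OF sets_br[of x y]] by simp
  have "emeasure mix (paths E) = emeasure P (paths E)"
  proof -
    have "emeasure mix (paths E) = (\<integral>\<^sup>+p. emeasure mix (paths E \<inter> ends (fst p) (snd p)) \<partial>count_space UNIV)"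
      using s sets_mix sets_Q by (intro emeasure_cells) auto
    also have "\<dots> = (\<integral>\<^sup>+p. emeasure P (paths E \<inter> ends (fst p) (snd p)) \<partial>count_space UNIV)"
    proof (rule nn_integral_cong)
      fix p :: "'a \<times> 'a"
      have "paths E \<inter> ends (fst p) (snd p) = ends (fst p) (snd p)" by auto
      then show "emeasure mix (paths E \<inter> ends (fst p) (snd p)) = emeasure P (paths E \<inter> ends (fst p) (snd p))"
        unfolding emeasure_mix[OF s] b by (simp only: P.emeasure_eq_measure cpl_def mult_1_right)
    qed
    also have "\<dots> = emeasure P (paths E)"
      using s sets_P sets_Q by (intro emeasure_cells[symmetric]) auto
    finally show ?thesis .
  qed
  also have "\<dots> = 1" using P.emeasure_space_1 sets_eq_imp_space_eq[OF sets_P] by simp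
  finally show "emeasure mix (space mix) = 1" using sets_eq_imp_space_eq[OF sets_mix] by simp
qed

lemma mix_integral:
  fixes f :: "(real \<Rightarrow> 'a) \<Rightarrow> real"
  assumes f: "f \<in> borel_measurable Q"
  shows "(\<integral>X. ind_ends x y X * f X \<partial>mix) = cpl x y * (\<integral>X. f X \<partial>br x y)"
proof -
  have "(\<integral>X. ind_ends x y X * f X \<partial>mix) = (\<integral>X. (cpl (X 0) (X 1) / \<beta> (X 0) (X 1)) *\<^sub>R (ind_ends x y X * f X) \<partial>GM)"
    unfolding mix_def
  proof (rule integral_density[OF _ mix_weight_measurable])
    show "(\<lambda>X. ind_ends x y X * f X) \<in> borel_measurable GM"
      unfolding measurable_cong_sets[OF sets_GM refl] using f ends_Q(1) by auto
    show "AE X in GM. 0 \<le> cpl (X 0) (X 1) / \<beta> (X 0) (X 1)" by (rule AE_I2) (rule mix_weight_nonneg)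
  qed
  also have "\<dots> = (\<integral>X. cpl x y / \<beta> x y * (ind_ends x y X * f X) \<partial>GM)"
    by (intro Bochner_Integration.integral_cong refl) (auto simp: indicator_def)
  also have "\<dots> = cpl x y / \<beta> x y * (\<integral>X. ind_ends x y X * f X \<partial>GM)" by (rule integral_mult_right_zero)
  finally show ?thesis by (simp add: integral_br(1)[OF f])
qed

text \<open>On a cell the integral is the mass of the cell times a conditional mean, and both
  factors converge. In the sum over the cells no mass is lost, because the limit \<open>mix\<close>
  is again a probability measure.\<close>

lemma Pk_limit:
  fixes f :: "(real \<Rightarrow> 'a) \<Rightarrow> real"
  assumes f: "f \<in> borel_measurable (path_space E)" "\<And>X. X \<in> paths E \<Longrightarrow> 0 \<le> f X \<and> f X \<le> 1"
  shows "(\<lambda>n. \<integral>X. f X \<partial>Pk (n + 2)) \<longlonglongrightarrow> (\<integral>X. f X \<partial>mix)"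
proof (rule convergence_on_partition[where N = "path_space E" and \<xi> = "\<lambda>X. (X 0, X 1)", OF _ _ prob_mix sets_mix])
  show "prob_space (Pk (n + 2))" "sets (Pk (n + 2)) = sets (path_space E)" for n using Pk_facts[of "n + 2"] by simp_all
  have c: "(\<lambda>X. X t) \<in> path_space E \<rightarrow>\<^sub>M count_space UNIV" if "t \<in> {0..1}" for t by (rule coord_measurable[OF that])
  show "(\<lambda>X. (X 0, X 1)) \<in> path_space E \<rightarrow>\<^sub>M count_space (UNIV :: ('a \<times> 'a) set)"
  proof (rule measurable_compose_countable[where f = "\<lambda>x X. (x, X 1)", OF _ c])
    show "(\<lambda>X. (x, X 1)) \<in> path_space E \<rightarrow>\<^sub>M count_space UNIV" for x :: 'a
      by (rule measurable_compose[OF c]) auto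
  qed simp
  fix h :: "(real \<Rightarrow> 'a) \<Rightarrow> real" and p :: "'a \<times> 'a"
  assume h: "h \<in> borel_measurable (path_space E)" "\<And>X. X \<in> space (path_space E) \<Longrightarrow> 0 \<le> h X \<and> h X \<le> 1"
  have hQ: "h \<in> borel_measurable Q" using h(1) measurable_cong_sets[OF sets_Q refl] by blast
  have s: "{X \<in> space (path_space E). (X 0, X 1) = p} = ends (fst p) (snd p)" by auto
  have "(\<lambda>n. measure (Pk (n + 2)) (ends (fst p) (snd p)) *
      ((\<integral>X. ind_ends (fst p) (snd p) X * h X \<partial>Rk (n + 2)) / measure (Rk (n + 2)) (ends (fst p) (snd p)))) \<longlonglongrightarrow>
      cpl (fst p) (snd p) * (\<integral>X. h X \<partial>br (fst p) (snd p))"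
    using h(2) by (intro tendsto_mult Pk_cpl slow_bridge_limit hQ) auto
  then show "(\<lambda>n. \<integral>X. indicator {X \<in> space (path_space E). (X 0, X 1) = p} X * h X \<partial>Pk (n + 2)) \<longlonglongrightarrow>
      (\<integral>X. indicator {X \<in> space (path_space E). (X 0, X 1) = p} X * h X \<partial>mix)"
    unfolding s mix_integral[OF hQ] Pk_integral[OF le_add2 hQ] .
qed (use f in auto)

theorem P_mix: "P = mix"
proof (rule narrow_limit_unique[OF prob_P sets_P prob_mix sets_mix _ Pk_limit])
  show "narrow_conv (skorokhod_topology E) (\<lambda>n. Pk (n + 2)) P"
    unfolding narrow_conv_def
  proof (intro allI impI)
    fix f assume "continuous_map (skorokhod_topology E) euclideanreal f \<and> bounded (f ` topspace (skorokhod_topology E))"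
    then have "(\<lambda>n. \<integral>X. f X \<partial>Pk n) \<longlonglongrightarrow> (\<integral>X. f X \<partial>P)" using narrow unfolding narrow_conv_def by blast
    from LIMSEQ_ignore_initial_segment[OF this, of 2]
    show "(\<lambda>n. \<integral>X. f X \<partial>Pk (n + 2)) \<longlonglongrightarrow> (\<integral>X. f X \<partial>P)" .
  qed
qed

text \<open>Once the limit is known to be \<open>mix\<close>, the convergence holds for all
  measurable functions with values in \<open>[0, 1]\<close>, hence setwise, as the passage to the
  limit in the Markov identity demands.\<close>

theorem markov_P: "markov_measure E P"
proof (rule markov_setwise_limit[where Ps = "\<lambda>n. Pk (n + 2)"])
  show "finite_measure (Pk (n + 2))" "markov_measure E (Pk (n + 2))" for n
    using Pk_facts[of "n + 2"] by (simp_all add: prob_space.finite_measure)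
  show "finite_measure P" using prob_P by (rule prob_space.finite_measure)
  show "(\<lambda>n. measure (Pk (n + 2)) B) \<longlonglongrightarrow> measure P B" if B: "B \<in> sets (path_space E)" for B
  proof -
    have I: "(\<integral>X. indicat_real B X \<partial>R) = measure R B" if "sets R = sets (path_space E)" for R
      using sets_eq_imp_space_eq[OF that] sets.sets_into_space[OF B] by (simp add: Int_absorb2)
    have "(\<lambda>n. \<integral>X. indicat_real B X \<partial>Pk (n + 2)) \<longlonglongrightarrow> (\<integral>X. indicat_real B X \<partial>mix)"
      by (rule Pk_limit) (use B in \<open>auto simp: indicator_def\<close>)
    then show ?thesis unfolding P_mix[symmetric] I[OF Pk_facts(2)[OF le_add2]] I[OF sets_P] .
  qed
qed (rule sets_P)

end

section \<open>The jump kernel of the displacement random walk\<close>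

context displacement
begin

abbreviation brp :: "'a \<times> 'a \<Rightarrow> (real \<Rightarrow> 'a) measure" where "brp p \<equiv> br (fst p) (snd p)"

abbreviation ker :: "'a \<Rightarrow> real \<Rightarrow> 'a \<Rightarrow> 'a \<Rightarrow> real" where "ker y \<equiv> geodesic_kernel E d j Q y"

definition coupling :: "('a \<times> 'a) measure" where
  "coupling = distr P (count_space UNIV) (\<lambda>X. (X 0, X 1))"

lemma coord_P: "t \<in> {0..1} \<Longrightarrow> (\<lambda>X. X t) \<in> P \<rightarrow>\<^sub>M count_space UNIV"
  using coord_measurable[of t "{0..1}" E] measurable_cong_sets[OF sets_P refl] by blast

lemma endpoints_P: "(\<lambda>X. (X 0, X 1)) \<in> P \<rightarrow>\<^sub>M count_space UNIV"
proof (rule measurable_compose_countable[where f = "\<lambda>x X. (x, X 1)" and g = "\<lambda>X. X 0"])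
  show "(\<lambda>X. (x, X 1)) \<in> P \<rightarrow>\<^sub>M count_space UNIV" for x :: 'a
    by (rule measurable_compose[OF coord_P]) auto
qed (rule coord_P, simp)

lemma space_P: "space P = paths E" using sets_eq_imp_space_eq[OF sets_P] by simp

lemma prob_coupling: "prob_space coupling"
  unfolding coupling_def by (rule prob_space.prob_space_distr[OF prob_P endpoints_P])

lemma sets_coupling: "sets coupling = UNIV" by (simp add: coupling_def)

lemma coupling_measurable: "f \<in> measurable coupling M \<longleftrightarrow> f \<in> UNIV \<rightarrow> space M"
  by (simp add: coupling_def)

lemma emeasure_coupling: "emeasure coupling {p} = ennreal (cpl (fst p) (snd p))"
proof -
  interpret P: prob_space P by (rule prob_P)
  have "emeasure coupling {p} = emeasure P (ends (fst p) (snd p))"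
    unfolding coupling_def using endpoints_P
    by (subst emeasure_distr) (auto intro!: arg_cong[where f = "emeasure P"] simp: space_P)
  then show ?thesis by (simp add: P.emeasure_eq_measure cpl_def)
qed

lemma P_ends: "B \<in> sets P \<Longrightarrow> emeasure P (B \<inter> ends x y) = ennreal (cpl x y) * ennreal (measure (br x y) B)"
  using emeasure_mix[of B x y] unfolding P_mix[symmetric] by (simp add: sets_P sets_Q ennreal_mult'' )

text \<open>On a cell, \<open>P\<close> gives to \<open>B\<close> the mass of the cell times the
  bridge mass of \<open>B\<close>. There are countably many pairs of endpoints, so these masses are
  the atoms of the law of the pair on \<open>B\<close>.\<close>

lemma disintegration:
  assumes B: "B \<in> sets P"
  shows "(\<integral>\<^sup>+X. h (X 1) * indicator B X \<partial>P) = (\<integral>\<^sup>+p. ennreal (measure (brp p) B) * h (snd p) \<partial>coupling)"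
proof -
  define M where "M = distr (density P (indicator B)) (count_space UNIV) (\<lambda>X. (X 0, X 1))"
  have e: "(\<lambda>X. (X 0, X 1)) \<in> density P (indicator B) \<rightarrow>\<^sub>M count_space UNIV"
    using endpoints_P by simp
  have iB: "indicator B \<in> borel_measurable P" using B by simp
  have hm: "(\<lambda>X. h (X 1)) \<in> borel_measurable P" by (rule measurable_compose[OF coord_P]) auto
  have M: "emeasure M {p} = ennreal (cpl (fst p) (snd p)) * ennreal (measure (brp p) B)" for p
  proof -
    have "emeasure M {p} = emeasure (density P (indicator B)) (ends (fst p) (snd p))"
      unfolding M_def using e by (subst emeasure_distr) (auto intro!: arg_cong[where f = "emeasure (density P (indicator B))"] simp: space_P)
    also have "\<dots> = (\<integral>\<^sup>+X. indicator (B \<inter> ends (fst p) (snd p)) X \<partial>P)"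
      using iB ends_P by (subst emeasure_density) (auto intro!: nn_integral_cong simp: indicator_def)
    also have "\<dots> = emeasure P (B \<inter> ends (fst p) (snd p))" by (rule nn_integral_indicator) (use B ends_P in blast)
    finally show ?thesis using P_ends[OF B] by simp
  qed
  have "(\<integral>\<^sup>+X. h (X 1) * indicator B X \<partial>P) = (\<integral>\<^sup>+X. h (X 1) \<partial>density P (indicator B))"
    using iB hm by (subst nn_integral_density) (auto simp: mult.commute)
  also have "\<dots> = (\<integral>\<^sup>+p. h (snd p) \<partial>M)"
    unfolding M_def using e by (subst nn_integral_distr) auto
  also have "\<dots> = (\<integral>\<^sup>+p. emeasure M {p} * h (snd p) \<partial>count_space UNIV)"
    by (rule nn_integral_countable_space) (simp add: M_def)
  also have "\<dots> = (\<integral>\<^sup>+p. emeasure coupling {p} * (ennreal (measure (brp p) B) * h (snd p)) \<partial>count_space UNIV)"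
    by (simp only: M emeasure_coupling mult.assoc)
  also have "\<dots> = (\<integral>\<^sup>+p. ennreal (measure (brp p) B) * h (snd p) \<partial>coupling)"
    by (rule nn_integral_countable_space[OF sets_coupling, symmetric])
  finally show ?thesis .
qed

lemma bounded_integrable:
  fixes f :: "'a \<times> 'a \<Rightarrow> real" assumes "\<And>p. \<bar>f p\<bar> \<le> K" shows "integrable coupling f"
proof -
  interpret prob_space coupling by (rule prob_coupling)
  show ?thesis by (rule integrable_const_bound[where B = K]) (use assms in \<open>auto simp: coupling_measurable\<close>)
qed

lemma br_le_1: "measure (br x y) B \<le> 1" using prob_space.prob_le_1[OF prob_br] .

lemma measure_P_disintegration:
  assumes B: "B \<in> sets P" shows "measure P B = (\<integral>p. measure (brp p) B \<partial>coupling)"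
proof -
  interpret P: prob_space P by (rule prob_P)
  have "ennreal (measure P B) = (\<integral>\<^sup>+p. ennreal (measure (brp p) B) \<partial>coupling)"
    using disintegration[OF B, of "\<lambda>_. 1"] B by (simp add: P.emeasure_eq_measure)
  also have "\<dots> = ennreal (\<integral>p. measure (brp p) B \<partial>coupling)"
    using br_le_1 by (intro nn_integral_eq_integral bounded_integrable[where K = 1]) auto
  finally show ?thesis by (subst (asm) ennreal_inj) (auto intro!: Bochner_Integration.integral_nonneg)
qed

definition jump_flux :: "(real \<Rightarrow> 'a) set \<Rightarrow> real \<Rightarrow> 'a \<Rightarrow> 'a \<Rightarrow> 'a \<times> 'a \<Rightarrow> real" where
  "jump_flux A q z w p = indicator {0..1} q * (measure (brp p) (A \<inter> at_time E q z) * ker (snd p) q z w)"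

text \<open>The endpoint average of the flux through an edge. Its values are extended because the
  unbounded kernels may average to infinity at exceptional times.\<close>

definition total_flux :: "(real \<Rightarrow> 'a) set \<Rightarrow> real \<Rightarrow> 'a \<Rightarrow> 'a \<Rightarrow> ennreal" where
  "total_flux A q z w = (\<integral>\<^sup>+p. ennreal (jump_flux A q z w p) \<partial>coupling)"

text \<open>The kernel of the claim. Where the mixture diverges the Bochner integral returns 0; by
  \<open>total_flux_finite\<close> this happens on an edge only at a null set of times.\<close>

definition mixed :: "real \<Rightarrow> 'a \<Rightarrow> 'a \<Rightarrow> real" where
  "mixed t z w = (\<integral>y. ker y t z w \<partial>distr (uniform_measure P (at_time E t z)) (count_space UNIV) (\<lambda>X. X 1))"

lemma at_time_P: "q \<in> {0..1} \<Longrightarrow> at_time E q z \<in> sets P"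
  using at_time_Q[of q z] by (simp add: sets_P sets_Q)

lemma jump_flux_nonneg: "0 \<le> jump_flux A q z w p"
  using kernel_nonneg[of q "snd p" z w] by (auto simp: jump_flux_def indicator_def)

lemma jump_flux_measurable:
  assumes A: "A \<in> sets P" shows "(\<lambda>q. jump_flux A q z w p) \<in> borel_measurable borel"
proof -
  have "jump_flux A q z w p = (indicator {0..1} q * measure (brp p) (A \<inter> at_time E q z)) * (indicator {0..1} q * ker (snd p) q z w)" for q
    by (simp add: jump_flux_def indicator_def)
  moreover have "(\<lambda>q. indicator {0..1} q * measure (brp p) (A \<inter> at_time E q z)) \<in> borel_measurable borel"
    using A by (intro state_measure_measurable prob_space.finite_measure prob_br) (auto simp: sets_br sets_P)
  ultimately show ?thesis using kernel_time_measurable[of "snd p" z w] by (simp only: borel_measurable_times)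
qed

lemma jump_flux_pair_measurable:
  assumes A: "A \<in> sets P" and S: "S \<in> sets borel"
  shows "(\<lambda>(p, q). ennreal (indicator S q * jump_flux A q z w p)) \<in> borel_measurable (coupling \<Otimes>\<^sub>M lborel)"
proof -
  have "(\<lambda>q. ennreal (indicator S q * jump_flux A q z w p)) \<in> borel_measurable lborel" for p
    using jump_flux_measurable[OF A, of z w p] S by simp
  then have "(\<lambda>r. ennreal (indicator S (snd r) * jump_flux A (snd r) z w p)) \<in> borel_measurable (coupling \<Otimes>\<^sub>M lborel)" for p
    by (rule measurable_compose[OF measurable_snd])
  from measurable_compose_countable[where f = "\<lambda>p r. ennreal (indicator S (snd r) * jump_flux A (snd r) z w p)" and g = fst, OF this]
  have "(\<lambda>r. ennreal (indicator S (snd r) * jump_flux A (snd r) z w (fst r))) \<in> borel_measurable (coupling \<Otimes>\<^sub>M lborel)"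
    using measurable_fst[of coupling lborel] by (simp add: coupling_def)
  then show ?thesis by (simp add: case_prod_beta)
qed

lemma total_flux_fubini:
  assumes A: "A \<in> sets P" and S: "S \<in> sets borel"
  shows "(\<integral>\<^sup>+q. indicator S q * total_flux A q z w \<partial>lborel) = (\<integral>\<^sup>+p. (\<integral>\<^sup>+q. ennreal (indicator S q * jump_flux A q z w p) \<partial>lborel) \<partial>coupling)"
proof -
  interpret c: prob_space coupling by (rule prob_coupling)
  interpret pair_sigma_finite coupling lborel ..
  have "indicator S q * total_flux A q z w = (\<integral>\<^sup>+p. ennreal (indicator S q * jump_flux A q z w p) \<partial>coupling)" for q
    unfolding total_flux_def by (auto simp: indicator_def)
  then show ?thesis using Fubini'[OF jump_flux_pair_measurable[OF A S, of z w]] by simp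
qed

lemma total_flux_measurable:
  assumes A: "A \<in> sets P" shows "(\<lambda>q. total_flux A q z w) \<in> borel_measurable borel"
proof -
  interpret c: prob_space coupling by (rule prob_coupling)
  have "(\<lambda>(p, q). ennreal (jump_flux A q z w p)) \<in> borel_measurable (coupling \<Otimes>\<^sub>M lborel)"
    using jump_flux_pair_measurable[OF A, of UNIV z w] by simp
  from measurable_compose[OF measurable_pair_swap' this]
  have "(\<lambda>(q, p). ennreal (jump_flux A q z w p)) \<in> borel_measurable (lborel \<Otimes>\<^sub>M coupling)" by (simp add: case_prod_beta)
  from c.borel_measurable_nn_integral[OF this] show ?thesis by (simp add: total_flux_def)
qed

lemma paths_P: "paths E \<in> sets P" using sets.top[of P] by (simp add: space_P)

lemma jump_flux_mono: assumes A: "A \<in> sets P" shows "jump_flux A q z w p \<le> jump_flux (paths E) q z w p"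
proof (cases "q \<in> {0..1}")
  case True
  interpret B: prob_space "brp p" by (rule prob_br)
  have "measure (brp p) (A \<inter> at_time E q z) \<le> measure (brp p) (paths E \<inter> at_time E q z)"
    using at_time_P[OF True, of z] paths_P sets.sets_into_space[OF A] by (intro B.finite_measure_mono) (auto simp: sets_br sets_P space_P)
  then show ?thesis using kernel_nonneg[OF True, of "snd p" z w] True by (simp add: jump_flux_def mult_right_mono)
qed (simp add: jump_flux_def)

lemma jump_flux_total:
  assumes zw: "E z w" and A: "A \<in> sets P"
  shows "(\<integral>\<^sup>+q. ennreal (jump_flux A q z w p) \<partial>lborel) \<le> 1"
proof -
  have "paths E \<inter> at_time E q z = at_time E q z" for q by auto
  then have "(\<integral>\<^sup>+q. ennreal (jump_flux (paths E) q z w p) \<partial>lborel) \<le> 1"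
    using br_flux_total[OF zw, of "fst p" "snd p"] by (simp only: jump_flux_def)
  moreover have "(\<integral>\<^sup>+q. ennreal (jump_flux A q z w p) \<partial>lborel) \<le> (\<integral>\<^sup>+q. ennreal (jump_flux (paths E) q z w p) \<partial>lborel)"
    by (intro nn_integral_mono ennreal_leI jump_flux_mono[OF A])
  ultimately show ?thesis by (rule order_trans[rotated])
qed

lemma total_flux_total:
  assumes zw: "E z w" and A: "A \<in> sets P"
  shows "(\<integral>\<^sup>+q. total_flux A q z w \<partial>lborel) \<le> 1"
proof -
  interpret c: prob_space coupling by (rule prob_coupling)
  have "(\<integral>\<^sup>+q. total_flux A q z w \<partial>lborel) = (\<integral>\<^sup>+p. (\<integral>\<^sup>+q. ennreal (jump_flux A q z w p) \<partial>lborel) \<partial>coupling)"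
    using total_flux_fubini[OF A, of UNIV z w] by simp
  also have "\<dots> \<le> (\<integral>\<^sup>+p. 1 \<partial>coupling)" by (intro nn_integral_mono jump_flux_total[OF zw A])
  also have "\<dots> = 1" using c.emeasure_space_1 by simp
  finally show ?thesis .
qed

lemma total_flux_eq:
  assumes A: "A \<in> sets P" and q: "q \<in> {0..1}"
  shows "total_flux A q z w = (\<integral>\<^sup>+X. ennreal (ker (X 1) q z w) * indicator (A \<inter> at_time E q z) X \<partial>P)"
proof -
  have "A \<inter> at_time E q z \<in> sets P" using A at_time_P[OF q] by blast
  from disintegration[OF this, of "\<lambda>y. ennreal (ker y q z w)"] show ?thesis
    unfolding total_flux_def jump_flux_def using q kernel_nonneg[OF q] by (simp add: ennreal_mult)
qed

lemma enn2real_divide: "0 \<le> m \<Longrightarrow> m \<noteq> 0 \<Longrightarrow> enn2real (x / ennreal m) = enn2real x / m"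
  by (auto simp: divide_ennreal_def inverse_ennreal enn2real_mult divide_real_def)

lemma mixed_eq:
  assumes q: "q \<in> {0..1}"
  shows "mixed q z w = enn2real (total_flux (paths E) q z w) / measure P (at_time E q z)"
proof -
  interpret P: prob_space P by (rule prob_P)
  let ?A = "at_time E q z"
  let ?U = "uniform_measure P ?A"
  have A: "?A \<in> sets P" by (rule at_time_P[OF q])
  have c1: "(\<lambda>X. X 1) \<in> P \<rightarrow>\<^sub>M count_space UNIV" by (rule coord_P) simp
  have km: "(\<lambda>X. ker (X 1) q z w) \<in> borel_measurable P" by (rule measurable_compose[OF c1]) auto
  have i: "paths E \<inter> ?A = ?A" by auto
  have N: "total_flux (paths E) q z w = (\<integral>\<^sup>+X. ennreal (ker (X 1) q z w) * indicator ?A X \<partial>P)"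
    using total_flux_eq[OF paths_P q, of z w] unfolding i .
  have "mixed q z w = (\<integral>X. ker (X 1) q z w \<partial>?U)"
    unfolding mixed_def using c1 by (intro integral_distr) auto
  \<comment> \<open>This covers a divergent mixture as well: both sides are then 0.\<close>
  also have "\<dots> = enn2real (\<integral>\<^sup>+X. ennreal (ker (X 1) q z w) \<partial>?U)"
    using km kernel_nonneg[OF q] by (intro integral_eq_nn_integral) auto
  also have "(\<integral>\<^sup>+X. ennreal (ker (X 1) q z w) \<partial>?U) = total_flux (paths E) q z w / ennreal (measure P ?A)"
    unfolding N P.emeasure_eq_measure[symmetric] using km A by (intro nn_integral_uniform_measure) auto
  finally have e: "mixed q z w = enn2real (total_flux (paths E) q z w / ennreal (measure P ?A))" .
  show ?thesis
  proof (cases "measure P ?A = 0")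
    case True
    then have "AE X in P. X \<notin> ?A" using A by (intro AE_not_in) (simp add: null_sets_def P.emeasure_eq_measure)
    then have "total_flux (paths E) q z w = 0"
      unfolding N by (intro nn_integral_zero') (auto elim!: eventually_mono)
    then show ?thesis using True e by simp
  next
    case False then show ?thesis using e by (simp add: enn2real_divide)
  qed
qed

lemma mixed_nonneg: "q \<in> {0..1} \<Longrightarrow> 0 \<le> mixed q z w" by (simp add: mixed_eq)

text \<open>The geodesic kernel depends on the terminal state, hence on the future. By the Markov
  property of \<open>P\<close> at time \<open>q\<close> it is independent of the past event
  \<open>A\<close> given \<open>X q = z\<close>, so its integral over \<open>A\<close> at
  \<open>z\<close> is the mass there times the mixed kernel.\<close>

lemma mixed_flux:
  assumes q: "q \<in> {0..1}" and A: "A \<in> sets (path_events E {0..q})" and fin: "total_flux (paths E) q z w < \<infinity>"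
  shows "ennreal (measure P (A \<inter> at_time E q z) * mixed q z w) = total_flux A q z w"
proof -
  interpret P: prob_space P by (rule prob_P)
  interpret MP: markov_path E P by unfold_locales (rule markov_P)
  let ?T = "at_time E q z"
  have AP: "A \<in> sets P" using A path_events_mono[of "{0..q}" "{0..1}" E] q by (auto simp: sets_P)
  have AT: "A \<inter> ?T \<in> sets P" using AP at_time_P[OF q] by blast
  have i: "paths E \<inter> ?T = ?T" by auto
  have km: "(\<lambda>X. ennreal (ker (X 1) q z w)) \<in> borel_measurable (path_events E {q..1})"
    by (rule coord_compose_measurable) (use q in auto)
  have "(\<integral>\<^sup>+X. indicator A X * ennreal (ker (X 1) q z w) * indicator ?T X \<partial>P) * emeasure P ?T =
      (\<integral>\<^sup>+X. indicator A X * indicator ?T X \<partial>P) * (\<integral>\<^sup>+X. ennreal (ker (X 1) q z w) * indicator ?T X \<partial>P)"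
    using A km by (intro MP.nn_markov q) auto
  moreover have "(\<integral>\<^sup>+X. indicator A X * ennreal (ker (X 1) q z w) * indicator ?T X \<partial>P) = total_flux A q z w"
    unfolding total_flux_eq[OF AP q] by (intro nn_integral_cong) (auto simp: indicator_def)
  moreover have "(\<integral>\<^sup>+X. indicator A X * indicator ?T X \<partial>P) = emeasure P (A \<inter> ?T)"
    using AT by (simp add: indicator_inter_arith[symmetric])
  moreover have "(\<integral>\<^sup>+X. ennreal (ker (X 1) q z w) * indicator ?T X \<partial>P) = total_flux (paths E) q z w"
    using total_flux_eq[OF paths_P q, of z w] unfolding i by simp
  ultimately have eq: "total_flux A q z w * ennreal (measure P ?T) = ennreal (measure P (A \<inter> ?T)) * total_flux (paths E) q z w"
    by (simp add: P.emeasure_eq_measure)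
  have le: "total_flux A q z w \<le> total_flux (paths E) q z w"
    unfolding total_flux_def by (intro nn_integral_mono ennreal_leI jump_flux_mono[OF AP])
  obtain n where n: "total_flux (paths E) q z w = ennreal n" "0 \<le> n" using fin by (cases "total_flux (paths E) q z w") auto
  obtain a where a: "total_flux A q z w = ennreal a" "0 \<le> a" using le n by (cases "total_flux A q z w") (auto simp: top_unique)
  have e: "a * measure P ?T = measure P (A \<inter> ?T) * n" using eq n a by (simp add: ennreal_mult[symmetric])
  show ?thesis
  proof (cases "measure P ?T = 0")
    case True
    then have "AE X in P. X \<notin> ?T" using at_time_P[OF q] by (intro AE_not_in) (simp add: null_sets_def P.emeasure_eq_measure)
    then have "total_flux A q z w = 0"
      unfolding total_flux_eq[OF AP q] by (intro nn_integral_zero') (auto elim!: eventually_mono simp: indicator_def)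
    then show ?thesis using True by (simp add: mixed_eq[OF q])
  next
    case False
    then have "measure P (A \<inter> ?T) * (n / measure P ?T) = a" using e by (simp add: field_simps)
    then show ?thesis using n a by (simp add: mixed_eq[OF q])
  qed
qed

lemma total_flux_finite:
  assumes "E z w" shows "AE q in lborel. total_flux (paths E) q z w < \<infinity>"
proof -
  have "AE q in lborel. total_flux (paths E) q z w \<noteq> \<infinity>"
    using total_flux_measurable[OF paths_P, of z w] total_flux_total[OF assms paths_P] by (intro nn_integral_noteq_infinite) (auto simp: top_unique)
  then show ?thesis by eventually_elim (simp add: less_top)
qed

lemma mixed_measurable: "(\<lambda>q. indicator {0..1} q * mixed q z w) \<in> borel_measurable borel"
proof -
  have "indicator {0..1} q * mixed q z w = indicator {0..1} q * (enn2real (total_flux (paths E) q z w) / (indicator {0..1} q * measure P (paths E \<inter> at_time E q z)))" for q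
  proof -
    have "paths E \<inter> at_time E q z = at_time E q z" by auto
    then show ?thesis by (cases "q \<in> {0..1}") (simp_all add: mixed_eq)
  qed
  moreover have "(\<lambda>q. indicator {0..1} q * (enn2real (total_flux (paths E) q z w) / (indicator {0..1} q * measure P (paths E \<inter> at_time E q z)))) \<in> borel_measurable borel"
    by (rule borel_measurable_times[OF borel_measurable_indicator borel_measurable_divide[OF borel_measurable_enn2real[OF total_flux_measurable[OF paths_P]]
      state_measure_measurable[OF prob_space.finite_measure[OF prob_P] sets_P paths_P]]]) simp
  ultimately show ?thesis by simp
qed

text \<open>Tonelli's theorem exchanges time and endpoints. The identity at a fixed time is
  available for almost every time, which is enough under the time integral; the bound by 1 makes the
  average over the endpoints integrable.\<close>

lemma mixed_integral:
  assumes zw: "E z w" and A: "A \<in> sets (path_events E {0..s})" and st: "0 \<le> s" "s \<le> t" "t \<le> 1"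
  shows "(LINT r:{s..t}|lborel. measure P (A \<inter> at_time E r z) * mixed r z w) =
    (\<integral>p. (LINT r:{s..t}|lborel. measure (brp p) (A \<inter> at_time E r z) * ker (snd p) r z w) \<partial>coupling)"
    and "\<bar>LINT r:{s..t}|lborel. measure (brp p) (A \<inter> at_time E r z) * ker (snd p) r z w\<bar> \<le> 1"
proof -
  have AP: "A \<in> sets P" using A path_events_mono[of "{0..s}" "{0..1}" E] st by (auto simp: sets_P)
  let ?I = "\<lambda>p. LINT r:{s..t}|lborel. measure (brp p) (A \<inter> at_time E r z) * ker (snd p) r z w"
  have I_eq: "?I p = (\<integral>r. indicator {s..t} r * jump_flux A r z w p \<partial>lborel)" for p
    unfolding set_lebesgue_integral_def using st
    by (intro Bochner_Integration.integral_cong refl) (auto simp: jump_flux_def indicator_def)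
  have I_nn: "ennreal (?I p) = (\<integral>\<^sup>+q. ennreal (indicator {s..t} q * jump_flux A q z w p) \<partial>lborel)" "?I p \<le> 1" "0 \<le> ?I p" for p
  proof -
    have le: "(\<integral>\<^sup>+q. ennreal (indicator {s..t} q * jump_flux A q z w p) \<partial>lborel) \<le> 1"
    proof (rule order_trans[OF _ jump_flux_total[OF zw AP, of p]])
      show "(\<integral>\<^sup>+q. ennreal (indicator {s..t} q * jump_flux A q z w p) \<partial>lborel) \<le> (\<integral>\<^sup>+q. ennreal (jump_flux A q z w p) \<partial>lborel)"
        using jump_flux_nonneg by (intro nn_integral_mono ennreal_leI) (auto simp: indicator_def)
    qed
    have m: "(\<lambda>q. indicator {s..t} q * jump_flux A q z w p) \<in> borel_measurable lborel"
      using jump_flux_measurable[OF AP, of z w p] by simp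
    have nn: "0 \<le> indicator {s..t} q * jump_flux A q z w p" for q using jump_flux_nonneg by (auto simp: indicator_def)
    have "integrable lborel (\<lambda>q. indicator {s..t} q * jump_flux A q z w p)"
      by (rule integrableI_nonneg[OF m]) (use le nn in \<open>auto intro: le_less_trans\<close>)
    then show 1: "ennreal (?I p) = (\<integral>\<^sup>+q. ennreal (indicator {s..t} q * jump_flux A q z w p) \<partial>lborel)"
      unfolding I_eq using nn by (intro nn_integral_eq_integral[symmetric]) auto
    show "0 \<le> ?I p" unfolding I_eq by (intro Bochner_Integration.integral_nonneg nn)
    have "ennreal (?I p) \<le> ennreal 1" using le 1 by simp
    then show "?I p \<le> 1" by (subst (asm) ennreal_le_iff) auto
  qed
  show "\<bar>?I p\<bar> \<le> 1" for p using I_nn(2,3)[of p] by simp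
  let ?f = "\<lambda>r. indicator {s..t} r * (measure P (A \<inter> at_time E r z) * mixed r z w)"
  have f_nn: "0 \<le> ?f r" for r using mixed_nonneg[of r z w] st by (auto simp: indicator_def)
  have f_m: "?f \<in> borel_measurable lborel"
  proof -
    have "?f = (\<lambda>r. indicator {s..t} r * ((indicator {0..1} r * measure P (A \<inter> at_time E r z)) * (indicator {0..1} r * mixed r z w)))"
      using st by (auto simp: indicator_def fun_eq_iff)
    moreover have "\<dots> \<in> borel_measurable lborel"
      using state_measure_measurable[OF prob_space.finite_measure[OF prob_P] sets_P AP, of z] mixed_measurable[of z w] by simp
    ultimately show ?thesis by simp
  qed
  have "(\<integral>\<^sup>+r. ennreal (?f r) \<partial>lborel) = (\<integral>\<^sup>+r. indicator {s..t} r * total_flux A r z w \<partial>lborel)"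
  proof (rule nn_integral_cong_AE)
    show "AE r in lborel. ennreal (?f r) = indicator {s..t} r * total_flux A r z w"
      using total_flux_finite[OF zw]
    proof eventually_elim
      case (elim r)
      show ?case
      proof (cases "r \<in> {s..t}")
        case True
        then have r: "r \<in> {0..1}" "A \<in> sets (path_events E {0..r})" using st A path_events_mono[of "{0..s}" "{0..r}" E] by auto
        from mixed_flux[OF r elim] show ?thesis using True by simp
      qed simp
    qed
  qed
  also have "\<dots> = (\<integral>\<^sup>+p. ennreal (?I p) \<partial>coupling)" unfolding I_nn(1) by (rule total_flux_fubini[OF AP]) simp
  also have "\<dots> = ennreal (\<integral>p. ?I p \<partial>coupling)"
    using I_nn(2,3) by (intro nn_integral_eq_integral bounded_integrable[where K = 1]) (auto simp: abs_le_iff intro: order_trans[of _ 0])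
  finally have "(\<integral>r. ?f r \<partial>lborel) = enn2real (ennreal (\<integral>p. ?I p \<partial>coupling))"
    using f_m f_nn by (subst integral_eq_nn_integral) auto
  also have "\<dots> = (\<integral>p. ?I p \<partial>coupling)" using I_nn(3) by (intro enn2real_ennreal Bochner_Integration.integral_nonneg)
  finally show "(LINT r:{s..t}|lborel. measure P (A \<inter> at_time E r z) * mixed r z w) = (\<integral>p. ?I p \<partial>coupling)"
    by (simp add: set_lebesgue_integral_def)
qed

text \<open>Finite support of \<open>u\<close> and local finiteness keep all sums finite, so
  averaging Dynkin's formula over \<open>coupling\<close> only exchanges finite sums with integrals
  of bounded functions of the endpoints.\<close>

theorem P_kernel: "has_jump_kernel E P mixed"
proof (rule has_jump_kernelI[OF prob_P sets_P _ mixed_measurable])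
  show "mixed r z w = 0" if "\<not> E z w" for r z w by (simp add: mixed_def kernel_support[OF that])
  interpret P: prob_space P by (rule prob_P)
  fix z w
  show "(\<integral>\<^sup>+r. ennreal (indicator {0..1} r * (measure P (at_time E r z) * \<bar>mixed r z w\<bar>)) \<partial>lborel) < \<infinity>"
  proof (cases "E z w")
    case True
    have "(\<integral>\<^sup>+r. ennreal (indicator {0..1} r * (measure P (at_time E r z) * \<bar>mixed r z w\<bar>)) \<partial>lborel) \<le> (\<integral>\<^sup>+r. total_flux (paths E) r z w \<partial>lborel)"
    proof (rule nn_integral_mono_AE)
      show "AE r in lborel. ennreal (indicator {0..1} r * (measure P (at_time E r z) * \<bar>mixed r z w\<bar>)) \<le> total_flux (paths E) r z w"
        using total_flux_finite[OF True]
      proof eventually_elim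
        case (elim r)
        show ?case
        proof (cases "r \<in> {0..1}")
          case True
          have "paths E \<inter> at_time E r z = at_time E r z" "paths E \<in> sets (path_events E {0..r})"
            using sets.top[of "path_events E {0..r}"] by auto
          with mixed_flux[OF True _ elim, of "paths E"] mixed_nonneg[OF True, of z w] show ?thesis using True by simp
        qed simp
      qed
    qed
    also have "\<dots> < \<infinity>" by (rule le_less_trans[OF total_flux_total[OF True paths_P]]) simp
    finally show ?thesis .
  qed (simp add: mixed_def kernel_support)
next
  interpret P: prob_space P by (rule prob_P)
  fix u :: "'a \<Rightarrow> real" and s t A
  assume u: "finite {x. u x \<noteq> 0}" and st: "0 \<le> s" "s \<le> t" "t \<le> 1" and A: "A \<in> sets (path_events E {0..s})"
  have AP: "A \<in> sets P" using A path_events_mono[of "{0..s}" "{0..1}" E] st by (auto simp: sets_P)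
  have Abr: "A \<in> sets (br x y)" for x y using AP by (simp add: sets_br sets_P)
  have tt: "t \<in> {0..1}" "s \<in> {0..1}" using st by auto
  have inc: "(LINT X:A|R. u (X t) - u (X s)) =
      (\<Sum>v | u v \<noteq> 0. u v * (measure R (A \<inter> at_time E t v) - measure R (A \<inter> at_time E s v)))"
    if R: "prob_space R" "sets R = sets (path_space E)" "A \<in> sets R" for R
  proof -
    have "(LINT X:A|R. u (X t) - u (X s)) = (LINT X:A|R. u (X t)) - (LINT X:A|R. u (X s))"
      by (rule set_integral_diff(2)) (rule integral_finite_support(2)[OF R _ u], fact)+
    then show ?thesis
      unfolding integral_finite_support(1)[OF R tt(1) u] integral_finite_support(1)[OF R tt(2) u]
      by (simp add: sum_subtractf right_diff_distrib)
  qed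
  let ?D = "\<lambda>v p. measure (brp p) (A \<inter> at_time E t v) - measure (brp p) (A \<inter> at_time E s v)"
  have D1: "integrable coupling (\<lambda>p. measure (brp p) B)" for B
    using br_le_1 by (intro bounded_integrable[where K = 1]) auto
  have sets: "A \<inter> at_time E q v \<in> sets P" if "q \<in> {0..1}" for q v using AP at_time_P[OF that, of v] by blast
  let ?I = "\<lambda>z w p. LINT r:{s..t}|lborel. measure (brp p) (A \<inter> at_time E r z) * ker (snd p) r z w"
  have Ii: "integrable coupling (?I z w)" if "E z w" for z w
    using mixed_integral(2)[OF that A st] by (intro bounded_integrable[where K = 1])
  have "(LINT X:A|P. u (X t) - u (X s)) = (\<Sum>v | u v \<noteq> 0. u v * (\<integral>p. ?D v p \<partial>coupling))"
    unfolding inc[OF prob_P sets_P AP] measure_P_disintegration[OF sets[OF tt(1)]] measure_P_disintegration[OF sets[OF tt(2)]]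
    by (simp add: D1 Bochner_Integration.integral_diff)
  also have "\<dots> = (\<integral>p. (\<Sum>v | u v \<noteq> 0. u v * ?D v p) \<partial>coupling)"
    by (subst Bochner_Integration.integral_sum) (auto simp: D1)
  also have "\<dots> = (\<integral>p. (LINT X:A|brp p. u (X t) - u (X s)) \<partial>coupling)"
    unfolding inc[OF prob_br sets_br Abr] ..
  also have "\<dots> = (\<integral>p. (\<Sum>z\<in>flux_states u. \<Sum>w | E z w. (u w - u z) * ?I z w p) \<partial>coupling)"
    unfolding br_dynkin_kernel[OF A st u] ..
  also have "\<dots> = (\<Sum>z\<in>flux_states u. \<integral>p. (\<Sum>w | E z w. (u w - u z) * ?I z w p) \<partial>coupling)"
    by (rule Bochner_Integration.integral_sum) (intro Bochner_Integration.integrable_sum integrable_mult_right Ii, simp)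
  also have "\<dots> = (\<Sum>z\<in>flux_states u. \<Sum>w | E z w. (u w - u z) * (\<integral>p. ?I z w p \<partial>coupling))"
  proof (rule sum.cong[OF refl])
    fix z
    have "(\<integral>p. (\<Sum>w | E z w. (u w - u z) * ?I z w p) \<partial>coupling) = (\<Sum>w | E z w. \<integral>p. (u w - u z) * ?I z w p \<partial>coupling)"
      by (rule Bochner_Integration.integral_sum) (intro integrable_mult_right Ii, simp)
    also have "\<dots> = (\<Sum>w | E z w. (u w - u z) * (\<integral>p. ?I z w p \<partial>coupling))"
      by (rule sum.cong[OF refl]) (rule integral_mult_right_zero)
    finally show "(\<integral>p. (\<Sum>w | E z w. (u w - u z) * ?I z w p) \<partial>coupling) = (\<Sum>w | E z w. (u w - u z) * (\<integral>p. ?I z w p \<partial>coupling))" .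
  qed
  also have "\<dots> = (\<Sum>z\<in>flux_states u. \<Sum>w | E z w. (u w - u z) * (LINT r:{s..t}|lborel. measure P (A \<inter> at_time E r z) * mixed r z w))"
  proof (intro sum.cong refl)
    fix z w assume "w \<in> {w. E z w}"
    then have "E z w" by simp
    from mixed_integral(1)[OF this A st] show "(u w - u z) * (\<integral>p. ?I z w p \<partial>coupling) =
      (u w - u z) * (LINT r:{s..t}|lborel. measure P (A \<inter> at_time E r z) * mixed r z w)" by (simp only:)
  qed
  finally show "(LINT X:A|P. u (X t) - u (X s)) =
    (\<Sum>z\<in>flux_states u. \<Sum>w | E z w. (u w - u z) * (LINT r:{s..t}|lborel. measure P (A \<inter> at_time E r z) * mixed r z w))" .
qed

end

section \<open>Kernels known on the unit time interval\<close>

text \<open>A kernel is read only at times of the unit interval, so rates given there may be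
  continued arbitrarily.\<close>

lemma has_jump_kernel_cong:
  assumes eq: "\<And>t x y. t \<in> {0..1} \<Longrightarrow> k t x y = k' t x y"
  shows "has_jump_kernel E Q k \<longleftrightarrow> has_jump_kernel E Q k'"
proof -
  have g: "kernel_gen k r u x = kernel_gen k' r u x" if "r \<in> {0..1}" for r u x
    using eq[OF that] by (simp add: kernel_gen_def)
  have "set_integrable (Q \<Otimes>\<^sub>M lborel) (A \<times> {s..t}) (\<lambda>(X, r). kernel_gen k r u (X r)) \<longleftrightarrow>
      set_integrable (Q \<Otimes>\<^sub>M lborel) (A \<times> {s..t}) (\<lambda>(X, r). kernel_gen k' r u (X r))"
    if "0 \<le> s" "t \<le> 1" for A s t u
    unfolding set_integrable_def
    by (rule arg_cong[where f = "integrable _"]) (use that in \<open>auto simp: indicator_def g fun_eq_iff\<close>)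
  moreover have "(LINT r:{s..t}|lborel. kernel_gen k r u (X r)) = (LINT r:{s..t}|lborel. kernel_gen k' r u (X r))"
    if "0 \<le> s" "t \<le> 1" for s t u X
    by (rule set_lebesgue_integral_cong) (use that in \<open>auto simp: g\<close>)
  ultimately show ?thesis
    unfolding has_jump_kernel_def by (intro all_cong1 imp_cong ball_cong refl) simp
qed

context
  fixes k k' :: "real \<Rightarrow> 'a \<Rightarrow> 'a \<Rightarrow> real"
  assumes eq: "\<And>t x y. t \<in> {0..1} \<Longrightarrow> k t x y = k' t x y"
begin

lemma exposure_cong: "0 \<le> t \<Longrightarrow> (LINT s:{t..1}|lborel. kernel_mass k s (X s)) = (LINT s:{t..1}|lborel. kernel_mass k' s (X s))"
  by (rule set_lebesgue_integral_cong) (auto simp: kernel_mass_def eq)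

lemma geodesic_measure_cong: "geodesic_measure E d k Q = geodesic_measure E d k' Q"
  by (simp add: geodesic_measure_def exposure_cong)

lemma geodesic_kernel_cong: "t \<in> {0..1} \<Longrightarrow> geodesic_kernel E d k Q y t z w = geodesic_kernel E d k' Q y t z w"
  by (simp add: geodesic_kernel_def geodesic_weight_def exposure_cong eq)

end

section \<open>Passage from rates on the unit interval to rates at all real times\<close>

theorem theorem2p11:
  fixes E :: "'a::countable \<Rightarrow> 'a \<Rightarrow> bool"
    and d :: "'a \<Rightarrow> 'a \<Rightarrow> real"
    and m :: "'a \<Rightarrow> real"
    and J :: "real \<Rightarrow> 'a \<Rightarrow> 'a \<Rightarrow> real"
    and R :: "(real \<Rightarrow> 'a) measure"
    and Rk :: "nat \<Rightarrow> (real \<Rightarrow> 'a) measure"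
    and \<mu>0 \<mu>1 :: "'a pmf"
    and \<pi>o :: "('a \<times> 'a) pmf"
    and Pk :: "nat \<Rightarrow> (real \<Rightarrow> 'a) measure"
    and P :: "(real \<Rightarrow> 'a) measure"
  assumes graph: "symp E" "irreflp E" "\<forall>x y. E\<^sup>*\<^sup>* x y" "\<forall>x. finite {y. E x y}"
    and dist: "Metric_space UNIV d"
      "\<forall>x y. x \<noteq> y \<longrightarrow> 1 \<le> d x y"
      "\<forall>x y. d x y = Inf {path_length d \<omega> | \<omega>. \<omega> \<in> paths E \<and> \<omega> 0 = x \<and> \<omega> 1 = y}"
    and rates: "\<forall>x y. (\<lambda>t. J t x y) \<in> borel_measurable (restrict_space borel {0..1})"
      "\<forall>t\<in>{0..1}. \<forall>x y. (E x y \<longrightarrow> 0 < J t x y) \<and> (\<not> E x y \<longrightarrow> J t x y = 0)"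
      "\<exists>C. \<forall>t\<in>{0..1}. \<forall>x. kernel_mass J t x \<le> C"
    and m_pos: "\<forall>x. 0 < m x"
    and slowed: "\<forall>k\<ge>1. markov_measure E (Rk k) \<and>
        has_jump_kernel E (Rk k) (\<lambda>t x y. real k powr (- d x y) * J t x y) \<and>
        marginal (Rk k) 0 = density (count_space UNIV) (\<lambda>x. ennreal (m x))"
    and R_eq: "R = Rk 1"
    and coupling: "map_pmf fst \<pi>o = \<mu>0" "map_pmf snd \<pi>o = \<mu>1"
      "(\<integral>\<^sup>+(x, y). (\<integral>\<^sup>+\<omega>. ennreal (path_length d \<omega>) \<partial>bridge E R x y) \<partial>measure_pmf \<pi>o) < \<infinity>"
      "rel_entropy (measure_pmf \<pi>o) (endpoint_marginal R) < \<infinity>"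
    and schroedinger: "\<forall>k\<ge>2. unique_arg_min (\<lambda>Q. rel_entropy Q (Rk k)) (walks_between E \<mu>0 \<mu>1) (Pk k)"
    and displacement: "prob_space P" "sets P = sets (path_space E)"
      "narrow_conv (skorokhod_topology E) Pk P"
  shows "markov_measure E P \<and>
    has_jump_kernel E P
      (\<lambda>t z w. \<integral>y. geodesic_kernel E d J R y t z w
         \<partial>distr (uniform_measure P (at_time E t z)) (count_space UNIV) (\<lambda>\<omega>. \<omega> 1)) \<and>
    (\<forall>x y. markov_measure E (bridge E (geodesic_measure E d J R) x y) \<and>
       has_jump_kernel E (bridge E (geodesic_measure E d J R) x y) (geodesic_kernel E d J R y))"
proof -
  \<comment> \<open>Continuation by zero: measurability, sign and total mass of the rates are then
    controlled at all real times, as the locales ask.\<close>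
  define j where "j t x y = indicator {0..1} t * J t x y" for t x y
  have jJ: "J t x y = j t x y" if "t \<in> {0..1}" for t x y using that by (simp add: j_def)
  obtain C0 where C0: "\<And>t x. t \<in> {0..1} \<Longrightarrow> kernel_mass J t x \<le> C0" using rates(3) by blast
  \<comment> \<open>The maximum with 0 covers the times outside the unit interval, where the total
    rate is 0.\<close>
  define C where "C = max 0 C0"
  have irr: "\<not> E x x" for x using graph(2) by (auto dest: irreflpD)
  have fin: "finite {y. E x y}" for x using graph(4) by blast
  have j_nonneg: "0 \<le> j t x y" for t x y
    using rates(2) by (cases "t \<in> {0..1}"; cases "E x y") (auto simp: j_def less_imp_le)
  have j_supp: "j t x y = 0" if "\<not> E x y" for t x y using rates(2) that by (auto simp: j_def indicator_def)
  have j_meas: "(\<lambda>t. j t x y) \<in> borel_measurable borel" for x y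
    using rates(1) borel_measurable_restrict_space_iff[of "{0..1}" borel "\<lambda>t. J t x y"] by (simp add: j_def)
  have j_mass: "(\<Sum>y | E x y. j t x y) \<le> C" for t x
  proof (cases "t \<in> {0..1}")
    case True
    have "kernel_mass J t x = (\<Sum>\<^sub>\<infinity>y\<in>{y. E x y}. J t x y)"
      unfolding kernel_mass_def by (rule infsum_cong_neutral) (use rates(2) True in auto)
    also have "\<dots> = (\<Sum>y | E x y. j t x y)" using fin True by (simp add: infsum_finite j_def)
    finally show ?thesis using C0[OF True, of x] by (simp add: C_def)
  qed (simp add: j_def C_def)
  interpret Metric_space UNIV d by (rule dist(1))
  have slow_rates: "jump_rates E (\<lambda>t x y. real k powr (- d x y) * j t x y) C" if k: "1 \<le> k" for k
  proof
    show "(\<lambda>t. real k powr (- d x y) * j t x y) \<in> borel_measurable borel" for x y using j_meas[of x y] by simp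
    show "(\<Sum>y | E x y. real k powr (- d x y) * j t x y) \<le> C" for t x
    proof (rule order_trans[OF sum_mono j_mass])
      fix y
      have "real k powr (- d x y) \<le> real k powr 0" by (rule powr_mono) (use k in auto)
      then show "real k powr (- d x y) * j t x y \<le> j t x y" using j_nonneg[of t x y] k by (simp add: mult_left_le_one_le)
    qed
  qed (use irr fin j_nonneg j_supp in auto)
  have walks: "walk E (\<lambda>t x y. real k powr (- d x y) * j t x y) C (Rk k)" if k: "1 \<le> k" for k
  proof -
    have "has_jump_kernel E (Rk k) (\<lambda>t x y. real k powr (- d x y) * j t x y)"
      using slowed k has_jump_kernel_cong[of "\<lambda>t x y. real k powr (- d x y) * J t x y" "\<lambda>t x y. real k powr (- d x y) * j t x y" E "Rk k"]
      by (simp add: jJ)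
    then show ?thesis unfolding walk_def walk_axioms_def markov_path_def using slow_rates[OF k] slowed k by blast
  qed
  have init: "emeasure (Rk k) (at_time E 0 x) = ennreal (m x)" if k: "1 \<le> k" for k x
  proof -
    interpret W: walk E "\<lambda>t x y. real k powr (- d x y) * j t x y" C "Rk k" by (rule walks[OF k])
    have "emeasure (Rk k) (at_time E 0 x) = emeasure (marginal (Rk k) 0) {x}"
      using W.coord_Q[of 0] by (subst emeasure_distr) (auto intro!: arg_cong[where f = "emeasure (Rk k)"])
    also have "\<dots> = emeasure (density (count_space UNIV) (\<lambda>x. ennreal (m x))) {x}" using slowed k by simp
    also have "\<dots> = ennreal (m x)" by (simp add: emeasure_density nn_integral_indicator_singleton)
    finally show ?thesis .
  qed
  have "measure (Rk 1) (at_time E 0 x) = m x" for x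
    using init[of 1 x] m_pos by (simp add: measure_def less_imp_le)
  moreover have "walk E j C (Rk 1)" using walks[of 1] by simp
  ultimately have "geodesic_walk E j C (Rk 1) d"
    unfolding geodesic_walk_def geodesic_walk_axioms_def
    using graph(1,3) dist m_pos rates(2) by (auto simp: jJ[symmetric] dest: sympD)
  then have "slowed_walks E j C (Rk 1) d Rk"
    unfolding slowed_walks_def slowed_walks_axioms_def using walks init by simp
  then interpret D: displacement E j C "Rk 1" d Rk \<mu>0 \<mu>1 Pk P
    unfolding displacement_def displacement_axioms_def using schroedinger displacement by simp
  have GM: "geodesic_measure E d J R = D.GM"
    unfolding D.GM_def R_eq by (rule geodesic_measure_cong) (rule jJ)
  have ker: "geodesic_kernel E d J R y t z w = geodesic_kernel E d j (Rk 1) y t z w" if "t \<in> {0..1}" for y t z w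
    unfolding R_eq by (rule geodesic_kernel_cong[OF _ that]) (rule jJ)
  have "has_jump_kernel E P (\<lambda>t z w. \<integral>y. geodesic_kernel E d J R y t z w
      \<partial>distr (uniform_measure P (at_time E t z)) (count_space UNIV) (\<lambda>X. X 1)) \<longleftrightarrow> has_jump_kernel E P D.mixed"
    by (rule has_jump_kernel_cong) (simp only: D.mixed_def ker)
  moreover have "has_jump_kernel E (D.br x y) (geodesic_kernel E d J R y) \<longleftrightarrow> has_jump_kernel E (D.br x y) (geodesic_kernel E d j (Rk 1) y)" for x y
    by (rule has_jump_kernel_cong) (rule ker)
  ultimately show ?thesis
    unfolding GM D.br_def[symmetric] using D.markov_P D.P_kernel D.markov_br D.br_kernel by simp
qed

end
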